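(* Let $\mathfrak g$ be a simply laced Kac–Moody algebra. The assignment $$x_i^\pm(z)\mapsto \mathbf X_i^\pm(z),\qquad h_i^\pm(z)\mapsto \mathbf H_i^\pm(z)\quad (i\in I),\qquad \mathsf c\mapsto 1$$ extends to a homomorphism of $\mathbb C[\hbar]$-algebras $\rho_\hbar: DY^{\mathsf c}_\hbar(\mathfrak g)\to \mathrm{End}_{\mathbb C[[\hbar]]}\,\mathcal V[[\hbar]]$.
   Context: Setting. $\mathfrak g$ has indecomposable symmetric Cartan matrix $\mathbf A=(a_{ij})_{i,j\in I}$ with $a_{ii}=2$ and $a_{ij}\in\{0,-1\}$ for $i\ne j$ (simply laced). The simple roots are $\alpha_i$, the root lattice is $Q=\bigoplus_{i\in I}\mathbb Z\alpha_i$, the invariant form is normalized by $(\alpha_i,\alpha_i)=2$ (so $(\alpha_i,\alpha_j)=a_{ij}$), and $d_{ij}=\frac12(\alpha_i,\alpha_j)$. Centrally extended Yangian double. $\delta(w,z)=\sum_{r\in\mathbb Z}w^rz^{-r-1}$; powers $(w+a)^r$ with $r<0$ are expanded in nonnegative powers of $aw^{-1}$. $DY^{\mathsf c}_\hbar(\mathfrak g)$ is the unital associative $\mathbb C[\hbar]$-algebra generated by $\mathsf c$ and $x_{ir}^\pm,h_{ir}$ ($i\in I$, $r\in\mathbb Z$). Put $x_i^\pm(z)=\sum_{r\in\mathbb Z}x_{ir}^\pm z^{-r-1}$, $\tilde h_i^+(z)=\sum_{r\ge0}h_{ir}z^{-r-1}$, $\tilde h_i^-(z)=\sum_{r<0}h_{ir}z^{-r-1}$,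 $h_i^\pm(z)=1\pm\hbar\tilde h_i^\pm(z)$, $\mathsf c_{ij}^\pm=\hbar d_{ij}\pm\frac{\hbar\mathsf c}{2}$. The defining relations are: $\mathsf c$ is central; $[\tilde h_i^\pm(z),\tilde h_j^\pm(w)]=0$ (same signs); $$((z-w)^2-(\mathsf c_{ij}^+)^2)\tilde h_j^-(w)\tilde h_i^+(z)-((z-w)^2-(\mathsf c_{ij}^-)^2)\tilde h_i^+(z)\tilde h_j^-(w)=-2d_{ij}\mathsf c+2\hbar d_{ij}(\tilde h_j^-(w)-\tilde h_i^+(z))\mathsf c;$$ $$(z-w\mp\mathsf c_{ij}^-)\tilde h_i^+(z)x_j^\pm(w)-(z-w\pm\mathsf c_{ij}^+)x_j^\pm(w)\tilde h_i^+(z)=\pm2d_{ij}x_j^\pm(w);$$ $$(z-w\pm\hbar d_{ij})x_j^\pm(w)\tilde h_i^-(z)-(z-w\mp\hbar d_{ij})\tilde h_i^-(z)x_j^\pm(w)=\pm2d_{ij}x_j^\pm(w);$$ $$(z-w\mp\hbar d_{ij})x_i^\pm(z)x_j^\pm(w)=(z-w\pm\hbar d_{ij})x_j^\pm(w)x_i^\pm(z);$$ $$[x_i^+(z),x_j^-(w)]=\tfrac{\delta_{ij}}{\hbar}\left(\delta(w+\hbar\mathsf c,z)h_i^+(w+\tfrac{\hbar\mathsf c}2)-\delta(w,z)h_i^-(z)\right),$$ which, in terms of $\tilde h_i^\pm$, has no negative powers of $\hbar$: the right side is $\delta_{ij}\big(\tfrac1\hbar(\delta(w+\hbar\mathsf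 c,z)-\delta(w,z))+\delta(w+\hbar\mathsf c,z)\tilde h_i^+(w+\tfrac{\hbar\mathsf c}2)+\delta(w,z)\tilde h_i^-(z)\big)$; and $$\sum_{\sigma\in S_m}[x_i^\pm(z_{\sigma(1)}),[x_i^\pm(z_{\sigma(2)}),\cdots,[x_i^\pm(z_{\sigma(m)}),x_j^\pm(w)]\cdots]]=0\quad(i\ne j,\ m=1-a_{ij}).$$ Representation space. $\mathcal V=\mathbb C[\mathcal H_{i,-r}]_{i\in I,r>0}\otimes\mathbb C_\varepsilon[Q]$. Here $\mathcal H_{i,-r}$ ($r>0$) acts on the polynomial ring by multiplication, and $\mathcal H_{ir}$ ($r>0$) by $r\,\partial/\partial\mathcal H_{i,-r}$. $\varepsilon:Q\times Q\to\{\pm1\}$ is a fixed bimultiplicative function with $\varepsilon(\alpha,\alpha)=(-1)^{\frac12(\alpha,\alpha)}$ for all $\alpha\in Q$, and $\mathbb C_\varepsilon[Q]$ has basis $\{e^\alpha\}_{\alpha\in Q}$ with $e^\alpha e^\beta=\varepsilon(\alpha,\beta)e^{\alpha+\beta}$; $e^\alpha$ acts on $\mathcal V$ by left multiplication on the second factor. For $\alpha\in Q$, $\partial_\alpha(f\otimes e^\beta)=(\alpha,\beta)f\otimes e^\beta$, and $g(z)^{\partial_\alpha}(f\otimes e^\beta)=g(z)^{(\alpha,\beta)}f\otimes e^\beta$ for $g(z)=z$ or $g(z)$ an invertible element of $\mathbb C[\hbar][[z^{-1}]]$. All operators are extended $\mathbb C[[\hbar]]$-linearly ($\hbar$-adically)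 to $\mathcal V[[\hbar]]$. Vertex operators. $N(i)=\{j\ne i: a_{ij}\neq0\}$ is the set of neighbours of $i$ in the Dynkin diagram. Define $$A_i^\pm(z)=\exp\Big(\pm\sum_{r>0}\tfrac{\mathcal H_{i,-r}}r(z^r+(z\mp\hbar)^r)\mp\sum_{r>0}\sum_{j\in N(i)}\tfrac{\mathcal H_{j,-r}}r(z\mp\tfrac\hbar2)^r\Big),\quad B_i^\pm(z)=\exp\Big(\mp\sum_{r>0}\tfrac{\mathcal H_{ir}}rz^{-r}\Big),$$ $$\mathbf X_i^\pm(z)=\pm A_i^\pm(z)B_i^\pm(z)e^{\pm\alpha_i}z^{\partial_{\pm\alpha_i}},\quad \mathbf H_i^+(z)=B_i^+(z+\tfrac\hbar2)B_i^-(z-\tfrac\hbar2)\Big(\tfrac{1+\frac\hbar2z^{-1}}{1-\frac\hbar2z^{-1}}\Big)^{\partial_{\alpha_i}},\quad \mathbf H_i^-(z)=A_i^+(z)A_i^-(z).$$ These are series in $(\mathrm{End}_{\mathbb C[[\hbar]]}\mathcal V[[\hbar]])[[z^{\pm1}]]$. Since $\mathcal V[[\hbar]]$ is torsion free and $\mathbf H_i^\pm(z)\equiv1$ mod $\hbar$, the assignment $h_i^\pm(z)\mapsto\mathbf H_i^\pm(z)$ means $\tilde h_i^\pm(z)\mapsto\pm\hbar^{-1}(\mathbf H_i^\pm(z)-1)$. *)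

theory Defs
  imports
    "HOL-Library.Poly_Mapping"
    "HOL-Library.Groups_Big_Fun"
    "HOL-Computational_Algebra.Formal_Power_Series"
    "HOL-Computational_Algebra.Polynomial_FPS"
    "HOL-Combinatorics.Permutations"
    "HOL-Algebra.QuotRing"
    "HOL-Algebra.Module"
begin

section \<open>Cartan data\<close>

definition simply_laced_cartan :: "('i::finite \<Rightarrow> 'i \<Rightarrow> int) \<Rightarrow> bool" where
  "simply_laced_cartan a \<longleftrightarrow>
     (\<forall>i. a i i = 2) \<and>
     (\<forall>i j. a i j = a j i) \<and>
     (\<forall>i j. i \<noteq> j \<longrightarrow> a i j \<in> {0, -1}) \<and>
     (\<forall>J. J \<noteq> {} \<and> J \<noteq> UNIV \<longrightarrow> (\<exists>i\<in>J. \<exists>j\<in>-J. a i j \<noteq> 0))"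

definition neighbours :: "('i \<Rightarrow> 'i \<Rightarrow> int) \<Rightarrow> 'i \<Rightarrow> 'i set" where
  "neighbours a i = {j. j \<noteq> i \<and> a i j \<noteq> 0}"

text \<open>The root lattice; \<open>\<alpha>\<^sub>i\<close> is \<open>Poly_Mapping.single i 1\<close>.\<close>

type_synonym 'i lattice = "'i \<Rightarrow>\<^sub>0 int"

definition form :: "('i::finite \<Rightarrow> 'i \<Rightarrow> int) \<Rightarrow> 'i lattice \<Rightarrow> 'i lattice \<Rightarrow> int" where
  "form a \<alpha> \<beta> =
     (\<Sum>i\<in>UNIV. \<Sum>j\<in>UNIV. Poly_Mapping.lookup \<alpha> i * a i j * Poly_Mapping.lookup \<beta> j)"

definition sign_cocycle ::
    "('i::finite \<Rightarrow> 'i \<Rightarrow> int) \<Rightarrow> ('i lattice \<Rightarrow> 'i lattice \<Rightarrow> complex) \<Rightarrow> bool" where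
  "sign_cocycle a \<epsilon> \<longleftrightarrow>
     (\<forall>\<alpha> \<beta>. \<epsilon> \<alpha> \<beta> \<in> {1, -1}) \<and>
     (\<forall>\<alpha> \<beta> \<gamma>. \<epsilon> (\<alpha> + \<beta>) \<gamma> = \<epsilon> \<alpha> \<gamma> * \<epsilon> \<beta> \<gamma>) \<and>
     (\<forall>\<alpha> \<beta> \<gamma>. \<epsilon> \<alpha> (\<beta> + \<gamma>) = \<epsilon> \<alpha> \<beta> * \<epsilon> \<alpha> \<gamma>) \<and>
     (\<forall>\<alpha>. \<epsilon> \<alpha> \<alpha> = (-1) powi (form a \<alpha> \<alpha> div 2))"

text \<open>The upper and lower signs of a formula containing \<open>\<plusminus>\<close>.\<close>

datatype sign = Plus | Minus

definition sg :: "sign \<Rightarrow> 'a::ring_1" where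
  "sg s = (case s of Plus \<Rightarrow> 1 | Minus \<Rightarrow> -1)"

text \<open>The binomial coefficient \<open>(r choose k)\<close> for an integer \<open>r\<close>; the division is exact.\<close>

definition int_gbinomial :: "int \<Rightarrow> nat \<Rightarrow> int" where
  "int_gbinomial r k = (\<Prod>i = 0..<k. r - int i) div fact k"

lemma of_int_int_gbinomial:
  "of_int (int_gbinomial r k) = (of_int r :: 'a::field_char_0) gchoose k"
  using of_int_gbinomial[of r k, where 'a = 'a]
  by (simp only: int_gbinomial_def gbinomial_prod_rev of_nat_id)

text \<open>
  Formal series in \<open>z\<close> (and \<open>w\<close>), infinite in both directions, are functions giving the
  coefficient of \<open>z\<^sup>p\<close> (of \<open>z\<^sup>p w\<^sup>q\<close>).  The next function gives the coefficient of \<open>z\<^sup>p\<close> in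
  \<open>(z + b)\<^sup>r\<close>, expanded in nonnegative powers of \<open>b\<close> for every integer \<open>r\<close>.
\<close>

definition shifted_power :: "'a::ring_1 \<Rightarrow> int \<Rightarrow> int \<Rightarrow> 'a" where
  "shifted_power b r p =
     (if p \<le> r then of_int (int_gbinomial r (nat (r - p))) * b ^ nat (r - p) else 0)"


section \<open>Algebras given by generators and relations\<close>

text \<open>
  Associative algebras with scalars \<open>'r\<close> are records of type \<^type>\<open>module\<close>, which carry both
  a multiplication and a scalar action.
\<close>

definition algebra_homs ::
    "('r, 'a, 'm) module_scheme \<Rightarrow> ('r, 'b, 'n) module_scheme \<Rightarrow> ('a \<Rightarrow> 'b) set" where
  "algebra_homs A B =
     {f \<in> ring_hom A B. \<forall>p. \<forall>x\<in>carrier A. f (p \<odot>\<^bsub>A\<^esub> x) = p \<odot>\<^bsub>B\<^esub> f x}"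

definition quotient_algebra ::
    "('r, 'a) module \<Rightarrow> 'a set \<Rightarrow> ('r, 'a set) module" where
  "quotient_algebra A I =
     ring.extend (A Quot I) (module.fields (\<lambda>p K. \<Union>u\<in>K. I +>\<^bsub>A\<^esub> (p \<odot>\<^bsub>A\<^esub> u)))"

datatype 'g word = Word "'g list"

instantiation word :: (type) monoid_add
begin

definition zero_word :: "'a word" where "zero_word = Word []"

fun plus_word :: "'a word \<Rightarrow> 'a word \<Rightarrow> 'a word" where
  "plus_word (Word u) (Word v) = Word (u @ v)"

instance
proof
  fix u v w :: "'a word"
  show "u + v + w = u + (v + w)" by (cases u; cases v; cases w) simp
  show "0 + u = u" by (cases u) (simp add: zero_word_def)
  show "u + 0 = u" by (cases u) (simp add: zero_word_def)
qed

end

text \<open>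
  The free associative \<open>\<complex>[\<hbar>]\<close>-algebra on a set of generators, as the monoid algebra of the
  free monoid (written additively, so that convolution is the product).
\<close>

type_synonym 'g free = "'g word \<Rightarrow>\<^sub>0 complex poly"

definition gen :: "'g \<Rightarrow> 'g free" where
  "gen g = Poly_Mapping.single (Word [g]) 1"

definition scalar :: "complex poly \<Rightarrow> 'g free" where
  "scalar p = Poly_Mapping.single 0 p"

definition free_algebra :: "(complex poly, 'g free) module" where
  "free_algebra =
     \<lparr>carrier = UNIV, mult = (*), one = 1, zero = 0, add = (+), smult = (\<lambda>p u. scalar p * u)\<rparr>"


section \<open>The centrally extended Yangian double\<close>

text \<open>\<open>GenC\<close>, \<open>GenX s i r\<close> and \<open>GenH i r\<close> are \<open>c\<close>, \<open>x\<^sup>s\<^sub>i\<^sub>r\<close> and \<open>h\<^sub>i\<^sub>r\<close>.\<close>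

datatype 'i ygen = GenC | GenX sign 'i int | GenH 'i int

type_synonym 'i yfree = "'i ygen free"

text \<open>
  In the sequel \<open>hb\<close> is \<open>\<hbar>\<close>, \<open>cc\<close> is \<open>c\<close>, \<open>dd a i j\<close> is \<open>d\<^sub>i\<^sub>j = a\<^sub>i\<^sub>j / 2\<close>, and \<open>cpm a s i j\<close> is
  \<open>c\<^sup>s\<^sub>i\<^sub>j = \<hbar> d\<^sub>i\<^sub>j \<plusminus> \<hbar> c / 2\<close>.
\<close>

definition hb :: "'i yfree" where "hb = scalar [:0, 1:]"

definition cc :: "'i yfree" where "cc = gen GenC"

definition dd :: "('i \<Rightarrow> 'i \<Rightarrow> int) \<Rightarrow> 'i \<Rightarrow> 'i \<Rightarrow> 'i yfree" where
  "dd a i j = scalar [:of_int (a i j) / 2:]"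

definition cpm :: "('i \<Rightarrow> 'i \<Rightarrow> int) \<Rightarrow> sign \<Rightarrow> 'i \<Rightarrow> 'i \<Rightarrow> 'i yfree" where
  "cpm a s i j = hb * dd a i j + sg s * scalar [:1/2:] * hb * cc"

text \<open>
  The mode \<open>r\<close> of a generating series is the coefficient of \<open>z\<^bsup>-r-1\<^esup>\<close>, so that the coefficient
  of \<open>z\<^sup>p\<close> is the mode \<open>- p - 1\<close>.
\<close>

definition x_ser :: "sign \<Rightarrow> 'i \<Rightarrow> int \<Rightarrow> 'i yfree" where
  "x_ser s i p = gen (GenX s i (- p - 1))"

text \<open>\<open>ht_ser\<close> is the series written with a tilde; \<open>h_ser\<close> is \<open>1 \<plusminus> \<hbar>\<close> times it.\<close>

definition ht_ser :: "sign \<Rightarrow> 'i \<Rightarrow> int \<Rightarrow> 'i yfree" where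
  "ht_ser s i p =
     (if (case s of Plus \<Rightarrow> - p - 1 \<ge> 0 | Minus \<Rightarrow> - p - 1 < 0) then gen (GenH i (- p - 1)) else 0)"

definition h_ser :: "sign \<Rightarrow> 'i \<Rightarrow> int \<Rightarrow> 'i yfree" where
  "h_ser s i p = of_bool (p = 0) + sg s * hb * ht_ser s i p"

definition comm :: "'a::ring_1 \<Rightarrow> 'a \<Rightarrow> 'a" where
  "comm u v = u * v - v * u"

definition in_z :: "(int \<Rightarrow> 'a::ring_1) \<Rightarrow> int \<Rightarrow> int \<Rightarrow> 'a" where
  "in_z f p q = (if q = 0 then f p else 0)"

definition in_w :: "(int \<Rightarrow> 'a::ring_1) \<Rightarrow> int \<Rightarrow> int \<Rightarrow> 'a" where
  "in_w f p q = (if p = 0 then f q else 0)"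

text \<open>\<open>zw_times b F\<close> is \<open>(z - w + b) F(z, w)\<close>.\<close>

definition zw_times :: "'a::ring_1 \<Rightarrow> (int \<Rightarrow> int \<Rightarrow> 'a) \<Rightarrow> int \<Rightarrow> int \<Rightarrow> 'a" where
  "zw_times b F p q = F (p - 1) q - F p (q - 1) + b * F p q"

text \<open>
  Coefficients of \<open>\<delta>(w + b, z) = (\<Sum>r. (w + b)\<^sup>r z\<^bsup>-r-1\<^esup>)\<close>, and of
  \<open>(\<delta>(w + \<hbar> c, z) - \<delta>(w, z)) / \<hbar>\<close>, where the division by \<open>\<hbar>\<close> is carried out termwise.
\<close>

definition delta_ser :: "'a::ring_1 \<Rightarrow> int \<Rightarrow> int \<Rightarrow> 'a" where
  "delta_ser b p q = shifted_power b (- p - 1) q"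

definition delta_quot :: "int \<Rightarrow> int \<Rightarrow> 'i yfree" where
  "delta_quot p q =
     (let r = - p - 1; k = nat (r - q) in
      if q < r then of_int (int_gbinomial r k) * hb ^ (k - 1) * cc ^ k else 0)"

lemma hb_central: "hb * u = u * hb"
proof -
  have "Poly_Mapping.single 0 p * v = v * Poly_Mapping.single 0 p"
    for p :: "complex poly" and v :: "'g free"
  proof (induction v rule: Poly_Mapping.update_induct)
    case (update v m b)
    have "Poly_Mapping.update m b v = v + Poly_Mapping.single m b"
      using update(1)
      by (intro poly_mapping_eqI) (auto simp: lookup_update lookup_add lookup_single when_def in_keys_iff)
    then show ?case
      by (simp add: update.IH distrib_left distrib_right mult_single mult.commute)
  qed simp
  then show ?thesis by (simp add: hb_def scalar_def)
qed

lemma hb_delta_quot: "hb * delta_quot p q = delta_ser (hb * cc) p q - delta_ser 0 p q"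
proof (cases "q < - p - 1")
  case True
  define k where "k = nat (- p - 1 - q)"
  have k: "k > 0" using True by (simp add: k_def)
  have pw: "(hb * cc) ^ n = hb ^ n * (cc :: 'i yfree) ^ n" for n
  proof (induction n)
    case (Suc n)
    have "hb ^ n * cc = cc * (hb :: 'i yfree) ^ n"
      by (rule power_commuting_commutes) (rule hb_central)
    then have "hb * (hb ^ n * cc) * (cc :: 'i yfree) ^ n = hb * (cc * hb ^ n) * cc ^ n"
      by simp
    then show ?case by (simp only: power_Suc Suc mult.assoc)
  qed simp
  have "hb * (of_int m * hb ^ (k - 1) * (cc :: 'i yfree) ^ k) = of_int m * (hb * cc) ^ k" for m
  proof -
    have "hb * (of_int m * hb ^ (k - 1) * (cc :: 'i yfree) ^ k)
        = (hb * of_int m) * hb ^ (k - 1) * cc ^ k"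
      by (simp only: mult.assoc)
    also have "hb * of_int m = of_int m * (hb :: 'i yfree)"
      by (rule hb_central)
    also have "of_int m * (hb :: 'i yfree) * hb ^ (k - 1) = of_int m * hb ^ k"
      using k by (simp add: power_eq_if mult.assoc)
    finally show ?thesis by (simp only: pw mult.assoc)
  qed
  then show ?thesis
    using True k by (simp add: delta_quot_def delta_ser_def shifted_power_def Let_def
        k_def[symmetric] zero_power)
qed (auto simp: delta_quot_def delta_ser_def shifted_power_def)

text \<open>
  \<open>ht_plus_shifted i b\<close> is the plus series of \<open>i\<close> with \<open>w + b\<close> substituted for \<open>w\<close>.  In it and
  in the product that follows, the omitted summands vanish.
\<close>

definition ht_plus_shifted :: "'i \<Rightarrow> 'i yfree \<Rightarrow> int \<Rightarrow> 'i yfree" where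
  "ht_plus_shifted i b q = (\<Sum>n\<in>{q..-1}. shifted_power b n q * ht_ser Plus i n)"

text \<open>
  The right-hand side of the relation for \<open>[x\<^sup>+\<^sub>i(z), x\<^sup>-\<^sub>i(w)]\<close>.  The last summand is \<open>\<delta>(w, z)\<close>
  times the minus series in \<open>z\<close>: the coefficient of \<open>z\<^sup>p w\<^sup>q\<close> comes from
  \<open>w\<^sup>q z\<^bsup>-q-1\<^esup> \<cdot> z\<^bsup>p+q+1\<^esup>\<close>.
\<close>

definition xx_bracket :: "'i \<Rightarrow> int \<Rightarrow> int \<Rightarrow> 'i yfree" where
  "xx_bracket i p q =
     delta_quot p q
     + (\<Sum>n\<in>{q<..-p-1}.
          delta_ser (hb * cc) p n * ht_plus_shifted i (scalar [:1/2:] * hb * cc) (q - n))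
     + ht_ser Minus i (p + q + 1)"

text \<open>Each defining relation \<open>L = R\<close> contributes all coefficients of \<open>L - R\<close>.\<close>

inductive_set yangian_relators :: "('i \<Rightarrow> 'i \<Rightarrow> int) \<Rightarrow> 'i yfree set" for a where
  central: "comm cc (gen g) \<in> yangian_relators a"
| h_h: "comm (ht_ser s i p) (ht_ser s j q) \<in> yangian_relators a"
| h_h_mixed:
    "(let L = (\<lambda>p q. ht_ser Minus j q * ht_ser Plus i p);
          R = (\<lambda>p q. ht_ser Plus i p * ht_ser Minus j q)
      in (zw_times 0 (zw_times 0 L) p q - (cpm a Plus i j)\<^sup>2 * L p q)
         - (zw_times 0 (zw_times 0 R) p q - (cpm a Minus i j)\<^sup>2 * R p q)
         - (- 2 * dd a i j * cc * of_bool (p = 0 \<and> q = 0)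
            + 2 * hb * dd a i j * (in_w (ht_ser Minus j) p q - in_z (ht_ser Plus i) p q) * cc))
     \<in> yangian_relators a"
| h_plus_x:
    "zw_times (- sg s * cpm a Minus i j) (\<lambda>p q. ht_ser Plus i p * x_ser s j q) p q
     - zw_times (sg s * cpm a Plus i j) (\<lambda>p q. x_ser s j q * ht_ser Plus i p) p q
     - sg s * 2 * dd a i j * in_w (x_ser s j) p q
     \<in> yangian_relators a"
| h_minus_x:
    "zw_times (sg s * hb * dd a i j) (\<lambda>p q. x_ser s j q * ht_ser Minus i p) p q
     - zw_times (- sg s * hb * dd a i j) (\<lambda>p q. ht_ser Minus i p * x_ser s j q) p q
     - sg s * 2 * dd a i j * in_w (x_ser s j) p q
     \<in> yangian_relators a"
| x_x:
    "zw_times (- sg s * hb * dd a i j) (\<lambda>p q. x_ser s i p * x_ser s j q) p q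
     - zw_times (sg s * hb * dd a i j) (\<lambda>p q. x_ser s j q * x_ser s i p) p q
     \<in> yangian_relators a"
| x_plus_x_minus:
    "comm (x_ser Plus i p) (x_ser Minus j q) - (if i = j then xx_bracket i p q else 0)
     \<in> yangian_relators a"
| serre:
    "i \<noteq> j \<Longrightarrow> m = nat (1 - a i j) \<Longrightarrow>
     (\<Sum>\<sigma> | \<sigma> permutes {..<m}.
        foldr (\<lambda>k u. comm (x_ser s i (f (\<sigma> k))) u) [0..<m] (x_ser s j q))
     \<in> yangian_relators a" for f :: "nat \<Rightarrow> int"

definition yangian_ideal :: "('i \<Rightarrow> 'i \<Rightarrow> int) \<Rightarrow> 'i yfree set" where
  "yangian_ideal a = genideal free_algebra (yangian_relators a)"

definition yangian_double ::
    "('i \<Rightarrow> 'i \<Rightarrow> int) \<Rightarrow> (complex poly, 'i yfree set) module" where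
  "yangian_double a = quotient_algebra free_algebra (yangian_ideal a)"

definition yclass :: "('i \<Rightarrow> 'i \<Rightarrow> int) \<Rightarrow> 'i yfree \<Rightarrow> 'i yfree set" where
  "yclass a u = yangian_ideal a +>\<^bsub>free_algebra\<^esub> u"


section \<open>The representation space\<close>

text \<open>
  The polynomial variable \<open>\<H>\<^bsub>i,-r\<^esub>\<close>, \<open>r > 0\<close>, is indexed by the pair \<open>(i, r - 1)\<close>, and
  \<open>f \<otimes> e\<^sup>\<beta>\<close> is \<open>Poly_Mapping.single \<beta> f\<close>.  The ring multiplication that the type \<open>'i fock\<close>
  inherits is the untwisted one of a group algebra; it is only used for multiplication by
  polynomials, i.e. by elements \<open>Poly_Mapping.single 0 f\<close>.
\<close>

type_synonym 'i pols = "('i \<times> nat \<Rightarrow>\<^sub>0 nat) \<Rightarrow>\<^sub>0 complex"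

type_synonym 'i fock = "'i lattice \<Rightarrow>\<^sub>0 'i pols"

definition pvar :: "'v \<Rightarrow> ('v \<Rightarrow>\<^sub>0 nat) \<Rightarrow>\<^sub>0 complex" where
  "pvar v = Poly_Mapping.single (Poly_Mapping.single v 1) 1"

definition pderivative ::
    "'v \<Rightarrow> (('v \<Rightarrow>\<^sub>0 nat) \<Rightarrow>\<^sub>0 complex) \<Rightarrow> (('v \<Rightarrow>\<^sub>0 nat) \<Rightarrow>\<^sub>0 complex)" where
  "pderivative v f =
     (\<Sum>m\<in>Poly_Mapping.keys f.
        Poly_Mapping.single (m - Poly_Mapping.single v 1)
          (of_nat (Poly_Mapping.lookup m v) * Poly_Mapping.lookup f m))"

text \<open>The action of \<open>\<complex>[[\<hbar>]]\<close> on \<open>\<V>[[\<hbar>]]\<close>, whose elements are power series in \<open>\<hbar>\<close>.\<close>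

definition hsmult :: "complex fps \<Rightarrow> 'i fock fps \<Rightarrow> 'i fock fps" where
  "hsmult c v =
     Abs_fps (\<lambda>n. Poly_Mapping.single 0 (Poly_Mapping.single 0 (fps_nth c n))) * v"

lemma module_hsmult: "Modules.module (hsmult :: complex fps \<Rightarrow> 'i fock fps \<Rightarrow> 'i fock fps)"
proof -
  define e :: "complex fps \<Rightarrow> 'i fock fps" where
    "e = (\<lambda>c. Abs_fps (\<lambda>n. Poly_Mapping.single 0 (Poly_Mapping.single 0 (fps_nth c n))))"
  have "e (c + d) = e c + e d" for c d
    by (simp add: e_def fps_eq_iff single_add)
  moreover have "e (c * d) = e c * e d" for c d
  proof -
    have "Poly_Mapping.single 0 (Poly_Mapping.single 0 (sum f I))
        = (\<Sum>k\<in>I. (Poly_Mapping.single 0 (Poly_Mapping.single 0 (f k)) :: 'i fock))"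
      for f and I :: "nat set"
      by (induction I rule: infinite_finite_induct) (simp_all add: single_add)
    then show ?thesis
      by (simp add: e_def fps_eq_iff fps_mult_nth mult_single)
  qed
  moreover have "e 1 = 1"
    by (simp add: e_def fps_eq_iff flip: single_one)
  moreover have "hsmult c v = e c * v" for c and v :: "'i fock fps"
    by (simp add: hsmult_def e_def)
  ultimately show ?thesis
    by unfold_locales (simp_all add: algebra_simps)
qed

definition linear_extend :: "('i fock \<Rightarrow> 'i fock) \<Rightarrow> 'i fock fps \<Rightarrow> 'i fock fps" where
  "linear_extend T v = Abs_fps (\<lambda>n. T (fps_nth v n))"

definition end_algebra :: "(complex poly, 'i fock fps \<Rightarrow> 'i fock fps) module" where
  "end_algebra =
     \<lparr>carrier = {T. Modules.module_hom hsmult hsmult T},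
      mult = (\<circ>), one = id, zero = (\<lambda>v. 0), add = (\<lambda>S T v. S v + T v),
      smult = (\<lambda>p T v. hsmult (fps_of_poly p) (T v))\<rparr>"

text \<open>
  Sum of a family that converges \<open>\<hbar>\<close>-adically, in the sense that each power of \<open>\<hbar>\<close> receives
  only finitely many contributions (as is the case in all uses below).
\<close>

definition hsum :: "('b \<Rightarrow> 'i fock fps) \<Rightarrow> 'i fock fps" where
  "hsum f = Abs_fps (\<lambda>n. Sum_any (\<lambda>b. fps_nth (f b) n))"


section \<open>Vertex operators\<close>

text \<open>Formal series in \<open>z\<close> with operator coefficients, their products and exponentials.\<close>

type_synonym 'i opser = "int \<Rightarrow> 'i fock fps \<Rightarrow> 'i fock fps"

definition op_const :: "('i fock fps \<Rightarrow> 'i fock fps) \<Rightarrow> 'i opser" where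
  "op_const T p v = (if p = 0 then T v else 0)"

definition op_times :: "'i opser \<Rightarrow> 'i opser \<Rightarrow> 'i opser" where
  "op_times F G p v = hsum (\<lambda>q. F q (G (p - q) v))"

definition op_exp :: "'i opser \<Rightarrow> 'i opser" where
  "op_exp E p v =
     hsum (\<lambda>n. hsmult (fps_const (1 / fact n)) ((op_times E ^^ n) (op_const id) p v))"

text \<open>\<open>heis_neg i r\<close> and \<open>heis_pos i r\<close> are \<open>\<H>\<^bsub>i,-r\<^esub>\<close> and \<open>\<H>\<^bsub>i,r\<^esub>\<close>, used for \<open>r > 0\<close> only.\<close>

definition heis_neg :: "'i \<Rightarrow> nat \<Rightarrow> 'i fock fps \<Rightarrow> 'i fock fps" where
  "heis_neg i r = linear_extend (\<lambda>v. Poly_Mapping.single 0 (pvar (i, r - 1)) * v)"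

definition heis_pos :: "'i \<Rightarrow> nat \<Rightarrow> 'i fock fps \<Rightarrow> 'i fock fps" where
  "heis_pos i r =
     linear_extend (Poly_Mapping.map (\<lambda>f. of_nat r * pderivative (i, r - 1) f))"

text \<open>
  \<open>heis_series T g\<close> is \<open>(\<Sum>r>0. (T\<^sub>r / r) g\<^sub>r(z))\<close>, where \<open>g r p\<close> is the coefficient of \<open>z\<^sup>p\<close>
  in \<open>g\<^sub>r(z)\<close>.
\<close>

definition heis_series ::
    "(nat \<Rightarrow> 'i fock fps \<Rightarrow> 'i fock fps) \<Rightarrow> (nat \<Rightarrow> int \<Rightarrow> complex fps) \<Rightarrow> 'i opser" where
  "heis_series T g p v =
     hsum (\<lambda>n. hsmult (fps_const (1 / of_nat (Suc n)) * g (Suc n) p) (T (Suc n) v))"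

definition A_op :: "('i::finite \<Rightarrow> 'i \<Rightarrow> int) \<Rightarrow> sign \<Rightarrow> 'i \<Rightarrow> 'i opser" where
  "A_op a s i = op_exp (\<lambda>p v.
     heis_series (heis_neg i)
       (\<lambda>r p. sg s * (shifted_power 0 (int r) p + shifted_power (- sg s * fps_X) (int r) p)) p v
     + (\<Sum>j\<in>neighbours a i.
          heis_series (heis_neg j)
            (\<lambda>r p. - sg s * shifted_power (- sg s * fps_const (1/2) * fps_X) (int r) p) p v))"

text \<open>\<open>B_op s i b\<close> is the series \<open>B\<close> with argument \<open>z + b\<close>.\<close>

definition B_op :: "sign \<Rightarrow> 'i \<Rightarrow> complex fps \<Rightarrow> 'i opser" where
  "B_op s i b =
     op_exp (heis_series (heis_pos i) (\<lambda>r p. - sg s * shifted_power b (- int r) p))"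

definition e_op ::
    "('i lattice \<Rightarrow> 'i lattice \<Rightarrow> complex) \<Rightarrow> 'i lattice \<Rightarrow> 'i fock fps \<Rightarrow> 'i fock fps" where
  "e_op \<epsilon> \<alpha> = linear_extend (\<lambda>v.
     \<Sum>\<beta>\<in>Poly_Mapping.keys v.
       Poly_Mapping.single (\<alpha> + \<beta>)
         (Poly_Mapping.single 0 (\<epsilon> \<alpha> \<beta>) * Poly_Mapping.lookup v \<beta>))"

text \<open>
  \<open>power_partial a G \<alpha>\<close> is \<open>g(z)\<close> to the power \<open>\<partial>\<^sub>\<alpha>\<close>, where \<open>G n p\<close> is the coefficient of
  \<open>z\<^sup>p\<close> in \<open>g(z)\<^sup>n\<close>: on \<open>\<P> \<otimes> e\<^sup>\<beta>\<close> it is the scalar series \<open>g(z)\<^bsup>(\<alpha>,\<beta>)\<^esup>\<close>.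
\<close>

definition power_partial ::
    "('i::finite \<Rightarrow> 'i \<Rightarrow> int) \<Rightarrow> (int \<Rightarrow> int \<Rightarrow> complex fps) \<Rightarrow> 'i lattice \<Rightarrow> 'i opser" where
  "power_partial a G \<alpha> p v =
     hsum (\<lambda>\<beta>. hsmult (G (form a \<alpha> \<beta>) p)
       (linear_extend (\<lambda>u. Poly_Mapping.single \<beta> (Poly_Mapping.lookup u \<beta>)) v))"

definition z_powers :: "int \<Rightarrow> int \<Rightarrow> complex fps" where
  "z_powers n p = of_bool (p = n)"

text \<open>
  Powers of \<open>(1 + (\<hbar>/2) z\<^bsup>-1\<^esup>) / (1 - (\<hbar>/2) z\<^bsup>-1\<^esup>)\<close>; here the variable of the outer power
  series is \<open>z\<^bsup>-1\<^esup>\<close> and that of the inner ones is \<open>\<hbar>\<close>.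
\<close>

definition cartan_ratio :: "complex fps fps" where
  "cartan_ratio =
     (let u = fps_const (fps_const (1/2) * fps_X) * fps_X in (1 + u) * inverse (1 - u))"

lemma cartan_ratio:
  "cartan_ratio * (1 - fps_const (fps_const (1/2) * fps_X) * fps_X) =
     1 + fps_const (fps_const (1/2) * fps_X) * fps_X"
proof -
  define u :: "complex fps fps" where "u = fps_const (fps_const (1/2) * fps_X) * fps_X"
  have "(1 - u) * inverse (1 - u) = 1"
    by (subst fps_inverse_def, rule fps_right_inverse) (simp add: u_def)
  then show ?thesis
    unfolding cartan_ratio_def Let_def u_def[symmetric] by (simp add: mult.assoc mult.commute)
qed

definition ratio_powers :: "int \<Rightarrow> int \<Rightarrow> complex fps" where
  "ratio_powers n p = (if p \<le> 0 then fps_nth (cartan_ratio powi n) (nat (- p)) else 0)"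

definition X_op ::
    "('i::finite \<Rightarrow> 'i \<Rightarrow> int) \<Rightarrow> ('i lattice \<Rightarrow> 'i lattice \<Rightarrow> complex) \<Rightarrow> sign \<Rightarrow> 'i \<Rightarrow> 'i opser"
  where
  "X_op a \<epsilon> s i =
     (let \<alpha> = Poly_Mapping.single i (sg s) in
      op_times (op_const (hsmult (sg s)))
        (op_times (A_op a s i)
          (op_times (B_op s i 0)
            (op_times (op_const (e_op \<epsilon> \<alpha>)) (power_partial a z_powers \<alpha>)))))"

definition H_op :: "('i::finite \<Rightarrow> 'i \<Rightarrow> int) \<Rightarrow> sign \<Rightarrow> 'i \<Rightarrow> 'i opser" where
  "H_op a s i =
     (case s of
        Plus \<Rightarrow>
          op_times (B_op Plus i (fps_const (1/2) * fps_X))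
            (op_times (B_op Minus i (- fps_const (1/2) * fps_X))
              (power_partial a ratio_powers (Poly_Mapping.single i 1)))
      | Minus \<Rightarrow> op_times (A_op a Plus i) (A_op a Minus i))"

end

theory Submission
  imports Defs "HOL-Library.Product_Plus"
begin

text \<open>
  Families of operators indexed by exponents, i.e. formal series in one or several variables, are
  acted upon by Laurent polynomials in these variables.  All products of the fields \<open>X\<close> and
  \<open>H\<close> have the same kind of commutation relations with the Heisenberg operators, and a family with
  such relations vanishes as soon as its vacuum expectation values do: applied to a vacuum vector it
  is an eigenvector of the annihilation operators, which determines it from its vacuum component, and
  commutation with the creation operators determines it on all other vectors.  Every relation is
  thereby reduced to scalar correlation functions.  These are expansions of rational functions, which
  are compared by clearing denominators: a linear factor acts injectively on the families that are
  bounded in the appropriate direction.  Expansions of the same function in opposite directions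
  differ by the delta functions in the bracket of \<open>X\<^sup>+\<close> and \<open>X\<^sup>-\<close>, and cancel in
  the Serre relation.  The division by \<open>\<hbar>\<close> in \<open>H = 1 \<plusminus> \<hbar> T\<close> is possible since the
  uniqueness principle also holds modulo \<open>\<hbar>\<close>.
\<close>

section \<open>Linear operators and \<hbar>-adic sums\<close>

text \<open>Linear factors are not injective on series that are infinite in both directions: z - w
  kills delta(w, z), so a relation between fields cannot be divided by it. Expectation values can be
  divided: there A contributes only its identity term and B only descending powers of z, which
  bounds the exponents. These functions are rational because the exponents of A are built from sums
  (x^r) / r with x a shift of z by a multiple of hbar / 2, and exp(- sum x^r z^-r / r) = 1 - x / z;
  Newton's recursion stands in for the logarithm. Commuting H^+(z) with a creation operator produces
  (z +/- hbar/2)^-r, which is not a Laurent polynomial. Hence commutators are recorded together with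
  a denominator, and such denominators have to be injective modulo every power of hbar. Arguments by
  generation from vacuum vectors are made modulo hbar^N because a vector is an infinite series in
  hbar, while creation operators reach only finite combinations. With c acting as 1, the shifts hbar
  c / 2 and hbar d_ij are all integral multiples of the one constant \<open>eta\<close>, which is
  hbar / 2.\<close>

abbreviation lookup where "lookup \<equiv> Poly_Mapping.lookup"

lemma poly_mapping_single_induct [case_names zero single add]:
  assumes "P 0" and "\<And>k c. P (Poly_Mapping.single k c)"
    and "\<And>f g. P f \<Longrightarrow> P g \<Longrightarrow> P (f + g)"
  shows "P (f :: 'a \<Rightarrow>\<^sub>0 'b::comm_monoid_add)"
proof (induction f rule: Poly_Mapping.update_induct)
  case const
  then show ?case by (rule assms(1))
next
  case (update f a b)
  have "Poly_Mapping.update a b f = f + Poly_Mapping.single a b"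
    using update(1)
    by (intro poly_mapping_eqI) (auto simp: lookup_update lookup_add lookup_single when_def in_keys_iff)
  then show ?case using assms update by simp
qed

text \<open>Products, derivatives, the action of shifts and the evaluation of the free algebra are
  additive in each argument, so identities between them reduce to monomials by this
  principle.\<close>

lemma additive_eq_on_single:
  fixes S T :: "('a \<Rightarrow>\<^sub>0 'b::comm_monoid_add) \<Rightarrow> 'c::ab_group_add"
  assumes "\<And>f g. S (f + g) = S f + S g" "\<And>f g. T (f + g) = T f + T g"
    and "\<And>k c. S (Poly_Mapping.single k c) = T (Poly_Mapping.single k c)"
  shows "S f = T f"
proof (induction f rule: poly_mapping_single_induct)
  case zero
  have "S 0 = 0" "T 0 = 0" using assms(1)[of 0 0] assms(2)[of 0 0] by simp_all
  then show ?case by simp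
qed (simp_all add: assms)

lemma lookup_single_0_mult [simp]:
  fixes f :: "'a::monoid_add \<Rightarrow>\<^sub>0 'b::comm_ring_1"
  shows "lookup (Poly_Mapping.single 0 c * f) k = c * lookup f k"
proof -
  have "lookup (Poly_Mapping.map ((*) c) f) k = c * lookup f k"
    by transfer (simp add: when_def)
  then show ?thesis by (simp add: mult_map_scale_conv_mult)
qed

text \<open>The scalar as a multiple of the unit of the untwisted group algebra, so that the
  coefficients of \<open>hsmult\<close> become ordinary products.\<close>

definition kk :: "complex \<Rightarrow> 'i fock" where
  "kk c = Poly_Mapping.single 0 (Poly_Mapping.single 0 c)"

lemma lookup_kk_mult [simp]: "lookup (lookup (kk c * u) \<beta>) m = c * lookup (lookup u \<beta>) m"
  by (simp add: kk_def)

lemma kk_0 [simp]: "kk 0 = 0" and kk_1 [simp]: "kk 1 = 1"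
  by (simp_all add: kk_def)

lemma hsmult_nth: "fps_nth (hsmult c v) n = (\<Sum>i\<le>n. kk (fps_nth c i) * fps_nth v (n - i))"
  by (simp add: hsmult_def fps_mult_nth kk_def atMost_atLeast0)

interpretation hs: Modules.module "hsmult :: complex fps \<Rightarrow> 'i fock fps \<Rightarrow> 'i fock fps"
  by (rule module_hsmult)

lemma hsmult_fps_const_nth [simp]: "fps_nth (hsmult (fps_const c) v) n = kk c * fps_nth v n"
proof -
  have "(\<Sum>i\<le>n. kk (fps_nth (fps_const c) i) * fps_nth v (n - i))
      = (\<Sum>i\<in>{0}. kk (fps_nth (fps_const c) i) * fps_nth v (n - i))"
    by (rule sum.mono_neutral_right) auto
  then show ?thesis by (simp add: hsmult_nth)
qed

lemma hsmult_fps_X_power_nth: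
  "fps_nth (hsmult (fps_X ^ N) v) n = (if n < N then 0 else fps_nth v (n - N))"
proof -
  have "(\<Sum>i\<le>n. kk (fps_nth (fps_X ^ N) i) * fps_nth v (n - i))
      = (\<Sum>i\<in>(if n < N then {} else {N}). kk (fps_nth (fps_X ^ N) i) * fps_nth v (n - i))"
    by (rule sum.mono_neutral_right) (auto simp: fps_X_power_nth)
  then show ?thesis by (simp add: hsmult_nth fps_X_power_nth)
qed

lemma hsmult_fps_X_nth: "fps_nth (hsmult fps_X v) n = (if n = 0 then 0 else fps_nth v (n - 1))"
  using hsmult_fps_X_power_nth[of 1 v n] by simp

lemma hsmult_eq_0_iff [simp]: "hsmult (of_nat m) v = 0 \<longleftrightarrow> m = 0 \<or> v = 0"
proof -
  have "v = 0" if "hsmult (of_nat m) v = 0" "m \<noteq> 0"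
  proof -
    have "hsmult (fps_const (1 / of_nat m)) (hsmult (of_nat m) v) = 0" using that by simp
    moreover have "fps_const (1 / of_nat m) * of_nat m = (1 :: complex fps)"
      using that by (simp flip: fps_of_nat)
    ultimately show "v = 0" by simp
  qed
  then show ?thesis by auto
qed

lemma hsmult_fps_X_eq_0_iff [simp]: "hsmult fps_X v = 0 \<longleftrightarrow> v = 0"
proof
  assume "hsmult fps_X v = 0"
  then have "fps_nth (hsmult fps_X v) (Suc n) = 0" for n by simp
  then show "v = 0" by (simp add: hsmult_fps_X_nth fps_eq_iff)
qed simp

lemma hsmult_fps_X_cancel: "hsmult fps_X u = hsmult fps_X v \<longleftrightarrow> u = v"
proof -
  have "hsmult fps_X u = hsmult fps_X v \<longleftrightarrow> hsmult fps_X (u - v) = 0"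
    by (simp add: hs.scale_right_diff_distrib)
  then show ?thesis by simp
qed

abbreviation lin :: "('i fock fps \<Rightarrow> 'i fock fps) \<Rightarrow> bool" where
  "lin T \<equiv> Modules.module_hom hsmult hsmult T"

lemma linI:
  assumes "\<And>u v. T (u + v) = T u + T v" "\<And>c v. T (hsmult c v) = hsmult c (T v)"
  shows "lin T"
  using assms by (simp add: module_hom_iff module_hsmult)

lemmas lin_add = module_hom.add
lemmas lin_scale = module_hom.scale
lemmas lin_zero = module_hom.zero[of hsmult hsmult]
lemmas lin_diff = module_hom.diff
lemmas lin_sum = module_hom.sum

lemma lin_compose: "lin S \<Longrightarrow> lin T \<Longrightarrow> lin (\<lambda>v. S (T v))"
  by (rule linI) (simp_all add: lin_add lin_scale)

lemma lin_id [simp]: "lin (\<lambda>v. v)" "lin id"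
  by (rule linI; simp)+

lemma lin_0 [simp]: "lin (\<lambda>v. 0)"
  by (rule linI) simp_all

lemma lin_plus: "lin S \<Longrightarrow> lin T \<Longrightarrow> lin (\<lambda>v. S v + T v)"
  by (rule linI) (simp_all add: lin_add lin_scale hs.scale_right_distrib)

lemma lin_minus: "lin S \<Longrightarrow> lin T \<Longrightarrow> lin (\<lambda>v. S v - T v)"
  by (rule linI) (simp_all add: lin_add lin_scale hs.scale_right_diff_distrib)

lemma lin_hsmult: "lin T \<Longrightarrow> lin (\<lambda>v. hsmult c (T v))"
  by (rule linI) (simp_all add: lin_add lin_scale hs.scale_right_distrib mult.commute)

lemma lin_setsum: "(\<And>b. b \<in> S \<Longrightarrow> lin (T b)) \<Longrightarrow> lin (\<lambda>v. \<Sum>b\<in>S. T b v)"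
  by (induction S rule: infinite_finite_induct) (simp_all add: lin_plus)

lemma lin_linear_extend:
  assumes "\<And>u v. T (u + v) = T u + T v" "\<And>c u. T (kk c * u) = kk c * T u"
  shows "lin (linear_extend T)"
proof -
  have T0: "T 0 = 0" using assms(1)[of 0 0] by simp
  have sum: "T (sum f I) = (\<Sum>i\<in>I. T (f i))" for f and I :: "nat set"
    by (induction I rule: infinite_finite_induct) (simp_all add: T0 assms)
  show ?thesis
    by (rule linI) (simp_all add: linear_extend_def fps_eq_iff assms hsmult_nth sum)
qed

section \<open>Divisibility by powers of hbar and continuity of linear maps\<close>

definition hz :: "nat \<Rightarrow> 'i fock fps \<Rightarrow> bool" where
  "hz N v \<longleftrightarrow> (\<forall>n<N. fps_nth v n = 0)"

lemma hz_0 [simp]: "hz N 0" by (simp add: hz_def)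
lemma hz_zero_order [simp]: "hz 0 v" by (simp add: hz_def)
lemma hz_add: "hz N u \<Longrightarrow> hz N v \<Longrightarrow> hz N (u + v)" by (simp add: hz_def)
lemma hz_diff: "hz N u \<Longrightarrow> hz N v \<Longrightarrow> hz N (u - v)" by (simp add: hz_def)
lemma hz_sum: "(\<And>b. b \<in> S \<Longrightarrow> hz N (f b)) \<Longrightarrow> hz N (sum f S)"
  by (induction S rule: infinite_finite_induct) (auto simp: hz_add)
lemma hz_mono: "hz N v \<Longrightarrow> M \<le> N \<Longrightarrow> hz M v" by (simp add: hz_def)
lemma hz_eqI: "(\<And>N. hz N v) \<Longrightarrow> v = 0" by (auto simp: hz_def fps_eq_iff)
lemma hz_imp_shift:
  assumes "hz N v" shows "v = hsmult (fps_X ^ N) (fps_shift N v)"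
  using assms by (simp add: fps_eq_iff hz_def hsmult_fps_X_power_nth)

lemma hz_fps_X_power: "hz (N + M) (hsmult (fps_X ^ N) v) \<longleftrightarrow> hz M v"
proof
  assume "hz M v"
  then show "hz (N + M) (hsmult (fps_X ^ N) v)" by (simp add: hz_def hsmult_fps_X_power_nth)
next
  assume *: "hz (N + M) (hsmult (fps_X ^ N) v)"
  show "hz M v" unfolding hz_def
  proof (intro allI impI)
    fix n assume "n < M"
    then have "fps_nth (hsmult (fps_X ^ N) v) (N + n) = 0" using * unfolding hz_def by simp
    then show "fps_nth v n = 0" by (simp add: hsmult_fps_X_power_nth)
  qed
qed

text \<open>Write v as hbar^N times its shift; linearity over power series in hbar takes the factor
  out. For M = 0 this says that every such linear map is hbar-adically continuous.\<close>

lemma hz_lin_add: "lin T \<Longrightarrow> (\<And>v. hz M (T v)) \<Longrightarrow> hz N v \<Longrightarrow> hz (N + M) (T v)"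
  by (subst hz_imp_shift[of N v]) (simp_all add: lin_scale hz_fps_X_power)

lemma hz_lin: "lin T \<Longrightarrow> hz N v \<Longrightarrow> hz N (T v)"
  using hz_lin_add[of T 0 N v] by simp

lemma hz_hsmult: "hz N v \<Longrightarrow> hz N (hsmult c v)"
  by (rule hz_lin[OF lin_hsmult[OF lin_id(1)]])

lemma hz_hsmult_0: "fps_nth c 0 = 0 \<Longrightarrow> hz 1 (hsmult c v)"
  by (simp add: hz_def hsmult_nth)

section \<open>Convergent sums in the hbar-adic topology\<close>

definition hsummable :: "('b \<Rightarrow> 'i fock fps) \<Rightarrow> bool" where
  "hsummable f \<longleftrightarrow> (\<forall>N. finite {b. \<not> hz N (f b)})"

lemma hsummable_finite_nth:
  assumes "hsummable f" shows "finite {b. fps_nth (f b) n \<noteq> 0}"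
  using assms unfolding hsummable_def
  by (rule_tac finite_subset[of _ "{b. \<not> hz (Suc n) (f b)}"]) (auto simp: hz_def)

lemma hsum_nth: "fps_nth (hsum f) n = Sum_any (\<lambda>b. fps_nth (f b) n)"
  by (simp add: hsum_def)

lemma hsum_nth_sum:
  assumes "finite S" "\<And>b. b \<notin> S \<Longrightarrow> fps_nth (f b) n = 0"
  shows "fps_nth (hsum f) n = (\<Sum>b\<in>S. fps_nth (f b) n)"
  unfolding hsum_nth by (rule Sum_any.expand_superset) (use assms in auto)

lemma hsum_eq_sum:
  assumes "finite S" "\<And>b. b \<notin> S \<Longrightarrow> f b = 0"
  shows "hsum f = sum f S"
  using assms by (simp add: fps_eq_iff hsum_nth_sum[of S] fps_sum_nth)

lemma hsummable_finite: "finite S \<Longrightarrow> (\<And>b. b \<notin> S \<Longrightarrow> f b = 0) \<Longrightarrow> hsummable f"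
  unfolding hsummable_def by (metis (mono_tags, lifting) hz_0 mem_Collect_eq rev_finite_subset subsetI)

lemma hsum_approx:
  assumes "hsummable f"
  shows "hz N (hsum f - sum f {b. \<not> hz N (f b)})"
proof -
  have "fps_nth (hsum f) n = fps_nth (sum f {b. \<not> hz N (f b)}) n" if "n < N" for n
    using assms that
    by (subst hsum_nth_sum[of "{b. \<not> hz N (f b)}"]) (auto simp: hsummable_def hz_def fps_sum_nth)
  then show ?thesis by (simp add: hz_def)
qed

lemma hsum_approx_superset:
  assumes "finite S" "\<And>b. b \<notin> S \<Longrightarrow> hz N (f b)"
  shows "hz N (hsum f - sum f S)"
proof -
  have "fps_nth (hsum f) n = fps_nth (sum f S) n" if "n < N" for n
    using assms that by (subst hsum_nth_sum[of S]) (auto simp: hz_def fps_sum_nth)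
  then show ?thesis by (simp add: hz_def)
qed

lemma hz_hsum:
  assumes "\<And>b. hz N (f b)" shows "hz N (hsum f)"
  using assms by (auto simp: hz_def hsum_nth)

lemma hsummable_add:
  assumes "hsummable f" "hsummable g" shows "hsummable (\<lambda>b. f b + g b)"
  unfolding hsummable_def
proof
  fix N
  have "{b. \<not> hz N (f b + g b)} \<subseteq> {b. \<not> hz N (f b)} \<union> {b. \<not> hz N (g b)}"
    by (metis (mono_tags, lifting) UnCI hz_add mem_Collect_eq subsetI)
  then show "finite {b. \<not> hz N (f b + g b)}"
    using assms unfolding hsummable_def by (meson finite_UnI finite_subset)
qed

lemma hsum_add:
  assumes "hsummable f" "hsummable g"
  shows "hsum (\<lambda>b. f b + g b) = hsum f + hsum g"
  using assms by (simp add: fps_eq_iff hsum_nth Sum_any.distrib hsummable_finite_nth)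

lemma hsummable_lin:
  assumes "lin T" "hsummable f" shows "hsummable (\<lambda>b. T (f b))"
  unfolding hsummable_def
proof
  fix N
  have "{b. \<not> hz N (T (f b))} \<subseteq> {b. \<not> hz N (f b)}" using hz_lin[OF assms(1)] by blast
  then show "finite {b. \<not> hz N (T (f b))}"
    using assms(2) unfolding hsummable_def by (meson finite_subset)
qed

text \<open>Modulo hbar^N the sum is finite, where linearity applies, and T keeps the neglected tail
  divisible by hbar^N; N is arbitrary.\<close>

lemma hsum_lin:
  assumes T: "lin T" and f: "hsummable f"
  shows "T (hsum f) = hsum (\<lambda>b. T (f b))"
proof -
  have "hz N (T (hsum f) - hsum (\<lambda>b. T (f b)))" for N
  proof -
    let ?S = "{b. \<not> hz N (f b)}"
    have "hz N (T (hsum f - sum f ?S))" by (rule hz_lin[OF T hsum_approx[OF f]])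
    moreover have "hz N (hsum (\<lambda>b. T (f b)) - (\<Sum>b\<in>?S. T (f b)))"
      using f hz_lin[OF T] by (intro hsum_approx_superset) (auto simp: hsummable_def)
    ultimately have "hz N (T (hsum f - sum f ?S) - (hsum (\<lambda>b. T (f b)) - (\<Sum>b\<in>?S. T (f b))))"
      by (rule hz_diff)
    then show ?thesis by (simp add: lin_diff[OF T] lin_sum[OF T])
  qed
  then show ?thesis using hz_eqI[of "T (hsum f) - hsum (\<lambda>b. T (f b))"] by simp
qed

lemma hsummable_bij:
  assumes "bij \<pi>" "hsummable f" shows "hsummable (\<lambda>b. f (\<pi> b))"
  unfolding hsummable_def
proof
  fix N
  have "finite (\<pi> -` {b. \<not> hz N (f b)})"
    using assms unfolding hsummable_def by (intro finite_vimageI bij_is_inj) blast+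
  then show "finite {b. \<not> hz N (f (\<pi> b))}" by (simp add: vimage_def)
qed

lemma hsum_bij:
  assumes "bij \<pi>" shows "hsum (\<lambda>b. f (\<pi> b)) = hsum f"
  unfolding fps_eq_iff hsum_nth
  by (intro allI sym[OF Sum_any.reindex_cong[OF assms]]) (simp add: o_def)

lemma hsummable_sum:
  "(\<And>t. t \<in> S \<Longrightarrow> hsummable (f t)) \<Longrightarrow> hsummable (\<lambda>b. \<Sum>t\<in>S. f t b)"
  by (induction S rule: infinite_finite_induct) (simp_all add: hsummable_add hsummable_finite[of "{}"])

lemma hsum_sum:
  "(\<And>t. t \<in> S \<Longrightarrow> hsummable (f t)) \<Longrightarrow> hsum (\<lambda>b. \<Sum>t\<in>S. f t b) = (\<Sum>t\<in>S. hsum (f t))"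
proof (induction S rule: infinite_finite_induct)
  case (insert t S)
  then show ?case by (simp add: hsum_add hsummable_sum)
qed (simp_all add: hsum_eq_sum[of "{}"])

lemma lin_hsum:
  assumes "\<And>b. lin (T b)" "\<And>v. hsummable (\<lambda>b. T b v)"
  shows "lin (\<lambda>v. hsum (\<lambda>b. T b v))"
proof (rule linI)
  show "hsum (\<lambda>b. T b (u + v)) = hsum (\<lambda>b. T b u) + hsum (\<lambda>b. T b v)" for u v
    by (simp add: lin_add[OF assms(1)] hsum_add[OF assms(2) assms(2)])
  show "hsum (\<lambda>b. T b (hsmult c v)) = hsmult c (hsum (\<lambda>b. T b v))" for c v
    by (simp add: lin_scale[OF assms(1)] hsum_lin[OF lin_hsmult[OF lin_id(1)] assms(2)])
qed

section \<open>Vacuum vectors and Heisenberg operators\<close>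

definition vv :: "'i lattice \<Rightarrow> 'i fock fps" where
  "vv \<beta> = fps_const (Poly_Mapping.single \<beta> 1)"

text \<open>The coefficient of the monomial 1 in sector \<beta>, returned as a multiple of the fixed
  vector 1 in sector 0 rather than as a power series. Expectation values thus have the type of
  vectors, and \<open>vac\<close> is a linear operator like all others.\<close>

definition vac :: "'i lattice \<Rightarrow> 'i fock fps \<Rightarrow> 'i fock fps" where
  "vac \<beta> = linear_extend (\<lambda>u. kk (lookup (lookup u \<beta>) 0))"

definition sector :: "'i lattice \<Rightarrow> 'i fock fps \<Rightarrow> 'i fock fps" where
  "sector \<beta> = linear_extend (\<lambda>u. Poly_Mapping.single \<beta> (lookup u \<beta>))"

lemma fock_eqI: "(\<And>\<beta> m. lookup (lookup u \<beta>) m = lookup (lookup v \<beta>) m) \<Longrightarrow> u = (v :: 'i fock)"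
  by (simp add: poly_mapping_eq_iff fun_eq_iff)

lemma fock_eq_iff: "u = (v :: 'i fock) \<longleftrightarrow> (\<forall>\<beta> m. lookup (lookup u \<beta>) m = lookup (lookup v \<beta>) m)"
  by (auto intro: fock_eqI)

lemma linear_extend_nth [simp]: "fps_nth (linear_extend T v) n = T (fps_nth v n)"
  by (simp add: linear_extend_def)

lemma lin_vac [simp]: "lin (vac \<beta>)"
  unfolding vac_def
  by (rule lin_linear_extend) (simp_all add: lookup_add kk_def single_add mult_single)

lemma lin_sector [simp]: "lin (sector \<beta>)"
  unfolding sector_def
  by (rule lin_linear_extend)
     (auto intro!: fock_eqI simp: lookup_add single_add kk_def lookup_single when_def)

lemma lin_heis_neg [simp]: "lin (heis_neg k r)"
  unfolding heis_neg_def
  by (rule lin_linear_extend) (simp_all add: algebra_simps)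

lemma pderivative_superset:
  assumes "finite S" "Poly_Mapping.keys f \<subseteq> S"
  shows "pderivative v f = (\<Sum>m\<in>S. Poly_Mapping.single (m - Poly_Mapping.single v 1)
     (of_nat (lookup m v) * lookup f m))"
  unfolding pderivative_def using assms
  by (intro sum.mono_neutral_left) (auto simp: in_keys_iff)

lemma pderivative_add: "pderivative v (f + g) = pderivative v f + pderivative v g"
proof -
  define S where "S = Poly_Mapping.keys f \<union> Poly_Mapping.keys g"
  have "Poly_Mapping.keys (f + g) \<subseteq> S" using keys_add[of f g] by (auto simp: S_def)
  then show ?thesis
    by (subst (1 2 3) pderivative_superset[of S])
       (auto simp: S_def lookup_add distrib_left single_add sum.distrib)
qed

lemma pderivative_single:
  "pderivative v (Poly_Mapping.single m c)
     = Poly_Mapping.single (m - Poly_Mapping.single v 1) (of_nat (lookup m v) * c)"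
  by (simp add: pderivative_superset[of "{m}"])

text \<open>Subtraction of exponents is truncated, so lowering the exponent of v can be undone only
  on monomials that contain v.\<close>

lemma single_1_diff_eq_iff:
  fixes m m' :: "'v \<Rightarrow>\<^sub>0 nat"
  assumes "lookup m' v \<noteq> 0"
  shows "m' - Poly_Mapping.single v 1 = m \<longleftrightarrow> m' = m + Poly_Mapping.single v 1"
  using assms
  by (auto simp: poly_mapping_eq_iff fun_eq_iff lookup_minus lookup_add lookup_single when_def
      split: if_splits; metis Suc_pred' add.commute diff_zero neq0_conv plus_1_eq_Suc)

lemma lookup_pderivative:
  fixes f :: "('v \<Rightarrow>\<^sub>0 nat) \<Rightarrow>\<^sub>0 complex"
  shows "lookup (pderivative v f) m
     = of_nat (Suc (lookup m v)) * lookup f (m + Poly_Mapping.single v 1)"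
proof (rule additive_eq_on_single[where f = f])
  fix k :: "'v \<Rightarrow>\<^sub>0 nat" and c :: complex
  show "lookup (pderivative v (Poly_Mapping.single k c)) m
     = of_nat (Suc (lookup m v)) * lookup (Poly_Mapping.single k c) (m + Poly_Mapping.single v 1)"
    using single_1_diff_eq_iff[of k v m]
    by (cases "lookup k v = 0")
       (auto simp: pderivative_single lookup_single when_def lookup_add)
qed (simp_all add: pderivative_add lookup_add algebra_simps)

lemma pvar_mult_single:
  "pvar v * Poly_Mapping.single m c = Poly_Mapping.single (Poly_Mapping.single v 1 + m) c"
  by (simp add: pvar_def mult_single)

lemma lookup_pvar_mult_0 [simp]:
  fixes f :: "('v \<Rightarrow>\<^sub>0 nat) \<Rightarrow>\<^sub>0 complex"
  shows "lookup (pvar v * f) 0 = 0"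
proof (rule additive_eq_on_single[where f = f])
  fix k :: "'v \<Rightarrow>\<^sub>0 nat" and c :: complex
  have "Poly_Mapping.single v 1 + k \<noteq> 0"
  proof
    assume "Poly_Mapping.single v 1 + k = 0"
    then have "lookup (Poly_Mapping.single v 1 + k) v = 0" by simp
    then show False by (simp add: lookup_add)
  qed
  then show "lookup (pvar v * Poly_Mapping.single k c) 0 = 0"
    by (simp add: pvar_mult_single lookup_single when_def)
qed (simp_all add: lookup_add algebra_simps)

lemma pderivative_pvar_mult:
  fixes f :: "('v \<Rightarrow>\<^sub>0 nat) \<Rightarrow>\<^sub>0 complex"
  shows "pderivative u (pvar v * f) = pvar v * pderivative u f + (if u = v then f else 0)"
proof (rule additive_eq_on_single[where f = f])
  fix m :: "'v \<Rightarrow>\<^sub>0 nat" and c :: complex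
  show "pderivative u (pvar v * Poly_Mapping.single m c) =
        pvar v * pderivative u (Poly_Mapping.single m c) + (if u = v then Poly_Mapping.single m c else 0)"
  proof (cases "u = v")
    case True
    have "Poly_Mapping.single v 1 + (m - Poly_Mapping.single v 1) = m" if "lookup m v \<noteq> 0"
      using that by (auto simp: poly_mapping_eq_iff fun_eq_iff lookup_minus lookup_add lookup_single when_def)
    then show ?thesis using True
      by (cases "lookup m v = 0")
         (auto simp: pderivative_single pvar_mult_single lookup_add algebra_simps simp flip: single_add)
  next
    case False
    have "Poly_Mapping.single v 1 + m - Poly_Mapping.single u 1
        = Poly_Mapping.single v 1 + (m - Poly_Mapping.single u 1)"
      using False by (auto simp: poly_mapping_eq_iff fun_eq_iff lookup_minus lookup_add lookup_single when_def)
    then show ?thesis using False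
      by (auto simp: pderivative_single pvar_mult_single lookup_add lookup_single when_def)
  qed
qed (simp_all add: pderivative_add algebra_simps)

lemma pderivative_0 [simp]: "pderivative v 0 = 0"
  by (simp add: pderivative_def)

lemma lookup_heis_pos_nth:
  "lookup (fps_nth (heis_pos k r v) n) \<beta> = of_nat r * pderivative (k, r - 1) (lookup (fps_nth v n) \<beta>)"
  by (simp add: heis_pos_def Poly_Mapping.map.rep_eq when_def)

lemma lookup_heis_neg_nth:
  "lookup (fps_nth (heis_neg k r v) n) \<beta> = pvar (k, r - 1) * lookup (fps_nth v n) \<beta>"
  by (simp add: heis_neg_def)

lemma lookup_of_nat_mult:
  fixes f :: "'a::monoid_add \<Rightarrow>\<^sub>0 'b::comm_ring_1"
  shows "lookup (of_nat n * f) m = of_nat n * lookup f m"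
  using lookup_single_0_mult[of "of_nat n :: 'b" f m] by simp

lemma lookup2_heis_pos_nth:
  "lookup (lookup (fps_nth (heis_pos k r v) n) \<beta>) m
     = of_nat r * of_nat (Suc (lookup m (k, r - 1)))
       * lookup (lookup (fps_nth v n) \<beta>) (m + Poly_Mapping.single (k, r - 1) 1)"
  by (simp add: lookup_heis_pos_nth lookup_of_nat_mult lookup_pderivative mult.assoc)

lemma lin_heis_pos [simp]: "lin (heis_pos k r)"
proof (rule linI)
  show "heis_pos k r (hsmult c v) = hsmult c (heis_pos k r v)" for c v
    by (simp add: fps_eq_iff fock_eq_iff lookup2_heis_pos_nth hsmult_nth lookup_sum sum_distrib_left
        algebra_simps)
qed (simp add: fps_eq_iff fock_eq_iff lookup2_heis_pos_nth lookup_add algebra_simps)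

lemma heis_pos_commute: "heis_pos k r (heis_pos l s v) = heis_pos l s (heis_pos k r v)"
  by (auto simp: fps_eq_iff fock_eq_iff lookup2_heis_pos_nth lookup_add lookup_single when_def ac_simps)

lemma heis_neg_commute: "heis_neg k r (heis_neg l s v) = heis_neg l s (heis_neg k r v)"
  by (auto simp: fps_eq_iff heis_neg_def ac_simps)

lemma heis_pos_neg:
  assumes "0 < r" "0 < s"
  shows "heis_pos k r (heis_neg l s v)
    = heis_neg l s (heis_pos k r v) + (if k = l \<and> r = s then hsmult (of_nat r) v else 0)"
proof -
  have "lookup (fps_nth (heis_pos k r (heis_neg l s v)) n) \<beta>
     = lookup (fps_nth (heis_neg l s (heis_pos k r v)
          + (if k = l \<and> r = s then hsmult (of_nat r) v else 0)) n) \<beta>" for n \<beta>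
  proof -
    \<comment> \<open>Variables are counted from 0 and r - 1 is truncated; positivity keeps distinct
      modes on distinct variables.\<close>
    have "r - 1 = s - 1 \<longleftrightarrow> r = s" using assms by auto
    moreover have "lookup (fps_nth (hsmult (of_nat r) v) n) \<beta> = of_nat r * lookup (fps_nth v n) \<beta>"
      by (simp add: kk_def lookup_of_nat_mult flip: fps_of_nat)
    ultimately show ?thesis
      by (auto simp: lookup_heis_pos_nth lookup_heis_neg_nth pderivative_pvar_mult lookup_add
          distrib_left mult.left_commute)
  qed
  then show ?thesis by (simp add: fps_eq_iff poly_mapping_eq_iff fun_eq_iff)
qed

lemma add_single_Suc_neq_0: "m + Poly_Mapping.single v (Suc n) \<noteq> 0"
proof
  assume "m + Poly_Mapping.single v (Suc n) = 0"
  then have "lookup (m + Poly_Mapping.single v (Suc n)) v = 0" by simp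
  then show False by (simp add: lookup_add)
qed

lemma heis_pos_vv [simp]: "heis_pos k r (vv \<beta>) = 0"
  by (auto simp: fps_eq_iff fock_eq_iff lookup2_heis_pos_nth vv_def lookup_single when_def lookup_one
      add_single_Suc_neq_0)

lemma vac_heis_neg [simp]: "vac \<beta> (heis_neg k r v) = 0"
  by (simp add: fps_eq_iff vac_def heis_neg_def)

lemma vac_vv: "vac \<beta> (vv \<gamma>) = (if \<beta> = \<gamma> then 1 else 0)"
  by (auto simp: fps_eq_iff vac_def vv_def lookup_single when_def)

lemma sector_heis_pos: "sector \<beta> (heis_pos k r v) = heis_pos k r (sector \<beta> v)"
  by (auto simp: fps_eq_iff fock_eq_iff sector_def lookup2_heis_pos_nth lookup_single when_def)

lemma sector_heis_neg: "sector \<beta> (heis_neg k r v) = heis_neg k r (sector \<beta> v)"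
  by (auto simp: fps_eq_iff poly_mapping_eq_iff fun_eq_iff sector_def heis_neg_def lookup_single when_def)

lemma vac_sector: "vac \<beta> (sector \<beta>' v) = (if \<beta> = \<beta>' then vac \<beta> v else 0)"
  by (auto simp: fps_eq_iff vac_def sector_def lookup_single when_def)

lemma sector_vv: "sector \<beta> (vv \<gamma>) = (if \<beta> = \<gamma> then vv \<gamma> else 0)"
  by (auto simp: fps_eq_iff sector_def vv_def lookup_single when_def)

text \<open>Z is stable under finite combinations and creation operators but not under hbar-adic
  limits, hence the approximation. Monomials are built by induction on their total degree, and the
  coefficients of hbar^n with n < N are then assembled.\<close>

lemma fock_generation:
  assumes vv: "\<And>\<beta>. Z (vv \<beta>)"
    and add: "\<And>u v. Z u \<Longrightarrow> Z v \<Longrightarrow> Z (u + v)"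
    and scale: "\<And>c v. Z v \<Longrightarrow> Z (hsmult c v)"
    and cre: "\<And>k r v. 0 < r \<Longrightarrow> Z v \<Longrightarrow> Z (heis_neg k r v)"
  shows "\<exists>u. Z u \<and> hz N (v - u)"
proof -
  have zero: "Z 0" using scale[OF vv, of 0] by simp
  have mono: "Z (fps_const (Poly_Mapping.single \<beta> (Poly_Mapping.single m 1)))" for \<beta> m
  proof (induction "\<Sum>x\<in>Poly_Mapping.keys m. lookup m x" arbitrary: m)
    case 0
    then have "m = 0" by (auto simp: poly_mapping_eq_iff fun_eq_iff in_keys_iff)
    then show ?case using vv[of \<beta>] by (simp add: vv_def)
  next
    case (Suc d)
    then have "Poly_Mapping.keys m \<noteq> {}" by force
    then obtain x where x: "x \<in> Poly_Mapping.keys m" by blast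
    define m' where "m' = m - Poly_Mapping.single x 1"
    have m: "m = Poly_Mapping.single x 1 + m'" using x
      by (auto simp: m'_def poly_mapping_eq_iff fun_eq_iff lookup_minus lookup_add lookup_single when_def in_keys_iff)
    have sub: "Poly_Mapping.keys m' \<subseteq> Poly_Mapping.keys m"
      by (auto simp: m'_def in_keys_iff lookup_minus)
    have "(\<Sum>x\<in>Poly_Mapping.keys m'. lookup m' x) = (\<Sum>x\<in>Poly_Mapping.keys m. lookup m' x)"
      using sub by (intro sum.mono_neutral_left) (auto simp: in_keys_iff)
    moreover have "(\<Sum>y\<in>Poly_Mapping.keys m. lookup m y) = Suc (\<Sum>y\<in>Poly_Mapping.keys m. lookup m' y)"
      using x by (subst m) (auto simp: lookup_add lookup_single when_def sum.distrib simp del: sum.delta)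
    ultimately have "(\<Sum>x\<in>Poly_Mapping.keys m'. lookup m' x) = d" using Suc(2) by simp
    then have "Z (fps_const (Poly_Mapping.single \<beta> (Poly_Mapping.single m' 1)))" using Suc(1) by simp
    then have "Z (heis_neg (fst x) (Suc (snd x)) (fps_const (Poly_Mapping.single \<beta> (Poly_Mapping.single m' 1))))"
      by (rule cre[rotated]) simp
    also have "heis_neg (fst x) (Suc (snd x)) (fps_const (Poly_Mapping.single \<beta> (Poly_Mapping.single m' 1)))
       = fps_const (Poly_Mapping.single \<beta> (Poly_Mapping.single m 1))"
      by (simp add: fps_eq_iff heis_neg_def mult_single pvar_mult_single m[symmetric] del: fps_const_mult)
         (simp add: m)
    finally show ?case .
  qed
  have const: "Z (fps_const u)" for u
  proof (induction u rule: poly_mapping_single_induct)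
    case (single \<beta> f)
    show ?case
    proof (induction f rule: poly_mapping_single_induct)
      case (single m c)
      have "hsmult (fps_const c) (fps_const (Poly_Mapping.single \<beta> (Poly_Mapping.single m 1)))
         = fps_const (Poly_Mapping.single \<beta> (Poly_Mapping.single m c))"
        by (simp add: fps_eq_iff kk_def mult_single)
      then show ?case using scale[OF mono] by metis
    next
      case (add f g)
      then show ?case using assms(2)[OF add] by (simp add: single_add)
    qed (simp add: zero)
  next
    case (add f g)
    then show ?case using assms(2)[OF add] by simp
  qed (simp add: zero)
  have "Z (\<Sum>n<N. hsmult (fps_X ^ n) (fps_const (fps_nth v n)))"
    by (induction N) (simp_all add: zero add scale const)
  moreover have "hz N (v - (\<Sum>n<N. hsmult (fps_X ^ n) (fps_const (fps_nth v n))))"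
  proof -
    have "fps_nth (\<Sum>n<N. hsmult (fps_X ^ n) (fps_const (fps_nth v n))) k = fps_nth v k" if "k < N" for k
    proof -
      have "fps_nth (\<Sum>n<N. hsmult (fps_X ^ n) (fps_const (fps_nth v n))) k
          = (\<Sum>n<N. if k = n then fps_nth v n else 0)"
        unfolding fps_sum_nth by (intro sum.cong) (auto simp: hsmult_fps_X_power_nth)
      then show ?thesis using that by simp
    qed
    then show ?thesis by (simp add: hz_def)
  qed
  ultimately show ?thesis by blast
qed

section \<open>Shift operators on families\<close>

text \<open>Laurent polynomials in formal variables, with coefficients in \<open>\<complex>[[\<hbar>]]\<close>, act on families
  indexed by the exponents, i.e. on formal series that are infinite in all directions.\<close>

type_synonym 'x shift = "'x \<Rightarrow>\<^sub>0 complex fps"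

definition act :: "'x::ab_group_add shift \<Rightarrow> ('x \<Rightarrow> 'i fock fps) \<Rightarrow> 'x \<Rightarrow> 'i fock fps" where
  "act L U x = (\<Sum>t\<in>Poly_Mapping.keys L. hsmult (lookup L t) (U (x - t)))"

lemma act_superset:
  assumes "finite S" "Poly_Mapping.keys L \<subseteq> S"
  shows "act L U x = (\<Sum>t\<in>S. hsmult (lookup L t) (U (x - t)))"
  unfolding act_def using assms by (intro sum.mono_neutral_left) (auto simp: in_keys_iff)

lemma act_add_left: "act (L + L') U x = act L U x + act L' U x"
proof -
  define S where "S = Poly_Mapping.keys L \<union> Poly_Mapping.keys L'"
  have "Poly_Mapping.keys (L + L') \<subseteq> S" using keys_add[of L L'] by (auto simp: S_def)
  then show ?thesis
    by (subst (1 2 3) act_superset[of S])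
       (auto simp: S_def lookup_add hs.scale_left_distrib sum.distrib)
qed

lemma act_single [simp]: "act (Poly_Mapping.single t c) U x = hsmult c (U (x - t))"
  by (subst act_superset[of "{t}"]) auto

lemma act_0_left [simp]: "act 0 U x = 0"
  by (simp add: act_def)

lemma act_1 [simp]: "act 1 U x = U x"
  using act_single[of 0 1 U x] by (simp del: act_single)

lemma act_uminus_left: "act (- L) U x = - act L U x"
  using act_add_left[of L "- L" U x] by (simp add: eq_neg_iff_add_eq_0 add.commute)

lemma act_diff_left: "act (L - L') U x = act L U x - act L' U x"
  using act_add_left[of L "- L'" U x] by (simp add: act_uminus_left)

lemma act_lin: "lin T \<Longrightarrow> act L (\<lambda>x. T (U x)) x = T (act L U x)"
  by (simp add: act_def lin_sum lin_scale)

lemma act_cong: "(\<And>t. U (x - t) = V (x - t)) \<Longrightarrow> act L U x = act L V x"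
  by (simp add: act_def)

lemma act_zero_right [simp]: "act L (\<lambda>x. 0) x = 0"
  by (simp add: act_def)

lemma act_add_right: "act L (\<lambda>x. U x + V x) x = act L U x + act L V x"
  by (simp add: act_def hs.scale_right_distrib sum.distrib)

lemma act_diff_right: "act L (\<lambda>x. U x - V x) x = act L U x - act L V x"
  by (simp add: act_def hs.scale_right_diff_distrib sum_subtractf)

lemma act_sum_right: "act L (\<lambda>x. \<Sum>b\<in>S. U b x) x = (\<Sum>b\<in>S. act L (U b) x)"
  by (induction S rule: infinite_finite_induct) (simp_all add: act_add_right)

lemma act_hsmult: "act L (\<lambda>x. hsmult c (U x)) x = hsmult c (act L U x)"
  by (rule act_lin[OF lin_hsmult[OF lin_id(1)]])

lemma act_mult: "act (L * L') U x = act L (act L' U) x"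
proof (rule additive_eq_on_single[where f = L])
  fix t c
  show "act (Poly_Mapping.single t c * L') U x = act (Poly_Mapping.single t c) (act L' U) x"
  proof (rule additive_eq_on_single[where f = L'])
    fix s d
    show "act (Poly_Mapping.single t c * Poly_Mapping.single s d) U x
        = act (Poly_Mapping.single t c) (act (Poly_Mapping.single s d) U) x"
      by (simp add: mult_single diff_diff_eq)
  qed (simp_all add: distrib_left act_add_left hs.scale_right_distrib)
qed (simp_all add: distrib_right act_add_left)

lemma act_commute: "act L (act L' U) x = act L' (act L U) x"
  by (simp add: mult.commute flip: act_mult)

lemma hsummable_act:
  "(\<And>x. hsummable (f x)) \<Longrightarrow> hsummable (\<lambda>b. act L (\<lambda>x. f x b) x)"
  unfolding act_def by (intro hsummable_sum hsummable_lin[OF lin_hsmult[OF lin_id(1)]])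

lemma act_hsum:
  "(\<And>x. hsummable (f x)) \<Longrightarrow> act L (\<lambda>x. hsum (f x)) x = hsum (\<lambda>b. act L (\<lambda>x. f x b) x)"
  unfolding act_def
  by (simp add: hsum_lin[OF lin_hsmult[OF lin_id(1)]] hsum_sum hsummable_lin[OF lin_hsmult[OF lin_id(1)]])

lemma lin_act: "(\<And>x. lin (P x)) \<Longrightarrow> lin (\<lambda>v. act L (\<lambda>x. P x v) x)"
  unfolding act_def by (intro lin_setsum lin_hsmult)

lemma hz_act: "(\<And>x. hz N (U x)) \<Longrightarrow> hz N (act L U x)"
  unfolding act_def by (intro hz_sum hz_hsmult)

text \<open>For additive \<phi> this is the ring homomorphism of Laurent polynomials that
  substitutes monomials for variables: it embeds variables among others, exchanges them or rotates
  them.\<close>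

definition push :: "('x \<Rightarrow> 'y) \<Rightarrow> 'x shift \<Rightarrow> 'y shift" where
  "push \<phi> L = (\<Sum>t\<in>Poly_Mapping.keys L. Poly_Mapping.single (\<phi> t) (lookup L t))"

lemma push_superset:
  assumes "finite S" "Poly_Mapping.keys L \<subseteq> S"
  shows "push \<phi> L = (\<Sum>t\<in>S. Poly_Mapping.single (\<phi> t) (lookup L t))"
  unfolding push_def using assms by (intro sum.mono_neutral_left) (auto simp: in_keys_iff)

lemma push_add: "push \<phi> (L + L') = push \<phi> L + push \<phi> L'"
proof -
  define S where "S = Poly_Mapping.keys L \<union> Poly_Mapping.keys L'"
  have "Poly_Mapping.keys (L + L') \<subseteq> S" using keys_add[of L L'] by (auto simp: S_def)
  then show ?thesis
    by (subst (1 2 3) push_superset[of S]) (auto simp: S_def lookup_add single_add sum.distrib)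
qed

lemma push_single [simp]: "push \<phi> (Poly_Mapping.single t c) = Poly_Mapping.single (\<phi> t) c"
  by (subst push_superset[of "{t}"]) auto

lemma push_0 [simp]: "push \<phi> 0 = 0"
  by (simp add: push_def)

lemma push_uminus: "push \<phi> (- L) = - push \<phi> L"
  using push_add[of \<phi> L "- L"] by (simp add: eq_neg_iff_add_eq_0 add.commute)

lemma push_diff: "push \<phi> (L - L') = push \<phi> L - push \<phi> L'"
  using push_add[of \<phi> L "- L'"] by (simp add: push_uminus)

lemma push_push: "push \<psi> (push \<phi> L) = push (\<lambda>x. \<psi> (\<phi> x)) L"
  by (rule additive_eq_on_single[where f = L]) (simp_all add: push_add)

locale additive_map =
  fixes \<phi> :: "'x::ab_group_add \<Rightarrow> 'y::ab_group_add"
  assumes additive: "\<phi> (x + y) = \<phi> x + \<phi> y"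
begin

lemma map_0: "\<phi> 0 = 0" using additive[of 0 0] by simp
lemma map_diff: "\<phi> (x - y) = \<phi> x - \<phi> y" using additive[of "x - y" y] by simp

lemma push_mult: "push \<phi> (L * L') = push \<phi> L * push \<phi> L'"
proof (rule additive_eq_on_single[where f = L])
  fix t c
  show "push \<phi> (Poly_Mapping.single t c * L') = push \<phi> (Poly_Mapping.single t c) * push \<phi> L'"
    by (rule additive_eq_on_single[where f = L'])
       (simp_all add: distrib_left push_add mult_single additive)
qed (simp_all add: distrib_right push_add)

lemma push_1: "push \<phi> 1 = 1"
  using push_single[of \<phi> 0 1] by (simp add: map_0 del: push_single)

lemma push_power: "push \<phi> (L ^ n) = push \<phi> L ^ n"
  by (induction n) (simp_all add: push_1 push_mult)

text \<open>If \<phi> embeds variables, the other exponents, collected in y, become parameters; if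
  \<phi> is a bijection, this is a renaming of variables.\<close>

lemma act_push: "act (push \<phi> L) V (y + \<phi> x) = act L (\<lambda>x. V (y + \<phi> x)) x"
  by (rule additive_eq_on_single[where f = L])
     (simp_all add: push_add act_add_left map_diff algebra_simps)

end

lemma additive_map_Pair [simp]: "additive_map (\<lambda>p. (p, 0))" "additive_map (\<lambda>y. (0, y))"
  by (unfold_locales; simp)+

lemma act_push_fst: "act (push (\<lambda>p. (p, 0)) L) V (p, y) = act L (\<lambda>p. V (p, y)) p"
  using additive_map.act_push[OF additive_map_Pair(1), of L V "(0, y)" p] by simp

lemma act_push_snd: "act (push (\<lambda>y. (0, y)) L) V (p, y) = act L (\<lambda>y. V (p, y)) y"
  using additive_map.act_push[OF additive_map_Pair(2), of L V "(p, 0)" y] by simp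

text \<open>\<open>z + b\<close> with \<open>b \<in> \<hbar>\<complex>[[\<hbar>]]\<close> acts injectively on all families, since it is invertible
  modulo \<open>\<hbar>\<close>.\<close>

inductive regular :: "'x::ab_group_add shift \<Rightarrow> bool" where
  regular_1: "regular 1"
| regular_mult: "regular L \<Longrightarrow> regular L' \<Longrightarrow> regular (L * L')"
| regular_linear: "fps_nth c 0 = 0 \<Longrightarrow> regular (Poly_Mapping.single u 1 + Poly_Mapping.single 0 c)"

text \<open>In the linear case the term with c gains a power of hbar, so divisibility of all values
  of U by hbar^M improves to hbar^(M+1), as long as the hypothesis permits.\<close>

lemma regular_hz:
  assumes "regular L" "\<And>x. hz N (act L U x)" shows "hz N (U x)"
  using assms
proof (induction arbitrary: U x)
  case (regular_mult L L')
  show ?case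
  proof (rule regular_mult.IH(2))
    show "hz N (act L' U x)" for x
      by (rule regular_mult.IH(1)) (use regular_mult.prems in \<open>simp add: act_mult\<close>)
  qed
next
  case (regular_linear c u)
  have "hz M (U x)" if "M \<le> N" for M x
    using that
  proof (induction M arbitrary: x)
    case (Suc M)
    have "hz (M + 1) (hsmult c (U (x + u)))"
      by (rule hz_lin_add[OF lin_hsmult[OF lin_id(1)] hz_hsmult_0[OF regular_linear(1)]]) (use Suc in auto)
    moreover have "hz (M + 1) (act (Poly_Mapping.single u 1 + Poly_Mapping.single 0 c) U (x + u))"
      by (rule hz_mono[OF regular_linear(2)]) (use Suc in auto)
    ultimately have "hz (M + 1) (act (Poly_Mapping.single u 1 + Poly_Mapping.single 0 c) U (x + u)
       - hsmult c (U (x + u)))" by (rule hz_diff[rotated])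
    then show ?case by (simp add: act_add_left)
  qed simp
  then show ?case by simp
qed simp_all

lemma regular_act_eq_0: "regular L \<Longrightarrow> (\<And>x. act L U x = 0) \<Longrightarrow> U x = 0"
  by (rule hz_eqI, rule regular_hz) auto

lemma regular_power: "regular L \<Longrightarrow> regular (L ^ n)"
  by (induction n) (auto intro: regular.intros)

section \<open>Families bounded in one direction, and factors that are injective on them\<close>

definition upper :: "('x \<Rightarrow> int) \<Rightarrow> ('x \<Rightarrow> 'i fock fps) \<Rightarrow> bool" where
  "upper d U \<longleftrightarrow> (\<exists>K. \<forall>x. d x > K \<longrightarrow> U x = 0)"

lemma upper_diff: "upper d U \<Longrightarrow> upper d V \<Longrightarrow> upper d (\<lambda>x. U x - V x)"
proof -
  assume "upper d U" "upper d V"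
  then obtain K K' where *: "\<And>x. d x > K \<Longrightarrow> U x = 0" "\<And>x. d x > K' \<Longrightarrow> V x = 0"
    unfolding upper_def by blast
  then show ?thesis unfolding upper_def by (intro exI[of _ "max K K'"]) auto
qed

lemma upper_act:
  assumes d: "additive_map d" and "upper d U"
  shows "upper d (act L U)"
proof -
  obtain K where K: "\<And>x. d x > K \<Longrightarrow> U x = 0" using assms(2) unfolding upper_def by blast
  let ?S = "insert 0 (d ` Poly_Mapping.keys L)"
  have "act L U x = 0" if "d x > K + Max ?S" for x
    unfolding act_def
  proof (intro sum.neutral ballI)
    fix t assume "t \<in> Poly_Mapping.keys L"
    then have "d t \<le> Max ?S" by (intro Max_ge) auto
    then have "d (x - t) > K" using that by (simp add: additive_map.map_diff[OF d])
    then show "hsmult (lookup L t) (U (x - t)) = 0" by (simp add: K)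
  qed
  then show ?thesis unfolding upper_def by blast
qed

text \<open>Products of linear factors whose leading term in the direction d is a monomial. The
  coefficients of the remaining terms are arbitrary, because a bound from above makes the leading
  term decisive.\<close>

inductive upper_regular :: "('x::ab_group_add \<Rightarrow> int) \<Rightarrow> 'x shift \<Rightarrow> bool" for d where
  upper_regular_1: "upper_regular d 1"
| upper_regular_mult: "upper_regular d L \<Longrightarrow> upper_regular d L' \<Longrightarrow> upper_regular d (L * L')"
| upper_regular_linear:
    "d u = 1 \<Longrightarrow> (\<And>t. t \<in> Poly_Mapping.keys L \<Longrightarrow> d t = 0) \<Longrightarrow>
     upper_regular d (Poly_Mapping.single u 1 + L)"

lemma upper_regular_power: "upper_regular d L \<Longrightarrow> upper_regular d (L ^ n)"
  by (induction n) (auto intro: upper_regular.intros)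

lemma upper_regular_prod_list:
  "(\<And>L. L \<in> set Ls \<Longrightarrow> upper_regular d L) \<Longrightarrow> upper_regular d (prod_list Ls)"
  by (induction Ls) (auto intro: upper_regular.intros)

text \<open>Descending induction on the degree, starting at the bound: evaluation at x + u isolates
  U x, since all other terms sit in degree d x + 1.\<close>

lemma upper_regular_act_eq_0:
  assumes "upper_regular d L" and d: "additive_map d" and "upper d U" "\<And>x. act L U x = 0"
  shows "U x = 0"
  using assms(1,3,4)
proof (induction arbitrary: U x)
  case (upper_regular_mult L L')
  show ?case
  proof (rule upper_regular_mult(4)[OF upper_regular_mult(5)])
    show "act L' U x = 0" for x
      by (rule upper_regular_mult(3)[OF upper_act[OF d upper_regular_mult(5)]])
         (use upper_regular_mult(6) in \<open>simp add: act_mult\<close>)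
  qed
next
  case (upper_regular_linear u L)
  obtain K where K: "\<And>x. d x > K \<Longrightarrow> U x = 0" using upper_regular_linear(3) unfolding upper_def by blast
  have "U x = 0" if "d x > K - int n" for n x
    using that
  proof (induction n arbitrary: x)
    case (Suc n)
    have "act (Poly_Mapping.single u 1 + L) U (x + u) = 0" by (rule upper_regular_linear(4))
    moreover have "act L U (x + u) = 0"
      unfolding act_def
    proof (intro sum.neutral ballI)
      fix t assume "t \<in> Poly_Mapping.keys L"
      then have "d (x + u - t) = d x + 1"
        using upper_regular_linear(1,2) by (simp add: additive_map.map_diff[OF d] additive_map.additive[OF d])
      then show "hsmult (lookup L t) (U (x + u - t)) = 0" using Suc by simp
    qed
    ultimately show ?case by (simp add: act_add_left)
  qed (use K in auto)
  from this[of "nat (K - d x + 1)" x] show ?case by simp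
qed simp_all

definition lower :: "('x \<Rightarrow> int) \<Rightarrow> ('x \<Rightarrow> 'i fock fps) \<Rightarrow> bool" where
  "lower d U \<longleftrightarrow> (\<exists>K. \<forall>x. d x < K \<longrightarrow> U x = 0)"

lemma lower_diff: "lower d U \<Longrightarrow> lower d V \<Longrightarrow> lower d (\<lambda>x. U x - V x)"
proof -
  assume "lower d U" "lower d V"
  then obtain K K' where *: "\<And>x. d x < K \<Longrightarrow> U x = 0" "\<And>x. d x < K' \<Longrightarrow> V x = 0"
    unfolding lower_def by blast
  then show ?thesis unfolding lower_def by (intro exI[of _ "min K K'"]) auto
qed

lemma lower_act:
  assumes d: "additive_map d" and "lower d U"
  shows "lower d (act L U)"
proof -
  obtain K where K: "\<And>x. d x < K \<Longrightarrow> U x = 0" using assms(2) unfolding lower_def by blast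
  let ?S = "insert 0 (d ` Poly_Mapping.keys L)"
  have "act L U x = 0" if "d x < K + Min ?S" for x
    unfolding act_def
  proof (intro sum.neutral ballI)
    fix t assume "t \<in> Poly_Mapping.keys L"
    then have "d t \<ge> Min ?S" by (intro Min_le) auto
    then have "d (x - t) < K" using that by (simp add: additive_map.map_diff[OF d])
    then show "hsmult (lookup L t) (U (x - t)) = 0" by (simp add: K)
  qed
  then show ?thesis unfolding lower_def by blast
qed

text \<open>Seen from a lower bound, the extremal part of u - L is L itself, which is not a
  monomial. It must be injective within a single degree, hence \<open>regular\<close>.\<close>

inductive lower_regular :: "('x::ab_group_add \<Rightarrow> int) \<Rightarrow> 'x shift \<Rightarrow> bool" for d where
  lower_regular_mult: "lower_regular d L \<Longrightarrow> lower_regular d L' \<Longrightarrow> lower_regular d (L * L')"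
| lower_regular_linear:
    "d u = 1 \<Longrightarrow> regular L \<Longrightarrow> (\<And>t. t \<in> Poly_Mapping.keys L \<Longrightarrow> d t = 0) \<Longrightarrow>
     lower_regular d (Poly_Mapping.single u 1 - L)"

lemma lower_regular_act_eq_0:
  assumes "lower_regular d L" and d: "additive_map d" and "lower d U" "\<And>x. act L U x = 0"
  shows "U x = 0"
  using assms(1,3,4)
proof (induction arbitrary: U x)
  case (lower_regular_mult L L')
  show ?case
  proof (rule lower_regular_mult(4)[OF lower_regular_mult(5)])
    show "act L' U x = 0" for x
      by (rule lower_regular_mult(3)[OF lower_act[OF d lower_regular_mult(5)]])
         (use lower_regular_mult(6) in \<open>simp add: act_mult\<close>)
  qed
next
  case (lower_regular_linear u L)
  obtain K where K: "\<And>x. d x < K \<Longrightarrow> U x = 0" using lower_regular_linear(4) unfolding lower_def by blast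
  have "U x = 0" if "d x < K + int n" for n x
    using that
  proof (induction n arbitrary: x)
    case (Suc n)
    \<comment> \<open>L preserves the degree, so it acts on the slice of U in degree K + n alone. By
      the induction hypothesis the term with u vanishes there, and L kills the slice.\<close>
    define V where "V = (\<lambda>x. if d x = K + int n then U x else 0)"
    have "act L V y = 0" for y
    proof (cases "d y = K + int n")
      case True
      have "act L V y = act L U y"
        unfolding act_def V_def using True lower_regular_linear(3)
        by (intro sum.cong) (auto simp: additive_map.map_diff[OF d])
      also have "act (Poly_Mapping.single u 1 - L) U y = 0" by (rule lower_regular_linear(5))
      then have "act L U y = U (y - u)" by (simp add: act_diff_left)
      also have "\<dots> = 0"
        using True lower_regular_linear(1) by (intro Suc.IH) (simp add: additive_map.map_diff[OF d])
      finally show ?thesis .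
    next
      case False
      then show ?thesis
        unfolding act_def V_def using lower_regular_linear(3)
        by (intro sum.neutral) (auto simp: additive_map.map_diff[OF d])
    qed
    then have "V x = 0" by (rule regular_act_eq_0[OF lower_regular_linear(2)])
    then show ?case using Suc by (cases "d x = K + int n") (auto simp: V_def)
  qed (use K in auto)
  from this[of x "nat (d x - K + 1)"] show ?case by simp
qed

section \<open>Families of operators determined by their vacuum expectation values\<close>

text \<open>The coefficient of a monomial in H_{k,r} U is a nonzero multiple of the coefficient of U
  at that monomial times the variable (k, r). The eigenvector equation therefore expresses
  coefficients of degree d + 1 by those of degree d, and degree 0 is the vacuum component.\<close>

lemma annihilation_determined:
  assumes ann: "\<And>k r x. 0 < r \<Longrightarrow> hz N (heis_pos k r (U x) - act (l k r) U x)"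
    and vac: "\<And>\<beta> x. hz N (vac \<beta> (U x))"
  shows "hz N (U x)"
proof -
  define cz where "cz d v \<longleftrightarrow> (\<forall>n<N. \<forall>\<beta> m. (\<Sum>y\<in>Poly_Mapping.keys m. lookup m y) = d \<longrightarrow>
      lookup (lookup (fps_nth v n) \<beta>) m = 0)" for d and v :: "'a fock fps"
  have cz_hsmult: "cz d (hsmult c v)" if "cz d v" for d c v
    using that by (auto simp: cz_def hsmult_nth lookup_sum intro!: sum.neutral)
  have cz_sum: "cz d (sum f S)" if "\<And>t. t \<in> S \<Longrightarrow> cz d (f t)" for d S and f :: "'b \<Rightarrow> 'a fock fps"
    using that by (auto simp: cz_def fps_sum_nth lookup_sum intro!: sum.neutral)
  have "cz d (U x)" for d x
  proof (induction d arbitrary: x)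
    case 0
    have "lookup (lookup (fps_nth (U x) n) \<beta>) 0 = 0" if "n < N" for n \<beta>
    proof -
      have "fps_nth (vac \<beta> (U x)) n = 0" using vac that by (auto simp: hz_def)
      then have "lookup (lookup (fps_nth (vac \<beta> (U x)) n) 0) 0 = 0" by simp
      then show ?thesis by (simp add: vac_def kk_def)
    qed
    moreover have "m = 0" if "(\<Sum>y\<in>Poly_Mapping.keys m. lookup m y) = 0" for m :: "'a \<times> nat \<Rightarrow>\<^sub>0 nat"
      using that by (auto simp: poly_mapping_eq_iff fun_eq_iff in_keys_iff)
    ultimately show ?case by (auto simp: cz_def)
  next
    case (Suc d)
    show ?case unfolding cz_def
    proof (intro allI impI)
      fix n \<beta> and m :: "'a \<times> nat \<Rightarrow>\<^sub>0 nat"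
      assume n: "n < N" and deg: "(\<Sum>y\<in>Poly_Mapping.keys m. lookup m y) = Suc d"
      then have "Poly_Mapping.keys m \<noteq> {}" by force
      then obtain y where y: "y \<in> Poly_Mapping.keys m" by blast
      obtain k s where ks: "y = (k, s)" by (cases y)
      define m' where "m' = m - Poly_Mapping.single y 1"
      have m: "m = m' + Poly_Mapping.single y 1" using y
        by (auto simp: m'_def poly_mapping_eq_iff fun_eq_iff lookup_minus lookup_add lookup_single when_def in_keys_iff)
      have sub: "Poly_Mapping.keys m' \<subseteq> Poly_Mapping.keys m"
        by (auto simp: m'_def in_keys_iff lookup_minus)
      have "(\<Sum>x\<in>Poly_Mapping.keys m'. lookup m' x) = (\<Sum>x\<in>Poly_Mapping.keys m. lookup m' x)"
        using sub by (intro sum.mono_neutral_left) (auto simp: in_keys_iff)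
      moreover have "(\<Sum>x\<in>Poly_Mapping.keys m. lookup m x) = Suc (\<Sum>x\<in>Poly_Mapping.keys m. lookup m' x)"
        using y by (subst m) (auto simp: lookup_add lookup_single when_def sum.distrib simp del: sum.delta)
      ultimately have deg': "(\<Sum>x\<in>Poly_Mapping.keys m'. lookup m' x) = d" using deg by simp
      have "cz d (act (l k (Suc s)) U x)"
        unfolding act_def by (intro cz_sum cz_hsmult Suc)
      then have "lookup (lookup (fps_nth (act (l k (Suc s)) U x) n) \<beta>) m' = 0"
        using n deg' by (auto simp: cz_def)
      moreover have "fps_nth (heis_pos k (Suc s) (U x) - act (l k (Suc s)) U x) n = 0"
        using ann[of "Suc s"] n by (auto simp: hz_def)
      ultimately have "lookup (lookup (fps_nth (heis_pos k (Suc s) (U x)) n) \<beta>) m' = 0"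
        by simp
      moreover have "of_nat (Suc j) \<noteq> (0 :: complex)" for j
        by (simp del: of_nat_Suc)
      ultimately show "lookup (lookup (fps_nth (U x) n) \<beta>) m = 0"
        unfolding m ks lookup2_heis_pos_nth by (simp del: of_nat_Suc)
    qed
  qed
  then show ?thesis
    unfolding hz_def cz_def by (auto intro!: fock_eqI)
qed

text \<open>The vectors on which all D x are divisible by hbar^N satisfy the closure conditions of
  \<open>fock_generation\<close>. All x are treated at once because a commutator with a creation
  operator mixes exponents.\<close>

lemma creation_determined:
  assumes "\<And>x. lin (D x)" and "\<And>\<beta> x. hz N (D x (vv \<beta>))"
    and "\<And>k r v. 0 < r \<Longrightarrow> (\<And>x. hz N (D x v)) \<Longrightarrow> (\<And>x. hz N (D x (heis_neg k r v)))"
  shows "hz N (D x v)"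
proof -
  have "\<exists>u. (\<forall>x. hz N (D x u)) \<and> hz N (v - u)"
  proof (rule fock_generation)
    show "\<forall>x. hz N (D x (u + v))" if "\<forall>x. hz N (D x u)" "\<forall>x. hz N (D x v)" for u v
      using that by (simp add: lin_add[OF assms(1)] hz_add)
    show "\<forall>x. hz N (D x (hsmult c v))" if "\<forall>x. hz N (D x v)" for c v
      using that by (simp add: lin_scale[OF assms(1)] hz_hsmult)
  qed (use assms(2,3) in auto)
  then obtain u where u: "\<And>x. hz N (D x u)" "hz N (v - u)" by blast
  have "D x v = D x (v - u) + D x u" using lin_diff[OF assms(1)[of x], of v u] by simp
  then show ?thesis using hz_lin[OF assms(1) u(2)] u(1) by (metis hz_add)
qed

text \<open>The data \<open>l\<close>, \<open>Q\<close>, \<open>m\<close> describe the commutation with annihilation and creation operators.\<close>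

definition vertex_family ::
    "('i \<Rightarrow> nat \<Rightarrow> 'x shift) \<Rightarrow> ('i \<Rightarrow> nat \<Rightarrow> 'x shift) \<Rightarrow> ('i \<Rightarrow> nat \<Rightarrow> 'x shift)
     \<Rightarrow> ('x::ab_group_add \<Rightarrow> 'i fock fps \<Rightarrow> 'i fock fps) \<Rightarrow> bool" where
  "vertex_family l Q m P \<longleftrightarrow>
     (\<forall>x. lin (P x)) \<and>
     (\<forall>k r \<beta> x. 0 < r \<longrightarrow> heis_pos k r (P x (vv \<beta>)) = act (l k r) (\<lambda>x. P x (vv \<beta>)) x) \<and>
     (\<forall>k r v x. 0 < r \<longrightarrow> act (Q k r) (\<lambda>x. heis_neg k r (P x v) - P x (heis_neg k r v)) x
        = act (m k r) (\<lambda>x. P x v) x)"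

theorem vertex_family_eq_0:
  assumes P: "vertex_family l Q m P" and Q: "\<And>k r. regular (Q k r)"
    and vac: "\<And>\<beta> \<gamma> x. vac \<beta> (P x (vv \<gamma>)) = 0"
  shows "P x v = 0"
proof (rule hz_eqI)
  fix N
  show "hz N (P x v)"
  proof (rule creation_determined[where D = P])
    show "lin (P x)" for x using P by (simp add: vertex_family_def)
    show "hz N (P x (vv \<beta>))" for \<beta> x
      using P vac by (rule_tac annihilation_determined[where l = l and U = "\<lambda>x. P x (vv \<beta>)"])
        (simp_all add: vertex_family_def)
    show "hz N (P x (heis_neg k r v))" if r: "0 < r" and v: "\<And>x. hz N (P x v)" for k r v x
    proof -
      \<comment> \<open>The commutator with a creation operator. Multiplied by Q it is a combination
        of values already known to be divisible by hbar^N, and Q is injective modulo hbar^N.\<close>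
      define W where "W x = heis_neg k r (P x v) - P x (heis_neg k r v)" for x
      have W: "act (Q k r) W x = act (m k r) (\<lambda>x. P x v) x" for x
        using P r unfolding W_def by (simp add: vertex_family_def)
      have "hz N (act (Q k r) W x)" for x
        unfolding W by (rule hz_act) (rule v)
      then have "hz N (W x)" by (rule regular_hz[OF Q])
      moreover have "hz N (heis_neg k r (P x v))" by (rule hz_lin[OF lin_heis_neg v])
      ultimately have "hz N (heis_neg k r (P x v) - W x)" by (intro hz_diff)
      then show ?thesis by (simp add: W_def)
    qed
  qed
qed

lemma vertex_family_act:
  assumes "vertex_family l Q m P"
  shows "vertex_family l Q m (\<lambda>x v. act L (\<lambda>x. P x v) x)"
  unfolding vertex_family_def
proof (intro conjI allI impI)
  have lin: "lin (P x)" for x using assms by (simp add: vertex_family_def)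
  show "lin (\<lambda>v. act L (\<lambda>x. P x v) x)" for x by (rule lin_act[OF lin])
  fix k and r :: nat assume r: "0 < r"
  show "heis_pos k r (act L (\<lambda>x. P x (vv \<beta>)) x) = act (l k r) (\<lambda>x. act L (\<lambda>x. P x (vv \<beta>)) x) x" for \<beta> x
  proof -
    have "heis_pos k r (act L (\<lambda>x. P x (vv \<beta>)) x) = act L (\<lambda>x. heis_pos k r (P x (vv \<beta>))) x"
      by (rule act_lin[OF lin_heis_pos, symmetric])
    also have "\<dots> = act L (act (l k r) (\<lambda>x. P x (vv \<beta>))) x"
      using assms r by (simp add: vertex_family_def)
    finally show ?thesis by (simp add: act_commute)
  qed
  show "act (Q k r) (\<lambda>x. heis_neg k r (act L (\<lambda>x. P x v) x) - act L (\<lambda>x. P x (heis_neg k r v)) x) x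
      = act (m k r) (\<lambda>x. act L (\<lambda>x. P x v) x) x" for v x
  proof -
    have "(\<lambda>x. heis_neg k r (act L (\<lambda>x. P x v) x) - act L (\<lambda>x. P x (heis_neg k r v)) x)
       = act L (\<lambda>x. heis_neg k r (P x v) - P x (heis_neg k r v))"
      by (rule ext) (simp only: act_diff_right act_lin[OF lin_heis_neg])
    then have "act (Q k r) (\<lambda>x. heis_neg k r (act L (\<lambda>x. P x v) x) - act L (\<lambda>x. P x (heis_neg k r v)) x) x
       = act L (act (Q k r) (\<lambda>x. heis_neg k r (P x v) - P x (heis_neg k r v))) x"
      by (simp add: act_commute)
    also have "act (Q k r) (\<lambda>x. heis_neg k r (P x v) - P x (heis_neg k r v)) = act (m k r) (\<lambda>x. P x v)"
      using assms r by (intro ext) (simp add: vertex_family_def)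
    finally show ?thesis by (simp add: act_commute)
  qed
qed

lemma vertex_family_diff:
  assumes "vertex_family l Q m P" "vertex_family l Q m P'"
  shows "vertex_family l Q m (\<lambda>x v. P x v - P' x v)"
  unfolding vertex_family_def
proof (intro conjI allI impI)
  have lin: "lin (P x)" "lin (P' x)" for x using assms by (simp_all add: vertex_family_def)
  show "lin (\<lambda>v. P x v - P' x v)" for x by (intro lin_minus lin)
  fix k and r :: nat assume r: "0 < r"
  show "heis_pos k r (P x (vv \<beta>) - P' x (vv \<beta>)) = act (l k r) (\<lambda>x. P x (vv \<beta>) - P' x (vv \<beta>)) x" for \<beta> x
    using assms r by (simp add: vertex_family_def act_diff_right lin_diff[OF lin_heis_pos])
  show "act (Q k r) (\<lambda>x. heis_neg k r (P x v - P' x v) - (P x (heis_neg k r v) - P' x (heis_neg k r v))) x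
      = act (m k r) (\<lambda>x. P x v - P' x v) x" for v x
  proof -
    have "(\<lambda>x. heis_neg k r (P x v - P' x v) - (P x (heis_neg k r v) - P' x (heis_neg k r v)))
      = (\<lambda>x. (heis_neg k r (P x v) - P x (heis_neg k r v)) - (heis_neg k r (P' x v) - P' x (heis_neg k r v)))"
      by (rule ext) (simp add: lin_diff[OF lin_heis_neg])
    then have "act (Q k r) (\<lambda>x. heis_neg k r (P x v - P' x v) - (P x (heis_neg k r v) - P' x (heis_neg k r v))) x
      = act (Q k r) (\<lambda>x. heis_neg k r (P x v) - P x (heis_neg k r v)) x
        - act (Q k r) (\<lambda>x. heis_neg k r (P' x v) - P' x (heis_neg k r v)) x"
      by (simp only: act_diff_right[of _ "\<lambda>x. heis_neg k r (P x v) - P x (heis_neg k r v)"])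
    then show ?thesis using assms r by (simp only: act_diff_right[of "m k r"]) (simp add: vertex_family_def)
  qed
qed

lemma vertex_family_add:
  assumes "vertex_family l Q m P" "vertex_family l Q m P'"
  shows "vertex_family l Q m (\<lambda>x v. P x v + P' x v)"
proof -
  have "vertex_family l Q m (\<lambda>x v. act (- 1) (\<lambda>x. P' x v) x)"
    by (rule vertex_family_act[OF assms(2)])
  from vertex_family_diff[OF assms(1) this] show ?thesis
    by (simp add: act_uminus_left)
qed

text \<open>Brings families with different denominators to common data, so that they can be
  subtracted.\<close>

lemma vertex_family_multiply:
  assumes "vertex_family l Q m P"
  shows "vertex_family l (\<lambda>k r. R k r * Q k r) (\<lambda>k r. R k r * m k r) P"
  using assms unfolding vertex_family_def act_mult by (auto intro!: act_cong)

lemma vertex_family_cong: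
  assumes "vertex_family l Q m P"
    and "\<And>k r. 0 < r \<Longrightarrow> l k r = l' k r" "\<And>k r. 0 < r \<Longrightarrow> Q k r = Q' k r" "\<And>k r. 0 < r \<Longrightarrow> m k r = m' k r"
  shows "vertex_family l' Q' m' P"
  using assms unfolding vertex_family_def by simp

text \<open>Products in opposite orders list their exponents in opposite orders; renaming makes
  their data comparable.\<close>

lemma vertex_family_reindex:
  assumes P: "vertex_family l Q m P" and \<sigma>: "additive_map \<sigma>" and \<sigma>\<tau>: "\<And>y. \<sigma> (\<tau> y) = y" "\<And>x. \<tau> (\<sigma> x) = x"
  shows "vertex_family (\<lambda>k r. push \<sigma> (l k r)) (\<lambda>k r. push \<sigma> (Q k r)) (\<lambda>k r. push \<sigma> (m k r)) (\<lambda>y. P (\<tau> y))"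
proof -
  have act: "act (push \<sigma> L) V y = act L (\<lambda>x. V (\<sigma> x)) (\<tau> y)" for L and V :: "'c \<Rightarrow> 'a fock fps" and y
    using additive_map.act_push[OF \<sigma>, of L V 0 "\<tau> y"] \<sigma>\<tau> by simp
  show ?thesis using P unfolding vertex_family_def by (simp add: act \<sigma>\<tau>)
qed

text \<open>Stronger than \<open>vertex_family\<close>: annihilation operators pass through F on
  every vector and not only on vacuum vectors. This is what a left factor of a product needs, since
  it acts on vectors that are not vacua.\<close>

definition vertex_field ::
    "('i \<Rightarrow> nat \<Rightarrow> int shift) \<Rightarrow> ('i \<Rightarrow> nat \<Rightarrow> int shift) \<Rightarrow> ('i \<Rightarrow> nat \<Rightarrow> int shift) \<Rightarrow> 'i opser \<Rightarrow> bool" where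
  "vertex_field l Q m F \<longleftrightarrow>
     (\<forall>p. lin (F p)) \<and>
     (\<forall>k r v p. 0 < r \<longrightarrow> heis_pos k r (F p v) = F p (heis_pos k r v) + act (l k r) (\<lambda>p. F p v) p) \<and>
     (\<forall>k r v p. 0 < r \<longrightarrow> act (Q k r) (\<lambda>p. heis_neg k r (F p v) - F p (heis_neg k r v)) p
        = act (m k r) (\<lambda>p. F p v) p)"

lemma vertex_field_imp_family:
  assumes "vertex_field l Q m F" shows "vertex_family l Q m F"
proof -
  have "F p 0 = 0" for p
    using assms by (intro module_hom.zero[of hsmult hsmult]) (simp add: vertex_field_def)
  then show ?thesis using assms by (simp add: vertex_field_def vertex_family_def)
qed

text \<open>The Leibniz rule [H, F P] = [H, F] P + F [H, P]: eigenvalues add, denominators multiply,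
  and each summand of the new numerator carries the denominator of the other factor.\<close>

lemma vertex_family_tensor:
  fixes P :: "'y::ab_group_add \<Rightarrow> 'i fock fps \<Rightarrow> 'i fock fps"
  assumes F: "vertex_field l Q m F" and P: "vertex_family l' Q' m' P"
  defines "\<iota>\<^sub>1 \<equiv> push (\<lambda>p. (p, 0 :: 'y))" and "\<iota>\<^sub>2 \<equiv> push (\<lambda>y. (0 :: int, y))"
  shows "vertex_family (\<lambda>k r. \<iota>\<^sub>1 (l k r) + \<iota>\<^sub>2 (l' k r)) (\<lambda>k r. \<iota>\<^sub>1 (Q k r) * \<iota>\<^sub>2 (Q' k r))
     (\<lambda>k r. \<iota>\<^sub>2 (Q' k r) * \<iota>\<^sub>1 (m k r) + \<iota>\<^sub>1 (Q k r) * \<iota>\<^sub>2 (m' k r)) (\<lambda>(p, y) v. F p (P y v))"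
  unfolding vertex_family_def
proof (intro conjI allI impI)
  have F1: "lin (F p)" for p using F by (simp add: vertex_field_def)
  have P1: "lin (P y)" for y using P by (simp add: vertex_family_def)
  show "lin (case x of (p, y) \<Rightarrow> \<lambda>v. F p (P y v))" for x
    by (cases x) (simp add: lin_compose[OF F1 P1])
  fix k and r :: nat assume r: "0 < r"
  show "heis_pos k r ((case x of (p, y) \<Rightarrow> \<lambda>v. F p (P y v)) (vv \<beta>))
      = act (\<iota>\<^sub>1 (l k r) + \<iota>\<^sub>2 (l' k r)) (\<lambda>x. (case x of (p, y) \<Rightarrow> \<lambda>v. F p (P y v)) (vv \<beta>)) x" for \<beta> x
  proof -
    obtain p y where x: "x = (p, y)" by (cases x)
    have "heis_pos k r (F p (P y (vv \<beta>))) = F p (heis_pos k r (P y (vv \<beta>))) + act (l k r) (\<lambda>p. F p (P y (vv \<beta>))) p"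
      using F r by (simp add: vertex_field_def)
    also have "heis_pos k r (P y (vv \<beta>)) = act (l' k r) (\<lambda>y. P y (vv \<beta>)) y"
      using P r by (simp add: vertex_family_def)
    finally show ?thesis
      by (simp add: x act_add_left \<iota>\<^sub>1_def \<iota>\<^sub>2_def act_push_fst act_push_snd act_lin[OF F1] add.commute)
  qed
  show "act (\<iota>\<^sub>1 (Q k r) * \<iota>\<^sub>2 (Q' k r)) (\<lambda>x. heis_neg k r ((case x of (p, y) \<Rightarrow> \<lambda>v. F p (P y v)) v)
          - (case x of (p, y) \<Rightarrow> \<lambda>v. F p (P y v)) (heis_neg k r v)) x
      = act (\<iota>\<^sub>2 (Q' k r) * \<iota>\<^sub>1 (m k r) + \<iota>\<^sub>1 (Q k r) * \<iota>\<^sub>2 (m' k r)) (\<lambda>x. (case x of (p, y) \<Rightarrow> \<lambda>v. F p (P y v)) v) x" for v x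
  proof -
    define U V W where "U = (\<lambda>(p, y). heis_neg k r (F p (P y v)) - F p (heis_neg k r (P y v)))"
      and "V = (\<lambda>(p, y). F p (heis_neg k r (P y v) - P y (heis_neg k r v)))"
      and "W = (\<lambda>(p, y). F p (P y v))"
    have "act (\<iota>\<^sub>1 (Q k r)) U x = act (\<iota>\<^sub>1 (m k r)) W x" for x
      using F r by (cases x) (simp add: U_def W_def \<iota>\<^sub>1_def act_push_fst vertex_field_def)
    then have U: "act (\<iota>\<^sub>1 (Q k r)) U = act (\<iota>\<^sub>1 (m k r)) W" by blast
    have "act (\<iota>\<^sub>2 (Q' k r)) V x = act (\<iota>\<^sub>2 (m' k r)) W x" for x
      using P r
      by (cases x) (simp add: V_def W_def \<iota>\<^sub>2_def act_push_snd act_lin[OF F1] vertex_family_def)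
    then have V: "act (\<iota>\<^sub>2 (Q' k r)) V = act (\<iota>\<^sub>2 (m' k r)) W" by blast
    have "(\<lambda>x. heis_neg k r ((case x of (p, y) \<Rightarrow> \<lambda>v. F p (P y v)) v)
          - (case x of (p, y) \<Rightarrow> \<lambda>v. F p (P y v)) (heis_neg k r v)) = (\<lambda>x. U x + V x)"
      by (auto simp: U_def V_def lin_diff[OF F1])
    then have "act (\<iota>\<^sub>1 (Q k r) * \<iota>\<^sub>2 (Q' k r)) (\<lambda>x. heis_neg k r ((case x of (p, y) \<Rightarrow> \<lambda>v. F p (P y v)) v)
          - (case x of (p, y) \<Rightarrow> \<lambda>v. F p (P y v)) (heis_neg k r v)) x
        = act (\<iota>\<^sub>2 (Q' k r) * \<iota>\<^sub>1 (Q k r)) U x + act (\<iota>\<^sub>1 (Q k r) * \<iota>\<^sub>2 (Q' k r)) V x"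
      by (simp only: act_add_right) (simp add: mult.commute)
    also have "\<dots> = act (\<iota>\<^sub>2 (Q' k r) * \<iota>\<^sub>1 (m k r) + \<iota>\<^sub>1 (Q k r) * \<iota>\<^sub>2 (m' k r)) W x"
      by (simp add: act_mult act_add_left U V)
    finally show ?thesis by (simp add: W_def case_prod_unfold)
  qed
qed

section \<open>Newton sequences\<close>

text \<open>\<open>newton l g\<close> says that \<open>(\<Sum>m. g m z\<^sup>m) = exp (\<Sum>r>0. l r z\<^sup>r / r) (g 0)\<close>.\<close>

definition newton :: "(nat \<Rightarrow> 'x::ab_group_add shift) \<Rightarrow> (nat \<Rightarrow> 'x \<Rightarrow> 'i fock fps) \<Rightarrow> bool" where
  "newton l g \<longleftrightarrow> (\<forall>m x. hsmult (of_nat m) (g m x) = (\<Sum>r = 1..m. act (l r) (g (m - r)) x))"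

lemma newton_unique:
  assumes "newton l g" "newton l g'" "\<And>x. g 0 x = g' 0 x"
  shows "g m = g' m"
proof (induction m rule: less_induct)
  case (less m)
  show ?case
  proof (cases "m = 0")
    case False
    have "hsmult (of_nat m) (g m x) = hsmult (of_nat m) (g' m x)" for x
      using assms(1,2) less False by (simp add: newton_def)
    then have "hsmult (of_nat m) (g m x - g' m x) = 0" for x
      by (simp add: hs.scale_right_diff_distrib)
    then show ?thesis using False by (auto simp: fun_eq_iff)
  qed (use assms(3) in auto)
qed

text \<open>The coefficients of (1 - y z) times the series of g.\<close>

definition newton_factor ::
    "'x::ab_group_add shift \<Rightarrow> (nat \<Rightarrow> 'x \<Rightarrow> 'i fock fps) \<Rightarrow> nat \<Rightarrow> 'x \<Rightarrow> 'i fock fps" where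
  "newton_factor y g m x = g m x - (if m = 0 then 0 else act y (g (m - 1)) x)"

text \<open>The logarithm of 1 - y z is - sum y^r z^r / r, so multiplication by it removes y^r from
  the logarithmic derivative.\<close>

lemma newton_factor:
  assumes "newton l g"
  shows "newton (\<lambda>r. l r - y ^ r) (newton_factor y g)"
  unfolding newton_def
proof (intro allI)
  fix m x
  define h where "h = newton_factor y g"
  have g: "(\<Sum>r = 1..m. act (l r) (g (m - r)) x) = hsmult (of_nat m) (g m x)" for m x
    using assms by (simp add: newton_def)
  \<comment> \<open>The recursion for g with the index lowered by one, multiplied by y.\<close>
  have shift: "(\<Sum>r = 1..m. act (l r) (\<lambda>x. if m - r = 0 then 0 else act y (g (m - r - 1)) x) x)
      = (if m = 0 then 0 else hsmult (of_nat (m - 1)) (act y (g (m - 1)) x))"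
  proof (cases m)
    case (Suc n)
    have "(\<Sum>r = 1..m. act (l r) (\<lambda>x. if m - r = 0 then 0 else act y (g (m - r - 1)) x) x)
       = (\<Sum>r = 1..n. act (l r) (act y (g (n - r))) x)"
      unfolding Suc by (subst sum.cl_ivl_Suc) (auto intro!: sum.cong simp: Suc_diff_le)
    also have "\<dots> = act y (\<lambda>x. \<Sum>r = 1..n. act (l r) (g (n - r)) x) x"
      by (simp only: act_sum_right act_commute[of y])
    also have "\<dots> = hsmult (of_nat n) (act y (g n) x)"
      by (simp only: g act_hsmult)
    finally show ?thesis by (simp add: Suc)
  qed simp
  \<comment> \<open>The geometric series in y z cancels the factor 1 - y z: sum y^r z^r over r > 0,
    times h, equals y z g, by telescoping.\<close>
  have tel: "(\<Sum>r = 1..m. act (y ^ r) (h (m - r)) x) = (if m = 0 then 0 else act y (g (m - 1)) x)" for m x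
  proof -
    have "act (y ^ r) (h (m - r)) x
        = (act (y ^ r) (g (m - r)) x) - (if r = m then 0 else act (y ^ Suc r) (g (m - Suc r)) x)"
      if "r \<in> {1..m}" for r
    proof (cases "r = m")
      case False
      then have "h (m - r) = (\<lambda>x. g (m - r) x - act y (g (m - Suc r)) x)"
        using that by (auto simp: h_def newton_factor_def)
      then have "act (y ^ r) (h (m - r)) x = act (y ^ r) (g (m - r)) x - act (y ^ r) (act y (g (m - Suc r))) x"
        by (simp only: act_diff_right)
      then show ?thesis using False by (simp only: power_Suc2 act_mult) simp
    next
      case True
      have "h 0 = g 0" by (auto simp: h_def newton_factor_def)
      then show ?thesis using True by simp
    qed
    then have "(\<Sum>r = 1..m. act (y ^ r) (h (m - r)) x)
        = (\<Sum>r = 1..m. (if r = m + 1 then 0 else act (y ^ r) (g (m - r)) x)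
            - (if Suc r = m + 1 then 0 else act (y ^ Suc r) (g (m - Suc r)) x))"
      by (intro sum.cong) auto
    also have "\<dots> = - (\<Sum>r = 1..m. (\<lambda>r. if r = m + 1 then 0 else act (y ^ r) (g (m - r)) x) (Suc r)
       - (\<lambda>r. if r = m + 1 then 0 else act (y ^ r) (g (m - r)) x) r)"
      by (simp add: sum_subtractf)
    also have "\<dots> = (if m = 0 then 0 else act y (g (m - 1)) x)"
      by (cases m) (simp, subst sum_Suc_diff, auto)
    finally show ?thesis .
  qed
  have "(\<Sum>r = 1..m. act (l r - y ^ r) (h (m - r)) x)
      = (\<Sum>r = 1..m. act (l r) (h (m - r)) x) - (\<Sum>r = 1..m. act (y ^ r) (h (m - r)) x)"
    by (simp add: act_diff_left sum_subtractf)
  also have "(\<Sum>r = 1..m. act (l r) (h (m - r)) x)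
      = (\<Sum>r = 1..m. act (l r) (g (m - r)) x)
        - (\<Sum>r = 1..m. act (l r) (\<lambda>x. if m - r = 0 then 0 else act y (g (m - r - 1)) x) x)"
    unfolding sum_subtractf[symmetric] act_diff_right[symmetric]
    by (intro sum.cong) (simp_all add: h_def newton_factor_def[abs_def])
  also have "\<dots> - (\<Sum>r = 1..m. act (y ^ r) (h (m - r)) x) = hsmult (of_nat m) (h m x)"
    unfolding g shift tel
    by (cases m) (simp_all add: h_def newton_factor_def hs.scale_right_diff_distrib hs.scale_left_distrib)
  finally show "hsmult (of_nat m) (h m x) = (\<Sum>r = 1..m. act (l r - y ^ r) (h (m - r)) x)" ..
qed

definition newton_factors ::
    "'x::ab_group_add shift list \<Rightarrow> (nat \<Rightarrow> 'x \<Rightarrow> 'i fock fps) \<Rightarrow> nat \<Rightarrow> 'x \<Rightarrow> 'i fock fps" where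
  "newton_factors ys g = fold newton_factor ys g"

definition psum :: "'a::comm_ring_1 list \<Rightarrow> nat \<Rightarrow> 'a" where
  "psum xs r = (\<Sum>x\<leftarrow>xs. x ^ r)"

lemma newton_factors: "newton l g \<Longrightarrow> newton (\<lambda>r. l r - psum ys r) (newton_factors ys g)"
proof (induction ys arbitrary: l g)
  case (Cons y ys)
  from Cons(1)[OF newton_factor[OF Cons(2)], of y] show ?case
    by (simp add: newton_factors_def psum_def diff_diff_eq)
qed (simp_all add: newton_factors_def psum_def)

lemma newton_factors_0: "newton_factors ys g 0 x = g 0 x"
  by (induction ys arbitrary: g) (simp_all add: newton_factors_def newton_factor_def)

text \<open>Multiplying g by all factors 1 - y z removes the positive power sums. Both sides then
  solve the recursion for minus the power sums of xs with the same initial term, and this recursion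
  has one solution because m is invertible.\<close>

lemma newton_solve:
  assumes "newton (\<lambda>r. psum ys r - psum xs r) g"
  shows "newton_factors ys g m = newton_factors xs (\<lambda>m x. if m = 0 then g 0 x else 0) m"
proof (rule newton_unique)
  show "newton (\<lambda>r. 0 - psum xs r) (newton_factors ys g)"
    using newton_factors[OF assms, of ys] by simp
  show "newton (\<lambda>r. 0 - psum xs r) (newton_factors xs (\<lambda>m x. if m = 0 then g 0 x else 0))"
    by (rule newton_factors) (auto simp: newton_def)
qed (simp add: newton_factors_0)

text \<open>A sequence \<open>g\<close> as the series \<open>(\<Sum>m. g m z\<^sup>e\<^sup>-\<^sup>m)\<close>.\<close>

definition descending :: "int \<Rightarrow> (nat \<Rightarrow> 'y \<Rightarrow> 'i fock fps) \<Rightarrow> int \<times> 'y \<Rightarrow> 'i fock fps" where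
  "descending e g = (\<lambda>(p, y). if p \<le> e then g (nat (e - p)) y else 0)"

abbreviation zvar :: "(int \<times> 'y::ab_group_add) shift" where
  "zvar \<equiv> Poly_Mapping.single (1, 0) 1"

abbreviation lift_snd :: "'y::ab_group_add shift \<Rightarrow> (int \<times> 'y) shift" where
  "lift_snd \<equiv> push (\<lambda>y. (0, y))"

lemma act_zvar_descending: "act zvar (descending e g) = descending (e + 1) g"
  by (auto simp: descending_def algebra_simps)

lemma act_linear_descending:
  "act (zvar - lift_snd y) (descending e g) = descending (e + 1) (newton_factor y g)"
proof
  fix x show "act (zvar - lift_snd y) (descending e g) x = descending (e + 1) (newton_factor y g) x"
  proof (cases x)
    case (Pair p q)
    have "act y (\<lambda>y. descending e g (p, y)) q = (if p \<le> e then act y (g (nat (e - p))) q else 0)"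
      by (auto simp: descending_def)
    moreover have "nat (e + 1 - p) - 1 = nat (e - p)" by simp
    ultimately show ?thesis
      by (auto simp: Pair act_diff_left act_push_snd descending_def newton_factor_def algebra_simps)
  qed
qed

lemma act_factors_descending:
  "act (\<Prod>y\<leftarrow>ys. zvar - lift_snd y) (descending e g)
     = descending (e + int (length ys)) (newton_factors ys g)"
proof (induction ys arbitrary: e g)
  case (Cons y ys)
  have "act (\<Prod>y\<leftarrow>y # ys. zvar - lift_snd y) (descending e g)
     = act (\<Prod>y\<leftarrow>ys. zvar - lift_snd y) (act (zvar - lift_snd y) (descending e g))"
    by (rule ext) (simp only: list.map prod_list.Cons act_mult act_commute[of "zvar - lift_snd y"])
  then show ?case by (simp add: act_linear_descending Cons newton_factors_def algebra_simps)
qed (auto simp: newton_factors_def)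

lemma act_zvar_power_descending: "act (zvar ^ n) (descending e g) = descending (e + int n) g"
proof (induction n arbitrary: e)
  case (Suc n)
  have "act (zvar ^ Suc n) (descending e g) = act (zvar ^ n) (act zvar (descending e g))"
    by (rule ext) (simp only: power_Suc2 act_mult)
  then show ?case by (simp add: act_zvar_descending Suc algebra_simps)
qed auto

text \<open>In descending powers, 1 - y / z becomes z - y at the cost of one power of z; the powers
  of \<open>zvar\<close> restore the balance between the two sides.\<close>

lemma newton_solve_descending:
  assumes "newton (\<lambda>r. psum ys r - psum xs r) g"
  shows "act ((\<Prod>y\<leftarrow>ys. zvar - lift_snd y) * zvar ^ length xs) (descending e g) u
       = act ((\<Prod>x\<leftarrow>xs. zvar - lift_snd x) * zvar ^ length ys)
           (\<lambda>(p, y). if p = e then g 0 y else 0) u"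
proof -
  have "(\<lambda>(p, y). if p = e then g 0 y else 0) = descending e (\<lambda>m x. if m = 0 then g 0 x else 0)"
    by (auto simp: descending_def)
  then show ?thesis
    by (simp add: act_mult act_zvar_power_descending act_factors_descending
        ext[OF newton_solve[OF assms]] algebra_simps)
qed

section \<open>Products and exponentials of operator series\<close>

text \<open>Summability of the product, also after a linear operator has been applied in the middle.\<close>

definition op_summable :: "'i opser \<Rightarrow> 'i opser \<Rightarrow> bool" where
  "op_summable F G \<longleftrightarrow>
     (\<forall>p v H. (\<forall>q N. hz N (G q v) \<longrightarrow> hz N (H q)) \<longrightarrow> hsummable (\<lambda>q. F q (H (p - q))))"

lemma op_summableD: "op_summable F G \<Longrightarrow> hsummable (\<lambda>q. F q (G (p - q) v))"
  unfolding op_summable_def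
  by (drule spec[of _ p], drule spec[of _ v], drule spec[of _ "\<lambda>q. G q v"]) simp

lemma op_summable_lin: "op_summable F G \<Longrightarrow> lin T \<Longrightarrow> hsummable (\<lambda>q. F q (T (G (p - q) v)))"
  unfolding op_summable_def
  by (drule spec[of _ p], drule spec[of _ v], drule spec[of _ "\<lambda>q. T (G q v)"]) (simp add: hz_lin)

lemma lin_op_times:
  assumes "\<And>p. lin (F p)" "\<And>p. lin (G p)" "op_summable F G"
  shows "lin (op_times F G p)"
proof -
  have "lin (\<lambda>v. hsum (\<lambda>q. F q (G (p - q) v)))"
    by (rule lin_hsum[OF lin_compose[OF assms(1,2)] op_summableD[OF assms(3)]])
  then show ?thesis by (simp add: op_times_def[abs_def])
qed

lemma op_times_const_left: "op_times (op_const T) F p v = T (F p v)"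
  unfolding op_times_def by (subst hsum_eq_sum[of "{0}"]) (auto simp: op_const_def)

text \<open>Translating the exponent of a product can be charged to its left factor by reindexing
  the convolution.\<close>

lemma act_convolution_left:
  fixes L :: "int shift"
  assumes "\<And>p. hsummable (\<lambda>q. K q (G (p - q)))"
  shows "act L (\<lambda>p. hsum (\<lambda>q. K q (G (p - q)))) p = hsum (\<lambda>q. act L (\<lambda>q'. K q' (G (p - q))) q)"
proof -
  have bij: "bij (\<lambda>q. q - t)" for t :: int by (rule bij_diff_right)
  have shift: "hsum (\<lambda>q. K q (G (p - t - q))) = hsum (\<lambda>q. K (q - t) (G (p - q)))" for t
    using hsum_bij[OF bij[of t], of "\<lambda>q. K q (G (p - t - q))"] by simp
  have summ: "hsummable (\<lambda>q. K (q - t) (G (p - q)))" for t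
    using hsummable_bij[OF bij[of t] assms[of "p - t"]] by simp
  show ?thesis
    unfolding act_def shift
    by (simp add: hsum_lin[OF lin_hsmult[OF lin_id(1)] summ] hsum_sum
        hsummable_lin[OF lin_hsmult[OF lin_id(1)] summ])
qed

lemma act_convolution_right:
  assumes "\<And>q. lin (F q)" "\<And>p. hsummable (\<lambda>q. F q (H (p - q)))"
  shows "act L (\<lambda>p. hsum (\<lambda>q. F q (H (p - q)))) p = hsum (\<lambda>q. F q (act L H (p - q)))"
proof -
  have "F q (act L H (p - q)) = act L (\<lambda>p. F q (H (p - q))) p" for q
    unfolding act_def by (simp add: module_hom.sum[OF assms(1)] module_hom.scale[OF assms(1)] algebra_simps)
  then show ?thesis using act_hsum[of "\<lambda>p q. F q (H (p - q))" L p] assms(2) by simp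
qed

lemma act_op_times_right:
  assumes "\<And>q. lin (F q)" "op_summable F G"
  shows "act L (\<lambda>p. op_times F G p v) p = hsum (\<lambda>q. F q (act L (\<lambda>p. G p v) (p - q)))"
  unfolding op_times_def by (rule act_convolution_right[OF assms(1) op_summableD[OF assms(2)]])

lemma hsummable_diff: "hsummable f \<Longrightarrow> hsummable g \<Longrightarrow> hsummable (\<lambda>b. f b - g b)"
  using hsummable_add[of f "\<lambda>b. 0 - g b"] hsummable_lin[OF lin_minus[OF lin_0 lin_id(1)], of g] by simp

lemma hsum_diff: "hsummable f \<Longrightarrow> hsummable g \<Longrightarrow> hsum (\<lambda>b. f b - g b) = hsum f - hsum g"
  using hsum_add[of f "\<lambda>b. 0 - g b"] hsummable_lin[OF lin_minus[OF lin_0 lin_id(1)], of g]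
    hsum_lin[OF lin_minus[OF lin_0 lin_id(1)], of g] by simp

text \<open>The commutator of T with F(z) is l / Q times F(z), written without division; Q = 1 when
  the commutator is a Laurent polynomial times F.\<close>

definition commutes_by ::
    "('i fock fps \<Rightarrow> 'i fock fps) \<Rightarrow> int shift \<Rightarrow> int shift \<Rightarrow> 'i opser \<Rightarrow> bool" where
  "commutes_by T Q l F \<longleftrightarrow> (\<forall>p v. act Q (\<lambda>p. T (F p v) - F p (T v)) p = act l (\<lambda>p. F p v) p)"

lemma commutes_by_1: "commutes_by T 1 l F \<longleftrightarrow> (\<forall>p v. T (F p v) = F p (T v) + act l (\<lambda>p. F p v) p)"
  by (auto simp: commutes_by_def algebra_simps)

lemma commutes_by_0: "commutes_by T 1 0 F \<longleftrightarrow> (\<forall>p v. T (F p v) = F p (T v))"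
  by (simp add: commutes_by_1)

text \<open>The Leibniz rule for a product in one variable: l / Q + l' / Q' over the common
  denominator. The commutator splits as U + V, from T meeting the left and the right factor.\<close>

lemma op_times_commutes_by:
  assumes T: "lin T" and F: "\<And>p. lin (F p)" and G: "\<And>p. lin (G p)"
    and FG: "op_summable F G"
    and cF: "commutes_by T Q l F" and cG: "commutes_by T Q' l' G"
  shows "commutes_by T (Q * Q') (Q' * l + Q * l') (op_times F G)"
  unfolding commutes_by_def
proof (intro allI)
  fix p v
  define K where "K q w = T (F q w) - F q (T w)" for q w
  define J where "J q = T (G q v) - G q (T v)" for q
  define U V where "U p = hsum (\<lambda>q. K q (G (p - q) v))" and "V p = hsum (\<lambda>q. F q (J (p - q)))" for p
  note s = op_summableD[OF FG]
  have s1: "hsummable (\<lambda>q. T (F q (G (p - q) v)))" for p by (rule hsummable_lin[OF T s])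
  have s2: "hsummable (\<lambda>q. F q (T (G (p - q) v)))" for p by (rule op_summable_lin[OF FG T])
  have sU: "hsummable (\<lambda>q. K q (G (p - q) v))" for p
    unfolding K_def by (rule hsummable_diff[OF s1 s2])
  have sV: "hsummable (\<lambda>q. F q (J (p - q)))" for p
    unfolding J_def module_hom.diff[OF F] by (rule hsummable_diff[OF s2 s])
  have "T (op_times F G p v) - op_times F G p (T v) = U p + V p" for p
    unfolding U_def V_def J_def K_def op_times_def module_hom.diff[OF F] hsum_lin[OF T s]
    by (simp add: hsum_diff s s1 s2)
  then have "act (Q * Q') (\<lambda>p. T (op_times F G p v) - op_times F G p (T v)) p
      = act (Q' * Q) U p + act (Q * Q') V p"
    by (simp add: act_add_right mult.commute)
  also have "act Q U = act l (\<lambda>p. op_times F G p v)"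
  proof
    fix p
    have "act Q U p = hsum (\<lambda>q. act Q (\<lambda>q'. K q' (G (p - q) v)) q)"
      unfolding U_def
      by (rule act_convolution_left[where K = K and G = "\<lambda>p. G p v", OF sU])
    also have "\<dots> = hsum (\<lambda>q. act l (\<lambda>q'. F q' (G (p - q) v)) q)"
      using cF by (simp add: commutes_by_def K_def)
    also have "\<dots> = act l (\<lambda>p. op_times F G p v) p"
      unfolding op_times_def
      by (rule act_convolution_left[where K = F and G = "\<lambda>p. G p v", OF s, symmetric])
    finally show "act Q U p = act l (\<lambda>p. op_times F G p v) p" .
  qed
  then have "act (Q' * Q) U p = act (Q' * l) (\<lambda>p. op_times F G p v) p" by (simp add: act_mult)
  also have "act Q' V = act l' (\<lambda>p. op_times F G p v)"
  proof
    fix p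
    have "act Q' V p = hsum (\<lambda>q. F q (act Q' J (p - q)))"
      unfolding V_def by (rule act_convolution_right[OF F sV])
    also have "act Q' J = act l' (\<lambda>p. G p v)"
      using cG by (auto simp: commutes_by_def J_def[abs_def])
    also have "hsum (\<lambda>q. F q (act l' (\<lambda>p. G p v) (p - q))) = act l' (\<lambda>p. op_times F G p v) p"
      by (rule act_op_times_right[OF F FG, symmetric])
    finally show "act Q' V p = act l' (\<lambda>p. op_times F G p v) p" .
  qed
  then have "act (Q * Q') V p = act (Q * l') (\<lambda>p. op_times F G p v) p" by (simp add: act_mult)
  finally show "act (Q * Q') (\<lambda>p. T (op_times F G p v) - op_times F G p (T v)) p
      = act (Q' * l + Q * l') (\<lambda>p. op_times F G p v) p" by (simp add: act_add_left)
qed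

text \<open>Series in \<open>z\<close> (for \<open>\<sigma> = 1\<close>) or \<open>z\<^sup>-\<^sup>1\<close> (for \<open>\<sigma> = -1\<close>).\<close>

definition one_sided :: "int \<Rightarrow> 'i opser \<Rightarrow> bool" where
  "one_sided \<sigma> F \<longleftrightarrow> \<bar>\<sigma>\<bar> = 1 \<and> (\<forall>p v. \<sigma> * p < 0 \<longrightarrow> F p v = 0)"

lemma one_sided_outside:
  assumes "one_sided \<sigma> F" "one_sided \<sigma> G" "\<And>p. lin (F p)" "q \<notin> {min 0 p..max 0 p}"
  shows "F q (G (p - q) v) = 0"
proof -
  have "\<sigma> * q < 0 \<or> \<sigma> * (p - q) < 0"
    using assms(1,4) by (auto simp: one_sided_def abs_if split: if_splits)
  then show ?thesis
    using assms(1,2) module_hom.zero[OF assms(3)] by (auto simp: one_sided_def)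
qed

lemma one_sided_op_summable:
  assumes "one_sided \<sigma> F" "one_sided \<sigma> G" "\<And>p. lin (F p)"
  shows "op_summable F G"
  unfolding op_summable_def
proof (intro allI impI)
  fix p v and H :: "int \<Rightarrow> 'a fock fps" assume H: "\<forall>q N. hz N (G q v) \<longrightarrow> hz N (H q)"
  show "hsummable (\<lambda>q. F q (H (p - q)))"
  proof (rule hsummable_finite[of "{min 0 p..max 0 p}"])
    fix q assume q: "q \<notin> {min 0 p..max 0 p}"
    have "H q = 0" if "\<sigma> * q < 0" for q
      using that H assms(2) by (intro hz_eqI) (simp add: one_sided_def)
    moreover have "\<sigma> * q < 0 \<or> \<sigma> * (p - q) < 0"
      using assms(1) q by (auto simp: one_sided_def abs_if split: if_splits)
    ultimately show "F q (H (p - q)) = 0"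
      using assms(1) module_hom.zero[OF assms(3)] by (auto simp: one_sided_def)
  qed simp
qed

lemma one_sided_op_times_sum:
  assumes "one_sided \<sigma> F" "one_sided \<sigma> G" "\<And>p. lin (F p)"
  shows "op_times F G p v = (\<Sum>q\<in>{min 0 p..max 0 p}. F q (G (p - q) v))"
  unfolding op_times_def
  by (rule hsum_eq_sum) (use one_sided_outside[OF assms] in auto)

lemma one_sided_op_times:
  assumes "one_sided \<sigma> F" "one_sided \<sigma> G" "\<And>p. lin (F p)"
  shows "one_sided \<sigma> (op_times F G)"
proof -
  have "op_times F G p v = 0" if "\<sigma> * p < 0" for p v
    unfolding one_sided_op_times_sum[OF assms]
  proof (intro sum.neutral ballI)
    fix q
    have "\<sigma> * q < 0 \<or> \<sigma> * (p - q) < 0" using that by (auto simp: algebra_simps)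
    then show "F q (G (p - q) v) = 0"
      using assms(1,2) module_hom.zero[OF assms(3)] by (auto simp: one_sided_def)
  qed
  then show ?thesis using assms(1) by (simp add: one_sided_def)
qed

section \<open>Powers and exponentials of operator series\<close>

definition op_power :: "'i opser \<Rightarrow> nat \<Rightarrow> 'i opser" where
  "op_power E n = (op_times E ^^ n) (op_const id)"

lemma op_power_0: "op_power E 0 p v = (if p = 0 then v else 0)"
  by (simp add: op_power_def op_const_def)

lemma op_power_Suc: "op_power E (Suc n) = op_times E (op_power E n)"
  by (simp add: op_power_def)

lemma op_exp_eq: "op_exp E p v = hsum (\<lambda>n. hsmult (fps_const (1 / fact n)) (op_power E n p v))"
  by (simp add: op_exp_def op_power_def)

text \<open>Two kinds of exponents occur. That of A has nonnegative powers of z, and its constant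
  term, coming from powers of z shifted by multiples of hbar, is only divisible by hbar; that of B
  has strictly negative powers. Either way a fixed coefficient of E^n tends to 0 as n grows.\<close>

locale exponent =
  fixes E :: "'i opser" and \<sigma> :: int
  assumes linE: "lin (E p)" and one_sided: "one_sided \<sigma> E"
    and small: "if \<sigma> = 1 then hz 1 (E 0 v) else E 0 v = 0"
begin

lemma lin_one_sided_op_power: "lin (op_power E n p) \<and> one_sided \<sigma> (op_power E n)"
proof (induction n arbitrary: p)
  case 0
  show ?case using one_sided
    by (auto intro!: linI simp: op_power_0 one_sided_def)
next
  case (Suc n)
  then show ?case
    by (auto simp: op_power_Suc intro!: lin_op_times linE one_sided_op_times one_sided
        one_sided_op_summable)
qed

lemmas lin_op_power = lin_one_sided_op_power[THEN conjunct1]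
  and one_sided_op_power = lin_one_sided_op_power[THEN conjunct2]

lemma op_summable_power: "op_summable E (op_power E n)"
  by (rule one_sided_op_summable[OF one_sided one_sided_op_power linE])

lemma op_power_Suc_sum:
  "op_power E (Suc n) p v = (\<Sum>q\<in>{min 0 p..max 0 p}. E q (op_power E n (p - q) v))"
  unfolding op_power_Suc by (rule one_sided_op_times_sum[OF one_sided one_sided_op_power linE])

lemma sigma: "\<sigma> = 1 \<or> \<sigma> = -1"
  using one_sided by (auto simp: one_sided_def abs_if split: if_splits)

text \<open>At z^p at most p of the n factors can carry a positive power of z; each of the others is
  the constant term of E and contributes a factor hbar.\<close>

lemma hz_op_power: "\<sigma> = 1 \<Longrightarrow> hz (n - nat p) (op_power E n p v)"
proof (induction n arbitrary: p)
  case (Suc n)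
  show ?case unfolding op_power_Suc_sum
  proof (rule hz_sum)
    fix q assume q: "q \<in> {min 0 p..max 0 p}"
    show "hz (Suc n - nat p) (E q (op_power E n (p - q) v))"
    proof (cases "q = 0")
      case True
      have "hz ((n - nat p) + 1) (E 0 (op_power E n p v))"
        using small Suc by (intro hz_lin_add[OF linE]) auto
      then show ?thesis using True by (auto intro: hz_mono)
    next
      case False
      show ?thesis
      proof (cases "0 < q")
        case True
        have "hz (n - nat (p - q)) (E q (op_power E n (p - q) v))"
          by (rule hz_lin[OF linE]) (use Suc in auto)
        then show ?thesis by (rule hz_mono) (use q True in auto)
      next
        case False
        then have "E q w = 0" for w using one_sided Suc(2) \<open>q \<noteq> 0\<close> by (simp add: one_sided_def)
        then show ?thesis by simp
      qed
    qed
  qed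
qed simp

lemma op_power_vanish: "\<sigma> = -1 \<Longrightarrow> - int n < p \<Longrightarrow> op_power E n p v = 0"
proof (induction n arbitrary: p)
  case (Suc n)
  show ?case unfolding op_power_Suc_sum
  proof (rule sum.neutral, rule ballI)
    fix q assume q: "q \<in> {min 0 p..max 0 p}"
    show "E q (op_power E n (p - q) v) = 0"
    proof (cases "0 \<le> q")
      case True
      then have "E q w = 0" for w
        using one_sided small Suc(2) by (cases "q = 0") (auto simp: one_sided_def)
      then show ?thesis by simp
    next
      case False
      then have "op_power E n (p - q) v = 0" using Suc by simp
      then show ?thesis by (simp add: module_hom.zero[OF linE])
    qed
  qed
qed (simp add: op_power_0)

lemma hsummable_op_power: "hsummable (\<lambda>n. op_power E n p v)"
proof (cases "\<sigma> = 1")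
  case True
  show ?thesis unfolding hsummable_def
  proof
    fix N
    have "hz N (op_power E n p v)" if "N + nat p \<le> n" for n
      by (rule hz_mono[OF hz_op_power[OF True]]) (use that in simp)
    then have "{n. \<not> hz N (op_power E n p v)} \<subseteq> {..<N + nat p}"
      by (metis (mono_tags, lifting) lessThan_iff linorder_not_less mem_Collect_eq subsetI)
    then show "finite {n. \<not> hz N (op_power E n p v)}" by (rule finite_subset) simp
  qed
next
  case False
  then have "\<sigma> = -1" using sigma by simp
  then show ?thesis
    by (intro hsummable_finite[of "{..nat (- p)}"]) (auto intro!: op_power_vanish)
qed

lemma hsummable_op_exp: "hsummable (\<lambda>n. hsmult (c n) (op_power E n p v))"
  unfolding hsummable_def
proof
  fix N
  have "{n. \<not> hz N (hsmult (c n) (op_power E n p v))} \<subseteq> {n. \<not> hz N (op_power E n p v)}"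
    by (auto intro: hz_hsmult)
  then show "finite {n. \<not> hz N (hsmult (c n) (op_power E n p v))}"
    using hsummable_op_power[of p v] unfolding hsummable_def by (meson finite_subset)
qed

lemma lin_op_exp: "lin (op_exp E p)"
proof -
  have "lin (\<lambda>v. hsum (\<lambda>n. hsmult (fps_const (1 / fact n)) (op_power E n p v)))"
    by (rule lin_hsum[OF lin_hsmult[OF lin_op_power] hsummable_op_exp])
  then show ?thesis by (simp add: op_exp_eq[abs_def])
qed

lemma one_sided_op_exp: "one_sided \<sigma> (op_exp E)"
  using one_sided_op_power one_sided
  by (auto simp: one_sided_def op_exp_eq hsum_eq_sum[of "{}"])

lemma op_exp_0: "\<sigma> = -1 \<Longrightarrow> op_exp E 0 v = v"
  unfolding op_exp_eq
  by (subst hsum_eq_sum[of "{0}"]) (auto simp: op_power_vanish op_power_0)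

text \<open>The commutator of T with E is a scalar series, hence central, and T acts on powers as a
  derivation: [T, E^n] = n l E^(n-1).\<close>

lemma op_power_commutator:
  assumes T: "lin T" and TE: "\<And>q v. T (E q v) = E q (T v) + hsmult (lookup l q) v"
  shows "T (op_power E n p v)
     = op_power E n p (T v) + hsmult (of_nat n) (act l (\<lambda>p. op_power E (n - 1) p v) p)"
proof (induction n arbitrary: p)
  case 0
  then show ?case by (simp add: op_power_0 module_hom.zero[OF T])
next
  case (Suc n)
  note s = op_summableD[OF op_summable_power]
  have IH: "T (op_power E n p v) = op_power E n p (T v)
      + hsmult (of_nat n) (act l (\<lambda>p. op_power E (n - 1) p v) p)" for p by (rule Suc)
  have s3: "hsummable (\<lambda>q. hsmult (lookup l q) (op_power E n (p - q) v))"
    by (rule hsummable_finite[of "Poly_Mapping.keys l"]) (auto simp: in_keys_iff)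
  have e3: "hsum (\<lambda>q. hsmult (lookup l q) (op_power E n (p - q) v)) = act l (\<lambda>p. op_power E n p v) p"
    unfolding act_def by (rule hsum_eq_sum) (auto simp: in_keys_iff)
  have s2: "hsummable (\<lambda>q. E q (act l (\<lambda>p. op_power E (n - 1) p v) (p - q)))"
  proof -
    have "hsummable (\<lambda>q. act l (\<lambda>p. E q (op_power E (n - 1) (p - q) v)) p)"
      by (rule hsummable_act) (rule s)
    then show ?thesis
      unfolding act_def by (simp add: module_hom.sum[OF linE] module_hom.scale[OF linE] algebra_simps)
  qed
  note s2' = hsummable_lin[OF lin_hsmult[OF lin_id(1)] s2, of "of_nat n"]
  have e2: "hsmult (of_nat n) (hsum (\<lambda>q. E q (act l (\<lambda>p. op_power E (n - 1) p v) (p - q))))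
      = hsmult (of_nat n) (act l (\<lambda>p. op_power E n p v) p)"
  proof (cases n)
    case (Suc m)
    show ?thesis
      unfolding Suc op_power_Suc diff_Suc_1
      by (subst act_op_times_right[OF linE op_summable_power]) simp
  qed simp
  have "T (op_power E (Suc n) p v) = hsum (\<lambda>q. T (E q (op_power E n (p - q) v)))"
    unfolding op_power_Suc op_times_def by (rule hsum_lin[OF T s])
  also have "\<dots> = hsum (\<lambda>q. E q (op_power E n (p - q) (T v))
      + hsmult (of_nat n) (E q (act l (\<lambda>p. op_power E (n - 1) p v) (p - q)))
      + hsmult (lookup l q) (op_power E n (p - q) v))"
    by (simp add: TE IH module_hom.add[OF linE] module_hom.scale[OF linE])
  also have "\<dots> = op_power E (Suc n) p (T v) + hsmult (of_nat n) (act l (\<lambda>p. op_power E n p v) p)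
      + act l (\<lambda>p. op_power E n p v) p"
    by (simp only: hsum_add[OF hsummable_add[OF s s2'] s3] hsum_add[OF s s2'] e3 e2
        hsum_lin[OF lin_hsmult[OF lin_id(1)] s2, symmetric] op_power_Suc op_times_def[symmetric])
  finally show ?case by (simp add: hs.scale_left_distrib algebra_simps)
qed

text \<open>Summing [T, E^n] / n! = l E^(n-1) / (n-1)! gives l times the exponential.\<close>

lemma op_exp_commutator:
  assumes T: "lin T" and TE: "\<And>q v. T (E q v) = E q (T v) + hsmult (lookup l q) v"
  shows "commutes_by T 1 l (op_exp E)"
  unfolding commutes_by_1
proof (intro allI)
  fix p v
  \<comment> \<open>The terms of the commutator series. The term for 0 vanishes and the term for n +
    1 is the n-th term of l exp E, so both series have the same sum after a shift of the
    index.\<close>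
  define f where "f n = hsmult (fps_const (1 / fact n) * of_nat n) (act l (\<lambda>p. op_power E (n - 1) p v) p)" for n
  have f: "f (Suc n) = act l (\<lambda>p. hsmult (fps_const (1 / fact n)) (op_power E n p v)) p" for n
  proof -
    have "fps_const (1 / fact (Suc n)) * of_nat (Suc n) = (fps_const (1 / fact n) :: complex fps)"
      by (simp add: field_simps del: of_nat_Suc flip: fps_of_nat fps_const_mult)
    then show ?thesis by (simp add: f_def act_hsmult del: fact_Suc of_nat_Suc)
  qed
  have sf: "hsummable (\<lambda>n. f (Suc n))"
    unfolding f by (rule hsummable_act) (rule hsummable_op_exp)
  have sf0: "hsummable f"
    unfolding hsummable_def
  proof
    fix N
    have "{n. \<not> hz N (f n)} \<subseteq> insert 0 (Suc ` {n. \<not> hz N (f (Suc n))})"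
      by (auto simp: image_iff) (metis not0_implies_Suc)
    then show "finite {n. \<not> hz N (f n)}"
      using sf unfolding hsummable_def by (meson finite_subset finite_insert finite_imageI)
  qed
  have "hsum f = hsum (\<lambda>n. f (Suc n))"
  proof (subst fps_eq_iff, intro allI)
    fix k
    let ?S = "{n. fps_nth (f (Suc n)) k \<noteq> 0}"
    have fin: "finite ?S" by (rule hsummable_finite_nth[OF sf])
    have "fps_nth (hsum f) k = (\<Sum>n\<in>Suc ` ?S. fps_nth (f n) k)"
    proof (rule hsum_nth_sum)
      fix n assume "n \<notin> Suc ` ?S"
      then show "fps_nth (f n) k = 0" by (cases n) (auto simp: f_def)
    qed (simp add: fin)
    also have "\<dots> = (\<Sum>n\<in>?S. fps_nth (f (Suc n)) k)" by (simp add: sum.reindex)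
    also have "\<dots> = fps_nth (hsum (\<lambda>n. f (Suc n))) k"
      by (rule hsum_nth_sum[symmetric]) (use fin in auto)
    finally show "fps_nth (hsum f) k = fps_nth (hsum (\<lambda>n. f (Suc n))) k" .
  qed
  also have "\<dots> = act l (\<lambda>p. op_exp E p v) p"
    unfolding f op_exp_eq by (rule act_hsum[symmetric]) (rule hsummable_op_exp)
  finally have hf: "hsum f = act l (\<lambda>p. op_exp E p v) p" .
  have "T (op_exp E p v) = hsum (\<lambda>n. T (hsmult (fps_const (1 / fact n)) (op_power E n p v)))"
    unfolding op_exp_eq by (rule hsum_lin[OF T hsummable_op_exp])
  also have "\<dots> = hsum (\<lambda>n. hsmult (fps_const (1 / fact n)) (op_power E n p (T v)) + f n)"
    by (simp add: module_hom.scale[OF T] op_power_commutator[OF T TE] f_def hs.scale_right_distrib)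
  also have "\<dots> = op_exp E p (T v) + act l (\<lambda>p. op_exp E p v) p"
    by (simp add: hsum_add hsummable_op_exp sf0 hf op_exp_eq)
  finally show "T (op_exp E p v) = op_exp E p (T v) + act l (\<lambda>p. op_exp E p v) p" .
qed

lemma op_exp_commute:
  assumes T: "lin T" and TE: "\<And>q v. T (E q v) = E q (T v)"
  shows "T (op_exp E p v) = op_exp E p (T v)"
  using op_exp_commutator[OF T, of 0] TE by (simp add: commutes_by_0)

text \<open>T kills the image of E, so every positive power drops out and only the identity term of
  the exponential is left.\<close>

lemma op_exp_annihilated:
  assumes T: "lin T" and TE: "\<And>q v. T (E q v) = 0"
  shows "T (op_exp E p v) = (if p = 0 then T v else 0)"
proof -
  have "T (op_power E (Suc n) p v) = 0" for n p
    unfolding op_power_Suc op_times_def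
    by (simp add: hsum_lin[OF T op_summableD[OF op_summable_power]] TE hsum_eq_sum[of "{}"])
  then have "n \<noteq> 0 \<Longrightarrow> T (op_power E n p v) = 0" for n p by (cases n) auto
  then show ?thesis
    unfolding op_exp_eq
    by (subst hsum_lin[OF T hsummable_op_exp], subst hsum_eq_sum[of "{0}"])
       (auto simp: module_hom.scale[OF T] op_power_0 module_hom.zero[OF T])
qed

lemma op_exp_fixed:
  assumes "\<And>q. E q v = 0"
  shows "op_exp E p v = (if p = 0 then v else 0)"
proof -
  have comm: "op_power E (Suc n) p v = 0" for n p
  proof (induction n arbitrary: p)
    case 0
    show ?case unfolding op_power_Suc op_times_def
      by (rule trans[OF hsum_eq_sum[of "{}"]]) (auto simp: op_power_0 assms module_hom.zero[OF linE])
  next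
    case (Suc n)
    show ?case unfolding op_power_Suc[of _ "Suc n"] op_times_def
      by (rule trans[OF hsum_eq_sum[of "{}"]]) (auto simp: Suc module_hom.zero[OF linE])
  qed
  then have "n \<noteq> 0 \<Longrightarrow> op_power E n p v = 0" for n p by (cases n) auto
  then show ?thesis
    unfolding op_exp_eq by (subst hsum_eq_sum[of "{0}"]) (auto simp: op_power_0)
qed

text \<open>Multiplication of the coefficient of z^p by p is the operator z d/dz. As the
  coefficients of E commute with each other, it sends E^(n+1) to (n + 1) (z dE/dz) E^n.\<close>

lemma op_power_derivation:
  assumes EE: "\<And>q t v. E q (E t v) = E t (E q v)"
  shows "hsmult (of_int p) (op_power E (Suc n) p v)
    = hsmult (of_nat (Suc n)) (\<Sum>q\<in>{min 0 p..max 0 p}. hsmult (of_int q) (E q (op_power E n (p - q) v)))"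
proof (induction n arbitrary: p)
  case 0
  have "hsmult (of_int p) (E q (op_power E 0 (p - q) v)) = hsmult (of_int q) (E q (op_power E 0 (p - q) v))" for q
    by (auto simp: op_power_0 module_hom.zero[OF linE])
  then show ?case by (simp add: op_power_Suc_sum hs.scale_sum_right)
next
  case (Suc n)
  let ?J = "{min 0 p..max 0 p}"
  note s = op_summableD[OF op_summable_power]
  \<comment> \<open>The series z dE/dz.\<close>
  define G where "G q w = hsmult (of_int q) (E q w)" for q w
  have linG: "lin (G q)" for q unfolding G_def[abs_def] by (rule lin_hsmult[OF linE])
  have G1: "one_sided \<sigma> G" using one_sided by (simp add: one_sided_def G_def)
  have deriv: "op_times G (op_power E n) p v = (\<Sum>q\<in>{min 0 p..max 0 p}. G q (op_power E n (p - q) v))" for n p v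
    by (rule one_sided_op_times_sum[OF G1 one_sided_op_power linG])
  have IH: "hsmult (of_int p) (op_power E (Suc n) p v)
      = hsmult (of_nat (Suc n)) (op_times G (op_power E n) p v)" for p
    unfolding deriv using Suc[of p] by (simp add: G_def)
  \<comment> \<open>Commutativity moves the differentiated factor to the front, past one factor
    E.\<close>
  have swap: "(\<Sum>q\<in>?J. E q (op_times G (op_power E n) (p - q) v)) = op_times G (op_power E (Suc n)) p v"
  proof -
    have sub: "{min 0 (p - q)..max 0 (p - q)} \<subseteq> ?J" if "q \<in> ?J" for q
      using that by (auto simp: min_def max_def split: if_splits)
    have A: "E q (op_times G (op_power E n) (p - q) v) = (\<Sum>t\<in>?J. E q (G t (op_power E n (p - q - t) v)))"
      if q: "q \<in> ?J" for q
    proof -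
      have "op_times G (op_power E n) (p - q) v = (\<Sum>t\<in>?J. G t (op_power E n (p - q - t) v))"
        unfolding op_times_def
        by (rule hsum_eq_sum)
           (use sub[OF q] one_sided_outside[OF G1 one_sided_op_power linG, of _ "p - q" n v] in blast)+
      then show ?thesis by (simp add: module_hom.sum[OF linE])
    qed
    have B: "G t (op_power E (Suc n) (p - t) v) = (\<Sum>q\<in>?J. G t (E q (op_power E n (p - t - q) v)))"
      if t: "t \<in> ?J" for t
    proof -
      have "op_power E (Suc n) (p - t) v = (\<Sum>q\<in>?J. E q (op_power E n (p - t - q) v))"
        unfolding op_power_Suc op_times_def
        by (rule hsum_eq_sum)
           (use sub[OF t] one_sided_outside[OF one_sided one_sided_op_power linE, of _ "p - t" n v] in blast)+
      then show ?thesis by (simp add: module_hom.sum[OF linG])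
    qed
    have C: "E q (G t w) = G t (E q w)" for q t w
      by (simp add: G_def module_hom.scale[OF linE] EE)
    have "(\<Sum>q\<in>?J. E q (op_times G (op_power E n) (p - q) v))
        = (\<Sum>q\<in>?J. \<Sum>t\<in>?J. G t (E q (op_power E n (p - t - q) v)))"
      by (intro sum.cong refl) (simp add: A C algebra_simps)
    also have "\<dots> = (\<Sum>t\<in>?J. \<Sum>q\<in>?J. G t (E q (op_power E n (p - t - q) v)))"
      by (rule sum.swap)
    also have "\<dots> = (\<Sum>t\<in>?J. G t (op_power E (Suc n) (p - t) v))"
      by (intro sum.cong refl) (simp add: B)
    finally show ?thesis by (simp add: deriv)
  qed
  have "hsmult (of_int p) (E q (op_power E (Suc n) (p - q) v))
      = G q (op_power E (Suc n) (p - q) v)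
        + hsmult (of_nat (Suc n)) (E q (op_times G (op_power E n) (p - q) v))" for q
  proof -
    have "hsmult (of_int p) (E q (op_power E (Suc n) (p - q) v))
       = G q (op_power E (Suc n) (p - q) v) + E q (hsmult (of_int (p - q)) (op_power E (Suc n) (p - q) v))"
      by (simp add: G_def module_hom.scale[OF linE] module_hom.diff[OF linE] hs.scale_left_diff_distrib)
    then show ?thesis by (simp only: IH module_hom.scale[OF linE])
  qed
  then have "hsmult (of_int p) (op_power E (Suc (Suc n)) p v)
     = op_times G (op_power E (Suc n)) p v
       + hsmult (of_nat (Suc n)) (\<Sum>q\<in>?J. E q (op_times G (op_power E n) (p - q) v))"
    unfolding op_power_Suc_sum[of "Suc n"]
    by (simp add: hs.scale_sum_right sum.distrib deriv del: of_nat_Suc)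
  also have "\<dots> = hsmult (of_nat (Suc (Suc n))) (op_times G (op_power E (Suc n)) p v)"
    unfolding swap
    by (simp only: of_nat_Suc[of "Suc n"] hs.scale_left_distrib hs.scale_one)
  finally show ?case by (simp add: deriv G_def del: of_nat_Suc)
qed

text \<open>The equation z d/dz exp E = (z dE/dz) exp E, the source of the Newton recursion for B.
  Strictly negative powers of z make all sums over n finite.\<close>

lemma op_exp_derivation:
  assumes EE: "\<And>q t v. E q (E t v) = E t (E q v)" and \<sigma>: "\<sigma> = -1"
  shows "hsmult (of_int p) (op_exp E p v)
    = (\<Sum>q\<in>{min 0 p..max 0 p}. hsmult (of_int q) (E q (op_exp E (p - q) v)))"
proof -
  define M where "M = nat (- p)"
  let ?J = "{min 0 p..max 0 p}"
  have van: "op_power E n (p - q) v = 0" if "q \<in> ?J" "M < n" for q n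
    using that by (intro op_power_vanish[OF \<sigma>]) (auto simp: M_def)
  have sum: "op_exp E (p - q) v = (\<Sum>n\<le>M. hsmult (fps_const (1 / fact n)) (op_power E n (p - q) v))"
    if "q \<in> ?J" for q
    unfolding op_exp_eq by (rule hsum_eq_sum) (use van[OF that] in auto)
  have sumS: "op_exp E p v = (\<Sum>n\<le>Suc M. hsmult (fps_const (1 / fact n)) (op_power E n p v))"
    unfolding op_exp_eq by (rule hsum_eq_sum) (use van[of 0] in auto)
  have c: "fps_const (1 / fact (Suc n)) * of_nat (Suc n) = (fps_const (1 / fact n) :: complex fps)" for n
    by (simp add: field_simps del: of_nat_Suc flip: fps_of_nat fps_const_mult)
  have "hsmult (of_int p) (op_exp E p v)
      = (\<Sum>n\<le>M. hsmult (fps_const (1 / fact (Suc n))) (hsmult (of_int p) (op_power E (Suc n) p v)))"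
    unfolding sumS by (subst sum.atMost_Suc_shift)
      (simp add: op_power_0 hs.scale_right_distrib hs.scale_sum_right mult.commute del: fact_Suc)
  also have "\<dots> = (\<Sum>n\<le>M. hsmult (fps_const (1 / fact n))
      (\<Sum>q\<in>?J. hsmult (of_int q) (E q (op_power E n (p - q) v))))"
    unfolding op_power_derivation[OF EE] hs.scale_scale c ..
  also have "\<dots> = (\<Sum>n\<le>M. \<Sum>q\<in>?J. hsmult (of_int q) (E q (hsmult (fps_const (1 / fact n)) (op_power E n (p - q) v))))"
    by (simp add: hs.scale_sum_right module_hom.scale[OF linE] mult.commute)
  also have "\<dots> = (\<Sum>q\<in>?J. \<Sum>n\<le>M. hsmult (of_int q) (E q (hsmult (fps_const (1 / fact n)) (op_power E n (p - q) v))))"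
    by (rule sum.swap)
  also have "\<dots> = (\<Sum>q\<in>?J. hsmult (of_int q) (E q (op_exp E (p - q) v)))"
    by (intro sum.cong refl) (simp add: sum module_hom.sum[OF linE] hs.scale_sum_right)
  finally show ?thesis .
qed

end

section \<open>Substitution of \<open>z + b\<close> for \<open>z\<close>\<close>

lemma shifted_power_eq:
  "p \<le> r \<Longrightarrow> shifted_power b r p = fps_const (of_int r gchoose nat (r - p)) * (b :: complex fps) ^ nat (r - p)"
  unfolding shifted_power_def
  by (simp add: of_int_int_gbinomial flip: fps_of_int)

lemma shifted_power_outside: "r < p \<Longrightarrow> shifted_power b r p = 0"
  by (simp add: shifted_power_def)

lemma shifted_power_same [simp]: "shifted_power b r r = 1"
  by (simp add: shifted_power_def int_gbinomial_def)

lemma shifted_power_0: "shifted_power (0 :: complex fps) r p = (if p = r then 1 else 0)"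
  by (auto simp: shifted_power_def zero_power int_gbinomial_def)

text \<open>Pascal's rule, valid for every integer exponent: multiplication of (z + b)^r by z +
  b.\<close>

lemma shifted_power_Suc:
  "shifted_power b (r + 1) p = shifted_power b r (p - 1) + (b :: complex fps) * shifted_power b r p"
proof (cases "p \<le> r")
  case True
  define j where "j = nat (r - p)"
  have j: "nat (r + 1 - p) = Suc j" "nat (r - (p - 1)) = Suc j" using True by (auto simp: j_def)
  have "(of_int (r + 1) gchoose Suc j) = (of_int r gchoose j) + (of_int r gchoose Suc j :: complex)"
    by (simp add: gbinomial_Suc_Suc)
  moreover have "shifted_power b (r + 1) p = fps_const (of_int (r + 1) gchoose Suc j) * b ^ Suc j"
    using shifted_power_eq[of p "r + 1" b] True unfolding j by simp
  moreover have "shifted_power b r (p - 1) = fps_const (of_int r gchoose Suc j) * b ^ Suc j"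
    using shifted_power_eq[of "p - 1" r b] True unfolding j by simp
  moreover have "shifted_power b r p = fps_const (of_int r gchoose j) * b ^ j"
    using shifted_power_eq[of p r b] True unfolding j_def by simp
  ultimately show ?thesis
    by (simp add: distrib_right distrib_left mult.assoc mult.left_commute flip: fps_const_add)
next
  case False
  then show ?thesis
    by (cases "p = r + 1") (auto simp: shifted_power_outside)
qed

text \<open>Vandermonde's identity, again for all integers: the product of (z + b)^n and (z +
  b)^m.\<close>

lemma shifted_power_convolution:
  "(\<Sum>q\<in>{p - m..n}. shifted_power b n q * shifted_power b m (p - q)) = shifted_power (b :: complex fps) (n + m) p"
proof (cases "p \<le> n + m")
  case True
  define K where "K = nat (n + m - p)"
  have "(\<Sum>q\<in>{p - m..n}. shifted_power b n q * shifted_power b m (p - q))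
      = (\<Sum>i\<in>{0..K}. shifted_power b n (n - int i) * shifted_power b m (p - (n - int i)))"
    using True
    by (intro sum.reindex_bij_witness[of _ "\<lambda>i. n - int i" "\<lambda>q. nat (n - q)"]) (auto simp: K_def)
  also have "\<dots> = (\<Sum>i\<in>{0..K}. fps_const ((of_int n gchoose i) * (of_int m gchoose (K - i))) * b ^ K)"
  proof (rule sum.cong[OF refl])
    fix i assume i: "i \<in> {0..K}"
    then have "nat (m - (p - (n - int i))) = K - i" "p - (n - int i) \<le> m" using True by (auto simp: K_def)
    moreover have "b ^ i * b ^ (K - i) = b ^ K" using i by (simp flip: power_add)
    ultimately show "shifted_power b n (n - int i) * shifted_power b m (p - (n - int i))
        = fps_const ((of_int n gchoose i) * (of_int m gchoose (K - i))) * b ^ K"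
      by (simp add: shifted_power_eq algebra_simps flip: fps_const_mult)
  qed
  also have "\<dots> = fps_const (\<Sum>i\<in>{0..K}. (of_int n gchoose i) * (of_int m gchoose (K - i))) * b ^ K"
  proof -
    have "fps_const (sum f {0..K}) = (\<Sum>i\<in>{0..K}. fps_const (f i))" for f :: "nat \<Rightarrow> complex"
      by (induction K) (simp_all flip: fps_const_add)
    then show ?thesis by (simp add: sum_distrib_right)
  qed
  also have "\<dots> = shifted_power b (n + m) p"
    using True by (simp add: gbinomial_Vandermonde shifted_power_eq K_def)
  finally show ?thesis .
qed (auto simp: shifted_power_outside)

text \<open>The series U(z + b) for U bounded above. Summing only over nonzero coefficients keeps
  the index set finite without mentioning the bound.\<close>

definition shift_series :: "complex fps \<Rightarrow> (int \<Rightarrow> 'i fock fps) \<Rightarrow> int \<Rightarrow> 'i fock fps" where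
  "shift_series b U p = (\<Sum>n | p \<le> n \<and> U n \<noteq> 0. hsmult (shifted_power b n p) (U n))"

lemma shift_series_sum:
  assumes "\<And>n. K < n \<Longrightarrow> U n = 0"
  shows "shift_series b U p = (\<Sum>n\<in>{p..K}. hsmult (shifted_power b n p) (U n))"
  unfolding shift_series_def
  by (rule sum.mono_neutral_left) (use assms in \<open>force+\<close>)

lemma shift_series_lin:
  assumes "\<And>n. K < n \<Longrightarrow> U n = 0" "lin T"
  shows "T (shift_series b U p) = shift_series b (\<lambda>n. T (U n)) p"
proof -
  have "T (U n) = 0" if "K < n" for n
    using assms(1)[OF that] module_hom.zero[OF assms(2)] by simp
  then show ?thesis
    using shift_series_sum[of K U b p] shift_series_sum[of K "\<lambda>n. T (U n)" b p] assms
    by (simp add: module_hom.sum[OF assms(2)] module_hom.scale[OF assms(2)])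
qed

lemma shift_series_diff:
  assumes "\<And>n. K < n \<Longrightarrow> U n = 0" "\<And>n. K < n \<Longrightarrow> V n = 0"
  shows "shift_series b (\<lambda>n. U n - V n) p = shift_series b U p - shift_series b V p"
  using shift_series_sum[of K U b p] shift_series_sum[of K V b p] shift_series_sum[of K "\<lambda>n. U n - V n" b p] assms
  by (simp add: hs.scale_right_diff_distrib sum_subtractf)

abbreviation zz :: "int shift" where "zz \<equiv> Poly_Mapping.single 1 1"

abbreviation const_shift :: "complex fps \<Rightarrow> 'x::zero shift" where
  "const_shift c \<equiv> Poly_Mapping.single 0 c"

text \<open>By Pascal's rule the substitution carries multiplication by z to multiplication by z +
  b.\<close>

lemma shift_series_zz:
  assumes "\<And>n. K < n \<Longrightarrow> U n = 0"
  shows "act (zz + const_shift b) (shift_series b U) p = shift_series b (act zz U) p"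
proof -
  have zzU: "act zz U = (\<lambda>a. U (a - 1))" by auto
  have "shift_series b (act zz U) p = (\<Sum>n\<in>{p..K + 1}. hsmult (shifted_power b n p) (U (n - 1)))"
    by (subst shift_series_sum[of "K + 1"]) (use assms in auto)
  also have "\<dots> = (\<Sum>n\<in>{p - 1..K}. hsmult (shifted_power b (n + 1) p) (U n))"
    by (rule sum.reindex_bij_witness[of _ "\<lambda>n. n + 1" "\<lambda>n. n - 1"]) auto
  also have "\<dots> = (\<Sum>n\<in>{p - 1..K}. hsmult (shifted_power b n (p - 1)) (U n))
      + (\<Sum>n\<in>{p - 1..K}. hsmult b (hsmult (shifted_power b n p) (U n)))"
    by (simp add: shifted_power_Suc hs.scale_left_distrib sum.distrib)
  also have "(\<Sum>n\<in>{p - 1..K}. hsmult b (hsmult (shifted_power b n p) (U n)))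
      = (\<Sum>n\<in>{p..K}. hsmult b (hsmult (shifted_power b n p) (U n)))"
    by (rule sum.mono_neutral_right) (auto simp: shifted_power_outside)
  finally show ?thesis
    using shift_series_sum[of K U b "p - 1"] shift_series_sum[of K U b p] assms
    by (simp add: act_add_left hs.scale_sum_right zzU)
qed

lemma act_zz_power: "act (zz ^ r) U p = U (p - int r)"
proof (induction r arbitrary: p)
  case (Suc r)
  then show ?case by (simp add: act_mult algebra_simps)
qed simp

lemma shift_series_zz_power:
  assumes "\<And>n. K < n \<Longrightarrow> U n = 0"
  shows "act ((zz + const_shift b) ^ r) (shift_series b U) p = shift_series b (act (zz ^ r) U) p"
proof (induction r arbitrary: p)
  case (Suc r)
  have IH: "act ((zz + const_shift b) ^ r) (shift_series b U) = shift_series b (act (zz ^ r) U)"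
    by (rule ext) (rule Suc)
  have z: "act (zz ^ Suc r) U = act zz (act (zz ^ r) U)"
    by (rule ext) (simp only: power_Suc act_mult)
  have "act ((zz + const_shift b) ^ Suc r) (shift_series b U) p
      = act (zz + const_shift b) (shift_series b (act (zz ^ r) U)) p"
    by (simp only: power_Suc act_mult IH)
  also have "\<dots> = shift_series b (act zz (act (zz ^ r) U)) p"
    by (rule shift_series_zz[of "K + int r"]) (simp add: act_zz_power assms)
  finally show ?case by (simp only: z)
next
  case 0
  have "act 1 U = U" by (rule ext) simp
  then show ?case by simp
qed

lemma shifted_power_0_right: "shifted_power (c :: complex fps) 0 p = (if p = 0 then 1 else 0)"
  by (cases "p \<le> 0"; cases "nat (- p)") (auto simp: shifted_power_eq shifted_power_outside)

text \<open>For nonnegative exponents the expansion of (z + c)^r is a Laurent polynomial. This turns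
  the coefficients in the exponent of A into powers of roots.\<close>

lemma lookup_linear_power: "lookup ((zz + const_shift c) ^ r) p = shifted_power c (int r) p"
proof (induction r arbitrary: p)
  case 0
  show ?case by (auto simp: shifted_power_0_right lookup_one when_def)
next
  case (Suc r)
  have "lookup (zz * L) p = lookup L (p - 1)" for L :: "int shift"
    by (rule additive_eq_on_single[where f = L])
       (auto simp: distrib_left lookup_add mult_single lookup_single when_def)
  then show ?case
    using shifted_power_Suc[of c "int r" p]
    by (simp add: distrib_right lookup_add Suc add.commute)
qed

section \<open>The annihilation part of the vertex operators\<close>

text \<open>The exponent of B(z) at shift 0. Shifted arguments are treated as substitutions into
  this one series.\<close>

definition B_exponent :: "sign \<Rightarrow> 'i \<Rightarrow> 'i opser" where
  "B_exponent s i p v =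
     (if p < 0 then hsmult (fps_const (- sg s / of_nat (nat (- p)))) (heis_pos i (nat (- p)) v) else 0)"

lemma fps_const_sg: "fps_const (sg s :: complex) = sg s"
  by (cases s) (simp_all add: sg_def fps_const_neg[symmetric] del: fps_const_neg)

lemma B_exponent_shifted:
  "heis_series (heis_pos i) (\<lambda>r p. - sg s * shifted_power b (- int r) p) p v
     = shift_series b (\<lambda>n. B_exponent s i n v) p"
proof -
  have "heis_series (heis_pos i) (\<lambda>r p. - sg s * shifted_power b (- int r) p) p v
     = (\<Sum>n\<in>{..<nat (- p)}. hsmult (fps_const (1 / of_nat (Suc n)) *
          (- sg s * shifted_power b (- int (Suc n)) p)) (heis_pos i (Suc n) v))"
    unfolding heis_series_def by (rule hsum_eq_sum) (auto simp: shifted_power_outside)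
  also have "\<dots> = (\<Sum>n\<in>{p..-1}. hsmult (shifted_power b n p) (B_exponent s i n v))"
  proof (rule sum.reindex_bij_witness[of _ "\<lambda>n. nat (- n - 1)" "\<lambda>n. - int n - 1"])
    fix a assume "a \<in> {..<nat (- p)}"
    have "fps_const (- sg s / of_nat (Suc a)) = (fps_const (1 / of_nat (Suc a)) * - sg s :: complex fps)"
      by (simp add: fps_const_sg[symmetric] del: of_nat_Suc)
    moreover have "nat (- (- int a - 1)) = Suc a" by simp
    moreover have "shifted_power b (- int (Suc a)) p = shifted_power b (- int a - 1) p"
      by (rule arg_cong[of _ _ "\<lambda>n. shifted_power b n p"]) simp
    ultimately show "hsmult (shifted_power b (- int a - 1) p) (B_exponent s i (- int a - 1) v)
        = hsmult (fps_const (1 / of_nat (Suc a)) * (- sg s * shifted_power b (- int (Suc a)) p)) (heis_pos i (Suc a) v)"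
      by (simp add: B_exponent_def mult.commute mult.left_commute del: of_nat_Suc)
  qed auto
  finally show ?thesis
    by (subst shift_series_sum[of "-1"]) (auto simp: B_exponent_def)
qed

lemma B_exponent_nonneg: "0 \<le> p \<Longrightarrow> B_exponent s i p v = 0"
  by (simp add: B_exponent_def)

lemma B_exponent_0: "shift_series 0 (\<lambda>n. B_exponent s i n v) p = B_exponent s i p v"
proof -
  have "shift_series 0 (\<lambda>n. B_exponent s i n v) p
     = (\<Sum>n\<in>{p..0}. hsmult (shifted_power 0 n p) (B_exponent s i n v))"
    by (rule shift_series_sum) (simp add: B_exponent_nonneg)
  also have "\<dots> = (\<Sum>n\<in>{p..0}. if n = p then B_exponent s i p v else 0)"
    by (intro sum.cong refl) (auto simp: shifted_power_0)
  also have "\<dots> = B_exponent s i p v"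
    by (auto simp: B_exponent_nonneg)
  finally show ?thesis .
qed

lemma B_op_eq: "B_op s i b = op_exp (\<lambda>p v. shift_series b (\<lambda>n. B_exponent s i n v) p)"
  unfolding B_op_def by (intro arg_cong[of _ _ op_exp] ext) (rule B_exponent_shifted)

lemma B_op_0_eq: "B_op s i 0 = op_exp (B_exponent s i)"
  unfolding B_op_eq by (intro arg_cong[of _ _ op_exp] ext) (rule B_exponent_0)

lemma lin_B_exponent: "lin (B_exponent s i p)"
proof -
  have "lin (\<lambda>v. hsmult (fps_const (- sg s / of_nat (nat (- p)))) (heis_pos i (nat (- p)) v))"
    by (rule lin_hsmult[OF lin_heis_pos])
  then show ?thesis by (cases "p < 0") (simp_all add: B_exponent_def[abs_def])
qed

lemma lin_shift_series:
  assumes "\<And>n. lin (F n)" "\<And>n v. K < n \<Longrightarrow> F n v = 0"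
  shows "lin (\<lambda>v. shift_series b (\<lambda>n. F n v) p)"
  using lin_setsum[of "{p..K}" "\<lambda>n v. hsmult (shifted_power b n p) (F n v)"] lin_hsmult[OF assms(1)]
  by (simp add: shift_series_sum[of K] assms(2))

lemma exponent_B: "exponent (\<lambda>p v. shift_series b (\<lambda>n. B_exponent s i n v) p) (-1)"
proof -
  have "lin (\<lambda>v. shift_series b (\<lambda>n. B_exponent s i n v) p)" for p
    by (rule lin_shift_series[OF lin_B_exponent, of "-1"]) (simp add: B_exponent_nonneg)
  moreover have "shift_series b (\<lambda>n. B_exponent s i n v) p = 0" if "0 \<le> p" for p v
    using that by (subst shift_series_sum[of "-1"]) (auto simp: B_exponent_nonneg)
  ultimately show ?thesis
    by (simp add: exponent_def one_sided_def)
qed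

interpretation B: exponent "\<lambda>p v. shift_series b (\<lambda>n. B_exponent s i n v) p" "-1"
  by (rule exponent_B)

interpretation B0: exponent "B_exponent s i" "-1"
  using B.exponent_axioms[where b = 0] by (simp only: B_exponent_0)

lemma lin_B_op [simp]: "lin (B_op s i b p)"
  unfolding B_op_eq by (rule B.lin_op_exp)

lemma one_sided_B_op: "one_sided (-1) (B_op s i b)"
  unfolding B_op_eq by (rule B.one_sided_op_exp)

lemma B_op_pos: "0 < p \<Longrightarrow> B_op s i b p v = 0"
  using one_sided_B_op[of s i b] by (simp add: one_sided_def)

lemma B_op_mode_0: "B_op s i b 0 v = v"
  unfolding B_op_eq by (rule B.op_exp_0) simp

lemma shift_B_exponent_lin:
  "lin T \<Longrightarrow> T (shift_series b (\<lambda>n. B_exponent s i n v) p) = shift_series b (\<lambda>n. T (B_exponent s i n v)) p"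
  by (rule shift_series_lin[of "-1"]) (simp_all add: B_exponent_nonneg)

lemma B_op_commute:
  assumes T: "lin T" and "\<And>r v. T (heis_pos i r v) = heis_pos i r (T v)"
  shows "T (B_op s i b p v) = B_op s i b p (T v)"
  unfolding B_op_eq
proof (rule B.op_exp_commute[OF T])
  have "T (B_exponent s i n v) = B_exponent s i n (T v)" for n v
    by (simp add: B_exponent_def module_hom.scale[OF T] assms(2) module_hom.zero[OF T])
  then show "T (shift_series b (\<lambda>n. B_exponent s i n v) q) = shift_series b (\<lambda>n. B_exponent s i n (T v)) q" for q v
    by (simp add: shift_B_exponent_lin[OF T])
qed

lemmas heis_pos_B_op = B_op_commute[OF lin_heis_pos heis_pos_commute]
  and sector_B_op = B_op_commute[OF lin_sector sector_heis_pos]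

lemma B_op_vv: "B_op s i b p (vv \<beta>) = (if p = 0 then vv \<beta> else 0)"
  unfolding B_op_eq
  by (rule B.op_exp_fixed) (simp add: B_exponent_def shift_series_def)

text \<open>The central term of the Heisenberg relation cancels the 1 / r of the exponent, so the
  commutator with the exponent, and hence with B, is the monomial +/- z^-r.\<close>

lemma B_op_0_heis_neg:
  assumes r: "0 < r"
  shows "commutes_by (heis_neg k r) 1 (if k = i then Poly_Mapping.single (- int r) (sg s) else 0) (B_op s i 0)"
  unfolding B_op_0_eq
proof (rule B0.op_exp_commutator)
  fix q v
  show "heis_neg k r (B_exponent s i q v) = B_exponent s i q (heis_neg k r v)
      + hsmult (lookup (if k = i then Poly_Mapping.single (- int r) (sg s) else 0) q) v"
  proof (cases "q < 0")
    case True
    define m where "m = nat (- q)"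
    have m: "0 < m" "q = - int m" using True by (auto simp: m_def)
    have "fps_const (- sg s / of_nat r) * of_nat r = (- sg s :: complex fps)" if "0 < r" for r
      using that by (simp flip: fps_of_nat add: fps_const_sg[symmetric])
    then show ?thesis
      using m r by (auto simp: B_exponent_def heis_pos_neg module_hom.scale[OF lin_heis_neg] lookup_single
          when_def hs.scale_right_distrib)
  next
    case False
    then show ?thesis using r by (auto simp: B_exponent_def lookup_single when_def module_hom.zero[OF lin_heis_neg])
  qed
qed simp

text \<open>From z d/dz of the exponential, with r cancelling 1 / r. Where the operators H_{i,r} act
  by power sums, the modes of B therefore form a Newton sequence.\<close>

lemma B_op_0_newton:
  "hsmult (of_nat m) (B_op s i 0 (- int m) v)
     = (\<Sum>r = 1..m. hsmult (- sg s) (heis_pos i r (B_op s i 0 (- int (m - r)) v)))"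
proof -
  have EE: "B_exponent s i q (B_exponent s i t v) = B_exponent s i t (B_exponent s i q v)" for q t v
    by (simp add: B_exponent_def module_hom.scale[OF lin_heis_pos] heis_pos_commute[of i _ i] mult.commute
        module_hom.zero[OF lin_heis_pos])
  have "hsmult (of_int (- int m)) (B_op s i 0 (- int m) v)
      = (\<Sum>q\<in>{min 0 (- int m)..max 0 (- int m)}. hsmult (of_int q) (B_exponent s i q (B_op s i 0 (- int m - q) v)))"
    unfolding B_op_0_eq by (rule B0.op_exp_derivation[OF EE]) simp
  also have "\<dots> = (\<Sum>q\<in>{- int m..-1}. hsmult (of_int q) (B_exponent s i q (B_op s i 0 (- int m - q) v)))"
    by (rule sum.mono_neutral_right) (auto simp: B_exponent_nonneg)
  also have "\<dots> = (\<Sum>r = 1..m. hsmult (sg s) (heis_pos i r (B_op s i 0 (- int (m - r)) v)))"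
  proof (rule sum.reindex_bij_witness[of _ "\<lambda>r. - int r" "\<lambda>q. nat (- q)"])
    fix q assume q: "q \<in> {- int m..-1}"
    have "of_int q * fps_const (- sg s / of_nat (nat (- q))) = (sg s :: complex fps)"
      using q by (simp add: fps_const_sg[symmetric] field_simps flip: fps_of_int)
    moreover have "- int (m - nat (- q)) = - int m - q" using q by auto
    ultimately show "hsmult (sg s) (heis_pos i (nat (- q)) (B_op s i 0 (- int (m - nat (- q))) v))
        = hsmult (of_int q) (B_exponent s i q (B_op s i 0 (- int m - q) v))"
      using q by (simp add: B_exponent_def)
  qed auto
  finally have "- hsmult (of_int (- int m)) (B_op s i 0 (- int m) v)
      = - (\<Sum>r = 1..m. hsmult (sg s) (heis_pos i r (B_op s i 0 (- int (m - r)) v)))" by simp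
  then show ?thesis by (simp add: sum_negf)
qed

text \<open>On vacuum vectors only mode 0 survives, and a creation operator of mode r lowers the
  bound by at most r, by its commutator with B. Vectors are infinite in hbar, so the bound depends
  on N; it makes the product of A and B summable.\<close>

lemma B_op_0_eventually: "\<exists>K. \<forall>p<K. hz N (B_op s i 0 p v)"
proof -
  let ?Z = "\<lambda>v. \<exists>K. \<forall>p<K. B_op s i 0 p v = 0"
  have "\<exists>u. ?Z u \<and> hz N (v - u)"
  proof (rule fock_generation)
    show "?Z (vv \<beta>)" for \<beta> by (auto simp: B_op_vv)
    show "?Z (u + v)" if u: "?Z u" and v: "?Z v" for u v
    proof -
      obtain K where "\<forall>p<K. B_op s i 0 p u = 0" using u by blast
      moreover obtain K' where "\<forall>p<K'. B_op s i 0 p v = 0" using v by blast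
      ultimately show ?thesis by (intro exI[of _ "min K K'"]) (simp add: module_hom.add[OF lin_B_op])
    qed
    show "?Z (hsmult c v)" if "?Z v" for c v
      using that by (metis module_hom.scale[OF lin_B_op] hs.scale_zero_right)
    show "?Z (heis_neg k r v)" if r: "0 < r" and v: "?Z v" for k r v
    proof -
      obtain K where K: "\<forall>p<K. B_op s i 0 p v = 0" using v by blast
      have "B_op s i 0 p (heis_neg k r v) = 0" if "p < K - int r" for p
      proof -
        have "heis_neg k r (B_op s i 0 p v) = B_op s i 0 p (heis_neg k r v)
            + act (if k = i then Poly_Mapping.single (- int r) (sg s) else 0) (\<lambda>p. B_op s i 0 p v) p"
          using B_op_0_heis_neg[OF r, of k i s] unfolding commutes_by_1 by blast
        then show ?thesis using K that r by (auto simp: module_hom.zero[OF lin_heis_neg] split: if_splits)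
      qed
      then show ?thesis by blast
    qed
  qed
  then obtain u K where u: "\<forall>p<K. B_op s i 0 p u = 0" "hz N (v - u)" by blast
  have "hz N (B_op s i 0 p v)" if "p < K" for p
    using hz_lin[OF lin_B_op u(2), of s i 0 p] u(1) that by (simp add: module_hom.diff[OF lin_B_op])
  then show ?thesis by blast
qed

text \<open>Substitution is multiplicative by the Vandermonde convolution. All sums are first
  enlarged to the common range p..0, where they can be exchanged.\<close>

lemma shift_op_power:
  "op_power (\<lambda>p v. shift_series b (\<lambda>n. B_exponent s i n v) p) n p v
     = shift_series b (\<lambda>k. op_power (B_exponent s i) n k v) p"
proof (induction n arbitrary: p)
  case 0
  have "shift_series b (\<lambda>k. op_power (B_exponent s i) 0 k v) p
     = (\<Sum>k\<in>{p..0}. hsmult (shifted_power b k p) (op_power (B_exponent s i) 0 k v))"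
    by (rule shift_series_sum) (simp add: op_power_0)
  also have "\<dots> = (\<Sum>k\<in>{p..0}. if k = 0 then hsmult (shifted_power b 0 p) v else 0)"
    by (intro sum.cong refl) (auto simp: op_power_0)
  also have "\<dots> = (if p = 0 then v else 0)"
    by (auto simp: shifted_power_0_right)
  finally show ?case by (simp add: op_power_0)
next
  case (Suc n)
  let ?E = "B_exponent s i" and ?F = "\<lambda>n. op_power (B_exponent s i) n"
  have F0: "?F n k v = 0" if "0 < k" for n k
    using B0.one_sided_op_power[of s i n] that by (simp add: one_sided_def)
  show ?case
  proof (cases "p \<le> 0")
    case False
    then show ?thesis
      using B.one_sided_op_power[of b s i "Suc n"] F0
      by (subst shift_series_sum[of 0]) (auto simp: one_sided_def)
  next
    case True
    let ?J = "{p..0}"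
    have J: "min 0 p = p" "max 0 p = 0" using True by auto
    have "op_power (\<lambda>p v. shift_series b (\<lambda>n. ?E n v) p) (Suc n) p v
       = (\<Sum>q\<in>?J. shift_series b (\<lambda>m. ?E m (shift_series b (\<lambda>k. ?F n k v) (p - q))) q)"
      unfolding B.op_power_Suc_sum J by (simp add: Suc)
    also have "\<dots> = (\<Sum>q\<in>?J. \<Sum>m\<in>?J. \<Sum>k\<in>?J.
        hsmult (shifted_power b m q * shifted_power b k (p - q)) (?E m (?F n k v)))"
    proof (rule sum.cong[OF refl])
      fix q assume q: "q \<in> ?J"
      have "shift_series b (\<lambda>k. ?F n k v) (p - q) = (\<Sum>k\<in>{p - q..0}. hsmult (shifted_power b k (p - q)) (?F n k v))"
        by (rule shift_series_sum) (rule F0)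
      also have "\<dots> = (\<Sum>k\<in>?J. hsmult (shifted_power b k (p - q)) (?F n k v))"
        by (rule sum.mono_neutral_left) (use q in \<open>auto simp: shifted_power_outside\<close>)
      finally have inner: "shift_series b (\<lambda>k. ?F n k v) (p - q)
          = (\<Sum>k\<in>?J. hsmult (shifted_power b k (p - q)) (?F n k v))" .
      have "shift_series b (\<lambda>m. ?E m w) q = (\<Sum>m\<in>?J. hsmult (shifted_power b m q) (?E m w))" for w
      proof -
        have "shift_series b (\<lambda>m. ?E m w) q = (\<Sum>m\<in>{q..0}. hsmult (shifted_power b m q) (?E m w))"
          by (rule shift_series_sum) (simp add: B_exponent_nonneg)
        also have "\<dots> = (\<Sum>m\<in>?J. hsmult (shifted_power b m q) (?E m w))"
          by (rule sum.mono_neutral_left) (use q in \<open>auto simp: shifted_power_outside\<close>)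
        finally show ?thesis .
      qed
      then show "shift_series b (\<lambda>m. ?E m (shift_series b (\<lambda>k. ?F n k v) (p - q))) q
          = (\<Sum>m\<in>?J. \<Sum>k\<in>?J. hsmult (shifted_power b m q * shifted_power b k (p - q)) (?E m (?F n k v)))"
        by (simp only: inner) (simp add: module_hom.sum[OF lin_B_exponent] module_hom.scale[OF lin_B_exponent] hs.scale_sum_right)
    qed
    also have "\<dots> = (\<Sum>m\<in>?J. \<Sum>k\<in>?J. \<Sum>q\<in>?J.
        hsmult (shifted_power b m q * shifted_power b k (p - q)) (?E m (?F n k v)))"
      by (subst sum.swap) (intro sum.cong refl sum.swap)
    also have "\<dots> = (\<Sum>m\<in>?J. \<Sum>k\<in>?J. hsmult (shifted_power b (m + k) p) (?E m (?F n k v)))"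
    proof (intro sum.cong refl)
      fix m k assume mk: "m \<in> ?J" "k \<in> ?J"
      have "(\<Sum>q\<in>?J. shifted_power b m q * shifted_power b k (p - q))
          = (\<Sum>q\<in>{p - k..m}. shifted_power b m q * shifted_power b k (p - q))"
        by (rule sum.mono_neutral_right) (use mk in \<open>auto simp: shifted_power_outside\<close>)
      then show "(\<Sum>q\<in>?J. hsmult (shifted_power b m q * shifted_power b k (p - q)) (?E m (?F n k v)))
          = hsmult (shifted_power b (m + k) p) (?E m (?F n k v))"
        by (simp add: shifted_power_convolution flip: hs.scale_sum_left)
    qed
    also have "\<dots> = (\<Sum>m\<in>?J. \<Sum>j\<in>?J. hsmult (shifted_power b j p) (?E m (?F n (j - m) v)))"
    proof (rule sum.cong[OF refl])
      fix m assume m: "m \<in> ?J"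
      have "(\<Sum>k\<in>?J. hsmult (shifted_power b (m + k) p) (?E m (?F n k v)))
          = (\<Sum>k\<in>{p - m..0}. hsmult (shifted_power b (m + k) p) (?E m (?F n k v)))"
        by (rule sum.mono_neutral_right) (use m in \<open>auto simp: shifted_power_outside\<close>)
      also have "\<dots> = (\<Sum>j\<in>{p..m}. hsmult (shifted_power b j p) (?E m (?F n (j - m) v)))"
        by (rule sum.reindex_bij_witness[of _ "\<lambda>j. j - m" "\<lambda>k. k + m"]) (auto simp: add.commute)
      also have "\<dots> = (\<Sum>j\<in>?J. hsmult (shifted_power b j p) (?E m (?F n (j - m) v)))"
        by (rule sum.mono_neutral_left) (use m in \<open>auto simp: F0 module_hom.zero[OF lin_B_exponent]\<close>)
      finally show "(\<Sum>k\<in>?J. hsmult (shifted_power b (m + k) p) (?E m (?F n k v)))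
          = (\<Sum>j\<in>?J. hsmult (shifted_power b j p) (?E m (?F n (j - m) v)))" .
    qed
    also have "\<dots> = (\<Sum>j\<in>?J. hsmult (shifted_power b j p) (\<Sum>m\<in>?J. ?E m (?F n (j - m) v)))"
      by (subst sum.swap) (simp add: hs.scale_sum_right)
    also have "\<dots> = (\<Sum>j\<in>?J. hsmult (shifted_power b j p) (?F (Suc n) j v))"
    proof (intro sum.cong refl)
      fix j assume j: "j \<in> ?J"
      have "?F (Suc n) j v = (\<Sum>m\<in>{j..0}. ?E m (?F n (j - m) v))"
        unfolding B0.op_power_Suc_sum using j by (intro sum.cong) auto
      also have "\<dots> = (\<Sum>m\<in>?J. ?E m (?F n (j - m) v))"
        by (rule sum.mono_neutral_left) (use j in \<open>auto simp: F0 module_hom.zero[OF lin_B_exponent]\<close>)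
      finally show "hsmult (shifted_power b j p) (\<Sum>m\<in>?J. ?E m (?F n (j - m) v))
          = hsmult (shifted_power b j p) (?F (Suc n) j v)" by simp
    qed
    also have "\<dots> = shift_series b (\<lambda>j. ?F (Suc n) j v) p"
      by (rule shift_series_sum[symmetric]) (rule F0)
    finally show ?thesis .
  qed
qed

text \<open>Substitution commutes with powers and with the sum of the exponential series, so results
  for shift 0 transfer to every shift.\<close>

lemma B_op_shift: "B_op s i b p v = shift_series b (\<lambda>n. B_op s i 0 n v) p"
proof -
  let ?F = "\<lambda>n. op_power (B_exponent s i) n"
  have "B_op s i b p v = hsum (\<lambda>n. hsmult (fps_const (1 / fact n)) (shift_series b (\<lambda>k. ?F n k v) p))"
    unfolding B_op_eq op_exp_eq shift_op_power ..
  also have "\<dots> = hsum (\<lambda>n. \<Sum>k\<in>{p..0}. hsmult (shifted_power b k p) (hsmult (fps_const (1 / fact n)) (?F n k v)))"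
  proof -
    have "shift_series b (\<lambda>k. ?F n k v) p = (\<Sum>k\<in>{p..0}. hsmult (shifted_power b k p) (?F n k v))" for n
      by (rule shift_series_sum) (use B0.one_sided_op_power[of s i n] in \<open>simp add: one_sided_def\<close>)
    then show ?thesis by (simp add: hs.scale_sum_right mult.commute)
  qed
  also have "\<dots> = (\<Sum>k\<in>{p..0}. hsum (\<lambda>n. hsmult (shifted_power b k p) (hsmult (fps_const (1 / fact n)) (?F n k v))))"
    by (rule hsum_sum) (rule hsummable_lin[OF lin_hsmult[OF lin_id(1)] B0.hsummable_op_exp])
  also have "\<dots> = (\<Sum>k\<in>{p..0}. hsmult (shifted_power b k p) (B_op s i 0 k v))"
    unfolding B_op_0_eq op_exp_eq hsum_lin[OF lin_hsmult[OF lin_id(1)] B0.hsummable_op_exp] ..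
  also have "\<dots> = shift_series b (\<lambda>n. B_op s i 0 n v) p"
    by (rule shift_series_sum[symmetric]) (simp add: B_op_pos)
  finally show ?thesis .
qed

text \<open>The commutator at argument z + b is +/- (z + b)^-r, an infinite expansion; multiplying
  by (z + b)^r makes it a constant.\<close>

lemma B_op_heis_neg:
  assumes r: "0 < r"
  shows "commutes_by (heis_neg k r) ((zz + const_shift b) ^ r) (if k = i then const_shift (sg s) else 0) (B_op s i b)"
  unfolding commutes_by_def
proof (intro allI)
  fix p v
  define D where "D p = heis_neg k r (B_op s i 0 p v) - B_op s i 0 p (heis_neg k r v)" for p
  have D: "D p = act (if k = i then Poly_Mapping.single (- int r) (sg s) else 0) (\<lambda>p. B_op s i 0 p v) p" for p
    using B_op_0_heis_neg[OF r, of k i s] unfolding commutes_by_def D_def by simp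
  have "heis_neg k r (B_op s i b p v) - B_op s i b p (heis_neg k r v) = shift_series b D p" for p
  proof -
    have "heis_neg k r (B_op s i b p v) = shift_series b (\<lambda>n. heis_neg k r (B_op s i 0 n v)) p"
      unfolding B_op_shift[of s i b] by (rule shift_series_lin[of 0]) (simp_all add: B_op_pos)
    then show ?thesis
      unfolding B_op_shift[of s i b] D_def
      by (subst shift_series_diff[of 0]) (simp_all add: B_op_pos module_hom.zero[OF lin_heis_neg])
  qed
  then have "act ((zz + const_shift b) ^ r) (\<lambda>p. heis_neg k r (B_op s i b p v) - B_op s i b p (heis_neg k r v)) p
      = shift_series b (act (zz ^ r) D) p"
    by (simp add: shift_series_zz_power[of 0] D_def B_op_pos module_hom.zero[OF lin_heis_neg])
  also have "act (zz ^ r) D = (\<lambda>p. act (if k = i then const_shift (sg s) else 0) (\<lambda>p. B_op s i 0 p v) p)"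
    by (auto simp: act_zz_power D)
  also have "shift_series b \<dots> p = act (if k = i then const_shift (sg s) else 0) (\<lambda>p. B_op s i b p v) p"
  proof (cases "k = i")
    case True
    then show ?thesis
      using shift_series_lin[of 0 "\<lambda>p. B_op s i 0 p v", OF B_op_pos lin_hsmult[OF lin_id(1), of "sg s"], of b p]
      by (simp add: B_op_shift[of s i b])
  qed (simp add: shift_series_def)
  finally show "act ((zz + const_shift b) ^ r)
       (\<lambda>p. heis_neg k r (B_op s i b p v) - B_op s i b p (heis_neg k r v)) p =
      act (if k = i then const_shift (sg s) else 0) (\<lambda>p. B_op s i b p v) p" .
qed

section \<open>The creation part of the vertex operators\<close>

lemma hz_hsmult_left: "(\<And>n. n < N \<Longrightarrow> fps_nth c n = 0) \<Longrightarrow> hz N (hsmult c v)"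
  by (auto simp: hz_def hsmult_nth intro!: sum.neutral)

text \<open>Give z and hbar degree 1: the r-th coefficient series has only terms of total degree at
  least r. At a fixed power of z and a fixed precision in hbar only finitely many r
  contribute.\<close>

definition creation_coeffs :: "(nat \<Rightarrow> int \<Rightarrow> complex fps) \<Rightarrow> bool" where
  "creation_coeffs g \<longleftrightarrow>
     (\<forall>r p. 0 < r \<longrightarrow> (p < 0 \<longrightarrow> g r p = 0) \<and> (\<forall>n. int n + p < int r \<longrightarrow> fps_nth (g r p) n = 0))"

lemma creation_coeffs_add: "creation_coeffs g \<Longrightarrow> creation_coeffs h \<Longrightarrow> creation_coeffs (\<lambda>r p. g r p + h r p)"
  by (simp add: creation_coeffs_def)

lemma creation_coeffs_sg: "creation_coeffs g \<Longrightarrow> creation_coeffs (\<lambda>r p. sg s * g r p)"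
  by (cases s) (simp_all add: creation_coeffs_def sg_def)

lemma creation_coeffs_uminus: "creation_coeffs g \<Longrightarrow> creation_coeffs (\<lambda>r p. - g r p)"
  by (simp add: creation_coeffs_def)

lemma creation_coeffs_shifted_power:
  assumes "fps_nth c 0 = 0" shows "creation_coeffs (\<lambda>r. shifted_power c (int r))"
  unfolding creation_coeffs_def
proof (intro allI impI conjI)
  fix r p
  show "shifted_power c (int r) p = 0" if "p < 0"
  proof -
    have "r < nat (int r - p)" using that by simp
    then have "(of_int (int r) gchoose nat (int r - p)) = (0 :: complex)"
      by (simp flip: binomial_gbinomial)
    then show ?thesis using that by (simp add: shifted_power_eq)
  qed
  show "fps_nth (shifted_power c (int r) p) n = 0" if "int n + p < int r" for n
  proof -
    have "fps_nth (c ^ nat (int r - p)) n = 0"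
      using that assms by (intro startsby_zero_power_prefix[rule_format]) auto
    then show ?thesis using that by (simp add: shifted_power_eq)
  qed
qed

locale creation_series =
  fixes i :: 'i and g :: "nat \<Rightarrow> int \<Rightarrow> complex fps"
  assumes g: "creation_coeffs g"
begin

lemma summable: "hsummable (\<lambda>n. hsmult (fps_const (1 / of_nat (Suc n)) * g (Suc n) p) (heis_neg i (Suc n) v))"
  unfolding hsummable_def
proof
  fix N
  have "hz N (hsmult (fps_const (1 / of_nat (Suc n)) * g (Suc n) p) (heis_neg i (Suc n) v))"
    if "N + nat p \<le> n" for n
  proof (rule hz_hsmult_left)
    fix k assume "k < N"
    then have "fps_nth (g (Suc n) p) k = 0" using g that unfolding creation_coeffs_def by simp
    then show "fps_nth (fps_const (1 / of_nat (Suc n)) * g (Suc n) p) k = 0" by simp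
  qed
  then have "{n. \<not> hz N (hsmult (fps_const (1 / of_nat (Suc n)) * g (Suc n) p) (heis_neg i (Suc n) v))} \<subseteq> {..<N + nat p}"
    by (metis (mono_tags, lifting) lessThan_iff linorder_not_less mem_Collect_eq subsetI)
  then show "finite {n. \<not> hz N (hsmult (fps_const (1 / of_nat (Suc n)) * g (Suc n) p) (heis_neg i (Suc n) v))}"
    by (rule finite_subset) simp
qed

lemma lin_ser: "lin (heis_series (heis_neg i) g p)"
proof -
  have "lin (\<lambda>v. hsum (\<lambda>n. hsmult (fps_const (1 / of_nat (Suc n)) * g (Suc n) p) (heis_neg i (Suc n) v)))"
    by (rule lin_hsum[OF lin_hsmult[OF lin_heis_neg] summable])
  then show ?thesis by (simp add: heis_series_def[abs_def])
qed

lemma ser_neg: "p < 0 \<Longrightarrow> heis_series (heis_neg i) g p v = 0"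
  using g unfolding heis_series_def creation_coeffs_def
  by (subst hsum_eq_sum[of "{}"]) auto

lemma hz_ser_0: "hz 1 (heis_series (heis_neg i) g 0 v)"
  unfolding heis_series_def
  by (rule hz_hsum, rule hz_hsmult_left) (use g in \<open>simp add: creation_coeffs_def\<close>)

lemma ser_commute:
  assumes T: "lin T" and "\<And>r v. T (heis_neg i r v) = heis_neg i r (T v)"
  shows "T (heis_series (heis_neg i) g p v) = heis_series (heis_neg i) g p (T v)"
  unfolding heis_series_def by (simp only: hsum_lin[OF T summable] module_hom.scale[OF T] assms(2))

lemma heis_pos_ser:
  assumes r: "0 < r"
  shows "heis_pos k r (heis_series (heis_neg i) g p v) = heis_series (heis_neg i) g p (heis_pos k r v) + (if k = i then hsmult (g r p) v else 0)"
proof -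
  let ?c = "\<lambda>n. fps_const (1 / of_nat (Suc n)) * g (Suc n) p"
  let ?f = "\<lambda>n. if Suc n = r \<and> k = i then hsmult (g r p) v else 0"
  \<comment> \<open>The central term of the Heisenberg relation cancels the denominator of the
    exponent.\<close>
  have c: "?c n * of_nat (Suc n) = g (Suc n) p" for n
  proof -
    have "fps_const (1 / of_nat (Suc n)) * of_nat (Suc n) = (1 :: complex fps)"
      by (simp del: of_nat_Suc flip: fps_of_nat)
    then show ?thesis by (metis mult.commute mult.left_commute mult_1_right)
  qed
  have s: "hsummable ?f" by (rule hsummable_finite[of "{r - 1}"]) auto
  have "heis_pos k r (heis_series (heis_neg i) g p v) = hsum (\<lambda>n. hsmult (?c n) (heis_pos k r (heis_neg i (Suc n) v)))"
    unfolding heis_series_def by (simp only: hsum_lin[OF lin_heis_pos summable] module_hom.scale[OF lin_heis_pos])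
  also have "\<dots> = hsum (\<lambda>n. hsmult (?c n) (heis_neg i (Suc n) (heis_pos k r v)) + ?f n)"
  proof (rule arg_cong[of _ _ hsum], rule ext)
    fix n
    have "hsmult (?c n) (hsmult (of_nat (Suc n)) v) = hsmult (g (Suc n) p) v"
      by (simp only: hs.scale_scale c)
    then show "hsmult (?c n) (heis_pos k r (heis_neg i (Suc n) v))
        = hsmult (?c n) (heis_neg i (Suc n) (heis_pos k r v)) + ?f n"
      using r by (auto simp: heis_pos_neg hs.scale_right_distrib simp del: hs.scale_scale of_nat_Suc)
  qed
  also have "\<dots> = heis_series (heis_neg i) g p (heis_pos k r v) + hsum ?f"
    unfolding heis_series_def by (rule hsum_add[OF summable s])
  also have "hsum ?f = (if k = i then hsmult (g r p) v else 0)"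
    using r by (subst hsum_eq_sum[of "{r - 1}"]) auto
  finally show ?thesis .
qed

lemma vac_ser: "vac \<beta> (heis_series (heis_neg i) g p v) = 0"
  unfolding heis_series_def
  by (simp only: hsum_lin[OF lin_vac summable] module_hom.scale[OF lin_vac])
     (simp add: hsum_eq_sum[of "{}"])

end

abbreviation eta :: "'x::zero shift" where
  "eta \<equiv> Poly_Mapping.single 0 (fps_const (1/2) * fps_X)"

text \<open>Commuting H_{k,r} past A_i gives the coefficient of H_{k,-r} / r in the exponent of A_i,
  which is a difference of power sums. For the upper sign the roots are z, z - hbar when k = i and,
  with negative sign, z - hbar/2 when k is a neighbour; the lower sign reverses hbar and the sign of
  the sums.\<close>

definition pos_roots :: "('i \<Rightarrow> 'i \<Rightarrow> int) \<Rightarrow> sign \<Rightarrow> 'i \<Rightarrow> 'i \<Rightarrow> 'x::ab_group_add shift \<Rightarrow> 'x shift list" where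
  "pos_roots a s i k z =
     (if k = i then (case s of Plus \<Rightarrow> [z, z - 2 * eta] | Minus \<Rightarrow> [])
      else if a i k \<noteq> 0 then (case s of Plus \<Rightarrow> [] | Minus \<Rightarrow> [z + eta]) else [])"

definition neg_roots :: "('i \<Rightarrow> 'i \<Rightarrow> int) \<Rightarrow> sign \<Rightarrow> 'i \<Rightarrow> 'i \<Rightarrow> 'x::ab_group_add shift \<Rightarrow> 'x shift list" where
  "neg_roots a s i k z =
     (if k = i then (case s of Plus \<Rightarrow> [] | Minus \<Rightarrow> [z, z + 2 * eta])
      else if a i k \<noteq> 0 then (case s of Plus \<Rightarrow> [z - eta] | Minus \<Rightarrow> []) else [])"

definition lam :: "('i \<Rightarrow> 'i \<Rightarrow> int) \<Rightarrow> sign \<Rightarrow> 'i \<Rightarrow> 'x::ab_group_add shift \<Rightarrow> 'i \<Rightarrow> nat \<Rightarrow> 'x shift" where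
  "lam a s i z k r = psum (pos_roots a s i k z) r - psum (neg_roots a s i k z) r"

definition A_exponent :: "('i::finite \<Rightarrow> 'i \<Rightarrow> int) \<Rightarrow> sign \<Rightarrow> 'i \<Rightarrow> 'i opser" where
  "A_exponent a s i = (\<lambda>p v.
     heis_series (heis_neg i)
       (\<lambda>r p. sg s * (shifted_power 0 (int r) p + shifted_power (- sg s * fps_X) (int r) p)) p v
     + (\<Sum>j\<in>neighbours a i.
          heis_series (heis_neg j)
            (\<lambda>r p. - sg s * shifted_power (- sg s * fps_const (1/2) * fps_X) (int r) p) p v))"

lemma A_op_eq: "A_op a s i = op_exp (A_exponent a s i)"
  by (simp add: A_op_def A_exponent_def)

interpretation A1: creation_series i "\<lambda>r p. sg s * (shifted_power 0 (int r) p + shifted_power (- sg s * fps_X) (int r) p)"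
  for i :: 'i and s
  by unfold_locales
     (intro creation_coeffs_sg creation_coeffs_add creation_coeffs_shifted_power; simp)

interpretation A2: creation_series j "\<lambda>r p. - sg s * shifted_power (- sg s * fps_const (1/2) * fps_X) (int r) p"
  for j :: 'i and s
proof unfold_locales
  have "creation_coeffs (\<lambda>r p. - (sg s * shifted_power (- sg s * fps_const (1/2) * fps_X) (int r) p))"
    by (intro creation_coeffs_uminus creation_coeffs_sg creation_coeffs_shifted_power) simp
  then show "creation_coeffs (\<lambda>r p. - sg s * shifted_power (- sg s * fps_const (1/2) * fps_X) (int r) p)" by simp
qed

lemma exponent_A: "exponent (A_exponent a s i) 1"
proof -
  have "lin (A_exponent a s i p)" for p
    unfolding A_exponent_def by (rule lin_plus[OF A1.lin_ser lin_setsum[OF A2.lin_ser]])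
  moreover have "A_exponent a s i p v = 0" if "p < 0" for p v
    using that by (simp only: A_exponent_def A1.ser_neg A2.ser_neg) simp
  moreover have "hz 1 (A_exponent a s i 0 v)" for v
    unfolding A_exponent_def by (rule hz_add[OF A1.hz_ser_0 hz_sum[OF A2.hz_ser_0]])
  ultimately show ?thesis by (simp add: exponent_def one_sided_def)
qed

interpretation A: exponent "A_exponent a s i" 1
  by (rule exponent_A)

lemma lin_A_op [simp]: "lin (A_op a s i p)"
  unfolding A_op_eq by (rule A.lin_op_exp)

lemma one_sided_A_op: "one_sided 1 (A_op a s i)"
  unfolding A_op_eq by (rule A.one_sided_op_exp)

lemma A_op_neg: "p < 0 \<Longrightarrow> A_op a s i p v = 0"
  using one_sided_A_op[of a s i] by (simp add: one_sided_def)

lemma A_op_commute: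
  assumes T: "lin T" and "\<And>j r v. T (heis_neg j r v) = heis_neg j r (T v)"
  shows "T (A_op a s i p v) = A_op a s i p (T v)"
  unfolding A_op_eq
  by (rule A.op_exp_commute[OF T])
     (simp only: A_exponent_def module_hom.add[OF T] module_hom.sum[OF T]
        A1.ser_commute[OF T assms(2)] A2.ser_commute[OF T assms(2)])

lemma vac_A_op: "vac \<beta> (A_op a s i p v) = (if p = 0 then vac \<beta> v else 0)"
  unfolding A_op_eq
  by (rule A.op_exp_annihilated[OF lin_vac])
     (simp only: A_exponent_def module_hom.add[OF lin_vac] module_hom.sum[OF lin_vac] A1.vac_ser A2.vac_ser, simp)

lemma lookup_zz_power:
  "lookup (zz ^ r) p = shifted_power 0 (int r) p"
  "lookup ((zz - 2 * eta) ^ r) p = shifted_power (- fps_X) (int r) p"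
  "lookup ((zz + 2 * eta) ^ r) p = shifted_power fps_X (int r) p"
  "lookup ((zz - eta) ^ r) p = shifted_power (- (fps_const (1/2) * fps_X)) (int r) p"
  "lookup ((zz + eta) ^ r) p = shifted_power (fps_const (1/2) * fps_X) (int r) p"
proof -
  have e: "2 * (eta :: int shift) = const_shift fps_X"
  proof -
    have "(2 :: int shift) = const_shift 2" by simp
    then have "2 * (eta :: int shift) = const_shift (2 * (fps_const (1/2) * fps_X))"
      by (simp only: mult_single) simp
    also have "2 * (fps_const (1/2) * fps_X) = (fps_X :: complex fps)"
    proof -
      have "2 * fps_const (1/2) = (1 :: complex fps)"
        by (simp flip: fps_numeral_fps_const)
      then show ?thesis by (simp only: mult.assoc[symmetric]) simp
    qed
    finally show ?thesis .
  qed
  show "lookup (zz ^ r) p = shifted_power 0 (int r) p"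
    using lookup_linear_power[of 0 r p] by simp
  show "lookup ((zz - 2 * eta) ^ r) p = shifted_power (- fps_X) (int r) p"
    using lookup_linear_power[of "- fps_X" r p] by (simp only: e) (simp add: single_uminus)
  show "lookup ((zz + 2 * eta) ^ r) p = shifted_power fps_X (int r) p"
    using lookup_linear_power[of "fps_X" r p] by (simp only: e)
  show "lookup ((zz - eta) ^ r) p = shifted_power (- (fps_const (1/2) * fps_X)) (int r) p"
    using lookup_linear_power[of "- (fps_const (1/2) * fps_X)" r p] by (simp add: single_uminus)
  show "lookup ((zz + eta) ^ r) p = shifted_power (fps_const (1/2) * fps_X) (int r) p"
    using lookup_linear_power[of "fps_const (1/2) * fps_X" r p] by simp
qed

lemma A_op_heis_pos:
  assumes r: "0 < r"
  shows "commutes_by (heis_pos k r) 1 (lam a s i zz k r) (A_op a s i)"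
  unfolding A_op_eq
proof (rule A.op_exp_commutator[OF lin_heis_pos])
  fix q v
  let ?g = "sg s * (shifted_power 0 (int r) q + shifted_power (- sg s * fps_X) (int r) q) :: complex fps"
  let ?h = "- sg s * shifted_power (- sg s * fps_const (1/2) * fps_X) (int r) q :: complex fps"
  have "heis_pos k r (A_exponent a s i q v) = A_exponent a s i q (heis_pos k r v)
      + ((if k = i then hsmult ?g v else 0) + (\<Sum>j\<in>neighbours a i. if k = j then hsmult ?h v else 0))"
    by (simp only: A_exponent_def module_hom.add[OF lin_heis_pos] module_hom.sum[OF lin_heis_pos]
        A1.heis_pos_ser[OF r] A2.heis_pos_ser[OF r] sum.distrib) (simp only: ac_simps)
  also have "(if k = i then hsmult ?g v else 0) + (\<Sum>j\<in>neighbours a i. if k = j then hsmult ?h v else 0)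
      = hsmult (lookup (lam a s i zz k r) q) v"
  proof -
    have "(\<Sum>j\<in>neighbours a i. if k = j then hsmult ?h v else 0) = (if k \<in> neighbours a i then hsmult ?h v else 0)"
      by simp
    moreover have e: "fps_const (- (1 / 2)) * fps_X = - (fps_const (1 / 2) * fps_X :: complex fps)"
      by (simp add: fps_const_neg[symmetric] del: fps_const_neg)
    ultimately show ?thesis
      by (cases s) (auto simp: neighbours_def lam_def pos_roots_def neg_roots_def psum_def sg_def
          lookup_minus lookup_add lookup_zz_power e simp del: fps_const_neg)
  qed
  finally show "heis_pos k r (A_exponent a s i q v) = A_exponent a s i q (heis_pos k r v)
      + hsmult (lookup (lam a s i zz k r) q) v" .
qed

section \<open>The lattice part of the vertex operators\<close>

lemma lookup_e_op_nth:
  "lookup (fps_nth (e_op \<epsilon> \<alpha> v) n) \<gamma> = Poly_Mapping.single 0 (\<epsilon> \<alpha> (\<gamma> - \<alpha>)) * lookup (fps_nth v n) (\<gamma> - \<alpha>)"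
proof -
  let ?u = "fps_nth v n"
  have "lookup (fps_nth (e_op \<epsilon> \<alpha> v) n) \<gamma>
     = (\<Sum>\<beta>\<in>Poly_Mapping.keys ?u. if \<beta> = \<gamma> - \<alpha> then Poly_Mapping.single 0 (\<epsilon> \<alpha> (\<gamma> - \<alpha>)) * lookup ?u (\<gamma> - \<alpha>) else 0)"
    unfolding e_op_def linear_extend_nth lookup_sum
    by (intro sum.cong refl) (auto simp: lookup_single when_def algebra_simps)
  also have "\<dots> = Poly_Mapping.single 0 (\<epsilon> \<alpha> (\<gamma> - \<alpha>)) * lookup ?u (\<gamma> - \<alpha>)"
    by (auto simp: in_keys_iff)
  finally show ?thesis .
qed

lemma lookup2_e_op_nth:
  "lookup (lookup (fps_nth (e_op \<epsilon> \<alpha> v) n) \<gamma>) m = \<epsilon> \<alpha> (\<gamma> - \<alpha>) * lookup (lookup (fps_nth v n) (\<gamma> - \<alpha>)) m"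
  by (simp add: lookup_e_op_nth)

lemma lin_e_op [simp]: "lin (e_op \<epsilon> \<alpha>)"
proof (rule linI)
  show "e_op \<epsilon> \<alpha> (hsmult c v) = hsmult c (e_op \<epsilon> \<alpha> v)" for c v
    by (simp add: fps_eq_iff fock_eq_iff lookup2_e_op_nth hsmult_nth lookup_sum sum_distrib_left algebra_simps)
qed (simp add: fps_eq_iff fock_eq_iff lookup2_e_op_nth lookup_add algebra_simps)

lemma heis_pos_e_op: "heis_pos k r (e_op \<epsilon> \<alpha> v) = e_op \<epsilon> \<alpha> (heis_pos k r v)"
  by (simp add: fps_eq_iff fock_eq_iff lookup2_e_op_nth lookup2_heis_pos_nth)

lemma heis_neg_e_op: "heis_neg k r (e_op \<epsilon> \<alpha> v) = e_op \<epsilon> \<alpha> (heis_neg k r v)"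
  by (simp add: fps_eq_iff poly_mapping_eq_iff[where 'a = "'a lattice"] fun_eq_iff lookup_e_op_nth lookup_heis_neg_nth mult.left_commute)

lemma sector_e_op: "sector \<beta> (e_op \<epsilon> \<alpha> v) = e_op \<epsilon> \<alpha> (sector (\<beta> - \<alpha>) v)"
  by (auto simp: fps_eq_iff fock_eq_iff lookup2_e_op_nth sector_def lookup_single when_def)

lemma vac_e_op: "vac \<beta> (e_op \<epsilon> \<alpha> v) = hsmult (fps_const (\<epsilon> \<alpha> (\<beta> - \<alpha>))) (vac (\<beta> - \<alpha>) v)"
  by (simp add: fps_eq_iff vac_def lookup2_e_op_nth kk_def mult_single)

lemma lookup_sector_nth: "lookup (fps_nth (sector \<beta> v) n) \<gamma> = (if \<gamma> = \<beta> then lookup (fps_nth v n) \<beta> else 0)"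
  by (auto simp: sector_def lookup_single when_def)

text \<open>Each coefficient of hbar^n has finite support in the lattice, and only n < N counts.
  Operators that act by a different scalar in each sector are therefore summable.\<close>

lemma hz_sector_finite: "finite {\<beta>. \<not> hz N (sector \<beta> v)}"
proof (rule finite_subset)
  show "{\<beta>. \<not> hz N (sector \<beta> v)} \<subseteq> (\<Union>n<N. Poly_Mapping.keys (fps_nth v n))"
  proof
    fix \<beta> assume "\<beta> \<in> {\<beta>. \<not> hz N (sector \<beta> v)}"
    then obtain n where n: "n < N" "fps_nth (sector \<beta> v) n \<noteq> 0" by (auto simp: hz_def)
    then have "lookup (fps_nth v n) \<beta> \<noteq> 0" by (auto simp: sector_def)
    then show "\<beta> \<in> (\<Union>n<N. Poly_Mapping.keys (fps_nth v n))" using n by (auto simp: in_keys_iff)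
  qed
qed simp

lemma power_partial_eq: "power_partial a G \<alpha> p v = hsum (\<lambda>\<beta>. hsmult (G (form a \<alpha> \<beta>) p) (sector \<beta> v))"
  by (simp add: power_partial_def sector_def)

lemma hsummable_power_partial: "hsummable (\<lambda>\<beta>. hsmult (G (form a \<alpha> \<beta>) p) (sector \<beta> v))"
  unfolding hsummable_def
proof
  fix N
  have "{\<beta>. \<not> hz N (hsmult (G (form a \<alpha> \<beta>) p) (sector \<beta> v))} \<subseteq> {\<beta>. \<not> hz N (sector \<beta> v)}"
    by (auto intro: hz_hsmult)
  then show "finite {\<beta>. \<not> hz N (hsmult (G (form a \<alpha> \<beta>) p) (sector \<beta> v))}"
    using hz_sector_finite by (rule finite_subset)
qed

lemma lin_power_partial [simp]: "lin (power_partial a G \<alpha> p)"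
proof -
  have "lin (\<lambda>v. hsum (\<lambda>\<beta>. hsmult (G (form a \<alpha> \<beta>) p) (sector \<beta> v)))"
    by (rule lin_hsum[OF lin_hsmult[OF lin_sector] hsummable_power_partial])
  then show ?thesis by (simp add: power_partial_eq[abs_def])
qed

lemma power_partial_commute:
  assumes T: "lin T" and "\<And>\<beta> v. T (sector \<beta> v) = sector \<beta> (T v)"
  shows "T (power_partial a G \<alpha> p v) = power_partial a G \<alpha> p (T v)"
  by (simp add: power_partial_eq hsum_lin[OF T hsummable_power_partial] module_hom.scale[OF T] assms(2))

lemma sector_sector: "sector \<beta> (sector \<gamma> v) = (if \<beta> = \<gamma> then sector \<beta> v else 0)"
  by (auto simp: fps_eq_iff lookup_sector_nth intro!: poly_mapping_eqI)

lemma sector_power_partial: "sector \<gamma> (power_partial a G \<alpha> p v) = hsmult (G (form a \<alpha> \<gamma>) p) (sector \<gamma> v)"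
  unfolding power_partial_eq
  by (simp add: hsum_lin[OF lin_sector hsummable_power_partial] module_hom.scale[OF lin_sector] sector_sector,
      subst hsum_eq_sum[of "{\<gamma>}"]) auto

lemma power_partial_sector: "power_partial a G \<alpha> p (sector \<gamma> v) = hsmult (G (form a \<alpha> \<gamma>) p) (sector \<gamma> v)"
  unfolding power_partial_eq
  by (subst hsum_eq_sum[of "{\<gamma>}"]) (auto simp: sector_sector)

lemma power_partial_vv: "power_partial a G \<alpha> p (vv \<beta>) = hsmult (G (form a \<alpha> \<beta>) p) (vv \<beta>)"
  using power_partial_sector[of a G \<alpha> p \<beta> "vv \<beta>"] by (simp add: sector_vv)

lemma z_power_finite: "finite {p. \<not> hz N (power_partial a z_powers \<alpha> p v)}"
proof (rule finite_subset)
  show "{p. \<not> hz N (power_partial a z_powers \<alpha> p v)} \<subseteq> form a \<alpha> ` {\<beta>. \<not> hz N (sector \<beta> v)}"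
  proof
    fix p assume p: "p \<in> {p. \<not> hz N (power_partial a z_powers \<alpha> p v)}"
    show "p \<in> form a \<alpha> ` {\<beta>. \<not> hz N (sector \<beta> v)}"
    proof (rule ccontr)
      assume n: "p \<notin> form a \<alpha> ` {\<beta>. \<not> hz N (sector \<beta> v)}"
      have "hz N (hsmult (z_powers (form a \<alpha> \<beta>) p) (sector \<beta> v))" for \<beta>
        using n by (cases "hz N (sector \<beta> v)") (auto simp: z_powers_def intro: hz_hsmult)
      then have "hz N (power_partial a z_powers \<alpha> p v)"
        unfolding power_partial_eq by (rule hz_hsum)
      then show False using p by simp
    qed
  qed
qed (rule finite_imageI[OF hz_sector_finite])

section \<open>The vertex operators\<close>

lemma vertex_field_iff:
  "vertex_field l Q m F \<longleftrightarrow> (\<forall>p. lin (F p)) \<and>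
     (\<forall>k r. 0 < r \<longrightarrow> commutes_by (heis_pos k r) 1 (l k r) F \<and> commutes_by (heis_neg k r) (Q k r) (m k r) F)"
  unfolding vertex_field_def commutes_by_1 unfolding commutes_by_def by blast

section \<open>The currents X as products of a creation, an annihilation and a lattice part\<close>

context
  fixes a :: "'i::finite \<Rightarrow> 'i \<Rightarrow> int" and \<epsilon> :: "'i lattice \<Rightarrow> 'i lattice \<Rightarrow> complex" and s :: sign and i :: 'i
begin

abbreviation "srt \<equiv> (Poly_Mapping.single i (sg s) :: 'i lattice)"

definition "X_lattice = op_times (op_const (e_op \<epsilon> srt)) (power_partial a z_powers srt)"
definition "X_annihilation = op_times (B_op s i 0) X_lattice"
definition "X_unsigned = op_times (A_op a s i) X_annihilation"

lemma X_op_eq: "X_op a \<epsilon> s i p v = hsmult (sg s) (X_unsigned p v)"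
  by (simp add: X_op_def X_unsigned_def X_annihilation_def X_lattice_def Let_def op_times_const_left)

lemma X_lattice_eq: "X_lattice p v = e_op \<epsilon> srt (power_partial a z_powers srt p v)"
  by (simp add: X_lattice_def op_times_const_left)

lemma lin_X_lattice: "lin (X_lattice p)"
  using lin_compose[OF lin_e_op lin_power_partial] by (simp add: X_lattice_eq[abs_def])

lemma X_lattice_finite: "finite {p. \<not> hz N (X_lattice p v)}"
proof (rule finite_subset)
  show "{p. \<not> hz N (X_lattice p v)} \<subseteq> {p. \<not> hz N (power_partial a z_powers srt p v)}"
    using hz_lin[OF lin_e_op] by (auto simp: X_lattice_eq)
qed (rule z_power_finite)

text \<open>Modulo hbar^N the lattice part applied to v contains finitely many powers of z, which
  leaves finitely many terms in the convolution.\<close>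

lemma op_summable_X_annihilation: "op_summable (B_op s i 0) X_lattice"
  unfolding op_summable_def
proof (intro allI impI)
  fix p v and H :: "int \<Rightarrow> 'i fock fps" assume H: "\<forall>q N. hz N (X_lattice q v) \<longrightarrow> hz N (H q)"
  show "hsummable (\<lambda>q. B_op s i 0 q (H (p - q)))"
    unfolding hsummable_def
  proof
    fix N
    have "{q. \<not> hz N (B_op s i 0 q (H (p - q)))} \<subseteq> (\<lambda>q. p - q) ` {q. \<not> hz N (X_lattice q v)}"
    proof
      fix q assume "q \<in> {q. \<not> hz N (B_op s i 0 q (H (p - q)))}"
      moreover have "hz N (B_op s i 0 q (H (p - q)))" if "hz N (X_lattice (p - q) v)"
        by (rule hz_lin[OF lin_B_op]) (use that H in simp)
      ultimately have "\<not> hz N (X_lattice (p - q) v)" by auto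
      then show "q \<in> (\<lambda>q. p - q) ` {q. \<not> hz N (X_lattice q v)}"
        by (intro image_eqI[of _ _ "p - q"]) auto
    qed
    then show "finite {q. \<not> hz N (B_op s i 0 q (H (p - q)))}"
      using X_lattice_finite by (meson finite_imageI finite_subset)
  qed
qed

lemma lin_X_annihilation: "lin (X_annihilation p)"
  unfolding X_annihilation_def by (rule lin_op_times[OF lin_B_op lin_X_lattice op_summable_X_annihilation])

lemma X_annihilation_eventually: "\<exists>K. \<forall>p<K. hz N (X_annihilation p v)"
proof -
  let ?S = "{p. \<not> hz N (X_lattice p v)}"
  have "\<exists>K. \<forall>p<K. \<forall>t\<in>?S. hz N (B_op s i 0 (p - t) (X_lattice t v))"
    using X_lattice_finite[of N v]
  proof (induction rule: finite_induct)
    case (insert t S)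
    then obtain K where K: "\<forall>p<K. \<forall>t\<in>S. hz N (B_op s i 0 (p - t) (X_lattice t v))" by blast
    obtain K' where "\<forall>p<K'. hz N (B_op s i 0 p (X_lattice t v))"
      using B_op_0_eventually[of N s i "X_lattice t v"] by blast
    then show ?case using K by (intro exI[of _ "min K (K' + t)"]) auto
  qed simp
  then obtain K where K: "\<And>p t. p < K \<Longrightarrow> \<not> hz N (X_lattice t v) \<Longrightarrow> hz N (B_op s i 0 (p - t) (X_lattice t v))"
    by blast
  have "hz N (X_annihilation p v)" if "p < K" for p
    unfolding X_annihilation_def op_times_def
  proof (rule hz_hsum)
    fix q
    show "hz N (B_op s i 0 q (X_lattice (p - q) v))"
    proof (cases "hz N (X_lattice (p - q) v)")
      case True
      then show ?thesis by (rule hz_lin[OF lin_B_op])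
    next
      case False
      then show ?thesis using K[OF that, of "p - q"] by simp
    qed
  qed
  then show ?thesis by blast
qed

text \<open>A has exponents q >= 0 only, and the remaining factors vanish modulo hbar^N at exponents
  below K, so q is confined to 0..p - K.\<close>

lemma op_summable_X_unsigned: "op_summable (A_op a s i) X_annihilation"
  unfolding op_summable_def
proof (intro allI impI)
  fix p v and H :: "int \<Rightarrow> 'i fock fps" assume H: "\<forall>q N. hz N (X_annihilation q v) \<longrightarrow> hz N (H q)"
  show "hsummable (\<lambda>q. A_op a s i q (H (p - q)))"
    unfolding hsummable_def
  proof
    fix N
    obtain K where K: "\<forall>p<K. hz N (X_annihilation p v)" using X_annihilation_eventually by blast
    have "{q. \<not> hz N (A_op a s i q (H (p - q)))} \<subseteq> {0..p - K}"
    proof (rule subsetI, rule ccontr)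
      fix q assume q: "q \<in> {q. \<not> hz N (A_op a s i q (H (p - q)))}" "q \<notin> {0..p - K}"
      then have "q < 0 \<or> p - q < K" by auto
      then show False
      proof
        assume "q < 0" then show False using q by (simp add: A_op_neg)
      next
        assume "p - q < K"
        then have "hz N (A_op a s i q (H (p - q)))"
          by (intro hz_lin[OF lin_A_op]) (use K H in simp)
        then show False using q by simp
      qed
    qed
    then show "finite {q. \<not> hz N (A_op a s i q (H (p - q)))}" by (rule finite_subset) simp
  qed
qed

lemma lin_X_unsigned: "lin (X_unsigned p)"
  unfolding X_unsigned_def by (rule lin_op_times[OF lin_A_op lin_X_annihilation op_summable_X_unsigned])

lemma lin_X_op: "lin (X_op a \<epsilon> s i p)"
  using lin_hsmult[OF lin_X_unsigned] by (simp add: X_op_eq[abs_def])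

lemma X_lattice_commute:
  "heis_pos k r (X_lattice p v) = X_lattice p (heis_pos k r v)"
  "heis_neg k r (X_lattice p v) = X_lattice p (heis_neg k r v)"
  by (simp_all add: X_lattice_eq heis_pos_e_op heis_neg_e_op power_partial_commute[OF lin_heis_pos]
      power_partial_commute[OF lin_heis_neg] sector_heis_pos sector_heis_neg)

lemma vertex_field_X:
  "vertex_field (lam a s i zz) (\<lambda>k r. 1)
     (\<lambda>k r. if k = i then Poly_Mapping.single (- int r) (sg s) else 0) (X_op a \<epsilon> s i)"
  unfolding vertex_field_iff
proof (intro conjI allI impI)
  show "lin (X_op a \<epsilon> s i p)" for p by (rule lin_X_op)
  fix k and r :: nat assume r: "0 < r"
  have scaled: "commutes_by T 1 l (X_op a \<epsilon> s i)" if T: "lin T" and "commutes_by T (1 * (1 * 1)) l X_unsigned" for T l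
    using that(2) unfolding commutes_by_1 mult_1_left
    by (simp add: X_op_eq module_hom.scale[OF T] hs.scale_right_distrib act_hsmult)
  have "commutes_by (heis_pos k r) (1 * 1) (1 * 0 + 1 * 0) X_annihilation"
    unfolding X_annihilation_def
    by (rule op_times_commutes_by[OF lin_heis_pos lin_B_op lin_X_lattice op_summable_X_annihilation])
       (simp_all add: commutes_by_0 heis_pos_B_op X_lattice_commute)
  from op_times_commutes_by[OF lin_heis_pos lin_A_op lin_X_annihilation op_summable_X_unsigned
      A_op_heis_pos[OF r] this]
  show "commutes_by (heis_pos k r) 1 (lam a s i zz k r) (X_op a \<epsilon> s i)"
    by (intro scaled[OF lin_heis_pos]) (simp add: X_unsigned_def)
  let ?l = "if k = i then Poly_Mapping.single (- int r) (sg s) else 0 :: int shift"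
  have "commutes_by (heis_neg k r) (1 * 1) (1 * ?l + 1 * 0) X_annihilation"
    unfolding X_annihilation_def
    by (rule op_times_commutes_by[OF lin_heis_neg lin_B_op lin_X_lattice op_summable_X_annihilation
          B_op_0_heis_neg[OF r]])
       (simp add: commutes_by_0 X_lattice_commute)
  moreover have "commutes_by (heis_neg k r) 1 0 (A_op a s i)"
    unfolding commutes_by_0 using A_op_commute[OF lin_heis_neg heis_neg_commute] by blast
  ultimately show "commutes_by (heis_neg k r) 1 ?l (X_op a \<epsilon> s i)"
    using op_times_commutes_by[OF lin_heis_neg lin_A_op lin_X_annihilation op_summable_X_unsigned]
    by (intro scaled[OF lin_heis_neg]) (fastforce simp add: X_unsigned_def)
qed

text \<open>Taking the component without oscillators leaves only the identity term of A. Sector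
  \<beta> is reached from one sector only, where the lattice part is a single power of z with a
  sign; what remains is B.\<close>

lemma vac_X_op:
  "vac \<beta> (X_op a \<epsilon> s i p v) = hsmult (sg s * fps_const (\<epsilon> srt (\<beta> - srt)))
     (vac (\<beta> - srt) (B_op s i 0 (p - form a srt (\<beta> - srt)) v))"
proof -
  let ?\<gamma> = "\<beta> - srt" and ?e = "form a srt (\<beta> - srt)"
  have "vac \<beta> (X_unsigned p v) = hsum (\<lambda>q. vac \<beta> (A_op a s i q (X_annihilation (p - q) v)))"
    unfolding X_unsigned_def op_times_def by (rule hsum_lin[OF lin_vac op_summableD[OF op_summable_X_unsigned]])
  also have "\<dots> = vac \<beta> (X_annihilation p v)"
    unfolding vac_A_op by (subst hsum_eq_sum[of "{0}"]) auto
  also have "\<dots> = vac \<beta> (sector \<beta> (X_annihilation p v))" by (simp add: vac_sector)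
  also have "sector \<beta> (X_annihilation p v) = hsum (\<lambda>q. sector \<beta> (B_op s i 0 q (X_lattice (p - q) v)))"
    unfolding X_annihilation_def op_times_def by (rule hsum_lin[OF lin_sector op_summableD[OF op_summable_X_annihilation]])
  also have "\<dots> = hsum (\<lambda>q. if q = p - ?e then B_op s i 0 q (e_op \<epsilon> srt (sector ?\<gamma> v)) else 0)"
  proof (rule arg_cong[of _ _ hsum], rule ext)
    fix q
    show "sector \<beta> (B_op s i 0 q (X_lattice (p - q) v))
        = (if q = p - ?e then B_op s i 0 q (e_op \<epsilon> srt (sector ?\<gamma> v)) else 0)"
      unfolding sector_B_op X_lattice_eq sector_e_op sector_power_partial
      by (auto simp: z_powers_def module_hom.zero[OF lin_e_op] module_hom.zero[OF lin_B_op])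
  qed
  also have "\<dots> = B_op s i 0 (p - ?e) (e_op \<epsilon> srt (sector ?\<gamma> v))"
    by (subst hsum_eq_sum[of "{p - ?e}"]) auto
  also have "\<dots> = e_op \<epsilon> srt (sector ?\<gamma> (B_op s i 0 (p - ?e) v))"
    unfolding sector_B_op by (rule B_op_commute[OF lin_e_op heis_pos_e_op[symmetric], symmetric])
  finally show ?thesis
    by (simp add: X_op_eq module_hom.scale[OF lin_vac] vac_e_op vac_sector)
qed

text \<open>On a vacuum vector B acts as 1 and the lattice part is a single power of z, which A can
  only raise. This is the lower bound used for products in the reverse order.\<close>

lemma X_op_vv_lower:
  assumes "p < form a srt \<beta>" shows "X_op a \<epsilon> s i p (vv \<beta>) = 0"
proof -
  have Y: "X_annihilation q (vv \<beta>) = 0" if "q < form a srt \<beta>" for q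
    unfolding X_annihilation_def op_times_def
  proof (rule trans[OF hsum_eq_sum[of "{}"]], simp)
    fix t
    have L: "X_lattice (q - t) (vv \<beta>) = hsmult (z_powers (form a srt \<beta>) (q - t)) (e_op \<epsilon> srt (vv \<beta>))"
      by (simp add: X_lattice_eq power_partial_vv module_hom.scale[OF lin_e_op])
    show "B_op s i 0 t (X_lattice (q - t) (vv \<beta>)) = 0"
    proof (cases "t = 0")
      case True
      then show ?thesis using that unfolding L by (simp add: z_powers_def module_hom.zero[OF lin_B_op])
    next
      case False
      have "B_op s i 0 t (e_op \<epsilon> srt (vv \<beta>)) = e_op \<epsilon> srt (B_op s i 0 t (vv \<beta>))"
        by (rule B_op_commute[OF lin_e_op heis_pos_e_op[symmetric], symmetric])
      then show ?thesis
        unfolding L module_hom.scale[OF lin_B_op] using False by (simp add: B_op_vv module_hom.zero[OF lin_e_op])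
    qed
  qed simp
  have "X_unsigned p (vv \<beta>) = 0"
    unfolding X_unsigned_def op_times_def
  proof (rule trans[OF hsum_eq_sum[of "{}"]], simp)
    fix q
    show "A_op a s i q (X_annihilation (p - q) (vv \<beta>)) = 0"
      using assms by (cases "q < 0") (simp_all add: A_op_neg Y module_hom.zero[OF lin_A_op])
  qed simp
  then show ?thesis by (simp add: X_op_eq)
qed

end

section \<open>The Cartan series with lower and upper sign\<close>

lemma lin_H_minus: "lin (H_op a Minus i p)"
  by (simp add: H_op_def lin_op_times[OF lin_A_op lin_A_op one_sided_op_summable[OF one_sided_A_op one_sided_A_op lin_A_op]])

lemma H_minus_neg: "p < 0 \<Longrightarrow> H_op a Minus i p v = 0"
  using one_sided_op_times[OF one_sided_A_op one_sided_A_op lin_A_op, of a Plus i a Minus i]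
  by (simp add: one_sided_def H_op_def)

lemma vertex_field_H_minus:
  "vertex_field (\<lambda>k r. lam a Minus i zz k r + lam a Plus i zz k r) (\<lambda>k r. 1) (\<lambda>k r. 0) (H_op a Minus i)"
  unfolding vertex_field_iff
proof (intro conjI allI impI)
  show "lin (H_op a Minus i p)" for p by (rule lin_H_minus)
  fix k and r :: nat assume r: "0 < r"
  note s = one_sided_op_summable[OF one_sided_A_op[of a Plus i] one_sided_A_op[of a Minus i] lin_A_op]
  show "commutes_by (heis_pos k r) 1 (lam a Minus i zz k r + lam a Plus i zz k r) (H_op a Minus i)"
    using op_times_commutes_by[OF lin_heis_pos lin_A_op lin_A_op s A_op_heis_pos[OF r] A_op_heis_pos[OF r], of k]
    by (simp add: H_op_def add.commute)
  have "commutes_by (heis_neg k r) 1 0 (A_op a s i)" for s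
    unfolding commutes_by_0 using A_op_commute[OF lin_heis_neg heis_neg_commute] by blast
  from op_times_commutes_by[OF lin_heis_neg lin_A_op lin_A_op s this this]
  show "commutes_by (heis_neg k r) 1 0 (H_op a Minus i)" by (simp add: H_op_def)
qed

lemma vac_H_minus: "vac \<beta> (H_op a Minus i p v) = (if p = 0 then vac \<beta> v else 0)"
proof -
  note s = one_sided_op_summable[OF one_sided_A_op[of a Plus i] one_sided_A_op[of a Minus i] lin_A_op]
  have "vac \<beta> (H_op a Minus i p v) = hsum (\<lambda>q. vac \<beta> (A_op a Plus i q (A_op a Minus i (p - q) v)))"
    unfolding H_op_def sign.case op_times_def by (rule hsum_lin[OF lin_vac op_summableD[OF s]])
  also have "\<dots> = (\<Sum>q\<in>{0}. vac \<beta> (A_op a Plus i q (A_op a Minus i (p - q) v)))"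
    by (rule hsum_eq_sum) (auto simp: vac_A_op)
  finally show ?thesis by (simp add: vac_A_op)
qed

lemma one_sided_ratio: "one_sided (-1) (power_partial a ratio_powers \<alpha>)"
  by (auto simp: one_sided_def power_partial_eq ratio_powers_def hsum_eq_sum[of "{}"])

lemma ratio_powers_0: "ratio_powers n 0 = 1"
proof -
  have "fps_nth (inverse (1 - u)) 0 = 1" if "fps_nth u 0 = (0 :: complex fps)" for u :: "complex fps fps"
    using that by simp
  then have 1: "fps_nth cartan_ratio 0 = 1"
    by (simp add: cartan_ratio_def Let_def)
  have "fps_nth (c ^ k) 0 = 1" if "fps_nth c 0 = (1 :: complex fps)" for c :: "complex fps fps" and k
    by (induction k) (simp_all add: that)
  then show ?thesis using 1 by (simp add: ratio_powers_def power_int_def)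
qed

context
  fixes a :: "'i::finite \<Rightarrow> 'i \<Rightarrow> int" and i :: 'i
begin

abbreviation "b_plus \<equiv> fps_const (1/2) * fps_X :: complex fps"
abbreviation "b_minus \<equiv> - fps_const (1/2) * fps_X :: complex fps"

definition "H_inner = op_times (B_op Minus i b_minus) (power_partial a ratio_powers (Poly_Mapping.single i 1))"

lemma H_plus_eq: "H_op a Plus i = op_times (B_op Plus i b_plus) H_inner"
  by (simp add: H_op_def H_inner_def)

lemmas op_summable_H_inner = one_sided_op_summable[OF one_sided_B_op[of Minus i b_minus]
   one_sided_ratio[of a "Poly_Mapping.single i 1"] lin_B_op]

lemma one_sided_H_inner: "one_sided (-1) H_inner"
  unfolding H_inner_def by (rule one_sided_op_times[OF one_sided_B_op one_sided_ratio lin_B_op])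

lemmas op_summable_H_plus = one_sided_op_summable[OF one_sided_B_op[of Plus i b_plus] one_sided_H_inner lin_B_op]

lemma lin_H_inner: "lin (H_inner p)"
  unfolding H_inner_def by (rule lin_op_times[OF lin_B_op lin_power_partial op_summable_H_inner])

lemma lin_H_plus: "lin (H_op a Plus i p)"
  unfolding H_plus_eq by (rule lin_op_times[OF lin_B_op lin_H_inner op_summable_H_plus])

lemma H_plus_pos: "0 < p \<Longrightarrow> H_op a Plus i p v = 0"
  using one_sided_op_times[OF one_sided_B_op[of Plus i b_plus] one_sided_H_inner lin_B_op]
  by (simp add: one_sided_def H_plus_eq)

lemma H_plus_mode_0: "H_op a Plus i 0 v = v"
proof -
  have "power_partial a ratio_powers (Poly_Mapping.single i 1) 0 v = hsum (\<lambda>\<beta>. sector \<beta> v)"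
    by (simp add: power_partial_eq ratio_powers_0)
  also have "\<dots> = v"
  proof -
    have "fps_nth (hsum (\<lambda>\<beta>. sector \<beta> v)) n = (\<Sum>\<beta>\<in>Poly_Mapping.keys (fps_nth v n). fps_nth (sector \<beta> v) n)" for n
      by (rule hsum_nth_sum) (auto simp: sector_def in_keys_iff)
    then have "lookup (fps_nth (hsum (\<lambda>\<beta>. sector \<beta> v)) n) \<gamma> = lookup (fps_nth v n) \<gamma>" for n \<gamma>
      by (simp add: lookup_sum lookup_sector_nth in_keys_iff)
    then show ?thesis by (simp add: fps_eq_iff poly_mapping_eq_iff fun_eq_iff)
  qed
  finally have R: "power_partial a ratio_powers (Poly_Mapping.single i 1) 0 v = v" .
  have "H_inner 0 v = v"
    unfolding H_inner_def one_sided_op_times_sum[OF one_sided_B_op one_sided_ratio lin_B_op]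
    by (simp add: B_op_mode_0 R)
  then show ?thesis
    unfolding H_plus_eq one_sided_op_times_sum[OF one_sided_B_op one_sided_H_inner lin_B_op]
    by (simp add: B_op_mode_0)
qed

lemma heis_pos_H_plus: "heis_pos k r (H_op a Plus i p v) = H_op a Plus i p (heis_pos k r v)"
proof -
  have "commutes_by (heis_pos k r) (1 * 1) (1 * 0 + 1 * 0) H_inner"
    unfolding H_inner_def
    by (rule op_times_commutes_by[OF lin_heis_pos lin_B_op lin_power_partial op_summable_H_inner])
       (simp_all add: commutes_by_0 heis_pos_B_op power_partial_commute[OF lin_heis_pos] sector_heis_pos)
  moreover have "commutes_by (heis_pos k r) 1 0 (B_op Plus i b_plus)"
    by (simp add: commutes_by_0 heis_pos_B_op)
  ultimately have "commutes_by (heis_pos k r) 1 0 (H_op a Plus i)"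
    unfolding H_plus_eq
    using op_times_commutes_by[OF lin_heis_pos lin_B_op lin_H_inner op_summable_H_plus] by fastforce
  then show ?thesis by (simp add: commutes_by_0)
qed

text \<open>The commutators of the two factors add up to (z + hbar/2)^-r - (z - hbar/2)^-r, written
  here over the common denominator.\<close>

lemma vertex_field_H_plus:
  "vertex_field (\<lambda>k r. 0) (\<lambda>k r. (zz + const_shift b_plus) ^ r * (zz + const_shift b_minus) ^ r)
     (\<lambda>k r. if k = i then (zz + const_shift b_minus) ^ r - (zz + const_shift b_plus) ^ r else 0) (H_op a Plus i)"
  unfolding vertex_field_iff
proof (intro conjI allI impI)
  show "lin (H_op a Plus i p)" for p by (rule lin_H_plus)
  fix k and r :: nat assume r: "0 < r"
  show "commutes_by (heis_pos k r) 1 0 (H_op a Plus i)"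
    by (simp add: commutes_by_0 heis_pos_H_plus)
  have "commutes_by (heis_neg k r) ((zz + const_shift b_minus) ^ r * 1)
      (1 * (if k = i then const_shift (sg Minus) else 0) + (zz + const_shift b_minus) ^ r * 0) H_inner"
    unfolding H_inner_def
    by (rule op_times_commutes_by[OF lin_heis_neg lin_B_op lin_power_partial op_summable_H_inner B_op_heis_neg[OF r]])
       (simp add: commutes_by_0 power_partial_commute[OF lin_heis_neg] sector_heis_neg)
  from op_times_commutes_by[OF lin_heis_neg lin_B_op lin_H_inner op_summable_H_plus B_op_heis_neg[OF r] this]
  show "commutes_by (heis_neg k r) ((zz + const_shift b_plus) ^ r * (zz + const_shift b_minus) ^ r)
     (if k = i then (zz + const_shift b_minus) ^ r - (zz + const_shift b_plus) ^ r else 0) (H_op a Plus i)"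
  proof -
    have e: "const_shift (sg Minus) = (- 1 :: int shift)" "const_shift (sg Plus) = (1 :: int shift)"
      by (simp_all add: sg_def single_uminus)
    assume "commutes_by (heis_neg k r)
      ((zz + const_shift b_plus) ^ r * ((zz + const_shift b_minus) ^ r * 1))
      ((zz + const_shift b_minus) ^ r * 1 * (if k = i then const_shift (sg Plus) else 0) +
       (zz + const_shift b_plus) ^ r * (1 * (if k = i then const_shift (sg Minus) else 0) +
          (zz + const_shift b_minus) ^ r * 0))
      (op_times (B_op Plus i b_plus) H_inner)"
    then show ?thesis unfolding H_plus_eq e by (cases "k = i") simp_all
  qed
qed

end

section \<open>Vacuum expectation values\<close>

text \<open>The exponents of B for the two signs are opposite, so zeros and poles of the correlation
  functions change places.\<close>

definition orient :: "sign \<Rightarrow> 'a \<Rightarrow> 'a \<Rightarrow> 'a" where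
  "orient s x y = (case s of Plus \<Rightarrow> x | Minus \<Rightarrow> y)"

lemma orient_simps [simp]: "orient Plus x y = x" "orient Minus x y = y"
  by (simp_all add: orient_def)

abbreviation zfactors :: "complex fps \<Rightarrow> 'y::ab_group_add shift list \<Rightarrow> (int \<times> 'y) shift" where
  "zfactors b xs \<equiv> (\<Prod>x\<leftarrow>xs. zvar + const_shift b - lift_snd x)"

text \<open>The family U viewed as a series in an additional variable z in which it is
  constant.\<close>

definition at_zero :: "('y \<Rightarrow> 'i fock fps) \<Rightarrow> int \<times> 'y \<Rightarrow> 'i fock fps" where
  "at_zero U = (\<lambda>(p, y). if p = 0 then U y else 0)"

definition shift_fst :: "complex fps \<Rightarrow> (int \<times> 'y \<Rightarrow> 'i fock fps) \<Rightarrow> int \<times> 'y \<Rightarrow> 'i fock fps" where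
  "shift_fst b C = (\<lambda>(p, y). shift_series b (\<lambda>p. C (p, y)) p)"

lemma shift_fst_linear:
  fixes C :: "int \<times> 'y::ab_group_add \<Rightarrow> 'i fock fps"
  assumes C: "\<And>p y. K < p \<Longrightarrow> C (p, y) = 0"
  shows "act (zvar + const_shift b - lift_snd x) (shift_fst b C) = shift_fst b (act (zvar - lift_snd x) C)"
proof
  fix u :: "int \<times> 'y" obtain p y where u: "u = (p, y)" by (cases u)
  have K1: "act zz (\<lambda>p. C (p, y)) n = 0" "act x (\<lambda>y. C (n, y)) y = 0" if "K + 1 < n" for n y
    using C that by simp_all
  have "act (zvar + const_shift b) (shift_fst b C) (p, y) = act (zz + const_shift b) (shift_series b (\<lambda>p. C (p, y))) p"
    by (simp add: act_add_left shift_fst_def)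
  also have "\<dots> = shift_series b (act zz (\<lambda>p. C (p, y))) p"
    by (rule shift_series_zz) (rule C)
  finally have 1: "act (zvar + const_shift b) (shift_fst b C) (p, y) = shift_series b (act zz (\<lambda>p. C (p, y))) p" .
  have "act (lift_snd x) (shift_fst b C) (p, y) = act x (\<lambda>y. \<Sum>n\<in>{p..K + 1}. hsmult (shifted_power b n p) (C (n, y))) y"
    unfolding act_push_snd shift_fst_def prod.case
    by (rule arg_cong[of _ _ "\<lambda>U. act x U y"], rule ext, rule shift_series_sum) (simp add: C)
  also have "\<dots> = (\<Sum>n\<in>{p..K + 1}. hsmult (shifted_power b n p) (act x (\<lambda>y. C (n, y)) y))"
    by (simp only: act_sum_right act_hsmult)
  also have "\<dots> = shift_series b (\<lambda>n. act x (\<lambda>y. C (n, y)) y) p"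
    by (rule shift_series_sum[symmetric]) (rule K1)
  finally have 2: "act (lift_snd x) (shift_fst b C) (p, y) = shift_series b (\<lambda>n. act x (\<lambda>y. C (n, y)) y) p" .
  have "shift_fst b (act (zvar - lift_snd x) C) (p, y)
      = shift_series b (\<lambda>n. act zz (\<lambda>p. C (p, y)) n - act x (\<lambda>y. C (n, y)) y) p"
    by (simp add: shift_fst_def act_diff_left act_push_snd)
  also have "\<dots> = shift_series b (act zz (\<lambda>p. C (p, y))) p - shift_series b (\<lambda>n. act x (\<lambda>y. C (n, y)) y) p"
    by (rule shift_series_diff[of "K + 1"]) (rule K1, assumption)+
  finally show "act (zvar + const_shift b - lift_snd x) (shift_fst b C) u = shift_fst b (act (zvar - lift_snd x) C) u"
    unfolding u act_diff_left 1 2 ..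
qed

lemma shift_fst_factors:
  fixes C :: "int \<times> 'y::ab_group_add \<Rightarrow> 'i fock fps"
  assumes "\<And>p y. K < p \<Longrightarrow> C (p, y) = 0"
  shows "act (zfactors b xs) (shift_fst b C) = shift_fst b (act (zfactors 0 xs) C)"
  using assms
proof (induction xs arbitrary: C K)
  case Nil
  have "act 1 V = V" for V :: "int \<times> 'y \<Rightarrow> 'i fock fps" by (rule ext) simp
  then show ?case by simp
next
  case (Cons x xs)
  let ?D = "act (zvar - lift_snd x) C"
  have D: "?D (p, y) = 0" if "K + 1 < p" for p y
    using that Cons(2) by (simp add: act_diff_left act_push_snd)
  have "act (zfactors b (x # xs)) (shift_fst b C) = act (zfactors b xs) (act (zvar + const_shift b - lift_snd x) (shift_fst b C))"
    by (rule ext) (simp only: list.map prod_list.Cons mult.commute[of "zvar + const_shift b - lift_snd x"] act_mult)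
  also have "\<dots> = shift_fst b (act (zfactors 0 xs) ?D)"
    by (simp only: shift_fst_linear[where C = C, OF Cons(2)] Cons.IH[where C = ?D, OF D])
  also have "act (zfactors 0 xs) ?D = act (zfactors 0 (x # xs)) C"
    by (rule ext) (simp only: list.map prod_list.Cons mult.commute[of "zvar + const_shift 0 - lift_snd x"] act_mult, simp)
  finally show ?case .
qed

lemma shift_fst_at_zero:
  fixes U :: "'y \<Rightarrow> 'i fock fps"
  shows "shift_fst b (at_zero U) = at_zero U"
proof
  fix u :: "int \<times> 'y" obtain p y where u: "u = (p, y)" by (cases u)
  have "shift_series b (\<lambda>p. if p = 0 then U y else 0) p
     = (\<Sum>n\<in>{p..0}. hsmult (shifted_power b n p) (if n = 0 then U y else 0))"
    by (rule shift_series_sum) simp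
  also have "\<dots> = (\<Sum>n\<in>{p..0}. if n = 0 then hsmult (shifted_power b 0 p) (U y) else 0)"
    by (intro sum.cong refl) auto
  finally show "shift_fst b (at_zero U) u = at_zero U u"
    by (auto simp: u shift_fst_def at_zero_def shifted_power_0_right)
qed

text \<open>If H_{i,r} acts by power sums, Newton's recursion sums B(z) U to a product of factors 1
  - x / z and their inverses. Writing them as z - x leaves powers of z, encoded by roots 0, so that
  the substitution of z + b treats all factors alike.\<close>

theorem B_eigen:
  fixes U :: "'y::ab_group_add \<Rightarrow> 'i fock fps" and s :: sign and i :: 'i
  assumes U: "\<And>r y. 0 < r \<Longrightarrow> heis_pos i r (U y) = act (psum xs r - psum ys r) U y"
  defines "num \<equiv> orient s xs ys" and "den \<equiv> orient s ys xs"
  shows "act (zfactors b (den @ replicate (length num) 0)) (\<lambda>(p, y). B_op s i b p (U y)) u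
       = act (zfactors b (num @ replicate (length den) 0)) (at_zero U) u"
proof -
  define g where "g m y = B_op s i 0 (- int m) (U y)" for m y
  have "newton (\<lambda>r. psum den r - psum num r) g"
    unfolding newton_def
  proof (intro allI)
    fix m y
    have "hsmult (of_nat m) (g m y) = (\<Sum>r = 1..m. hsmult (- sg s) (heis_pos i r (g (m - r) y)))"
      unfolding g_def by (rule B_op_0_newton)
    also have "\<dots> = (\<Sum>r = 1..m. act (psum den r - psum num r) (g (m - r)) y)"
    proof (rule sum.cong[OF refl])
      fix r assume r: "r \<in> {1..m}"
      have "heis_pos i r (g (m - r) y) = B_op s i 0 (- int (m - r)) (heis_pos i r (U y))"
        unfolding g_def by (rule heis_pos_B_op)
      also have "heis_pos i r (U y) = act (psum xs r - psum ys r) U y" using r by (intro U) simp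
      also have "B_op s i 0 (- int (m - r)) (act (psum xs r - psum ys r) U y)
          = act (psum xs r - psum ys r) (g (m - r)) y"
        by (simp add: g_def[abs_def] act_lin[OF lin_B_op])
      finally show "hsmult (- sg s) (heis_pos i r (g (m - r) y)) = act (psum den r - psum num r) (g (m - r)) y"
        by (cases s) (simp_all add: sg_def num_def den_def act_diff_left)
    qed
    finally show "hsmult (of_nat m) (g m y) = (\<Sum>r = 1..m. act (psum den r - psum num r) (g (m - r)) y)" .
  qed
  note newton = newton_solve_descending[OF this, of 0]
  have g0: "(\<lambda>(p, y). if p = 0 then g 0 y else 0) = at_zero U"
    by (auto simp: at_zero_def g_def B_op_mode_0)
  from newton
  have "act (zfactors 0 (den @ replicate (length num) 0)) (descending 0 g)
      = act (zfactors 0 (num @ replicate (length den) 0)) (at_zero U)"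
    by (intro ext) (simp add: g0 prod_list_replicate map_replicate)
  also have "descending 0 g = (\<lambda>(p, y). B_op s i 0 p (U y))"
    by (auto simp: descending_def g_def B_op_pos)
  finally have eq: "act (zfactors 0 (den @ replicate (length num) 0)) (\<lambda>(p, y). B_op s i 0 p (U y))
      = act (zfactors 0 (num @ replicate (length den) 0)) (at_zero U)" .
  have "(\<lambda>(p, y). B_op s i b p (U y)) = shift_fst b (\<lambda>(p, y). B_op s i 0 p (U y))"
    by (auto simp: shift_fst_def B_op_shift[of s i b])
  then have "act (zfactors b (den @ replicate (length num) 0)) (\<lambda>(p, y). B_op s i b p (U y))
      = shift_fst b (act (zfactors 0 (num @ replicate (length den) 0)) (at_zero U))"
    by (simp only: shift_fst_factors[of 0 "\<lambda>(p, y). B_op s i 0 p (U y)"] prod.case B_op_pos eq)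
  also have "\<dots> = act (zfactors b (num @ replicate (length den) 0)) (shift_fst b (at_zero U))"
    by (rule shift_fst_factors[of 0, symmetric]) (simp add: at_zero_def)
  finally show ?thesis by (simp only: shift_fst_at_zero)
qed

lemma act_vac: "act L (\<lambda>x. vac \<beta> (U x)) x = vac \<beta> (act L U x)"
  by (rule act_lin[OF lin_vac])

lemma zvar_power: "zvar ^ n = (Poly_Mapping.single (int n, 0) 1 :: (int \<times> 'y::ab_group_add) shift)"
  by (induction n) (simp_all add: mult_single zero_prod_def flip: single_one)

text \<open>Once B is summed only monomials are left: the lattice part gives z to the power of the
  form on the right, and each replacement of 1 - x / z by z - x changes that exponent by one, which
  accounts for the two lengths.\<close>

theorem X_correlator:
  fixes a :: "'i::finite \<Rightarrow> 'i \<Rightarrow> int" and U :: "'y::ab_group_add \<Rightarrow> 'i fock fps" and s :: sign and i :: 'i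
  assumes U: "\<And>r y. 0 < r \<Longrightarrow> heis_pos i r (U y) = act (psum xs r - psum ys r) U y"
  defines "num \<equiv> orient s xs ys" and "den \<equiv> orient s ys xs"
  defines "\<alpha> \<equiv> Poly_Mapping.single i (sg s)"
  shows "act (zfactors 0 den) (\<lambda>(p, y). vac \<beta> (X_op a \<epsilon> s i p (U y))) u
     = act (zfactors 0 num * Poly_Mapping.single (form a \<alpha> (\<beta> - \<alpha>) + int (length den) - int (length num), 0)
          (sg s * fps_const (\<epsilon> \<alpha> (\<beta> - \<alpha>)))) (at_zero (\<lambda>y. vac (\<beta> - \<alpha>) (U y))) u"
proof -
  define e \<kappa> \<gamma> where "e = form a \<alpha> (\<beta> - \<alpha>)" and "\<kappa> = sg s * fps_const (\<epsilon> \<alpha> (\<beta> - \<alpha>))" and "\<gamma> = \<beta> - \<alpha>"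
  define G where "G = (\<lambda>(p, y). vac \<gamma> (B_op s i 0 p (U y)))"
  let ?n = "length num" and ?d = "length den"
  have C: "(\<lambda>(p, y). vac \<beta> (X_op a \<epsilon> s i p (U y))) = act (Poly_Mapping.single (e, 0) \<kappa>) G"
    by (rule ext) (auto simp: vac_X_op e_def \<kappa>_def \<gamma>_def \<alpha>_def G_def)
  have rep: "zfactors 0 (zs @ replicate n 0) = zfactors 0 zs * zvar ^ n" for zs n
    by (simp add: prod_list_replicate map_replicate)
  have "act (zfactors 0 (den @ replicate ?n 0)) G u = vac \<gamma> (act (zfactors 0 (den @ replicate ?n 0)) (\<lambda>(p, y). B_op s i 0 p (U y)) u)" for u
    unfolding G_def act_vac[symmetric] by (simp add: case_prod_unfold)
  also have "\<dots> u = vac \<gamma> (act (zfactors 0 (num @ replicate ?d 0)) (at_zero U) u)" for u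
    unfolding num_def den_def by (rule arg_cong[OF B_eigen[OF U]])
  also have "\<dots> u = act (zfactors 0 (num @ replicate ?d 0)) (at_zero (\<lambda>y. vac \<gamma> (U y))) u" for u
  proof -
    have "at_zero (\<lambda>y. vac \<gamma> (U y)) = (\<lambda>x. vac \<gamma> (at_zero U x))"
      by (auto simp: at_zero_def module_hom.zero[OF lin_vac])
    then show ?thesis by (simp only: act_vac)
  qed
  finally have G: "act (zfactors 0 den * zvar ^ ?n) G = act (zfactors 0 num * zvar ^ ?d) (at_zero (\<lambda>y. vac \<gamma> (U y)))"
    unfolding rep by (rule ext)
  have z: "zvar ^ n * Poly_Mapping.single (m, 0) c = Poly_Mapping.single (int n + m, 0 :: 'y) c" for n m c
    by (simp add: zvar_power mult_single)
  have 1: "zfactors 0 den * Poly_Mapping.single (e, 0) \<kappa>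
     = Poly_Mapping.single (e - int ?n, 0) \<kappa> * (zfactors 0 den * zvar ^ ?n)"
  proof -
    have "Poly_Mapping.single (e, 0 :: 'y) \<kappa> = zvar ^ ?n * Poly_Mapping.single (e - int ?n, 0) \<kappa>"
      by (simp add: z)
    then show ?thesis by (simp only: ac_simps)
  qed
  have 2: "zfactors 0 num * Poly_Mapping.single (e + int ?d - int ?n, 0) \<kappa>
     = Poly_Mapping.single (e - int ?n, 0) \<kappa> * (zfactors 0 num * zvar ^ ?d)"
  proof -
    have "Poly_Mapping.single (e + int ?d - int ?n, 0 :: 'y) \<kappa> = zvar ^ ?d * Poly_Mapping.single (e - int ?n, 0) \<kappa>"
      by (simp add: z algebra_simps)
    then show ?thesis by (simp only: ac_simps)
  qed
  have "act (zfactors 0 den) (\<lambda>(p, y). vac \<beta> (X_op a \<epsilon> s i p (U y))) u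
      = act (zfactors 0 den * Poly_Mapping.single (e, 0) \<kappa>) G u"
    unfolding C act_mult ..
  also have "\<dots> = act (Poly_Mapping.single (e - int ?n, 0) \<kappa>) (act (zfactors 0 den * zvar ^ ?n) G) u"
    unfolding 1 act_mult[of "Poly_Mapping.single (e - int ?n, 0) \<kappa>"] ..
  also have "\<dots> = act (zfactors 0 num * Poly_Mapping.single (e + int ?d - int ?n, 0) \<kappa>) (at_zero (\<lambda>y. vac \<gamma> (U y))) u"
    unfolding G 2 act_mult[of "Poly_Mapping.single (e - int ?n, 0) \<kappa>"] ..
  finally show ?thesis by (simp add: e_def \<kappa>_def \<gamma>_def)
qed

lemma X_correlator_upper:
  fixes U :: "'y \<Rightarrow> 'i::finite fock fps"
  shows "upper fst (\<lambda>(p, y). vac \<beta> (X_op a \<epsilon> s i p (U y)))"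
  unfolding upper_def
proof (intro exI allI impI)
  fix x :: "int \<times> 'y" assume "form a (Poly_Mapping.single i (sg s)) (\<beta> - Poly_Mapping.single i (sg s)) < fst x"
  then show "(case x of (p, y) \<Rightarrow> vac \<beta> (X_op a \<epsilon> s i p (U y))) = 0"
    by (cases x) (simp add: vac_X_op B_op_pos module_hom.zero[OF lin_vac])
qed

text \<open>The n-th power of (z + hbar/2) / (z - hbar/2) with denominators cleared. N1 and N2 can
  be larger than the positive and negative parts of n; in \<open>H_plus_commute\<close> they are
  enlarged by numbers of roots.\<close>

lemma ratio_powers_eq:
  fixes w :: "'i fock fps"
  assumes n: "n = int N1 - int N2"
  shows "act ((zz + const_shift b_minus) ^ N1 * (zz + const_shift b_plus) ^ N2) (\<lambda>p. hsmult (ratio_powers n p) w) p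
       = act ((zz + const_shift b_plus) ^ N1 * (zz + const_shift b_minus) ^ N2) (\<lambda>p. if p = 0 then w else 0) p"
proof -
  \<comment> \<open>The coefficients of F(z^-1) times w. Multiplication by z + c is multiplication
    of F by 1 + c z^-1, followed by a shift by z.\<close>
  define V where "V F p = (if p \<le> 0 then hsmult (fps_nth F (nat (- p))) w else 0)" for F and p :: int
  define u :: "complex fps fps" where "u = fps_const b_plus * fps_X"
  have lin1: "act (zz + const_shift c) (V F) = act zz (V ((1 + fps_const c * fps_X) * F))" for c F
  proof
    fix p :: int
    show "act (zz + const_shift c) (V F) p = act zz (V ((1 + fps_const c * fps_X) * F)) p"
    proof (cases "p \<le> 0")
      case True
      then have "nat (1 - p) = Suc (nat (- p))" by simp
      then show ?thesis using True
        by (simp add: act_add_left V_def distrib_right mult.assoc hs.scale_left_distrib)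
    qed (auto simp: act_add_left V_def distrib_right mult.assoc)
  qed
  have power1: "act ((zz + const_shift c) ^ N) (V F) = act (zz ^ N) (V ((1 + fps_const c * fps_X) ^ N * F))" for c N F
  proof (induction N arbitrary: F)
    case (Suc N)
    have "act ((zz + const_shift c) ^ Suc N) (V F) = act ((zz + const_shift c) ^ N) (act (zz + const_shift c) (V F))"
      by (rule ext) (simp only: power_Suc2 act_mult)
    also have "\<dots> = act zz (act ((zz + const_shift c) ^ N) (V ((1 + fps_const c * fps_X) * F)))"
      unfolding lin1 by (rule ext) (rule act_commute)
    also have "\<dots> = act (zz ^ Suc N) (V ((1 + fps_const c * fps_X) ^ Suc N * F))"
      unfolding Suc by (rule ext) (simp only: power_Suc act_mult mult.assoc mult.left_commute)
    finally show ?case .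
  qed simp
  have both: "act ((zz + const_shift c) ^ N * (zz + const_shift d) ^ M) (V F) p
      = act (zz ^ (N + M)) (V ((1 + fps_const c * fps_X) ^ N * ((1 + fps_const d * fps_X) ^ M * F))) p" for c d N M F
    unfolding act_mult power1 power_add act_mult
    by (subst (1 2) act_commute) (simp only: power1 act_commute)
  have bm: "1 + fps_const b_minus * fps_X = 1 - u" and bp: "1 + fps_const b_plus * fps_X = 1 + u"
    by (simp_all add: u_def flip: fps_const_neg)
  define r where "r = (cartan_ratio :: complex fps fps)"
  have r: "r * (1 - u) = 1 + u" using cartan_ratio by (simp add: u_def r_def)
  have r0: "fps_nth r 0 = 1" using ratio_powers_0[of 1] by (simp add: ratio_powers_def r_def)
  have rinv: "r * inverse r = 1"
    by (subst fps_inverse_def, rule fps_right_inverse) (simp add: r0)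
  have key: "(1 - u) ^ N1 * ((1 + u) ^ N2 * (r powi n)) = (1 + u) ^ N1 * ((1 - u) ^ N2 * 1)"
  proof (cases "N2 \<le> N1")
    case True
    define k where "k = N1 - N2"
    have k: "N1 = N2 + k" "n = int k" using True n by (auto simp: k_def)
    have "(1 - u) ^ k * r ^ k = (1 + u) ^ k" by (metis r mult.commute power_mult_distrib)
    then show ?thesis unfolding k power_int_of_nat power_add
      by (metis (no_types, opaque_lifting) mult.assoc mult.commute mult_1_right)
  next
    case False
    define k where "k = N2 - N1"
    have k: "N2 = N1 + k" "n = - int k" using False n by (auto simp: k_def)
    have "(1 + u) ^ k * inverse r ^ k = (1 - u) ^ k"
    proof -
      have "(1 + u) * inverse r = (1 - u)"
        using rinv by (metis r mult.assoc mult.commute mult_1_right)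
      then show ?thesis by (metis power_mult_distrib)
    qed
    then show ?thesis unfolding k power_int_minus_left power_add
      by (simp add: power_int_minus mult.assoc power_int_def)
  qed
  have Vr: "(\<lambda>p. hsmult (ratio_powers n p) w) = V (r powi n)"
    by (auto simp: V_def ratio_powers_def r_def)
  have V1: "(\<lambda>p. if p = 0 then w else 0) = V 1"
    by (auto simp: V_def)
  show ?thesis
    unfolding Vr V1 both bm bp key ..
qed

text \<open>B is the left factor and its coefficients are linear, so a Laurent polynomial can be
  applied to the inner family. The factors of H^+ can thus be evaluated from the inside
  outwards.\<close>

lemma act_B_convolution:
  fixes C :: "int \<times> 'y::ab_group_add \<Rightarrow> 'i fock fps"
  assumes C: "\<And>p y. K < p \<Longrightarrow> C (p, y) = 0"
  shows "act L (\<lambda>(p, y). hsum (\<lambda>q. B_op s i b q (C (p - q, y)))) (p, y)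
       = hsum (\<lambda>q. B_op s i b q (act L C (p - q, y)))"
proof -
  have s: "hsummable (\<lambda>q. B_op s i b q (C (fst x - q, snd x)))" for x
  proof (rule hsummable_finite[of "{fst x - K..0}"])
    fix q assume "q \<notin> {fst x - K..0}"
    then have "0 < q \<or> K < fst x - q" by auto
    then show "B_op s i b q (C (fst x - q, snd x)) = 0"
      by (auto simp: B_op_pos C module_hom.zero[OF lin_B_op])
  qed simp
  have "act L (\<lambda>(p, y). hsum (\<lambda>q. B_op s i b q (C (p - q, y)))) (p, y)
     = act L (\<lambda>x. hsum (\<lambda>q. B_op s i b q (C (fst x - q, snd x)))) (p, y)"
    by (simp add: case_prod_unfold)
  also have "\<dots> = hsum (\<lambda>q. act L (\<lambda>x. B_op s i b q (C (fst x - q, snd x))) (p, y))"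
    by (rule act_hsum) (rule s)
  also have "\<dots> = hsum (\<lambda>q. B_op s i b q (act L C (p - q, y)))"
  proof (rule arg_cong[of _ _ hsum], rule ext)
    fix q
    have "act L (\<lambda>x. B_op s i b q (C (fst x - q, snd x))) (p, y)
        = B_op s i b q (act L (\<lambda>x. C (fst x - q, snd x)) (p, y))"
      by (rule act_lin[OF lin_B_op])
    also have "act L (\<lambda>x. C (fst x - q, snd x)) (p, y) = act L C (p - q, y)"
      unfolding act_def by (rule sum.cong[OF refl]) (auto simp: split_paired_all diff_diff_eq add.commute)
    finally show "act L (\<lambda>x. B_op s i b q (C (fst x - q, snd x))) (p, y) = B_op s i b q (act L C (p - q, y))" .
  qed
  finally show ?thesis .
qed

lemma zfactors_replicate:
  "zfactors b (zs @ replicate n 0) = zfactors b zs * (zvar + const_shift b) ^ n"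
  by (simp add: prod_list_replicate map_replicate)

text \<open>The lattice ratio and the two factors B are evaluated one after the other, each
  contributing one bracketed factor on either side. Restriction to sector \<beta> first makes the
  ratio a scalar series.\<close>

theorem H_plus_correlator:
  fixes a :: "'i::finite \<Rightarrow> 'i \<Rightarrow> int" and U :: "'y::ab_group_add \<Rightarrow> 'i fock fps" and i :: 'i
  assumes U: "\<And>r y. 0 < r \<Longrightarrow> heis_pos i r (U y) = act (psum xs r - psum ys r) U y"
    and n: "form a (Poly_Mapping.single i 1) \<beta> = int N1 - int N2"
  shows "act (((zvar + const_shift b_minus) ^ N1 * (zvar + const_shift b_plus) ^ N2) *
      (zfactors b_minus xs * (zvar + const_shift b_minus) ^ length ys) *
      (zfactors b_plus ys * (zvar + const_shift b_plus) ^ length xs))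
      (\<lambda>(p, y). vac \<beta> (H_op a Plus i p (U y))) u
   = act (((zvar + const_shift b_plus) ^ N1 * (zvar + const_shift b_minus) ^ N2) *
      (zfactors b_minus ys * (zvar + const_shift b_minus) ^ length xs) *
      (zfactors b_plus xs * (zvar + const_shift b_plus) ^ length ys))
      (at_zero (\<lambda>y. vac \<beta> (U y))) u"
proof -
  define V where "V y = sector \<beta> (U y)" for y
  define C0 where "C0 = (\<lambda>(p, y). power_partial a ratio_powers (Poly_Mapping.single i 1) p (V y))"
  define C1 where "C1 = (\<lambda>(p, y). hsum (\<lambda>q. B_op Minus i b_minus q (C0 (p - q, y))))"
  define C2 where "C2 = (\<lambda>(p, y). hsum (\<lambda>q. B_op Plus i b_plus q (C1 (p - q, y))))"
  define M0 N0' M1 N1' M2 N2' :: "(int \<times> 'y) shift"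
    where "M0 = (zvar + const_shift b_minus) ^ N1 * (zvar + const_shift b_plus) ^ N2"
      and "N0' = (zvar + const_shift b_plus) ^ N1 * (zvar + const_shift b_minus) ^ N2"
      and "M1 = zfactors b_minus xs * (zvar + const_shift b_minus) ^ length ys"
      and "N1' = zfactors b_minus ys * (zvar + const_shift b_minus) ^ length xs"
      and "M2 = zfactors b_plus ys * (zvar + const_shift b_plus) ^ length xs"
      and "N2' = zfactors b_plus xs * (zvar + const_shift b_plus) ^ length ys"
  have V: "heis_pos i r (V y) = act (psum xs r - psum ys r) V y" if "0 < r" for r y
    using U[OF that, of y] sector_heis_pos[of \<beta> i r "U y"] by (simp add: V_def[abs_def] act_lin[OF lin_sector])
  have C0_pos: "C0 (p, y) = 0" if "0 < p" for p y
    using one_sided_ratio[of a "Poly_Mapping.single i 1"] that by (simp add: one_sided_def C0_def)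
  have H: "H_inner a i p v = hsum (\<lambda>q. B_op Minus i b_minus q (power_partial a ratio_powers (Poly_Mapping.single i 1) (p - q) v))" for p v
    by (simp add: H_inner_def op_times_def)
  have C1: "C1 = (\<lambda>(p, y). H_inner a i p (V y))"
    by (auto simp: C1_def C0_def H)
  have C1_pos: "C1 (p, y) = 0" if "0 < p" for p y
    using one_sided_H_inner[of a i] that by (simp add: one_sided_def C1)
  have C2: "C2 = (\<lambda>(p, y). H_op a Plus i p (V y))"
    by (auto simp: C2_def C1 H_plus_eq op_times_def)
  have e0: "act M0 C0 = act N0' (at_zero V)"
  proof
    fix u :: "int \<times> 'y" obtain p y where u: "u = (p, y)" by (cases u)
    have z: "zvar + const_shift c = push (\<lambda>p. (p, 0 :: 'y)) (zz + const_shift c)" for c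
      by (simp add: push_add zero_prod_def)
    have "act M0 C0 (p, y) = act ((zz + const_shift b_minus) ^ N1 * (zz + const_shift b_plus) ^ N2) (\<lambda>p. C0 (p, y)) p"
      unfolding M0_def z
      by (simp only: act_push_fst additive_map.push_power[OF additive_map_Pair(1), symmetric]
          additive_map.push_mult[OF additive_map_Pair(1), symmetric])
    also have "(\<lambda>p. C0 (p, y)) = (\<lambda>p. hsmult (ratio_powers (int N1 - int N2) p) (V y))"
      by (simp add: C0_def V_def power_partial_sector n)
    also have "act ((zz + const_shift b_minus) ^ N1 * (zz + const_shift b_plus) ^ N2) \<dots> p
        = act ((zz + const_shift b_plus) ^ N1 * (zz + const_shift b_minus) ^ N2) (\<lambda>p. if p = 0 then V y else 0) p"
      by (rule ratio_powers_eq) simp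
    also have "\<dots> = act N0' (at_zero V) (p, y)"
      unfolding N0'_def z
      by (simp only: act_push_fst additive_map.push_power[OF additive_map_Pair(1), symmetric]
          additive_map.push_mult[OF additive_map_Pair(1), symmetric] at_zero_def prod.case)
    finally show "act M0 C0 u = act N0' (at_zero V) u" by (simp add: u)
  qed
  have conv0: "(\<lambda>(p, y). hsum (\<lambda>q. B_op s i b q (at_zero V (p - q, y)))) = (\<lambda>(p, y). B_op s i b p (V y))" for s b
  proof (rule ext)
    fix x :: "int \<times> 'y" obtain p y where x: "x = (p, y)" by (cases x)
    have "hsum (\<lambda>q. B_op s i b q (at_zero V (p - q, y))) = (\<Sum>q\<in>{p}. B_op s i b q (at_zero V (p - q, y)))"
      by (rule hsum_eq_sum) (auto simp: at_zero_def module_hom.zero[OF lin_B_op])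
    then show "(case x of (p, y) \<Rightarrow> hsum (\<lambda>q. B_op s i b q (at_zero V (p - q, y)))) = (case x of (p, y) \<Rightarrow> B_op s i b p (V y))"
      by (simp add: x at_zero_def)
  qed
  have atz: "at_zero V (p, y) = 0" if "0 < p" for p y using that by (simp add: at_zero_def)
  have e1: "act (M0 * M1) C1 = act (N0' * N1') (at_zero V)"
  proof
    fix u :: "int \<times> 'y" 
    have "act M0 C1 = act N0' (\<lambda>(p, y). B_op Minus i b_minus p (V y))"
    proof
      fix u :: "int \<times> 'y" obtain p y where u: "u = (p, y)" by (cases u)
      have "act M0 C1 (p, y) = hsum (\<lambda>q. B_op Minus i b_minus q (act M0 C0 (p - q, y)))"
        unfolding C1_def by (rule act_B_convolution[of 0]) (rule C0_pos)
      also have "\<dots> = act N0' (\<lambda>(p, y). hsum (\<lambda>q. B_op Minus i b_minus q (at_zero V (p - q, y)))) (p, y)"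
        unfolding e0 by (rule act_B_convolution[of 0, symmetric]) (rule atz)
      finally show "act M0 C1 u = act N0' (\<lambda>(p, y). B_op Minus i b_minus p (V y)) u"
        by (simp only: u conv0)
    qed
    moreover have "act M1 (\<lambda>(p, y). B_op Minus i b_minus p (V y)) = act N1' (at_zero V)"
      using B_eigen[where s = Minus and b = b_minus, OF V]
      by (intro ext) (simp only: orient_simps zfactors_replicate M1_def N1'_def)
    ultimately show "act (M0 * M1) C1 u = act (N0' * N1') (at_zero V) u"
      by (simp only: mult.commute[of M0 M1] act_mult act_commute[of M1 N0'])
  qed
  have e2: "act (M0 * M1 * M2) C2 = act (N0' * N1' * N2') (at_zero V)"
  proof
    fix u :: "int \<times> 'y"
    have "act (M0 * M1) C2 = act (N0' * N1') (\<lambda>(p, y). B_op Plus i b_plus p (V y))"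
    proof
      fix u :: "int \<times> 'y" obtain p y where u: "u = (p, y)" by (cases u)
      have "act (M0 * M1) C2 (p, y) = hsum (\<lambda>q. B_op Plus i b_plus q (act (M0 * M1) C1 (p - q, y)))"
        unfolding C2_def by (rule act_B_convolution[of 0]) (rule C1_pos)
      also have "\<dots> = act (N0' * N1') (\<lambda>(p, y). hsum (\<lambda>q. B_op Plus i b_plus q (at_zero V (p - q, y)))) (p, y)"
        unfolding e1 by (rule act_B_convolution[of 0, symmetric]) (rule atz)
      finally show "act (M0 * M1) C2 u = act (N0' * N1') (\<lambda>(p, y). B_op Plus i b_plus p (V y)) u"
        by (simp only: u conv0)
    qed
    moreover have "act M2 (\<lambda>(p, y). B_op Plus i b_plus p (V y)) = act N2' (at_zero V)"
      using B_eigen[where s = Plus and b = b_plus, OF V]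
      by (intro ext) (simp only: orient_simps zfactors_replicate M2_def N2'_def)
    ultimately show "act (M0 * M1 * M2) C2 u = act (N0' * N1' * N2') (at_zero V) u"
      by (simp only: mult.commute[of "M0 * M1" M2] act_mult[of M2] act_mult[of "N0' * N1'"] act_commute[of M2])
  qed
  have sect: "sector \<beta> (H_op a Plus i p v) = H_op a Plus i p (sector \<beta> v)" for p v
  proof -
    have "commutes_by (sector \<beta>) (1 * 1) (1 * 0 + 1 * 0) (H_inner a i)"
      unfolding H_inner_def
      by (rule op_times_commutes_by[OF lin_sector lin_B_op lin_power_partial op_summable_H_inner])
         (auto simp: commutes_by_0 sector_B_op sector_power_partial power_partial_sector)
    moreover have "commutes_by (sector \<beta>) 1 0 (B_op Plus i b_plus)"
      by (simp add: commutes_by_0 sector_B_op)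
    ultimately have "commutes_by (sector \<beta>) 1 0 (H_op a Plus i)"
      unfolding H_plus_eq
      using op_times_commutes_by[OF lin_sector lin_B_op lin_H_inner op_summable_H_plus] by fastforce
    then show ?thesis by (simp add: commutes_by_0)
  qed
  have C: "(\<lambda>(p, y). vac \<beta> (H_op a Plus i p (U y))) = (\<lambda>x. vac \<beta> (C2 x))"
    by (auto simp: C2 V_def sect[symmetric] vac_sector)
  have Z: "at_zero (\<lambda>y. vac \<beta> (U y)) = (\<lambda>x. vac \<beta> (at_zero V x))"
    by (auto simp: at_zero_def V_def vac_sector module_hom.zero[OF lin_vac])
  show ?thesis
    unfolding C Z M0_def[symmetric] M1_def[symmetric] M2_def[symmetric] N0'_def[symmetric] N1'_def[symmetric] N2'_def[symmetric]
      act_vac e2 ..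
qed

lemma H_plus_correlator_upper:
  fixes U :: "'y \<Rightarrow> 'i::finite fock fps"
  shows "upper fst (\<lambda>(p, y). vac \<beta> (H_op a Plus i p (U y)))"
  unfolding upper_def by (intro exI[of _ 0]) (auto simp: H_plus_pos module_hom.zero[OF lin_vac])

section \<open>Commutation of two fields\<close>

text \<open>The constant series \<omega>, as opposed to the formal delta function: a correlation
  function is a Laurent polynomial times this, divided by linear factors.\<close>

definition delta :: "'i fock fps \<Rightarrow> 'x::zero \<Rightarrow> 'i fock fps" where
  "delta \<omega> x = (if x = 0 then \<omega> else 0)"

lemma at_zero_delta: "at_zero (act N (delta \<omega>)) = act (lift_snd N) (delta \<omega>)"
proof
  fix x :: "int \<times> 'a" obtain p y where x: "x = (p, y)" by (cases x)
  have "(\<lambda>y. delta \<omega> (p, y)) = (if p = 0 then delta \<omega> else (\<lambda>y. 0))"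
    by (auto simp: delta_def zero_prod_def)
  then have "act (lift_snd N) (delta \<omega>) (p, y) = act N (if p = 0 then delta \<omega> else (\<lambda>y. 0)) y"
    by (rule trans[OF act_push_snd arg_cong[of _ _ "\<lambda>U. act N U y"]])
  then show "at_zero (act N (delta \<omega>)) x = act (lift_snd N) (delta \<omega>) x"
    by (simp add: x at_zero_def)
qed

lemma upper_delta: "upper d (delta \<omega>)"
  unfolding upper_def by (intro exI[of _ "d 0"]) (auto simp: delta_def)

text \<open>C is the expansion of N / M. The hypothesis \<open>LK\<close> says L N / M = K, and M
  can be cancelled because both sides are bounded above.\<close>

lemma upper_cancel:
  assumes M: "upper_regular d M" "additive_map d" "upper d C"
    and C: "\<And>x. act M C x = act N (delta \<omega>) x" and LK: "L * N = K * M"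
  shows "act L C x = act K (delta \<omega>) x"
proof -
  have "act M (\<lambda>x. act L C x - act K (delta \<omega>) x) x = 0" for x
  proof -
    have "act M C = act N (delta \<omega>)" by (rule ext) (rule C)
    then have "act M (act L C) x = act (L * N) (delta \<omega>) x"
      by (simp only: act_commute[of M] act_mult)
    then show ?thesis unfolding act_diff_right LK by (simp add: act_mult act_commute[of M])
  qed
  then have "act L C x - act K (delta \<omega>) x = 0"
    by (rule upper_regular_act_eq_0[OF M(1,2) upper_diff[OF upper_act[OF M(2,3)] upper_act[OF M(2) upper_delta]]])
  then show ?thesis by simp
qed

text \<open>C and C' are expansions of N / M and N' / M' in the same direction, so an identity
  between L N / M and L' N' / M' can be cross-multiplied.\<close>

lemma upper_compare:
  assumes M: "upper_regular d M" "upper_regular d M'" and d: "additive_map d" "upper d C" "upper d C'"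
    and C: "\<And>x. act M C x = act N (delta \<omega>) x" "\<And>x. act M' C' x = act N' (delta \<omega>) x"
    and LK: "L * M' * N = L' * M * N'"
  shows "act L C x = act L' C' x"
proof -
  have C': "act M C = act N (delta \<omega>)" "act M' C' = act N' (delta \<omega>)" using C by blast+
  have "act (M * M') (\<lambda>x. act L C x - act L' C' x) x = 0" for x
  proof -
    have "act (M * M') (act L C) x = act (L * M') (act M C) x"
      by (simp add: mult.commute mult.left_commute flip: act_mult)
    moreover have "act (M * M') (act L' C') x = act (L' * M) (act M' C') x"
      by (simp add: mult.commute mult.left_commute flip: act_mult)
    ultimately show ?thesis unfolding act_diff_right C' act_mult[symmetric] LK by simp
  qed
  then have "act L C x - act L' C' x = 0"
    by (rule upper_regular_act_eq_0[OF upper_regular_mult[OF M] d(1) upper_diff[OF upper_act[OF d(1,2)] upper_act[OF d(1,3)]]])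
  then show ?thesis by simp
qed

abbreviation Z1 :: "(int \<times> int) shift" where "Z1 \<equiv> Poly_Mapping.single (1, 0) 1"
abbreviation W1 :: "(int \<times> int) shift" where "W1 \<equiv> Poly_Mapping.single (0, 1) 1"

lemma additive_map_swap [simp]: "additive_map (prod.swap :: int \<times> int \<Rightarrow> _)"
  by unfold_locales auto

lemma additive_map_fst_snd [simp]: "additive_map fst" "additive_map snd"
  by unfold_locales auto

lemma act_swap: "act (push prod.swap L) (\<lambda>(p, q). C (q, p)) (p, q) = act L C (q :: int, p :: int)"
proof -
  have "(\<lambda>x. case 0 + prod.swap x of (p, q) \<Rightarrow> C (q, p)) = C" by auto
  then show ?thesis
    using additive_map.act_push[OF additive_map_swap, of L "\<lambda>(p, q). C (q, p)" 0 "(q, p)"]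
    by (simp only: add_0_left) simp
qed

lemma push_swap_fst: "push prod.swap (push (\<lambda>p. (p, 0)) L) = (push (\<lambda>p. (0, p)) L :: (int \<times> int) shift)"
  and push_swap_snd: "push prod.swap (push (\<lambda>p. (0, p)) L) = (push (\<lambda>p. (p, 0)) L :: (int \<times> int) shift)"
  by (simp_all add: push_push)

text \<open>After exchanging the variables, the product in the other order has the same data, so the
  difference of the two sides is again a vertex family.\<close>

theorem fields_commute:
  fixes F G :: "'i opser"
  assumes F: "vertex_field l Q m F" and G: "vertex_field l' Q' m' G"
    and Q: "\<And>k r. regular (push (\<lambda>p. (p, 0 :: int)) (Q k r))" "\<And>k r. regular (push (\<lambda>q. (0 :: int, q)) (Q' k r))"
    and vac: "\<And>\<beta> \<gamma> x. act L (\<lambda>(p, q). vac \<beta> (F p (G q (vv \<gamma>)))) x = act L' (\<lambda>(p, q). vac \<beta> (G q (F p (vv \<gamma>)))) x"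
  shows "act L (\<lambda>(p, q). F p (G q v)) x = act L' (\<lambda>(p, q). G q (F p v)) x"
proof -
  let ?\<iota>1 = "push (\<lambda>p. (p, 0 :: int)) :: int shift \<Rightarrow> _" and ?\<iota>2 = "push (\<lambda>y. (0 :: int, y)) :: int shift \<Rightarrow> _"
  define l2 Q2 m2 where "l2 = (\<lambda>k r. ?\<iota>1 (l k r) + ?\<iota>2 (l' k r))" and "Q2 = (\<lambda>k r. ?\<iota>1 (Q k r) * ?\<iota>2 (Q' k r))"
    and "m2 = (\<lambda>k r. ?\<iota>2 (Q' k r) * ?\<iota>1 (m k r) + ?\<iota>1 (Q k r) * ?\<iota>2 (m' k r))"
  define P where "P = (\<lambda>x v. case x of (p, q) \<Rightarrow> F p (G q v))"
  define P' where "P' = (\<lambda>x v. case x of (p, q) \<Rightarrow> G q (F p v))"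
  have PP: "(\<lambda>(p, y) v. F p (G y v)) = P" by (auto simp: P_def)
  have P: "vertex_family l2 Q2 m2 P"
    using vertex_family_tensor[OF F vertex_field_imp_family[OF G]] unfolding l2_def Q2_def m2_def PP .
  have "vertex_family l2 Q2 m2 (\<lambda>y. (\<lambda>(p, y) v. G p (F y v)) (prod.swap y))"
    by (rule vertex_family_cong[OF vertex_family_reindex[OF vertex_family_tensor[OF G vertex_field_imp_family[OF F]]
            additive_map_swap]])
       (simp_all add: l2_def Q2_def m2_def push_add additive_map.push_mult[OF additive_map_swap]
          push_swap_fst push_swap_snd mult.commute add.commute)
  also have "(\<lambda>y. (\<lambda>(p, y) v. G p (F y v)) (prod.swap y)) = P'" by (auto simp: P'_def)
  finally have P': "vertex_family l2 Q2 m2 P'" .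
  have "vertex_family l2 Q2 m2 (\<lambda>x v. act L (\<lambda>x. P x v) x - act L' (\<lambda>x. P' x v) x)"
    by (rule vertex_family_diff[OF vertex_family_act[OF P] vertex_family_act[OF P']])
  then have "act L (\<lambda>x. P x v) x - act L' (\<lambda>x. P' x v) x = 0"
  proof (rule vertex_family_eq_0)
    show "regular (Q2 k r)" for k r unfolding Q2_def by (intro regular_mult Q)
    show "vac \<beta> (act L (\<lambda>x. P x (vv \<gamma>)) x - act L' (\<lambda>x. P' x (vv \<gamma>)) x) = 0" for \<beta> \<gamma> x
      using vac[of \<beta> \<gamma> x]
      by (simp add: module_hom.diff[OF lin_vac] act_vac[symmetric] P_def P'_def case_prod_unfold)
  qed
  then show ?thesis by (simp add: P_def P'_def case_prod_unfold)
qed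

section \<open>Two-point functions\<close>

locale simply_laced =
  fixes a :: "'i::finite \<Rightarrow> 'i \<Rightarrow> int" and \<epsilon> :: "'i lattice \<Rightarrow> 'i lattice \<Rightarrow> complex"
  assumes a: "simply_laced_cartan a" and \<epsilon>: "sign_cocycle a \<epsilon>"
begin

abbreviation X where "X \<equiv> X_op a \<epsilon>"
abbreviation H where "H \<equiv> H_op a"
abbreviation rt :: "sign \<Rightarrow> 'i \<Rightarrow> 'i lattice" where "rt s i \<equiv> Poly_Mapping.single i (sg s)"

lemma a_diag [simp]: "a i i = 2" and a_sym: "a i j = a j i" and a_off: "i \<noteq> j \<Longrightarrow> a i j = 0 \<or> a i j = -1"
  using a by (auto simp: simply_laced_cartan_def)

lemma form_add_right: "form a x (y + z) = form a x y + form a x z"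
  by (simp add: form_def lookup_add distrib_left sum.distrib)

lemma form_add_left: "form a (x + y) z = form a x z + form a y z"
  by (simp add: form_def lookup_add distrib_right sum.distrib)

lemma form_sym: "form a x y = form a y x"
  unfolding form_def by (subst sum.swap) (simp add: a_sym algebra_simps)

lemma form_rt: "form a (rt s i) (rt t j) = sg s * sg t * a i j"
proof -
  have "(\<Sum>j'\<in>UNIV. lookup (rt s i) i' * a i' j' * lookup (rt t j) j')
      = (\<Sum>j'\<in>UNIV. if j' = j then lookup (rt s i) i' * a i' j * sg t else 0)" for i'
    by (intro sum.cong refl) (auto simp: lookup_single when_def)
  then have "form a (rt s i) (rt t j) = (\<Sum>i'\<in>UNIV. lookup (rt s i) i' * a i' j * sg t)"
    by (simp add: form_def)
  also have "\<dots> = (\<Sum>i'\<in>UNIV. if i' = i then sg s * a i j * sg t else 0)"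
    by (intro sum.cong refl) (auto simp: lookup_single when_def)
  finally show ?thesis by (simp add: ac_simps)
qed

lemma sg_square: "sg s * sg s = (1 :: 'a::ring_1)"
  by (cases s) (simp_all add: sg_def)

lemma cocycle: "\<epsilon> (x + y) z = \<epsilon> x z * \<epsilon> y z" "\<epsilon> x (y + z) = \<epsilon> x y * \<epsilon> x z"
    "\<epsilon> x y = 1 \<or> \<epsilon> x y = -1" "\<epsilon> x x = (-1) powi (form a x x div 2)"
  using \<epsilon> by (auto simp: sign_cocycle_def)

lemma cocycle_square: "\<epsilon> x y * \<epsilon> x y = 1"
  using cocycle(3)[of x y] by auto

text \<open>Expanding \<epsilon>(x + y, x + y) and inserting the prescribed diagonal values gives
  the commutator (-1)^(x, y). Only the parity of a_ij matters, so the signs s and t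
  disappear.\<close>

lemma cocycle_swap: "\<epsilon> (rt t j) (rt s i) = (-1) powi (a i j) * \<epsilon> (rt s i) (rt t j)"
proof -
  let ?x = "rt s i" and ?y = "rt t j"
  have self: "\<epsilon> (rt s i) (rt s i) = -1" for s i
    by (simp add: cocycle(4) form_rt sg_square)
  have "form a (?x + ?y) (?x + ?y) = 2 * (2 + sg s * sg t * a i j)"
    by (simp add: form_add_left form_add_right form_rt sg_square form_sym[of ?y ?x] a_sym[of j i] algebra_simps)
  then have "\<epsilon> (?x + ?y) (?x + ?y) = (-1) powi (2 + sg s * sg t * a i j)"
    by (simp add: cocycle(4))
  also have "\<epsilon> (?x + ?y) (?x + ?y) = \<epsilon> ?x ?y * \<epsilon> ?y ?x"
    by (simp add: cocycle(1,2) self)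
  also have "(-1) powi (2 + sg s * sg t * a i j) = ((-1) powi (a i j) :: complex)"
  proof -
    have "a i j = 2 \<or> a i j = 0 \<or> a i j = -1" using a_off[of i j] by (cases "i = j") auto
    then show ?thesis by (cases s; cases t) (auto simp: sg_def power_int_def)
  qed
  finally have "\<epsilon> ?x ?y * \<epsilon> ?y ?x = (-1) powi (a i j)" .
  then have "\<epsilon> ?x ?y * (\<epsilon> ?x ?y * \<epsilon> ?y ?x) = (-1) powi (a i j) * \<epsilon> ?x ?y" by simp
  then show ?thesis by (simp add: mult.assoc[symmetric] cocycle_square)
qed

lemma X_vv_eigen: "0 < r \<Longrightarrow> heis_pos k r (X t j q (vv \<beta>)) = act (lam a t j zz k r) (\<lambda>q. X t j q (vv \<beta>)) q"
  using vertex_field_X[of a t j \<epsilon>] by (simp add: vertex_field_def module_hom.zero[OF lin_X_op])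

lemma H_minus_vv_eigen:
  "0 < r \<Longrightarrow> heis_pos k r (H Minus j q (vv \<beta>))
     = act (psum (pos_roots a Minus j k zz @ pos_roots a Plus j k zz) r
          - psum (neg_roots a Minus j k zz @ neg_roots a Plus j k zz) r) (\<lambda>q. H Minus j q (vv \<beta>)) q"
  using vertex_field_H_minus[of a j]
  by (simp add: vertex_field_def module_hom.zero[OF lin_H_minus] lam_def psum_def algebra_simps)

lemma vac_X_vv:
  "(\<lambda>q. vac \<gamma> (X t j q (vv \<beta>))) = act (Poly_Mapping.single (form a (rt t j) (\<gamma> - rt t j))
      (sg t * fps_const (\<epsilon> (rt t j) (\<gamma> - rt t j)))) (delta (vac (\<gamma> - rt t j) (vv \<beta>)))"
  by (rule ext) (simp add: vac_X_op B_op_vv delta_def module_hom.zero[OF lin_vac])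

lemma H_plus_vv: "H Plus i p (vv \<beta>) = hsmult (ratio_powers (form a (Poly_Mapping.single i 1) \<beta>) p) (vv \<beta>)"
proof -
  have inner: "H_inner a i p (vv \<beta>) = hsmult (ratio_powers (form a (Poly_Mapping.single i 1) \<beta>) p) (vv \<beta>)" for p
  proof -
    have "H_inner a i p (vv \<beta>) = (\<Sum>q\<in>{0}. B_op Minus i b_minus q
        (power_partial a ratio_powers (Poly_Mapping.single i 1) (p - q) (vv \<beta>)))"
      unfolding H_inner_def op_times_def
      by (rule hsum_eq_sum) (auto simp: power_partial_vv module_hom.scale[OF lin_B_op] B_op_vv)
    then show ?thesis by (simp add: B_op_mode_0 power_partial_vv)
  qed
  have "H Plus i p (vv \<beta>) = (\<Sum>q\<in>{0}. B_op Plus i b_plus q (H_inner a i (p - q) (vv \<beta>)))"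
    unfolding H_plus_eq op_times_def
    by (rule hsum_eq_sum) (auto simp: inner module_hom.scale[OF lin_B_op] B_op_vv)
  then show ?thesis by (simp add: B_op_mode_0 inner)
qed

text \<open>What remains of the two-point function besides linear factors: the powers of z and w
  from the lattice part, and the cocycle values of the two translations applied to \<gamma>.\<close>

definition mono2 :: "sign \<Rightarrow> 'i \<Rightarrow> sign \<Rightarrow> 'i \<Rightarrow> 'i lattice \<Rightarrow> (int \<times> int) shift" where
  "mono2 s i t j \<gamma> = Poly_Mapping.single (form a (rt s i) \<gamma>, form a (rt t j) \<gamma>)
     (sg s * sg t * fps_const (\<epsilon> (rt s i) \<gamma> * \<epsilon> (rt t j) \<gamma> * \<epsilon> (rt s i) (rt t j)))"

text \<open>The degree of the linear factors equals the form of the two roots. Hence the correction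
  by lengths in \<open>X_correlator\<close> cancels the contribution of the inner root to the
  exponent.\<close>

lemma length_roots:
  "int (length (orient s (neg_roots a t j i z) (pos_roots a t j i z)))
     - int (length (orient s (pos_roots a t j i z) (neg_roots a t j i z))) = - (sg s * sg t * a i j)"
  using a_off[of i j] a_sym[of j i]
  by (cases s; cases t; cases "i = j") (auto simp: pos_roots_def neg_roots_def sg_def)

lemma XX_correlator:
  fixes i j :: 'i and s t :: sign and \<beta> :: "'i lattice"
  defines "num \<equiv> orient s (pos_roots a t j i zz) (neg_roots a t j i zz)"
    and "den \<equiv> orient s (neg_roots a t j i zz) (pos_roots a t j i zz)"
    and "\<gamma> \<equiv> \<beta> - rt s i - rt t j"
  shows "act (zfactors 0 den) (\<lambda>(p, q). vac \<beta> (X s i p (X t j q (vv \<beta>0)))) u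
     = act (zfactors 0 num * mono2 s i t j \<gamma>) (delta (vac \<gamma> (vv \<beta>0))) u"
proof -
  have e: "form a (rt s i) (\<beta> - rt s i) + int (length den) - int (length num) = form a (rt s i) \<gamma>"
  proof -
    have "\<beta> - rt s i = \<gamma> + rt t j" by (simp add: \<gamma>_def)
    then show ?thesis using length_roots[of s t j i zz] by (simp add: form_add_right form_rt num_def den_def)
  qed
  have b: "\<beta> - rt s i = \<gamma> + rt t j" by (simp add: \<gamma>_def)
  have "act (zfactors 0 den) (\<lambda>(p, q). vac \<beta> (X s i p (X t j q (vv \<beta>0)))) u
    = act (zfactors 0 num * Poly_Mapping.single (form a (rt s i) (\<beta> - rt s i) + int (length den) - int (length num), 0)
          (sg s * fps_const (\<epsilon> (rt s i) (\<beta> - rt s i)))) (at_zero (\<lambda>q. vac (\<beta> - rt s i) (X t j q (vv \<beta>0)))) u"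
    unfolding num_def den_def by (rule X_correlator) (simp add: X_vv_eigen lam_def)
  also have "at_zero (\<lambda>q. vac (\<beta> - rt s i) (X t j q (vv \<beta>0)))
     = act (lift_snd (Poly_Mapping.single (form a (rt t j) \<gamma>) (sg t * fps_const (\<epsilon> (rt t j) \<gamma>)))) (delta (vac \<gamma> (vv \<beta>0)))"
    unfolding vac_X_vv at_zero_delta by (simp add: \<gamma>_def)
  also have "act (zfactors 0 num * Poly_Mapping.single (form a (rt s i) (\<beta> - rt s i) + int (length den) - int (length num), 0)
          (sg s * fps_const (\<epsilon> (rt s i) (\<beta> - rt s i)))) \<dots> u
     = act (zfactors 0 num * mono2 s i t j \<gamma>) (delta (vac \<gamma> (vv \<beta>0))) u"
    unfolding e act_mult[symmetric] mult.assoc mono2_def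
    by (simp add: mult_single b cocycle algebra_simps flip: fps_const_mult)
  finally show ?thesis .
qed

lemma mono2_swap: "push prod.swap (mono2 t j s i \<gamma>) = const_shift (fps_const ((-1) powi (a i j))) * mono2 s i t j \<gamma>"
proof -
  define c where "c = \<epsilon> (rt t j) (rt s i)"
  have c: "c = (-1) powi (a i j) * \<epsilon> (rt s i) (rt t j)" unfolding c_def by (rule cocycle_swap)
  have "mono2 t j s i \<gamma> = Poly_Mapping.single (form a (rt t j) \<gamma>, form a (rt s i) \<gamma>)
     (sg t * sg s * fps_const (\<epsilon> (rt t j) \<gamma> * \<epsilon> (rt s i) \<gamma> * c))"
    by (simp add: mono2_def c_def)
  then show ?thesis
    unfolding c by (simp add: mono2_def mult_single mult.commute mult.left_commute flip: fps_const_mult)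
qed

lemma XX_correlator_swapped:
  fixes i j :: 'i and s t :: sign and \<beta> :: "'i lattice"
  defines "num \<equiv> orient t (pos_roots a s i j zz) (neg_roots a s i j zz)"
    and "den \<equiv> orient t (neg_roots a s i j zz) (pos_roots a s i j zz)"
    and "\<gamma> \<equiv> \<beta> - rt s i - rt t j"
  shows "act (push prod.swap (zfactors 0 den)) (\<lambda>(p, q). vac \<beta> (X t j q (X s i p (vv \<beta>0)))) u
     = act (push prod.swap (zfactors 0 num) * (const_shift (fps_const ((-1) powi (a i j))) * mono2 s i t j \<gamma>))
         (delta (vac \<gamma> (vv \<beta>0))) u"
proof -
  obtain p q where u: "u = (p, q)" by (cases u)
  have \<gamma>: "\<gamma> = \<beta> - rt t j - rt s i" by (simp add: \<gamma>_def)
  have "act (push prod.swap (zfactors 0 den)) (\<lambda>(p, q). (\<lambda>(q, p). vac \<beta> (X t j q (X s i p (vv \<beta>0)))) (q, p)) (p, q)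
     = act (zfactors 0 num * mono2 t j s i \<gamma>) (delta (vac \<gamma> (vv \<beta>0))) (q, p)"
    unfolding act_swap num_def den_def \<gamma> by (rule XX_correlator)
  also have "\<dots> = act (push prod.swap (zfactors 0 num * mono2 t j s i \<gamma>)) (\<lambda>(p, q). delta (vac \<gamma> (vv \<beta>0)) (q, p)) (p, q)"
    by (rule act_swap[symmetric])
  also have "(\<lambda>(p, q). delta (vac \<gamma> (vv \<beta>0)) (q :: int, p :: int)) = delta (vac \<gamma> (vv \<beta>0))"
    by (auto simp: delta_def zero_prod_def)
  finally show ?thesis
    unfolding u additive_map.push_mult[OF additive_map_swap] mono2_swap by simp
qed

lemma push_eta: "additive_map \<phi> \<Longrightarrow> push \<phi> eta = eta"
  by (simp add: additive_map.map_0)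

lemma push_numeral: "additive_map \<phi> \<Longrightarrow> push \<phi> (2 * L) = 2 * push \<phi> L"
  by (simp only: mult_2 push_add)

lemmas push_rules = push_add push_diff push_numeral push_eta additive_map.push_mult additive_map.push_1
  additive_map_swap additive_map_Pair push_single

lemmas root_rules = pos_roots_def neg_roots_def

end

lemma keys_push_subset: "Poly_Mapping.keys (push \<phi> L) \<subseteq> \<phi> ` Poly_Mapping.keys L"
proof -
  have "Poly_Mapping.keys (push \<phi> L) \<subseteq> (\<Union>t\<in>Poly_Mapping.keys L. Poly_Mapping.keys (Poly_Mapping.single (\<phi> t) (lookup L t)))"
    unfolding push_def by (rule keys_sum)
  then show ?thesis by auto
qed

lemma upper_regular_zfactor: "upper_regular fst (zvar + const_shift b - lift_snd x)"
proof -
  have "upper_regular fst (Poly_Mapping.single (1, 0) 1 + (const_shift b - lift_snd x))"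
  proof (rule upper_regular_linear)
    fix t :: "int \<times> 'a" assume t: "t \<in> Poly_Mapping.keys (const_shift b - lift_snd x)"
    show "fst t = 0"
    proof (rule ccontr)
      assume f: "fst t \<noteq> 0"
      then have "t \<notin> (\<lambda>y. (0, y)) ` Poly_Mapping.keys x" by auto
      then have "t \<notin> Poly_Mapping.keys (lift_snd x)" using keys_push_subset[of "\<lambda>y. (0 :: int, y)" x] by auto
      moreover have "t \<noteq> 0" using f by auto
      ultimately have "lookup (const_shift b - lift_snd x) t = 0"
        by (simp add: lookup_minus lookup_single when_def in_keys_iff)
      then show False using t by (simp add: in_keys_iff)
    qed
  qed simp
  then show ?thesis by (simp add: add_diff_eq)
qed

lemma upper_regular_zfactors: "upper_regular fst (zfactors b xs)"
  by (rule upper_regular_prod_list) (auto simp: upper_regular_zfactor)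

lemma upper_regular_zconst: "upper_regular fst (zvar + const_shift b)"
  using upper_regular_zfactor[of b 0] by simp

lemma upper_regular_swap: "upper_regular fst L \<Longrightarrow> upper_regular snd (push (prod.swap :: int \<times> int \<Rightarrow> _) L)"
proof (induction rule: upper_regular.induct)
  case upper_regular_1
  then show ?case by (simp add: additive_map.push_1 upper_regular.upper_regular_1)
next
  case (upper_regular_mult L L')
  then show ?case by (simp add: additive_map.push_mult upper_regular.upper_regular_mult)
next
  case (upper_regular_linear u L)
  show ?case unfolding push_add push_single
  proof (rule upper_regular.upper_regular_linear)
    show "snd (prod.swap u) = 1" using upper_regular_linear(1) by simp
    fix t assume "t \<in> Poly_Mapping.keys (push prod.swap L)"
    then have "t \<in> prod.swap ` Poly_Mapping.keys L" using keys_push_subset[of prod.swap L] by auto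
    then show "snd t = 0" using upper_regular_linear(2) by auto
  qed
qed

lemma upper_swap:
  assumes "upper fst (\<lambda>(q, p). C q p)"
  shows "upper snd (\<lambda>(p, q). C (q :: int) (p :: int))"
proof -
  obtain K where K: "\<And>x. fst x > K \<Longrightarrow> (\<lambda>(q, p). C q p) x = 0"
    using assms unfolding upper_def by blast
  have "C q p = 0" if "q > K" for q p using K[of "(q, p)"] that by simp
  then show ?thesis unfolding upper_def by (intro exI[of _ K]) auto
qed

lemma regular_push_1:
  "regular (push (\<lambda>p. (p, 0)) (1 :: int shift) :: (int \<times> 'y::ab_group_add) shift)"
  "regular (push (\<lambda>q. (0 :: int, q)) (1 :: 'y shift))"
  by (simp_all add: additive_map.push_1 regular_1)

lemma push_linear:
  "push (\<lambda>p. (p, 0)) (zz + const_shift b) = (zvar + const_shift b :: (int \<times> 'y::ab_group_add) shift)"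
  "push (\<lambda>p. (0 :: int, p)) (zz + const_shift b) = W1 + const_shift b"
  by (simp_all add: push_add zero_prod_def)

lemma regular_push_H_plus:
  "regular (push (\<lambda>p. (p, 0)) ((zz + const_shift b_plus) ^ r * (zz + const_shift b_minus) ^ r) :: (int \<times> 'y::ab_group_add) shift)"
  "regular (push (\<lambda>p. (0 :: int, p)) ((zz + const_shift b_plus) ^ r * (zz + const_shift b_minus) ^ r))"
  by (simp_all only: additive_map.push_mult additive_map.push_power additive_map_Pair push_linear)
     (intro regular_mult regular_power regular_linear; simp)+

lemma push_2: "additive_map \<phi> \<Longrightarrow> push \<phi> 2 = 2"
  using push_add[of \<phi> 1 1] by (simp add: additive_map.push_1)

lemma single_00: "Poly_Mapping.single (0, 0) c = const_shift c"
  by (simp add: zero_prod_def)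

lemma swap_0: "prod.swap (0 :: int \<times> int) = 0"
  by (simp add: zero_prod_def)

lemma const_b_minus: "const_shift b_minus = - (eta :: 'x::ab_group_add shift)"
  by (simp add: single_uminus flip: fps_const_neg)

section \<open>Exchange relations between pairs of fields\<close>

context simply_laced
begin

text \<open>The two orders are expansions, in opposite directions, of num / den and of its exchanged
  form with the sign (-1)^(a_ij). If L and L' turn both into the same Laurent polynomial K, the
  directions no longer matter, since a Laurent polynomial has only one expansion.\<close>

lemma XX_commute:
  fixes i j :: 'i and s t :: sign
  defines "num \<equiv> orient s (pos_roots a t j i zz) (neg_roots a t j i zz)"
    and "den \<equiv> orient s (neg_roots a t j i zz) (pos_roots a t j i zz)"
    and "num' \<equiv> orient t (pos_roots a s i j zz) (neg_roots a s i j zz)"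
    and "den' \<equiv> orient t (neg_roots a s i j zz) (pos_roots a s i j zz)"
  assumes K: "L * zfactors 0 num = K * zfactors 0 den"
    and K': "L' * push prod.swap (zfactors 0 num') * const_shift (fps_const ((-1) powi (a i j)))
       = K * push prod.swap (zfactors 0 den')"
  shows "act L (\<lambda>(p, q). X s i p (X t j q v)) x = act L' (\<lambda>(p, q). X t j q (X s i p v)) x"
proof (rule fields_commute[OF vertex_field_X vertex_field_X regular_push_1])
  fix \<beta> \<beta>0 x
  let ?\<gamma> = "\<beta> - rt s i - rt t j"
  let ?\<mu> = "mono2 s i t j ?\<gamma>"
  have "act L (\<lambda>(p, q). vac \<beta> (X s i p (X t j q (vv \<beta>0)))) x = act (K * ?\<mu>) (delta (vac ?\<gamma> (vv \<beta>0))) x"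
  proof (rule upper_cancel[OF upper_regular_zfactors additive_map_fst_snd(1) X_correlator_upper])
    show "act (zfactors 0 den) (\<lambda>(p, q). vac \<beta> (X s i p (X t j q (vv \<beta>0)))) x
        = act (zfactors 0 num * ?\<mu>) (delta (vac ?\<gamma> (vv \<beta>0))) x" for x
      unfolding num_def den_def by (rule XX_correlator)
    show "L * (zfactors 0 num * ?\<mu>) = K * ?\<mu> * zfactors 0 den"
      using arg_cong[OF K, of "\<lambda>L. L * ?\<mu>"] by (simp only: ac_simps)
  qed
  moreover have "act L' (\<lambda>(p, q). vac \<beta> (X t j q (X s i p (vv \<beta>0)))) x = act (K * ?\<mu>) (delta (vac ?\<gamma> (vv \<beta>0))) x"
  proof (rule upper_cancel[OF upper_regular_swap[OF upper_regular_zfactors] additive_map_fst_snd(2) upper_swap[OF X_correlator_upper]])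
    show "act (push prod.swap (zfactors 0 den')) (\<lambda>(p, q). vac \<beta> (X t j q (X s i p (vv \<beta>0)))) x
        = act (push prod.swap (zfactors 0 num') * (const_shift (fps_const ((-1) powi (a i j))) * ?\<mu>)) (delta (vac ?\<gamma> (vv \<beta>0))) x" for x
      unfolding num'_def den'_def by (rule XX_correlator_swapped)
    show "L' * (push prod.swap (zfactors 0 num') * (const_shift (fps_const ((-1) powi (a i j))) * ?\<mu>))
        = K * ?\<mu> * push prod.swap (zfactors 0 den')"
      using arg_cong[OF K', of "\<lambda>L. L * ?\<mu>"] by (simp only: ac_simps)
  qed
  ultimately show "act L (\<lambda>(p, q). vac \<beta> (X s i p (X t j q (vv \<beta>0)))) x
      = act L' (\<lambda>(p, q). vac \<beta> (X t j q (X s i p (vv \<beta>0)))) x" by simp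
qed

lemma const_minus_1: "const_shift (fps_const (-1)) = (-1 :: 'x::comm_monoid_add shift)"
  by (simp add: single_uminus flip: fps_const_neg)

lemma a_cases: obtains "i = j" "a i j = 2" | "i \<noteq> j" "a i j = -1" "a j i = -1" | "i \<noteq> j" "a i j = 0" "a j i = 0"
  using a_off[of i j] a_sym[of i j] by (cases "i = j") auto

theorem XX_same_sign:
  "act (Z1 - W1 - of_int (sg s * a i j) * eta) (\<lambda>(p, q). X s i p (X s j q v)) x
     = act (Z1 - W1 + of_int (sg s * a i j) * eta) (\<lambda>(p, q). X s j q (X s i p v)) x"
proof (cases rule: a_cases[of i j])
  case 1
  show ?thesis
    \<comment> \<open>For i = j and equal signs there is no denominator; K is L times the numerator
      and comes out the same for both signs.\<close>
    by (rule XX_commute[where K = "(Z1 - W1) * (Z1 - W1 + 2 * eta) * (Z1 - W1 - 2 * eta)"])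
       (insert 1, (cases s; simp add: push_rules push_2 single_00 swap_0 root_rules sg_def; simp add: algebra_simps)+)
next
  case 2
  show ?thesis
    \<comment> \<open>For neighbours L is exactly the single denominator.\<close>
    by (rule XX_commute[where K = 1])
       (insert 2, (cases s; simp add: push_rules push_2 single_00 swap_0 root_rules sg_def const_minus_1)+)
next
  case 3
  show ?thesis
    by (rule XX_commute[where K = "Z1 - W1"])
       (insert 3, (cases s; simp add: push_rules push_2 single_00 swap_0 root_rules)+)
qed

theorem XX_orthogonal:
  assumes "a i j = 0" shows "X s i p (X t j q v) = X t j q (X s i p v)"
proof -
  have "act 1 (\<lambda>(p, q). X s i p (X t j q v)) (p, q) = act 1 (\<lambda>(p, q). X t j q (X s i p v)) (p, q)"
    by (rule XX_commute[where K = 1])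
       (insert assms a_sym[of i j], (cases s; cases t; auto simp add: push_rules push_2 single_00 swap_0 root_rules additive_map.push_1)+)
  then show ?thesis by simp
qed

theorem XX_opposite:
  assumes "i \<noteq> j" shows "X Plus i p (X Minus j q v) = X Minus j q (X Plus i p v)"
proof (cases "a i j = 0")
  case False
  then have a1: "a i j = -1" "a j i = -1" using assms a_off[of i j] a_sym[of i j] by auto
  have "act 1 (\<lambda>(p, q). X Plus i p (X Minus j q v)) (p, q) = act 1 (\<lambda>(p, q). X Minus j q (X Plus i p v)) (p, q)"
    \<comment> \<open>Opposite signs turn the denominator of neighbours into a numerator, so both
      orders are already polynomial up to a monomial.\<close>
    by (rule XX_commute[where K = "Z1 - W1 - eta"])
       (insert assms a1, (simp add: push_rules push_2 single_00 swap_0 root_rules additive_map.push_1 const_minus_1; simp add: algebra_simps)+)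
  then show ?thesis by simp
qed (rule XX_orthogonal)

text \<open>H^- is built from creation operators, so on the left its expectation value is only its
  constant term. On the right it presents X with equally many zeros and poles, and after
  cancellation these leave the quotient of the two linear factors.\<close>

theorem HX_minus:
  "act (Z1 - W1 - of_int (sg s * a i j) * eta) (\<lambda>(p, q). H Minus i p (X s j q v)) x
     = act (Z1 - W1 + of_int (sg s * a i j) * eta) (\<lambda>(p, q). X s j q (H Minus i p v)) x"
proof (rule fields_commute[OF vertex_field_H_minus vertex_field_X regular_push_1])
  fix \<beta> \<beta>0 x
  let ?L = "Z1 - W1 - of_int (sg s * a i j) * eta" and ?L' = "Z1 - W1 + of_int (sg s * a i j) * eta"
  define \<gamma> where "\<gamma> = \<beta> - rt s j"
  define e \<kappa> where "e = form a (rt s j) \<gamma>" and "\<kappa> = sg s * fps_const (\<epsilon> (rt s j) \<gamma>)"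
  define \<omega> where "\<omega> = vac \<gamma> (vv \<beta>0)"
  define \<mu> :: "(int \<times> int) shift" where "\<mu> = Poly_Mapping.single (0, e) \<kappa>"
  define xs where "xs = pos_roots a Minus i j zz @ pos_roots a Plus i j zz"
  define ys where "ys = neg_roots a Minus i j zz @ neg_roots a Plus i j zz"
  define num den where "num = orient s xs ys" and "den = orient s ys xs"
  have len: "length num = length den"
    by (cases s) (auto simp: num_def den_def xs_def ys_def root_rules)
  have "(\<lambda>(p, q). vac \<beta> (H Minus i p (X s j q (vv \<beta>0)))) = at_zero (\<lambda>q. vac \<beta> (X s j q (vv \<beta>0)))"
    by (auto simp: at_zero_def vac_H_minus)
  also have "\<dots> = act \<mu> (delta \<omega>)"
    unfolding vac_X_vv at_zero_delta by (simp add: \<mu>_def e_def \<kappa>_def \<gamma>_def \<omega>_def)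
  finally have 1: "act ?L (\<lambda>(p, q). vac \<beta> (H Minus i p (X s j q (vv \<beta>0)))) x = act (?L * \<mu>) (delta \<omega>) x"
    by (simp only: act_mult)
  have C: "act (zfactors 0 den) (\<lambda>(q, p). vac \<beta> (X s j q (H Minus i p (vv \<beta>0)))) u
      = act (zfactors 0 num * Poly_Mapping.single (e, 0) \<kappa>) (delta \<omega>) u" for u
  proof -
    have "act (zfactors 0 den) (\<lambda>(q, p). vac \<beta> (X s j q (H Minus i p (vv \<beta>0)))) u
       = act (zfactors 0 num * Poly_Mapping.single (form a (rt s j) (\<beta> - rt s j) + int (length den) - int (length num), 0)
          (sg s * fps_const (\<epsilon> (rt s j) (\<beta> - rt s j)))) (at_zero (\<lambda>p. vac (\<beta> - rt s j) (H Minus i p (vv \<beta>0)))) u"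
      unfolding num_def den_def by (rule X_correlator) (simp only: xs_def ys_def H_minus_vv_eigen)
    also have "at_zero (\<lambda>p. vac (\<beta> - rt s j) (H Minus i p (vv \<beta>0))) = delta \<omega>"
      by (auto simp: at_zero_def vac_H_minus delta_def zero_prod_def \<omega>_def \<gamma>_def)
    finally show ?thesis by (simp add: len e_def \<kappa>_def \<gamma>_def)
  qed
  have "act ?L' (\<lambda>(p, q). vac \<beta> (X s j q (H Minus i p (vv \<beta>0)))) x = act (?L * \<mu>) (delta \<omega>) x"
  proof (rule upper_cancel[OF upper_regular_swap[OF upper_regular_zfactors] additive_map_fst_snd(2) upper_swap[OF X_correlator_upper]])
    fix x :: "int \<times> int" obtain p q where x: "x = (p, q)" by (cases x)
    have "act (push prod.swap (zfactors 0 den)) (\<lambda>(p, q). (\<lambda>(q, p). vac \<beta> (X s j q (H Minus i p (vv \<beta>0)))) (q, p)) (p, q)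
       = act (zfactors 0 num * Poly_Mapping.single (e, 0) \<kappa>) (delta \<omega>) (q, p)"
      unfolding act_swap by (rule C)
    also have "\<dots> = act (push prod.swap (zfactors 0 num * Poly_Mapping.single (e, 0) \<kappa>)) (\<lambda>(p, q). delta \<omega> (q, p)) (p, q)"
      by (rule act_swap[symmetric])
    also have "(\<lambda>(p, q). delta \<omega> (q :: int, p :: int)) = delta \<omega>"
      by (auto simp: delta_def zero_prod_def)
    also have "push prod.swap (zfactors 0 num * Poly_Mapping.single (e, 0) \<kappa>) = push prod.swap (zfactors 0 num) * \<mu>"
      by (simp add: additive_map.push_mult \<mu>_def)
    finally show "act (push prod.swap (zfactors 0 den)) (\<lambda>(p, q). vac \<beta> (X s j q (H Minus i p (vv \<beta>0)))) x
        = act (push prod.swap (zfactors 0 num) * \<mu>) (delta \<omega>) x" by (simp add: x)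
  next
    have "?L' * push prod.swap (zfactors 0 num) = ?L * push prod.swap (zfactors 0 den)"
    proof (cases rule: a_cases[of i j])
      case 1
      then show ?thesis
        by (cases s; simp add: num_def den_def xs_def ys_def push_rules push_2 single_00 swap_0 root_rules sg_def; simp add: algebra_simps)
    next
      case 2
      then show ?thesis
        by (cases s; simp add: num_def den_def xs_def ys_def push_rules push_2 single_00 swap_0 root_rules sg_def; simp add: algebra_simps)
    next
      case 3
      then show ?thesis
        by (cases s; simp add: num_def den_def xs_def ys_def push_rules push_2 single_00 swap_0 root_rules)
    qed
    from arg_cong[OF this, of "\<lambda>L. L * \<mu>"]
    show "?L' * (push prod.swap (zfactors 0 num) * \<mu>) = ?L * \<mu> * push prod.swap (zfactors 0 den)"
      by (simp only: ac_simps)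
  qed
  then show "act ?L (\<lambda>(p, q). vac \<beta> (H Minus i p (X s j q (vv \<beta>0)))) x
      = act ?L' (\<lambda>(p, q). vac \<beta> (X s j q (H Minus i p (vv \<beta>0)))) x"
    using 1 by simp
qed

text \<open>Covers G = X and G = H^- together; \<theta> is the weight that G adds and \<kappa> its
  scalar. H^+ sees weight \<beta> on the left and \<beta> - \<theta> on the right;
  \<open>len\<close> makes the resulting extra power of the ratio cancel against the zero roots of
  \<open>H_plus_correlator\<close>.\<close>

lemma H_plus_commute:
  assumes G: "vertex_field l (\<lambda>k r. 1) m G"
    and eigen: "\<And>r q \<beta>0. 0 < r \<Longrightarrow> heis_pos i r (G q (vv \<beta>0)) = act (psum xs r - psum ys r) (\<lambda>q. G q (vv \<beta>0)) q"
    and vacG: "\<And>\<beta> \<beta>0. (\<lambda>q. vac \<beta> (G q (vv \<beta>0))) = act (Poly_Mapping.single (e \<beta>) (\<kappa> \<beta>)) (delta (vac (\<beta> - \<theta>) (vv \<beta>0)))"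
    and len: "form a (Poly_Mapping.single i 1) \<theta> = int (length xs) - int (length ys)"
    and L: "L * (zfactors b_minus ys * zfactors b_plus xs) = L' * (zfactors b_minus xs * zfactors b_plus ys)"
  shows "act L (\<lambda>(p, q). H Plus i p (G q v)) x = act L' (\<lambda>(p, q). G q (H Plus i p v)) x"
proof (rule fields_commute[OF vertex_field_H_plus G regular_push_H_plus(1) regular_push_1(2)])
  fix \<beta> \<beta>0 x
  define \<gamma> \<omega> where "\<gamma> = \<beta> - \<theta>" and "\<omega> = vac \<gamma> (vv \<beta>0)"
  define n where "n = form a (Poly_Mapping.single i 1) \<gamma>"
  define N1 N2 where "N1 = nat n" and "N2 = nat (- n)"
  have n: "n = int N1 - int N2" by (simp add: N1_def N2_def)
  define \<mu> :: "(int \<times> int) shift" where "\<mu> = Poly_Mapping.single (0, e \<beta>) (\<kappa> \<beta>)"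
  let ?A = "zvar + const_shift b_minus :: (int \<times> int) shift" and ?B = "zvar + const_shift b_plus :: (int \<times> int) shift"
  let ?x = "length xs" and ?y = "length ys"
  have \<beta>: "form a (Poly_Mapping.single i 1) \<beta> = int (N1 + ?x) - int (N2 + ?y)"
  proof -
    have "\<beta> = \<gamma> + \<theta>" by (simp add: \<gamma>_def)
    then show ?thesis using len n by (simp add: form_add_right n_def)
  qed
  have mu: "at_zero (\<lambda>q. vac \<beta> (G q (vv \<beta>0))) = act \<mu> (delta \<omega>)"
    unfolding vacG at_zero_delta by (simp add: \<mu>_def \<omega>_def \<gamma>_def)
  define M N where "M = (?A ^ (N1 + ?x) * ?B ^ (N2 + ?y)) * (zfactors b_minus xs * ?A ^ ?y) * (zfactors b_plus ys * ?B ^ ?x)"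
    and "N = (?B ^ (N1 + ?x) * ?A ^ (N2 + ?y)) * (zfactors b_minus ys * ?A ^ ?x) * (zfactors b_plus xs * ?B ^ ?y)"
  have C: "act M (\<lambda>(p, q). vac \<beta> (H Plus i p (G q (vv \<beta>0)))) u = act (N * \<mu>) (delta \<omega>) u" for u
    using H_plus_correlator[OF eigen \<beta>, of \<beta>0 u] unfolding M_def N_def mu act_mult[of _ \<mu>] .
  have linG: "lin (G q)" for q using G by (simp add: vertex_field_def)
  have C': "act (?A ^ N1 * ?B ^ N2) (\<lambda>(p, q). vac \<beta> (G q (H Plus i p (vv \<beta>0)))) u
      = act (?B ^ N1 * ?A ^ N2 * \<mu>) (delta \<omega>) u" for u
  proof (cases "\<gamma> = \<beta>0")
    case True
    obtain p q where u: "u = (p, q)" by (cases u)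
    have z: "zvar + const_shift c = push (\<lambda>p. (p, 0 :: int)) (zz + const_shift c)" for c
      by (simp add: push_add zero_prod_def)
    have "act (?A ^ N1 * ?B ^ N2) (\<lambda>(p, q). vac \<beta> (G q (H Plus i p (vv \<beta>0)))) (p, q)
       = act ((zz + const_shift b_minus) ^ N1 * (zz + const_shift b_plus) ^ N2)
           (\<lambda>p. hsmult (ratio_powers n p) (vac \<beta> (G q (vv \<beta>0)))) p"
      unfolding z
      by (simp only: act_push_fst additive_map.push_power[OF additive_map_Pair(1), symmetric]
          additive_map.push_mult[OF additive_map_Pair(1), symmetric] prod.case H_plus_vv
          module_hom.scale[OF linG] module_hom.scale[OF lin_vac] n_def True)
    also have "\<dots> = act ((zz + const_shift b_plus) ^ N1 * (zz + const_shift b_minus) ^ N2)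
           (\<lambda>p. if p = 0 then vac \<beta> (G q (vv \<beta>0)) else 0) p"
      by (rule ratio_powers_eq[OF n])
    also have "\<dots> = act (?B ^ N1 * ?A ^ N2) (at_zero (\<lambda>q. vac \<beta> (G q (vv \<beta>0)))) (p, q)"
      unfolding z
      by (simp only: act_push_fst additive_map.push_power[OF additive_map_Pair(1), symmetric]
          additive_map.push_mult[OF additive_map_Pair(1), symmetric] at_zero_def prod.case)
    finally show ?thesis unfolding mu u act_mult[of _ \<mu>] .
  next
    case False
    then have \<omega>: "\<omega> = 0" by (simp add: \<omega>_def vac_vv)
    have d0: "delta (0 :: 'i fock fps) = (\<lambda>x. 0 :: 'i fock fps)" for x by (rule ext) (simp add: delta_def)
    have "vac \<beta> (G q (vv \<beta>0)) = 0" for q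
      using fun_cong[OF vacG[of \<beta> \<beta>0], of q] \<omega> by (simp add: \<omega>_def \<gamma>_def delta_def)
    then show ?thesis
      by (simp add: \<omega> H_plus_vv module_hom.scale[OF linG] module_hom.scale[OF lin_vac] case_prod_unfold
          delta_def[abs_def])
  qed
  have ureg: "upper_regular fst ?A" "upper_regular fst ?B" by (rule upper_regular_zconst)+
  show "act L (\<lambda>(p, q). vac \<beta> (H Plus i p (G q (vv \<beta>0)))) x = act L' (\<lambda>(p, q). vac \<beta> (G q (H Plus i p (vv \<beta>0)))) x"
  proof (rule upper_compare[OF _ _ additive_map_fst_snd(1) H_plus_correlator_upper _ C C'])
    show "upper_regular fst M"
      unfolding M_def by (intro upper_regular_mult upper_regular_power upper_regular_zfactors ureg)
    show "upper_regular fst (?A ^ N1 * ?B ^ N2)"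
      by (intro upper_regular_mult upper_regular_power ureg)
    show "upper fst (\<lambda>(p, q). vac \<beta> (G q (H Plus i p (vv \<beta>0))))"
      unfolding upper_def by (intro exI[of _ 0]) (auto simp: H_plus_pos module_hom.zero[OF lin_vac] module_hom.zero[OF linG])
    define A B where "A = ?A" and "B = ?B"
    have "L * (A ^ N1 * B ^ N2) * (N * \<mu>)
       = (L * (zfactors b_minus ys * zfactors b_plus xs)) * (A ^ (N1 + N2 + ?x + ?y) * B ^ (N1 + N2 + ?x + ?y) * \<mu>)"
      unfolding N_def A_def[symmetric] B_def[symmetric] power_add by (simp only: ac_simps)
    also have "\<dots> = (L' * (zfactors b_minus xs * zfactors b_plus ys)) * (A ^ (N1 + N2 + ?x + ?y) * B ^ (N1 + N2 + ?x + ?y) * \<mu>)"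
      by (simp only: L)
    also have "\<dots> = L' * M * (B ^ N1 * A ^ N2 * \<mu>)"
      unfolding M_def A_def[symmetric] B_def[symmetric] power_add by (simp only: ac_simps)
    finally show "L * (?A ^ N1 * ?B ^ N2) * (N * \<mu>) = L' * M * (?B ^ N1 * ?A ^ N2 * \<mu>)"
      by (simp only: A_def B_def)
  qed
qed

lemma rt_Plus: "Poly_Mapping.single i (1 :: int) = rt Plus i"
  by (simp add: sg_def)

text \<open>The two arguments z +/- hbar/2 of H^+ shift each root of X by +/- \<open>eta\<close>.
  For i = j the two roots differ by hbar, so the inner factors cancel and one quotient of linear
  factors remains.\<close>

theorem HX_plus:
  "act (Z1 - W1 - of_int (sg s * (a i j - 1)) * eta) (\<lambda>(p, q). H Plus i p (X s j q v)) x
     = act (Z1 - W1 + of_int (sg s * (a i j + 1)) * eta) (\<lambda>(p, q). X s j q (H Plus i p v)) x"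
proof (rule H_plus_commute[OF vertex_field_X, where xs = "pos_roots a s j i zz" and ys = "neg_roots a s j i zz" and \<theta> = "rt s j"])
  show "heis_pos i r (X s j q (vv \<beta>0)) = act (psum (pos_roots a s j i zz) r - psum (neg_roots a s j i zz) r)
      (\<lambda>q. X s j q (vv \<beta>0)) q" if "0 < r" for r q \<beta>0
    using X_vv_eigen[OF that] by (simp add: lam_def)
  show "(\<lambda>q. vac \<beta> (X s j q (vv \<beta>0))) = act (Poly_Mapping.single (form a (rt s j) (\<beta> - rt s j))
      (sg s * fps_const (\<epsilon> (rt s j) (\<beta> - rt s j)))) (delta (vac (\<beta> - rt s j) (vv \<beta>0)))" for \<beta> \<beta>0
    by (rule vac_X_vv)
  show "form a (Poly_Mapping.single i 1) (rt s j) = int (length (pos_roots a s j i (zz :: int shift))) - int (length (neg_roots a s j i (zz :: int shift)))"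
    using length_roots[of Plus s j i "zz :: int shift"] unfolding rt_Plus form_rt by (simp add: sg_def)
  show "(Z1 - W1 - of_int (sg s * (a i j - 1)) * eta) * (zfactors b_minus (neg_roots a s j i zz) * zfactors b_plus (pos_roots a s j i zz))
      = (Z1 - W1 + of_int (sg s * (a i j + 1)) * eta) * (zfactors b_minus (pos_roots a s j i zz) * zfactors b_plus (neg_roots a s j i zz))"
    unfolding const_b_minus
  proof (cases rule: a_cases[of i j])
    case 1
    then show "(Z1 - W1 - of_int (sg s * (a i j - 1)) * eta) * ((\<Prod>x\<leftarrow>neg_roots a s j i zz. Z1 + - eta - lift_snd x) * zfactors b_plus (pos_roots a s j i zz))
      = (Z1 - W1 + of_int (sg s * (a i j + 1)) * eta) * ((\<Prod>x\<leftarrow>pos_roots a s j i zz. Z1 + - eta - lift_snd x) * zfactors b_plus (neg_roots a s j i zz))"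
      by (cases s; simp add: push_rules push_2 single_00 swap_0 root_rules sg_def; simp add: algebra_simps)
  next
    case 2
    then show "(Z1 - W1 - of_int (sg s * (a i j - 1)) * eta) * ((\<Prod>x\<leftarrow>neg_roots a s j i zz. Z1 + - eta - lift_snd x) * zfactors b_plus (pos_roots a s j i zz))
      = (Z1 - W1 + of_int (sg s * (a i j + 1)) * eta) * ((\<Prod>x\<leftarrow>pos_roots a s j i zz. Z1 + - eta - lift_snd x) * zfactors b_plus (neg_roots a s j i zz))"
      by (cases s; simp add: push_rules push_2 single_00 swap_0 root_rules sg_def; simp add: algebra_simps)
  next
    case 3
    then show "(Z1 - W1 - of_int (sg s * (a i j - 1)) * eta) * ((\<Prod>x\<leftarrow>neg_roots a s j i zz. Z1 + - eta - lift_snd x) * zfactors b_plus (pos_roots a s j i zz))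
      = (Z1 - W1 + of_int (sg s * (a i j + 1)) * eta) * ((\<Prod>x\<leftarrow>pos_roots a s j i zz. Z1 + - eta - lift_snd x) * zfactors b_plus (neg_roots a s j i zz))"
      by (cases s; simp add: push_rules push_2 single_00 swap_0 root_rules sg_def)
  qed
qed

theorem HH_mixed:
  "act ((Z1 - W1)\<^sup>2 - (of_int (a i j - 1) * eta)\<^sup>2) (\<lambda>(p, q). H Plus i p (H Minus j q v)) x
     = act ((Z1 - W1)\<^sup>2 - (of_int (a i j + 1) * eta)\<^sup>2) (\<lambda>(p, q). H Minus j q (H Plus i p v)) x"
proof (rule H_plus_commute[OF vertex_field_H_minus H_minus_vv_eigen, where \<theta> = 0 and e = "\<lambda>_. 0" and \<kappa> = "\<lambda>_. 1"])
  show "(\<lambda>q. vac \<beta> (H Minus j q (vv \<beta>0))) = act (Poly_Mapping.single 0 1) (delta (vac (\<beta> - 0) (vv \<beta>0)))" for \<beta> \<beta>0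
    by (rule ext) (simp add: vac_H_minus delta_def del: single_one)
  show "form a (Poly_Mapping.single i 1) 0 = int (length (pos_roots a Minus j i (zz :: int shift) @ pos_roots a Plus j i zz))
      - int (length (neg_roots a Minus j i (zz :: int shift) @ neg_roots a Plus j i zz))"
    by (simp add: form_def root_rules)
  let ?goal = "((Z1 - W1)\<^sup>2 - (of_int (a i j - 1) * eta)\<^sup>2) *
        ((\<Prod>x\<leftarrow>neg_roots a Minus j i zz @ neg_roots a Plus j i zz. Z1 + - eta - lift_snd x) * zfactors b_plus (pos_roots a Minus j i zz @ pos_roots a Plus j i zz))
      = ((Z1 - W1)\<^sup>2 - (of_int (a i j + 1) * eta)\<^sup>2) *
        ((\<Prod>x\<leftarrow>pos_roots a Minus j i zz @ pos_roots a Plus j i zz. Z1 + - eta - lift_snd x) * zfactors b_plus (neg_roots a Minus j i zz @ neg_roots a Plus j i zz))"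
  have ?goal
  proof (cases rule: a_cases[of i j])
    case 1
    define x where "x = Z1 - W1"
    have f: "Z1 + c - W1 = x + c" "Z1 + c - (W1 - d) = x + c + d" "Z1 + c - (W1 + d) = x + c - d" for c d :: "(int \<times> int) shift"
      by (simp_all add: x_def algebra_simps)
    show ?thesis using 1
      by (simp add: push_rules push_2 single_00 swap_0 root_rules f x_def[symmetric]) (simp add: power2_eq_square algebra_simps)
  next
    case 2
    then show ?thesis by (simp add: push_rules push_2 single_00 swap_0 root_rules power2_eq_square; simp add: algebra_simps)
  next
    case 3
    then show ?thesis by (simp add: push_rules push_2 single_00 swap_0 root_rules)
  qed
  then show "((Z1 - W1)\<^sup>2 - (of_int (a i j - 1) * eta)\<^sup>2) *
        (zfactors b_minus (neg_roots a Minus j i zz @ neg_roots a Plus j i zz) * zfactors b_plus (pos_roots a Minus j i zz @ pos_roots a Plus j i zz))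
      = ((Z1 - W1)\<^sup>2 - (of_int (a i j + 1) * eta)\<^sup>2) *
        (zfactors b_minus (pos_roots a Minus j i zz @ pos_roots a Plus j i zz) * zfactors b_plus (neg_roots a Minus j i zz @ neg_roots a Plus j i zz))"
    unfolding const_b_minus .
qed

text \<open>For the plus series the expectation values are products of two scalars, and for the
  minus series only constant terms survive; both are symmetric.\<close>

theorem HH_same_sign: "H s i p (H s j q v) = H s j q (H s i p v)"
proof -
  have "act 1 (\<lambda>(p, q). H s i p (H s j q v)) (p, q) = act 1 (\<lambda>(p, q). H s j q (H s i p v)) (p, q)"
  proof (cases s)
    case Plus
    show ?thesis unfolding Plus
      by (rule fields_commute[OF vertex_field_H_plus vertex_field_H_plus regular_push_H_plus])
         (auto simp: H_plus_vv module_hom.scale[OF lin_H_plus] module_hom.scale[OF lin_vac] mult.commute)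
  next
    case Minus
    show ?thesis unfolding Minus
      by (rule fields_commute[OF vertex_field_H_minus vertex_field_H_minus regular_push_1])
         (auto simp: vac_H_minus)
  qed
  then show ?thesis by simp
qed

end

section \<open>The bracket of \<open>X\<^sup>+\<close> and \<open>X\<^sup>-\<close>\<close>

lemma act_dvd_eq_0:
  assumes "T dvd L" "\<And>x. act T U x = 0" shows "act L U x = 0"
proof -
  obtain R where "L = R * T" using assms(1) by (metis dvd_def mult.commute)
  moreover have "act T U = (\<lambda>x. 0)" using assms(2) by blast
  ultimately show ?thesis by (simp add: act_mult)
qed

text \<open>On families killed by T one may compute modulo T: on delta(w + hbar, z) replace z by w +
  hbar, on delta(w, z) replace z by w.\<close>

lemma act_dvd_eq:
  assumes "T dvd L - L'" "\<And>x. act T U x = 0" shows "act L U x = act L' U x"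
  using act_dvd_eq_0[OF assms, of x] by (simp add: act_diff_left)

lemma diff_dvd_power_diff: "(a - b :: 'a::comm_ring_1) dvd a ^ n - b ^ n"
  by (simp add: power_diff_sumr2)

lemma two_eta: "2 * (eta :: 'x::comm_monoid_add shift) = const_shift fps_X"
proof -
  have "(2 :: 'x shift) = const_shift 2" by simp
  then have "2 * (eta :: 'x shift) = const_shift (2 * (fps_const (1/2) * fps_X))"
    by (simp only: mult_single) simp
  also have "2 * (fps_const (1/2) * fps_X) = (fps_X :: complex fps)"
  proof -
    have "2 * fps_const (1/2) = (1 :: complex fps)"
      by (simp flip: fps_numeral_fps_const)
    then show ?thesis by (simp only: mult.assoc[symmetric]) simp
  qed
  finally show ?thesis .
qed

lemma shift_series_zz_const:
  assumes "\<And>n. K < n \<Longrightarrow> U n = 0"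
  shows "act (zz + const_shift (b + c)) (shift_series b U) p = shift_series b (act (zz + const_shift c) U) p"
proof -
  have fn: "act (zz + const_shift c) U = (\<lambda>n. act zz U n - hsmult (- c) (U n))"
    by (rule ext) (simp add: act_add_left)
  have "shift_series b (act (zz + const_shift c) U) p = shift_series b (\<lambda>n. act zz U n - hsmult (- c) (U n)) p"
    by (simp only: fn)
  also have "\<dots> = shift_series b (act zz U) p - shift_series b (\<lambda>n. hsmult (- c) (U n)) p"
    by (rule shift_series_diff[of "K + 1"]) (simp_all add: assms)
  also have "shift_series b (\<lambda>n. hsmult (- c) (U n)) p = hsmult (- c) (shift_series b U p)"
    by (rule shift_series_lin[symmetric, OF assms lin_hsmult[OF lin_id(1)]]) simp
  also have "shift_series b (act zz U) p = act (zz + const_shift b) (shift_series b U) p"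
    by (rule shift_series_zz[symmetric, OF assms])
  finally have e: "shift_series b (act (zz + const_shift c) U) p
    = act (zz + const_shift b) (shift_series b U) p - hsmult (- c) (shift_series b U p)" .
  have "hsmult (b + c) (shift_series b U p)
    = hsmult b (shift_series b U p) - hsmult (- c) (shift_series b U p)"
    by (simp add: hs.scale_left_distrib)
  then show ?thesis
    unfolding e by (simp add: act_add_left)
qed

lemma shift_series_zz_const_power:
  assumes "\<And>n. K < n \<Longrightarrow> U n = 0"
  shows "act ((zz + const_shift (b + c)) ^ r) (shift_series b U) = shift_series b (act ((zz + const_shift c) ^ r) U)
    \<and> (\<forall>n. K + int r < n \<longrightarrow> act ((zz + const_shift c) ^ r) U n = 0)"
proof (induction r)
  case 0
  have "act 1 V = V" for V :: "int \<Rightarrow> 'a fock fps" by (rule ext) simp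
  then show ?case using assms by simp
next
  case (Suc r)
  have e: "act ((zz + const_shift c) ^ Suc r) U = act (zz + const_shift c) (act ((zz + const_shift c) ^ r) U)"
    by (rule ext) (simp only: power_Suc act_mult)
  have "act ((zz + const_shift (b + c)) ^ Suc r) (shift_series b U)
      = act (zz + const_shift (b + c)) (shift_series b (act ((zz + const_shift c) ^ r) U))"
    by (rule ext) (simp only: power_Suc act_mult Suc)
  also have "\<dots> = shift_series b (act (zz + const_shift c) (act ((zz + const_shift c) ^ r) U))"
    by (rule ext, rule shift_series_zz_const[of "K + int r"]) (use Suc in blast)
  finally have 1: "act ((zz + const_shift (b + c)) ^ Suc r) (shift_series b U)
      = shift_series b (act ((zz + const_shift c) ^ Suc r) U)" unfolding e .
  have 2: "act ((zz + const_shift c) ^ Suc r) U n = 0" if "K + int (Suc r) < n" for n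
    unfolding e using that Suc by (simp add: act_add_left)
  show ?case using 1 2 by blast
qed

lemma shift_series_zz_const_powers:
  assumes "\<And>n. K < n \<Longrightarrow> U n = 0"
  shows "act ((zz + const_shift (b + c)) ^ r * (zz + const_shift (b + d)) ^ m) (shift_series b U) p
       = shift_series b (act ((zz + const_shift c) ^ r * (zz + const_shift d) ^ m) U) p"
proof -
  let ?V = "act ((zz + const_shift d) ^ m) U"
  note V = shift_series_zz_const_power[OF assms, where c = d and r = m and b = b]
  have "act ((zz + const_shift (b + c)) ^ r) (shift_series b ?V) = shift_series b (act ((zz + const_shift c) ^ r) ?V)"
    by (rule shift_series_zz_const_power[THEN conjunct1, of "K + int m"]) (rule V[THEN conjunct2, rule_format])
  moreover have "act ((zz + const_shift c) ^ r * (zz + const_shift d) ^ m) U = act ((zz + const_shift c) ^ r) ?V"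
    by (rule ext) (rule act_mult)
  ultimately show ?thesis using V by (simp add: act_mult)
qed

text \<open>The coefficient of \<open>z\<^sup>p\<close> in \<open>\<delta>(w + \<hbar>, z) V(w)\<close>, as a series in \<open>w\<close>.\<close>

definition delta_times :: "int \<Rightarrow> (int \<Rightarrow> 'i fock fps) \<Rightarrow> int \<Rightarrow> 'i fock fps" where
  "delta_times p V q = hsum (\<lambda>n. hsmult (shifted_power fps_X (- p - 1) n) (V (q - n)))"

lemma delta_times_summable:
  assumes "\<And>n. K < n \<Longrightarrow> V n = 0"
  shows "hsummable (\<lambda>n. hsmult (shifted_power fps_X r n) (V (q - n)))"
proof (rule hsummable_finite[of "{q - K..r}"])
  fix n assume "n \<notin> {q - K..r}"
  then have "K < q - n \<or> r < n" by auto
  then show "hsmult (shifted_power fps_X r n) (V (q - n)) = 0"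
    using assms by (auto simp: shifted_power_outside)
qed simp

lemma delta_times_sum:
  assumes "\<And>n. 0 < n \<Longrightarrow> V n = 0"
  shows "delta_times p V q = (\<Sum>n\<in>{q..- p - 1}. hsmult (shifted_power fps_X (- p - 1) n) (V (q - n)))"
  unfolding delta_times_def
proof (rule hsum_eq_sum)
  fix n assume "n \<notin> {q..- p - 1}"
  then have "0 < q - n \<or> - p - 1 < n" by auto
  then show "hsmult (shifted_power fps_X (- p - 1) n) (V (q - n)) = 0"
    using assms by (auto simp: shifted_power_outside)
qed simp

lemma act_delta_times:
  assumes "\<And>n. K < n \<Longrightarrow> V n = 0"
  shows "act L (delta_times p V) q = delta_times p (act L V) q"
  unfolding delta_times_def
  by (rule act_convolution_right[OF lin_hsmult[OF lin_id(1)] delta_times_summable[OF assms]])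

lemma delta_times_lin:
  assumes "\<And>n. K < n \<Longrightarrow> V n = 0" and T: "lin T"
  shows "T (delta_times p V q) = delta_times p (\<lambda>n. T (V n)) q"
  unfolding delta_times_def module_hom.scale[OF T, symmetric]
  by (rule hsum_lin[OF T delta_times_summable[where V = V, OF assms(1)]])

lemma delta_times_diff:
  assumes "\<And>n. K < n \<Longrightarrow> V n = 0" "\<And>n. K < n \<Longrightarrow> W n = 0"
  shows "delta_times p (\<lambda>n. V n - W n) q = delta_times p V q - delta_times p W q"
  unfolding delta_times_def hs.scale_right_diff_distrib
  by (rule hsum_diff[OF delta_times_summable[where V = V, OF assms(1)] delta_times_summable[where V = W, OF assms(2)]])

text \<open>Pascal's rule for (w + hbar)^-p says z delta(w + hbar, z) = (w + hbar) delta(w + hbar,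
  z), and 2 \<open>eta\<close> is hbar.\<close>

lemma delta_times_z:
  assumes V: "\<And>n. K < n \<Longrightarrow> V n = 0"
  shows "act (Z1 - W1 - 2 * eta) (\<lambda>(p, q). delta_times p V q) x = 0"
proof -
  obtain p q where x: "x = (p, q)" by (cases x)
  note s = delta_times_summable[where V = V, OF V]
  have "delta_times (p - 1) V q = hsum (\<lambda>n. hsmult (shifted_power fps_X (- p - 1) (n - 1)) (V (q - n))
      + hsmult fps_X (hsmult (shifted_power fps_X (- p - 1) n) (V (q - n))))"
    using shifted_power_Suc[of fps_X "- p - 1"]
    by (simp add: delta_times_def hs.scale_left_distrib)
  also have "\<dots> = hsum (\<lambda>n. hsmult (shifted_power fps_X (- p - 1) (n - 1)) (V (q - n)))
      + hsum (\<lambda>n. hsmult fps_X (hsmult (shifted_power fps_X (- p - 1) n) (V (q - n))))"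
  proof (rule hsum_add)
    have "hsummable (\<lambda>n. hsmult (shifted_power fps_X (- p - 1) (n - 1)) (V ((q - 1) - (n - 1))))"
      by (rule hsummable_bij[OF bij_diff_right[of 1] s])
    then show "hsummable (\<lambda>n. hsmult (shifted_power fps_X (- p - 1) (n - 1)) (V (q - n)))" by simp
    show "hsummable (\<lambda>n. hsmult fps_X (hsmult (shifted_power fps_X (- p - 1) n) (V (q - n))))"
      by (rule hsummable_lin[OF lin_hsmult[OF lin_id(1)] s])
  qed
  also have "hsum (\<lambda>n. hsmult (shifted_power fps_X (- p - 1) (n - 1)) (V (q - n))) = delta_times p V (q - 1)"
    using hsum_bij[OF bij_diff_right, of "\<lambda>n. hsmult (shifted_power fps_X (- p - 1) n) (V (q - 1 - n))" 1]
    by (simp add: delta_times_def)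
  also have "hsum (\<lambda>n. hsmult fps_X (hsmult (shifted_power fps_X (- p - 1) n) (V (q - n)))) = hsmult fps_X (delta_times p V q)"
    unfolding delta_times_def by (rule hsum_lin[OF lin_hsmult[OF lin_id(1)] s, symmetric])
  finally show ?thesis by (simp add: x two_eta act_diff_left)
qed

section \<open>The two delta terms as vertex families\<close>

context simply_laced
begin

text \<open>H^+(w + hbar/2), which is h^+(w + hbar c / 2) at c = 1.\<close>

definition H_shifted :: "'i \<Rightarrow> 'i opser" where
  "H_shifted i q v = shift_series b_plus (\<lambda>n. H Plus i n v) q"

lemma H_shifted_pos: "0 < q \<Longrightarrow> H_shifted i q v = 0"
  unfolding H_shifted_def by (subst shift_series_sum[of 0]) (auto simp: H_plus_pos)

lemma lin_H_shifted: "lin (H_shifted i q)"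
proof -
  have "lin (\<lambda>v. shift_series b_plus (\<lambda>n. H Plus i n v) q)"
    by (rule lin_shift_series[OF lin_H_plus, of 0]) (simp add: H_plus_pos)
  then show ?thesis by (simp add: H_shifted_def[abs_def])
qed

lemma heis_pos_H_shifted: "heis_pos k r (H_shifted i q v) = H_shifted i q (heis_pos k r v)"
proof -
  have "heis_pos k r (shift_series b_plus (\<lambda>n. H Plus i n v) q) = shift_series b_plus (\<lambda>n. heis_pos k r (H Plus i n v)) q"
    by (rule shift_series_lin[of 0]) (simp_all add: H_plus_pos)
  then show ?thesis by (simp add: H_shifted_def heis_pos_H_plus)
qed

lemma b_sums: "b_plus + b_minus = 0" "b_plus + b_plus = fps_X" "const_shift (b_plus + b_minus) = 0"
proof -
  show 1: "b_plus + b_minus = 0" by (simp flip: fps_const_neg)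
  show "b_plus + b_plus = fps_X"
    by (simp flip: distrib_right)
  show "const_shift (b_plus + b_minus) = 0" unfolding 1 by simp
qed

text \<open>The substitution moves the denominators z + hbar/2 and z - hbar/2 of H^+(z) to w + hbar
  and w.\<close>

lemma heis_neg_H_shifted:
  assumes r: "0 < r"
  shows "act ((zz + const_shift fps_X) ^ r * zz ^ r) (\<lambda>q. heis_neg k r (H_shifted i q v) - H_shifted i q (heis_neg k r v)) q
     = act (if k = i then zz ^ r - (zz + const_shift fps_X) ^ r else 0) (\<lambda>q. H_shifted i q v) q"
proof -
  define D where "D n = heis_neg k r (H Plus i n v) - H Plus i n (heis_neg k r v)" for n
  have D0: "D n = 0" if "0 < n" for n using that by (simp add: D_def H_plus_pos module_hom.zero[OF lin_heis_neg])
  have U0: "H Plus i n v = 0" if "0 < n" for n using that by (rule H_plus_pos)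
  have "heis_neg k r (H_shifted i q v) - H_shifted i q (heis_neg k r v) = shift_series b_plus D q" for q
  proof -
    have "heis_neg k r (H_shifted i q v) = shift_series b_plus (\<lambda>n. heis_neg k r (H Plus i n v)) q"
      unfolding H_shifted_def by (rule shift_series_lin[of 0]) (simp_all add: H_plus_pos)
    then show ?thesis unfolding D_def H_shifted_def
      by (subst shift_series_diff[of 0]) (simp_all add: H_plus_pos module_hom.zero[OF lin_heis_neg])
  qed
  then have "act ((zz + const_shift fps_X) ^ r * zz ^ r) (\<lambda>q. heis_neg k r (H_shifted i q v) - H_shifted i q (heis_neg k r v)) q
     = act ((zz + const_shift (b_plus + b_plus)) ^ r * (zz + const_shift (b_plus + b_minus)) ^ r) (shift_series b_plus D) q"
    by (simp only: b_sums) simp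
  also have "\<dots> = shift_series b_plus (act ((zz + const_shift b_plus) ^ r * (zz + const_shift b_minus) ^ r) D) q"
    by (rule shift_series_zz_const_powers[OF D0])
  also have "act ((zz + const_shift b_plus) ^ r * (zz + const_shift b_minus) ^ r) D
      = act (if k = i then (zz + const_shift b_minus) ^ r - (zz + const_shift b_plus) ^ r else 0) (\<lambda>n. H Plus i n v)"
    unfolding D_def
    by (rule ext) (rule conjunct2[OF conjunct2[OF vertex_field_H_plus[of i a, unfolded vertex_field_def]], rule_format, OF r])
  also have "shift_series b_plus \<dots> q = act (if k = i then zz ^ r - (zz + const_shift fps_X) ^ r else 0) (\<lambda>q. H_shifted i q v) q"
  proof (cases "k = i")
    case True
    note P = shift_series_zz_const_power[OF U0, where b = b_plus]
    have P2: "act ((zz + const_shift c) ^ r) (\<lambda>n. H Plus i n v) n = 0" if "0 + int r < n" for c n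
      using P[where r = r and c = c] that by simp
    have "shift_series b_plus (act ((zz + const_shift b_minus) ^ r - (zz + const_shift b_plus) ^ r) (\<lambda>n. H Plus i n v)) q
      = shift_series b_plus (\<lambda>n. act ((zz + const_shift b_minus) ^ r) (\<lambda>n. H Plus i n v) n
          - act ((zz + const_shift b_plus) ^ r) (\<lambda>n. H Plus i n v) n) q"
      by (rule arg_cong[of _ _ "\<lambda>U. shift_series b_plus U q"], rule ext, rule act_diff_left)
    also have "\<dots> = shift_series b_plus (act ((zz + const_shift b_minus) ^ r) (\<lambda>n. H Plus i n v)) q
        - shift_series b_plus (act ((zz + const_shift b_plus) ^ r) (\<lambda>n. H Plus i n v)) q"
      by (rule shift_series_diff[of "0 + int r"]) (simp_all only: P2)
    also have "\<dots> = act ((zz + const_shift (b_plus + b_minus)) ^ r) (\<lambda>q. H_shifted i q v) q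
        - act ((zz + const_shift (b_plus + b_plus)) ^ r) (\<lambda>q. H_shifted i q v) q"
      unfolding H_shifted_def[abs_def] by (simp only: P[THEN conjunct1])
    finally show ?thesis using True by (simp only: b_sums if_True) (simp add: act_diff_left)
  qed (simp add: shift_series_def)
  finally show ?thesis .
qed

text \<open>The summands delta(w + hbar, z) H^+(w + hbar/2) and delta(w, z) H^-(z) of the bracket at
  c = 1.\<close>

abbreviation "Delta1 i \<equiv> (\<lambda>(p, q) v. delta_times p (\<lambda>n. H_shifted i n v) q)"
abbreviation "Delta2 i \<equiv> (\<lambda>(p :: int, q) v. H Minus i (p + q + 1) v)"

text \<open>Data shared by both products of X^+(z) and X^-(w) and by both delta terms: the
  eigenvalues and commutators are those of the products, while the denominator is the one that H^+(w
  + hbar/2) requires.\<close>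

definition bracket_l :: "'i \<Rightarrow> 'i \<Rightarrow> nat \<Rightarrow> (int \<times> int) shift" where
  "bracket_l i k r = lam a Plus i Z1 k r + lam a Minus i W1 k r"
definition bracket_Q :: "'i \<Rightarrow> nat \<Rightarrow> (int \<times> int) shift" where
  "bracket_Q k r = (W1 + const_shift fps_X) ^ r * W1 ^ r"
definition bracket_m :: "'i \<Rightarrow> 'i \<Rightarrow> nat \<Rightarrow> (int \<times> int) shift" where
  "bracket_m i k r = bracket_Q k r *
     (if k = i then Poly_Mapping.single (- int r, 0) 1 - Poly_Mapping.single (0, - int r) 1 else 0)"

lemma push_psum: "additive_map \<phi> \<Longrightarrow> push \<phi> (psum xs r) = psum (map (push \<phi>) xs) r"
  by (induction xs) (simp_all add: psum_def push_add additive_map.push_power)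

lemma push_lam: "additive_map \<phi> \<Longrightarrow> push \<phi> (lam a s i z k r) = lam a s i (push \<phi> z) k r"
proof -
  assume \<phi>: "additive_map \<phi>"
  have "map (push \<phi>) (pos_roots a s i k z) = pos_roots a s i k (push \<phi> z)"
    "map (push \<phi>) (neg_roots a s i k z) = neg_roots a s i k (push \<phi> z)"
    by (cases s; simp add: root_rules push_add push_diff push_numeral[OF \<phi>] additive_map.map_0[OF \<phi>])+
  then show ?thesis by (simp add: lam_def push_diff push_psum[OF \<phi>])
qed

lemma zz_power: "W1 ^ n = Poly_Mapping.single (0, int n) 1" "Z1 ^ n = Poly_Mapping.single (int n, 0) 1"
  by (induction n) (simp_all add: mult_single zero_prod_def flip: single_one)

lemma bracket_family_12:
  "vertex_family (bracket_l i) bracket_Q (bracket_m i) (\<lambda>(p, q) v. X Plus i p (X Minus i q v))"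
  by (rule vertex_family_cong[OF vertex_family_multiply[OF vertex_family_tensor[OF vertex_field_X vertex_field_imp_family[OF vertex_field_X]], where R = bracket_Q]])
     (auto simp: bracket_l_def bracket_m_def push_lam additive_map.push_1 sg_def single_uminus push_uminus)

lemma bracket_family_21:
  "vertex_family (bracket_l i) bracket_Q (bracket_m i) (\<lambda>(p, q) v. X Minus i q (X Plus i p v))"
proof -
  have "vertex_family (bracket_l i) bracket_Q (bracket_m i) (\<lambda>y. (\<lambda>(q, p) v. X Minus i q (X Plus i p v)) (prod.swap y))"
    by (rule vertex_family_cong[OF vertex_family_multiply[OF vertex_family_reindex[OF
          vertex_family_tensor[OF vertex_field_X vertex_field_imp_family[OF vertex_field_X]] additive_map_swap], where R = bracket_Q]])
       (auto simp: bracket_l_def bracket_m_def push_lam additive_map.push_1 sg_def single_uminus push_uminus push_add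
          push_push additive_map.push_mult)
  also have "(\<lambda>y. (\<lambda>(q, p) v. X Minus i q (X Plus i p v)) (prod.swap y)) = (\<lambda>(p, q) v. X Minus i q (X Plus i p v))"
    by (auto simp: prod.swap_def)
  finally show ?thesis .
qed

lemma bracket_family_Delta1: "vertex_family (bracket_l i) bracket_Q (bracket_m i) (Delta1 i)"
  unfolding vertex_family_def
proof (intro conjI allI impI)
  let ?T = "Z1 - W1 - 2 * eta"
  have pos: "H_shifted i n v = 0" if "0 < n" for n v using that by (rule H_shifted_pos)
  have z: "act ?T (\<lambda>(p, q). delta_times p (\<lambda>n. H_shifted i n v) q) x = 0" for v x
    by (rule delta_times_z[OF pos])
  show "lin (Delta1 i x)" for x
  proof -
    obtain p q where x: "x = (p, q)" by (cases x)
    have "lin (\<lambda>v. \<Sum>n\<in>{q..- p - 1}. hsmult (shifted_power fps_X (- p - 1) n) (H_shifted i (q - n) v))"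
      by (rule lin_setsum[OF lin_hsmult[OF lin_H_shifted]])
    then show ?thesis by (simp add: x delta_times_sum[OF pos])
  qed
  fix k and r :: nat assume r: "0 < r"
  show "heis_pos k r (Delta1 i x (vv \<beta>)) = act (bracket_l i k r) (\<lambda>x. Delta1 i x (vv \<beta>)) x" for \<beta> x
  proof -
    \<comment> \<open>At z = w + hbar the roots cancel in pairs: z with w + hbar, z - hbar with w, z
      - hbar/2 with w + hbar/2. The eigenvalue vanishes there, in agreement with H^+ commuting with
      annihilation operators.\<close>
    have T: "?T dvd Z1 ^ r - (W1 + 2 * eta) ^ r" "?T dvd (Z1 - 2 * eta) ^ r - W1 ^ r" "?T dvd (W1 + eta) ^ r - (Z1 - eta) ^ r"
    proof -
      show "?T dvd Z1 ^ r - (W1 + 2 * eta) ^ r"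
        using diff_dvd_power_diff[of Z1 "W1 + 2 * eta" r] by (simp add: diff_diff_eq)
      show "?T dvd (Z1 - 2 * eta) ^ r - W1 ^ r"
        using diff_dvd_power_diff[of "Z1 - 2 * eta" W1 r] by (simp add: algebra_simps)
      have e: "W1 + eta - (Z1 - eta) = - ?T" by (simp add: algebra_simps)
      have "- ?T dvd (W1 + eta) ^ r - (Z1 - eta) ^ r" using diff_dvd_power_diff[of "W1 + eta" "Z1 - eta" r] unfolding e .
      then show "?T dvd (W1 + eta) ^ r - (Z1 - eta) ^ r" by (simp only: minus_dvd_iff)
    qed
    have "?T dvd bracket_l i k r"
      unfolding bracket_l_def lam_def root_rules
      using dvd_add[OF T(1,2)] T(3) by (simp add: psum_def algebra_simps)
    then have "act (bracket_l i k r) (\<lambda>(p, q). delta_times p (\<lambda>n. H_shifted i n (vv \<beta>)) q) x = 0"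
      by (rule act_dvd_eq_0) (rule z)
    moreover have "heis_pos k r (delta_times p (\<lambda>n. H_shifted i n (vv \<beta>)) q) = 0" for p q
    proof -
      have "heis_pos k r (H_shifted i n (vv \<beta>)) = 0" for n
        by (simp add: heis_pos_H_shifted module_hom.zero[OF lin_H_shifted])
      then show ?thesis
        by (subst delta_times_lin[of 0, OF H_shifted_pos lin_heis_pos]) (simp_all add: delta_times_def hsum_eq_sum[of "{}"])
    qed
    ultimately show ?thesis by (simp add: case_prod_unfold)
  qed
  show "act (bracket_Q k r) (\<lambda>x. heis_neg k r (Delta1 i x v) - Delta1 i x (heis_neg k r v)) x
      = act (bracket_m i k r) (\<lambda>x. Delta1 i x v) x" for v x
  proof -
    obtain p q where x: "x = (p, q)" by (cases x)
    define D where "D q = heis_neg k r (H_shifted i q v) - H_shifted i q (heis_neg k r v)" for q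
    have D0: "D n = 0" if "0 < n" for n using that by (simp add: D_def H_shifted_pos module_hom.zero[OF lin_heis_neg])
    have Q: "bracket_Q k r = lift_snd ((zz + const_shift fps_X) ^ r * zz ^ r)"
      by (simp add: bracket_Q_def additive_map.push_mult additive_map.push_power push_add single_00)
    have "heis_neg k r (delta_times p (\<lambda>n. H_shifted i n v) q) - delta_times p (\<lambda>n. H_shifted i n (heis_neg k r v)) q
        = delta_times p D q" for p q
    proof -
      have "heis_neg k r (delta_times p (\<lambda>n. H_shifted i n v) q) = delta_times p (\<lambda>n. heis_neg k r (H_shifted i n v)) q"
        by (rule delta_times_lin[of 0, OF H_shifted_pos lin_heis_neg]) simp
      then show ?thesis unfolding D_def
        by (subst delta_times_diff[of 0]) (simp_all add: H_shifted_pos module_hom.zero[OF lin_heis_neg])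
    qed
    then have "act (bracket_Q k r) (\<lambda>x. heis_neg k r (Delta1 i x v) - Delta1 i x (heis_neg k r v)) x
       = act (bracket_Q k r) (\<lambda>(p, q). delta_times p D q) (p, q)"
      by (simp add: x case_prod_unfold)
    also have "\<dots> = delta_times p (act ((zz + const_shift fps_X) ^ r * zz ^ r) D) q"
      unfolding Q act_push_snd prod.case by (rule act_delta_times[OF D0])
    also have "act ((zz + const_shift fps_X) ^ r * zz ^ r) D
        = act (if k = i then zz ^ r - (zz + const_shift fps_X) ^ r else 0) (\<lambda>q. H_shifted i q v)"
      unfolding D_def by (rule ext) (rule heis_neg_H_shifted[OF r])
    also have "delta_times p \<dots> q = act (lift_snd (if k = i then zz ^ r - (zz + const_shift fps_X) ^ r else 0))
        (\<lambda>(p, q). delta_times p (\<lambda>n. H_shifted i n v) q) (p, q)"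
      unfolding act_push_snd prod.case by (rule act_delta_times[of 0, symmetric]) (rule H_shifted_pos)
    also have "\<dots> = act (bracket_m i k r) (\<lambda>(p, q). delta_times p (\<lambda>n. H_shifted i n v) q) (p, q)"
    proof (cases "k = i")
      case True
      let ?Zi = "Poly_Mapping.single (- int r, 0) 1 :: (int \<times> int) shift" and ?Wi = "Poly_Mapping.single (0, - int r) 1 :: (int \<times> int) shift"
      have inv: "W1 ^ r * ?Wi = 1" "Z1 ^ r * ?Zi = 1" by (simp_all add: zz_power mult_single flip: zero_prod_def)
      have lift: "lift_snd (zz ^ r - (zz + const_shift fps_X) ^ r) = W1 ^ r - (W1 + const_shift fps_X) ^ r"
        by (simp add: push_diff additive_map.push_power push_add single_00)
      \<comment> \<open>Replacing z^-r by (w + hbar)^-r on the support of the delta function; with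
        denominators cleared this is the divisibility of a difference of r-th powers.\<close>
      have "?T dvd Z1 ^ r - (W1 + 2 * eta) ^ r"
        using diff_dvd_power_diff[of Z1 "W1 + 2 * eta" r] by (simp add: diff_diff_eq)
      then have "?T dvd W1 ^ r * ?Zi * (Z1 ^ r - (W1 + 2 * eta) ^ r)" by (rule dvd_mult)
      also have "W1 ^ r * ?Zi * (Z1 ^ r - (W1 + 2 * eta) ^ r)
          = W1 ^ r * (Z1 ^ r * ?Zi) - (W1 + const_shift fps_X) ^ r * W1 ^ r * ?Zi"
        unfolding two_eta by (simp only: right_diff_distrib ac_simps)
      also have "\<dots> = lift_snd (zz ^ r - (zz + const_shift fps_X) ^ r) - bracket_m i k r"
      proof -
        have "bracket_m i k r = (W1 + const_shift fps_X) ^ r * W1 ^ r * ?Zi - (W1 + const_shift fps_X) ^ r * (W1 ^ r * ?Wi)"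
          using True by (simp add: bracket_m_def bracket_Q_def algebra_simps)
        then show ?thesis by (simp add: inv lift)
      qed
      finally have "?T dvd lift_snd (if k = i then zz ^ r - (zz + const_shift fps_X) ^ r else 0) - bracket_m i k r"
        using True by simp
      then show ?thesis by (rule act_dvd_eq) (rule z)
    qed (simp add: bracket_m_def)
    finally show ?thesis by (simp add: x case_prod_unfold)
  qed
qed

text \<open>Put z = w. The common eigenvalue becomes that of H^-(z), and z^-r - w^-r becomes 0, in
  agreement with H^- commuting with creation operators.\<close>

lemma bracket_family_Delta2: "vertex_family (bracket_l i) bracket_Q (bracket_m i) (Delta2 i)"
  unfolding vertex_family_def
proof (intro conjI allI impI)
  let ?T = "Z1 - W1"
  have z: "act ?T (\<lambda>(p, q). V (p + q + 1 :: int)) x = 0" for V :: "int \<Rightarrow> 'i fock fps" and x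
    by (cases x) (simp add: act_diff_left algebra_simps)
  show "lin (Delta2 i x)" for x by (cases x) (simp add: lin_H_minus)
  fix k and r :: nat assume r: "0 < r"
  show "heis_pos k r (Delta2 i x (vv \<beta>)) = act (bracket_l i k r) (\<lambda>x. Delta2 i x (vv \<beta>)) x" for \<beta> x
  proof -
    obtain p q where x: "x = (p, q)" by (cases x)
    let ?L = "lam a Minus i zz k r + lam a Plus i zz k r :: int shift"
    let ?V = "\<lambda>m. H Minus i m (vv \<beta>)"
    have "heis_pos k r (?V (p + q + 1)) = act ?L ?V (p + q + 1)"
      using vertex_field_H_minus[of a i] r by (simp add: vertex_field_def module_hom.zero[OF lin_H_minus])
    also have "\<dots> = act (push (\<lambda>p. (p, 0)) ?L) (\<lambda>(p, q). ?V (p + q + 1)) (p, q)"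
      unfolding act_push_fst prod.case by (simp add: act_def algebra_simps)
    also have "\<dots> = act (bracket_l i k r) (\<lambda>(p, q). ?V (p + q + 1)) (p, q)"
    proof (rule act_dvd_eq[OF _ z])
      have T: "?T dvd Z1 ^ r - W1 ^ r" "?T dvd (Z1 + c) ^ r - (W1 + c) ^ r" for c
        using diff_dvd_power_diff[of Z1 W1 r] diff_dvd_power_diff[of "Z1 + c" "W1 + c" r] by simp_all
      have "?T dvd lam a Minus i Z1 k r - lam a Minus i W1 k r"
      proof -
        consider "k = i" | "k \<noteq> i" "a i k \<noteq> 0" | "k \<noteq> i" "a i k = 0" by blast
        then show ?thesis
        proof cases
          case 1
          have "?T dvd - ((Z1 ^ r - W1 ^ r) + ((Z1 + 2 * eta) ^ r - (W1 + 2 * eta) ^ r))"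
            using dvd_add[OF T(1) T(2)[of "2 * eta"]] by (simp only: dvd_minus_iff)
          then show ?thesis using 1 by (simp add: lam_def root_rules psum_def algebra_simps)
        next
          case 2
          then show ?thesis using T(2)[of eta] by (simp add: lam_def root_rules psum_def)
        qed (simp add: lam_def root_rules psum_def)
      qed
      then show "?T dvd push (\<lambda>p. (p, 0)) ?L - bracket_l i k r"
        by (simp add: push_add push_lam bracket_l_def)
    qed
    finally show ?thesis by (simp add: x case_prod_unfold)
  qed
  show "act (bracket_Q k r) (\<lambda>x. heis_neg k r (Delta2 i x v) - Delta2 i x (heis_neg k r v)) x
      = act (bracket_m i k r) (\<lambda>x. Delta2 i x v) x" for v x
  proof -
    have "heis_neg k r (H Minus i m v) = H Minus i m (heis_neg k r v)" for m
      using vertex_field_H_minus[of a i] r by (simp add: vertex_field_def)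
    moreover have "act (bracket_m i k r) (\<lambda>(p, q). H Minus i (p + q + 1) v) x = 0"
    proof (rule act_dvd_eq_0[OF _ z])
      let ?Zi = "Poly_Mapping.single (- int r, 0) 1 :: (int \<times> int) shift" and ?Wi = "Poly_Mapping.single (0, - int r) 1 :: (int \<times> int) shift"
      have inv: "W1 ^ r * ?Wi = 1" "Z1 ^ r * ?Zi = 1" by (simp_all add: zz_power mult_single flip: zero_prod_def)
      have "?T dvd - (?Zi * ?Wi) * (Z1 ^ r - W1 ^ r)"
        by (rule dvd_mult[OF diff_dvd_power_diff])
      also have "- (?Zi * ?Wi) * (Z1 ^ r - W1 ^ r) = (W1 ^ r * ?Wi) * ?Zi - (Z1 ^ r * ?Zi) * ?Wi"
        by (simp add: algebra_simps)
      finally have "?T dvd ?Zi - ?Wi" by (simp add: inv)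
      then show "?T dvd bracket_m i k r" by (simp add: bracket_m_def)
    qed
    ultimately show ?thesis by (simp add: case_prod_unfold)
  qed
qed

text \<open>\<open>(w + \<hbar>)\<^sup>r\<close> times a vector.\<close>

definition shifted_vec :: "'i fock fps \<Rightarrow> int \<Rightarrow> int \<Rightarrow> 'i fock fps" where
  "shifted_vec \<omega> r q = hsmult (shifted_power fps_X r q) \<omega>"

lemma act_shifted_vec: "act ((zz + const_shift fps_X) ^ N) (shifted_vec \<omega> r) q = shifted_vec \<omega> (r + int N) q"
proof (induction N arbitrary: q)
  case (Suc N)
  have "act ((zz + const_shift fps_X) ^ Suc N) (shifted_vec \<omega> r) q
     = act (zz + const_shift fps_X) (shifted_vec \<omega> (r + int N)) q"
    by (simp only: power_Suc act_mult) (rule act_cong, rule Suc)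
  also have "\<dots> = shifted_vec \<omega> (r + int N + 1) q"
    by (simp add: act_add_left shifted_vec_def shifted_power_Suc hs.scale_left_distrib)
  finally show ?case by (simp add: add.commute add.left_commute)
qed simp

text \<open>On a vacuum vector H^+(w + hbar/2) is the scalar ((w + hbar) / w)^n, so multiplication
  of the delta function by it shifts the exponents of w + hbar and w by n and -n. Both signs of n
  are handled by clearing the regular factors w + hbar and w.\<close>

lemma delta_times_ratio:
  fixes \<beta> \<beta>0 :: "'i lattice"
  assumes n: "n = form a (rt Plus i) \<beta>"
  defines "\<omega> \<equiv> vac \<beta> (vv \<beta>0)"
  shows "vac \<beta> (delta_times p (\<lambda>m. H_shifted i m (vv \<beta>0)) q) = shifted_vec \<omega> (n - p - 1) (q + n)"
proof (cases "\<beta> = \<beta>0")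
  case False
  have "vac \<beta> (H_shifted i m (vv \<beta>0)) = 0" for m
    unfolding H_shifted_def
    by (subst shift_series_lin[of 0, OF H_plus_pos lin_vac])
       (simp_all add: H_plus_vv module_hom.scale[OF lin_vac] vac_vv False shift_series_def)
  then have "vac \<beta> (delta_times p (\<lambda>m. H_shifted i m (vv \<beta>0)) q) = 0"
    by (subst delta_times_lin[of 0, OF H_shifted_pos lin_vac]) (simp_all add: delta_times_def hsum_eq_sum[of "{}"])
  then show ?thesis by (simp add: \<omega>_def vac_vv False shifted_vec_def)
next
  case True
  define N1 N2 where "N1 = nat n" and "N2 = nat (- n)"
  have N: "n = int N1 - int N2" by (simp add: N1_def N2_def)
  define R where "R p = hsmult (ratio_powers n p) \<omega>" for p
  have R0: "R p = 0" if "0 < p" for p using that by (simp add: R_def ratio_powers_def)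
  define S where "S = shift_series b_plus R"
  have S0: "S m = 0" if "0 < m" for m
    unfolding S_def using that by (subst shift_series_sum[of 0]) (auto simp: R0)
  have S: "(\<lambda>m. vac \<beta> (H_shifted i m (vv \<beta>0))) = S"
  proof
    fix m
    have "vac \<beta> (H_shifted i m (vv \<beta>0)) = shift_series b_plus (\<lambda>n. vac \<beta> (H Plus i n (vv \<beta>0))) m"
      unfolding H_shifted_def by (rule shift_series_lin[of 0, OF H_plus_pos lin_vac])
    then show "vac \<beta> (H_shifted i m (vv \<beta>0)) = S m"
      using True n by (simp add: S_def R_def[abs_def] H_plus_vv module_hom.scale[OF lin_vac] \<omega>_def sg_def)
  qed
  let ?h = "const_shift fps_X :: int shift"
  have eqS: "act ((zz + ?h) ^ N2 * zz ^ N1) S = act ((zz + ?h) ^ N1 * zz ^ N2) (delta \<omega>)"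
  proof
    fix q
    have "act ((zz + ?h) ^ N2 * zz ^ N1) S q
       = act ((zz + const_shift (b_plus + b_plus)) ^ N2 * (zz + const_shift (b_plus + b_minus)) ^ N1) S q"
      by (simp only: b_sums) simp
    also have "\<dots> = shift_series b_plus (act ((zz + const_shift b_plus) ^ N2 * (zz + const_shift b_minus) ^ N1) R) q"
      unfolding S_def by (rule shift_series_zz_const_powers[OF R0])
    also have "act ((zz + const_shift b_plus) ^ N2 * (zz + const_shift b_minus) ^ N1) R
        = act ((zz + const_shift b_plus) ^ N1 * (zz + const_shift b_minus) ^ N2) (delta \<omega>)"
    proof
      fix p
      have d: "(\<lambda>p :: int. if p = 0 then \<omega> else 0) = delta \<omega>" by (auto simp: delta_def)
      show "act ((zz + const_shift b_plus) ^ N2 * (zz + const_shift b_minus) ^ N1) R p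
        = act ((zz + const_shift b_plus) ^ N1 * (zz + const_shift b_minus) ^ N2) (delta \<omega>) p"
        using ratio_powers_eq[OF N, of \<omega> p] unfolding d R_def[abs_def, symmetric]
        by (simp only: mult.commute[of "(zz + const_shift b_plus) ^ N2"])
    qed
    also have "shift_series b_plus \<dots> q
        = act ((zz + const_shift (b_plus + b_plus)) ^ N1 * (zz + const_shift (b_plus + b_minus)) ^ N2) (shift_series b_plus (delta \<omega>)) q"
      by (rule shift_series_zz_const_powers[of 0, symmetric]) (simp add: delta_def)
    also have "shift_series b_plus (delta \<omega>) = delta \<omega>"
      using fun_cong[OF shift_fst_at_zero[of b_plus "\<lambda>_ :: unit. \<omega>"], of "(p, ())" for p]
      by (auto simp: shift_fst_def at_zero_def delta_def[abs_def])
    finally show "act ((zz + ?h) ^ N2 * zz ^ N1) S q = act ((zz + ?h) ^ N1 * zz ^ N2) (delta \<omega>) q"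
      by (simp only: b_sums) simp
  qed
  have dd: "delta_times p (delta \<omega>) = shifted_vec \<omega> (- p - 1)"
  proof
    fix q
    have "delta_times p (delta \<omega>) q = (\<Sum>n\<in>{q}. hsmult (shifted_power fps_X (- p - 1) n) (delta \<omega> (q - n)))"
      unfolding delta_times_def by (rule hsum_eq_sum) (auto simp: delta_def)
    then show "delta_times p (delta \<omega>) q = shifted_vec \<omega> (- p - 1) q" by (simp add: shifted_vec_def delta_def)
  qed
  have lhs: "act ((zz + ?h) ^ N2 * zz ^ N1) (delta_times p S) q = shifted_vec \<omega> (int N1 - p - 1) (q - int N2)" for q
  proof -
    have "act ((zz + ?h) ^ N2 * zz ^ N1) (delta_times p S) q = delta_times p (act ((zz + ?h) ^ N2 * zz ^ N1) S) q"
      by (rule act_delta_times[OF S0])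
    also have "\<dots> = act ((zz + ?h) ^ N1 * zz ^ N2) (delta_times p (delta \<omega>)) q"
      unfolding eqS by (rule act_delta_times[of 0, symmetric]) (simp add: delta_def)
    also have "\<dots> = act (zz ^ N2) (act ((zz + ?h) ^ N1) (shifted_vec \<omega> (- p - 1))) q"
      unfolding dd mult.commute[of "(zz + ?h) ^ N1"] act_mult ..
    also have "\<dots> = shifted_vec \<omega> (int N1 - p - 1) (q - int N2)"
      unfolding act_zz_power act_shifted_vec by (simp add: algebra_simps)
    finally show ?thesis .
  qed
  define E where "E q = shifted_vec \<omega> (n - p - 1) (q + n)" for q
  have E: "act ((zz + ?h) ^ N2 * zz ^ N1) E q = shifted_vec \<omega> (int N1 - p - 1) (q - int N2)" for q
  proof -
    have shift: "act L E q = act L (shifted_vec \<omega> (n - p - 1)) (q + n)" for L q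
      unfolding act_def E_def by (simp add: algebra_simps)
    have "act ((zz + ?h) ^ N2 * zz ^ N1) E q = act (zz ^ N1) (act ((zz + ?h) ^ N2) (shifted_vec \<omega> (n - p - 1))) (q + n)"
      unfolding shift mult.commute[of "(zz + ?h) ^ N2"] act_mult ..
    then show ?thesis unfolding act_zz_power act_shifted_vec using N by (simp add: algebra_simps)
  qed
  have "delta_times p S q - E q = 0"
  proof (rule regular_act_eq_0[of "(zz + ?h) ^ N2 * zz ^ N1"])
    have "regular (zz + const_shift 0)" by (rule regular_linear) simp
    then show "regular ((zz + ?h) ^ N2 * zz ^ N1)"
      by (intro regular_mult regular_power regular_linear) simp_all
    show "act ((zz + ?h) ^ N2 * zz ^ N1) (\<lambda>q. delta_times p S q - E q) q = 0" for q
      unfolding act_diff_right lhs E by simp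
  qed
  moreover have "vac \<beta> (delta_times p (\<lambda>m. H_shifted i m (vv \<beta>0)) q) = delta_times p S q"
    unfolding S[symmetric] by (rule delta_times_lin[of 0, OF H_shifted_pos lin_vac])
  ultimately show ?thesis by (simp add: E_def)
qed

end

lemma lower_restrict: "(\<And>x. d x < K \<Longrightarrow> U x = 0) \<Longrightarrow> lower d U"
  unfolding lower_def by blast

section \<open>Partial fractions and the bracket\<close>

context simply_laced
begin

lemma cocycle_0: "\<epsilon> 0 y = 1" "\<epsilon> x 0 = 1"
  using cocycle(1)[of 0 0 y] cocycle(2)[of x 0 0] cocycle(3)[of 0 y] cocycle(3)[of x 0] by auto

lemma form_uminus_left: "form a (- x) y = - form a x y"
  by (simp add: form_def sum_negf)

text \<open>The two roots are opposite, so the cocycle values on \<beta> cancel, and \<epsilon>(x,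
  -x) = -1 is offset by the sign in front of X^-.\<close>

lemma mono2_opposite:
  "mono2 Plus i Minus i \<beta> = Poly_Mapping.single (form a (rt Plus i) \<beta>, - form a (rt Plus i) \<beta>) 1"
proof -
  let ?x = "rt Plus i" and ?y = "rt Minus i"
  have y: "?y = - ?x" by (simp add: sg_def single_uminus)
  have s: "?x + ?y = 0" by (simp add: y)
  have "\<epsilon> ?x \<beta> * \<epsilon> ?y \<beta> = 1"
    using cocycle(1)[of ?x ?y \<beta>] unfolding s by (simp add: cocycle_0)
  moreover have "\<epsilon> ?x ?y = - 1"
  proof -
    have "\<epsilon> ?x ?x = -1" using form_rt[where s = Plus and i = i and t = Plus and j = i] by (simp add: cocycle(4) sg_square)
    moreover have "\<epsilon> ?x ?x * \<epsilon> ?x ?y = 1"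
      using cocycle(2)[of ?x ?x ?y] unfolding s by (simp add: cocycle_0)
    ultimately have "- \<epsilon> ?x ?y = 1" by simp
    then show ?thesis by (simp add: equation_minus_iff)
  qed
  ultimately have "\<epsilon> ?x \<beta> * \<epsilon> ?y \<beta> * \<epsilon> ?x ?y = -1" by simp
  moreover have "form a ?y \<beta> = - form a ?x \<beta>" unfolding y by (rule form_uminus_left)
  ultimately show ?thesis
    unfolding mono2_def by (simp add: sg_def flip: fps_const_neg)
qed

theorem XX_bracket:
  "hsmult fps_X (X Plus i p (X Minus i q v) - X Minus i q (X Plus i p v))
     = delta_times p (\<lambda>n. H_shifted i n v) q - H Minus i (p + q + 1) v"
proof -
  define P P' where "P = (\<lambda>(p, q) v. X Plus i p (X Minus i q v))" and "P' = (\<lambda>(p, q) v. X Minus i q (X Plus i p v))"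
  let ?D = "\<lambda>x v. act (const_shift fps_X) (\<lambda>x. P x v - P' x v) x - (Delta1 i x v - Delta2 i x v)"
  \<comment> \<open>The relation is proved after multiplication by hbar, where every term is defined
    without division and carries the same data.\<close>
  have fam: "vertex_family (bracket_l i) bracket_Q (bracket_m i) ?D"
    unfolding P_def P'_def
    by (rule vertex_family_diff[OF vertex_family_act[OF vertex_family_diff[OF bracket_family_12 bracket_family_21]]
          vertex_family_diff[OF bracket_family_Delta1 bracket_family_Delta2]])
  have "?D (p, q) v = 0"
  proof (rule vertex_family_eq_0[OF fam])
    have "regular (W1 + const_shift 0)" by (rule regular_linear) simp
    then show "regular (bracket_Q k r)" for k r
      unfolding bracket_Q_def by (intro regular_mult regular_power regular_linear) simp_all
    fix \<beta> \<beta>0 x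
    let ?T1 = "Z1 - W1" and ?T2 = "Z1 - W1 - 2 * eta"
    define n where "n = form a (rt Plus i) \<beta>"
    define \<omega> where "\<omega> = vac \<beta> (vv \<beta>0)"
    define \<mu> :: "(int \<times> int) shift" where "\<mu> = Poly_Mapping.single (n, - n) 1"
    define C12 C21 where "C12 = (\<lambda>(p, q). vac \<beta> (X Plus i p (X Minus i q (vv \<beta>0))))"
      and "C21 = (\<lambda>(p, q). vac \<beta> (X Minus i q (X Plus i p (vv \<beta>0))))"
    \<comment> \<open>The expectation values of the delta terms. With \<mu> = (z / w)^n they are
      \<mu> delta(w + hbar, z) and \<mu> delta(w, z); in the second the factor \<mu> is 1 on the
      support.\<close>
    define E F where "E = (\<lambda>(p, q). shifted_vec \<omega> (n - p - 1) (q + n))"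
      and "F = (\<lambda>(p, q). if p + q + 1 = (0 :: int) then \<omega> else 0)"
    \<comment> \<open>Cutting at z^(n-1) leaves the expansions of \<mu> / (z - w - hbar) and \<mu> /
      (z - w) in descending powers of z.\<close>
    define E' F' where "E' = (\<lambda>x. if fst x \<le> n - 1 then E x else 0)" and "F' = (\<lambda>x. if fst x \<le> n - 1 then F x else 0)"
    have \<gamma>: "\<beta> - rt Plus i - rt Minus i = \<beta>" by (simp add: sg_def single_uminus)
    have c12: "act (?T1 * ?T2) C12 x = act \<mu> (delta \<omega>) x" for x
    proof -
      let ?N = "neg_roots a Minus i i zz" and ?P = "pos_roots a Minus i i zz"
      have "act (zfactors 0 (orient Plus ?N ?P)) C12 x
          = act (zfactors 0 (orient Plus ?P ?N) * mono2 Plus i Minus i (\<beta> - rt Plus i - rt Minus i))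
              (delta (vac (\<beta> - rt Plus i - rt Minus i) (vv \<beta>0))) x"
        unfolding C12_def by (rule XX_correlator)
      also have "zfactors 0 (orient Plus ?N ?P) = ?T1 * ?T2"
        by (simp add: root_rules push_rules push_2 single_00; simp add: algebra_simps)
      also have "zfactors 0 (orient Plus ?P ?N) = 1"
        by (simp add: root_rules)
      finally show ?thesis unfolding \<gamma> mono2_opposite by (simp add: n_def \<mu>_def \<omega>_def)
    qed
    have c21: "act (?T1 * ?T2) C21 x = act \<mu> (delta \<omega>) x" for x
    proof -
      let ?N = "neg_roots a Plus i i zz" and ?P = "pos_roots a Plus i i zz"
      have "act (push prod.swap (zfactors 0 (orient Minus ?N ?P))) C21 x
          = act (push prod.swap (zfactors 0 (orient Minus ?P ?N)) * (const_shift (fps_const ((-1) powi (a i i)))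
              * mono2 Plus i Minus i (\<beta> - rt Plus i - rt Minus i))) (delta (vac (\<beta> - rt Plus i - rt Minus i) (vv \<beta>0))) x"
        unfolding C21_def by (rule XX_correlator_swapped)
      also have "push prod.swap (zfactors 0 (orient Minus ?N ?P)) = ?T1 * ?T2"
        by (simp add: root_rules push_rules push_2 single_00 swap_0; simp add: algebra_simps)
      also have "push prod.swap (zfactors 0 (orient Minus ?P ?N)) = 1"
        by (simp add: root_rules push_rules)
      finally show ?thesis unfolding \<gamma> mono2_opposite by (simp add: n_def \<mu>_def \<omega>_def)
    qed
    have e: "act ?T2 E x = 0" "act ?T2 E' x = act \<mu> (delta \<omega>) x" for x
    proof -
      obtain p q where x: "x = (p, q)" by (cases x)
      have s: "shifted_power fps_X (n - p) (q + n) = shifted_power fps_X (n - p - 1) (q + n - 1)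
          + fps_X * (shifted_power fps_X (n - p - 1) (q + n) :: complex fps)"
        using shifted_power_Suc[of fps_X "n - p - 1" "q + n"] by simp
      have T2: "act ?T2 U (p, q) = U (p - 1, q) - U (p, q - 1) - hsmult fps_X (U (p, q))" for U :: "_ \<Rightarrow> 'i fock fps"
        unfolding two_eta by (simp add: act_diff_left)
      have E: "E (p - 1, q) = E (p, q - 1) + hsmult fps_X (E (p, q))"
      proof -
        have i: "n - (p - 1) - 1 = n - p" "q - 1 + n = q + n - 1" by simp_all
        show ?thesis unfolding E_def prod.case shifted_vec_def i s by (simp add: hs.scale_left_distrib)
      qed
      show "act ?T2 E x = 0" unfolding x T2 E by simp
      have p0: "E (n - 1, q) = (if q + n = 0 then \<omega> else 0)"
        by (simp add: E_def shifted_vec_def shifted_power_0_right)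
      consider "p \<le> n - 1" | "p = n" | "n < p" by linarith
      then show "act ?T2 E' x = act \<mu> (delta \<omega>) x"
      proof cases
        case 1
        then show ?thesis
          unfolding x T2 by (simp add: E'_def E \<mu>_def delta_def zero_prod_def)
      next
        case 2
        then show ?thesis
          unfolding x T2 by (auto simp add: E'_def p0 \<mu>_def delta_def zero_prod_def)
      next
        case 3
        then show ?thesis
          unfolding x T2 by (simp add: E'_def \<mu>_def delta_def zero_prod_def)
      qed
    qed
    have f: "act ?T1 F x = 0" "act ?T1 F' x = act \<mu> (delta \<omega>) x" for x
      by (cases x; auto simp: act_diff_left F_def F'_def \<mu>_def delta_def zero_prod_def)+
    have E: "act ?T2 E = (\<lambda>x. 0)" "act ?T2 E' = act \<mu> (delta \<omega>)" and F: "act ?T1 F = (\<lambda>x. 0)" "act ?T1 F' = act \<mu> (delta \<omega>)"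
      using e f by blast+
    have T: "act (?T1 * ?T2) U = act ?T1 (act ?T2 U)" "act (?T1 * ?T2) U = act ?T2 (act ?T1 U)" for U :: "_ \<Rightarrow> 'i fock fps"
      by (auto simp: act_mult[symmetric] mult.commute)
    \<comment> \<open>Partial fractions: hbar / ((z - w) (z - w - hbar)) = 1 / (z - w - hbar) - 1 /
      (z - w).\<close>
    have *: "act (?T1 * ?T2) (\<lambda>x. E' x - F' x) x = act (const_shift fps_X) (act \<mu> (delta \<omega>)) x" for x
    proof -
      have "act (?T1 * ?T2) (\<lambda>x. E' x - F' x) x = act ?T1 (act \<mu> (delta \<omega>)) x - act ?T2 (act \<mu> (delta \<omega>)) x"
        unfolding act_diff_right T(1)[of E'] T(2)[of F'] E F ..
      also have "\<dots> = act (2 * eta) (act \<mu> (delta \<omega>)) x" by (simp only: act_diff_left[symmetric]) simp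
      finally show ?thesis by (simp only: two_eta)
    qed
    have **: "act (?T1 * ?T2) (\<lambda>x. E x - F x) x = 0" for x
      unfolding act_diff_right T(1)[of E] T(2)[of F] E F by simp
    have h: "act (?T1 * ?T2) (act (const_shift fps_X) U) x = act (const_shift fps_X) (act (?T1 * ?T2) U) x" for U :: "_ \<Rightarrow> 'i fock fps" and x
      by (rule act_commute)
    have c: "act (?T1 * ?T2) C12 = act \<mu> (delta \<omega>)" "act (?T1 * ?T2) C21 = act \<mu> (delta \<omega>)" using c12 c21 by blast+
    \<comment> \<open>X^+(z) X^-(w) is bounded above in z, so it is the expansion in descending
      powers.\<close>
    have up: "act (const_shift fps_X) C12 x - (E' x - F' x) = 0"
    proof (rule upper_regular_act_eq_0[of fst "?T1 * ?T2"])
      have k: "upper_regular fst (Poly_Mapping.single (1, 0) 1 + (c - W1))" if "Poly_Mapping.keys c \<subseteq> {0}" for c :: "(int \<times> int) shift"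
      proof (rule upper_regular_linear)
        fix t assume "t \<in> Poly_Mapping.keys (c - W1)"
        then have "t \<in> Poly_Mapping.keys c \<union> Poly_Mapping.keys W1" using keys_diff[of c W1] by blast
        then show "fst t = 0" using that by auto
      qed simp
      show "upper_regular fst (?T1 * ?T2)"
        unfolding two_eta using upper_regular_mult[OF k[of 0] k[of "- const_shift fps_X"]] by (simp add: algebra_simps)
      show "upper fst (\<lambda>x. act (const_shift fps_X) C12 x - (E' x - F' x))"
      proof (rule upper_diff[OF upper_act])
        show "upper fst C12" unfolding C12_def by (rule X_correlator_upper)
        show "upper fst (\<lambda>x. E' x - F' x)" unfolding upper_def by (intro exI[of _ n]) (auto simp: E'_def F'_def)
      qed simp
      show "act (?T1 * ?T2) (\<lambda>x. act (const_shift fps_X) C12 x - (E' x - F' x)) x = 0" for x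
        using *[of x] unfolding act_diff_right h c by simp
    qed simp
    \<comment> \<open>The reverse order is bounded below in z. It is the opposite expansion of the
      same function, namely the descending one minus the full delta series; subtracting the two
      orders leaves E - F.\<close>
    have low: "act (const_shift fps_X) C21 x + ((E x - E' x) - (F x - F' x)) = 0"
    proof -
      have "act (const_shift fps_X) C21 x - ((E' x - F' x) - (E x - F x)) = 0"
      proof (rule lower_regular_act_eq_0[of fst "?T1 * ?T2"])
        have "lower_regular fst (Poly_Mapping.single (1, 0) 1 - (W1 + const_shift c))" if c: "fps_nth c 0 = 0" for c
        proof (rule lower_regular_linear)
          fix t assume "t \<in> Poly_Mapping.keys (W1 + const_shift c)"
          then have "t \<in> Poly_Mapping.keys W1 \<union> Poly_Mapping.keys (const_shift c :: (int \<times> int) shift)" using Poly_Mapping.keys_add[of W1 "const_shift c"] by blast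
          then show "fst t = 0" by (auto split: if_splits)
        next
          show "regular (W1 + const_shift c)" by (rule regular_linear[OF c])
        qed simp
        from lower_regular_mult[OF this[of 0] this[of fps_X]]
        show "lower_regular fst (?T1 * ?T2)" unfolding two_eta by (simp add: diff_diff_eq)
        show "lower fst (\<lambda>x. act (const_shift fps_X) C21 x - ((E' x - F' x) - (E x - F x)))"
        proof (rule lower_diff[OF lower_act])
          have "C21 x = 0" if "fst x < form a (rt Plus i) \<beta>0" for x
            using that by (cases x) (simp add: C21_def X_op_vv_lower module_hom.zero[OF lin_X_op] module_hom.zero[OF lin_vac])
          then show "lower fst C21" by (rule lower_restrict)
          show "lower fst (\<lambda>x. E' x - F' x - (E x - F x))" by (rule lower_restrict[of _ n]) (simp add: E'_def F'_def)
        qed simp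
        show "act (?T1 * ?T2) (\<lambda>x. act (const_shift fps_X) C21 x - ((E' x - F' x) - (E x - F x))) x = 0" for x
          using *[of x] **[of x] unfolding act_diff_right h c by simp
      qed simp
      then show ?thesis by (simp add: algebra_simps)
    qed
    obtain p q where x: "x = (p, q)" by (cases x)
    have "vac \<beta> (?D x (vv \<beta>0)) = act (const_shift fps_X) C12 x - act (const_shift fps_X) C21 x - (E x - F x)"
      using delta_times_ratio[OF n_def, of p \<beta>0 q]
      by (simp add: x module_hom.diff[OF lin_vac] module_hom.scale[OF lin_vac] P_def P'_def C12_def C21_def
          E_def F_def vac_H_minus \<omega>_def hs.scale_right_diff_distrib)
    also have "\<dots> = (act (const_shift fps_X) C12 x - (E' x - F' x)) - (act (const_shift fps_X) C21 x + ((E x - E' x) - (F x - F' x)))"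
      by (simp add: algebra_simps)
    finally show "vac \<beta> (?D x (vv \<beta>0)) = 0" unfolding up low by simp
  qed
  then show ?thesis by (simp add: P_def P'_def)
qed

end

section \<open>The Serre relations\<close>

abbreviation Z3 :: "(int \<times> int \<times> int) shift" where "Z3 \<equiv> Poly_Mapping.single (1, 0, 0) 1"
abbreviation Y3 :: "(int \<times> int \<times> int) shift" where "Y3 \<equiv> Poly_Mapping.single (0, 1, 0) 1"
abbreviation W3 :: "(int \<times> int \<times> int) shift" where "W3 \<equiv> Poly_Mapping.single (0, 0, 1) 1"

text \<open>Denominators for neighbouring i and j, with h equal to hbar/2 or -hbar/2: f belongs to
  X_i on the left of X_j and g to the opposite order; the index tells which of the two copies of X_i
  is meant.\<close>

abbreviation f1 :: "complex fps \<Rightarrow> (int \<times> int \<times> int) shift" where "f1 h \<equiv> Z3 - W3 + const_shift h"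
abbreviation g1 :: "complex fps \<Rightarrow> (int \<times> int \<times> int) shift" where "g1 h \<equiv> Z3 - W3 - const_shift h"
abbreviation f2 :: "complex fps \<Rightarrow> (int \<times> int \<times> int) shift" where "f2 h \<equiv> Y3 - W3 + const_shift h"
abbreviation g2 :: "complex fps \<Rightarrow> (int \<times> int \<times> int) shift" where "g2 h \<equiv> Y3 - W3 - const_shift h"

definition swap3 :: "(int \<times> int \<times> int \<Rightarrow> 'i fock fps) \<Rightarrow> int \<times> int \<times> int \<Rightarrow> 'i fock fps" where
  "swap3 U = (\<lambda>(p, p', q). U (p', p, q))"

text \<open>\<open>(w - h)\<^sup>m (w + h)\<^sup>r\<close> times a vector.\<close>

definition w_powers :: "complex fps \<Rightarrow> 'i fock fps \<Rightarrow> nat \<Rightarrow> int \<Rightarrow> int \<Rightarrow> 'i fock fps" where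
  "w_powers h \<omega> m r = act ((zz + const_shift (- h)) ^ m) (\<lambda>q. hsmult (shifted_power h r q) \<omega>)"

lemma w_powers_Suc: "w_powers h \<omega> (Suc m) r q = w_powers h \<omega> m r (q - 1) - hsmult h (w_powers h \<omega> m r q)"
  unfolding w_powers_def power_Suc act_mult by (simp add: act_add_left)

lemma w_powers_plus: "w_powers h \<omega> m (r + 1) q = w_powers h \<omega> m r (q - 1) + hsmult h (w_powers h \<omega> m r q)"
proof -
  have "(\<lambda>q. hsmult (shifted_power h (r + 1) q) \<omega>) = act (zz + const_shift h) (\<lambda>q. hsmult (shifted_power h r q) \<omega>)"
    by (rule ext) (simp add: act_add_left shifted_power_Suc hs.scale_left_distrib)
  then have "w_powers h \<omega> m (r + 1) q = act (zz + const_shift h) (w_powers h \<omega> m r) q"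
    unfolding w_powers_def by (simp only: act_commute[of "(zz + const_shift (- h)) ^ m"])
  then show ?thesis by (simp add: act_add_left)
qed

lemma w_powers_0: "w_powers h \<omega> 0 0 q = (if q = 0 then \<omega> else 0)"
  by (simp add: w_powers_def shifted_power_0_right)

lemma w_powers_upper: "r < q \<Longrightarrow> w_powers h \<omega> 0 r q = 0"
  by (simp add: w_powers_def shifted_power_outside)

text \<open>
  The expansions of \<open>1 / (z - w + h)\<close> in \<open>z\<^sup>-\<^sup>1\<close> and of \<open>1 / (z - w - h)\<close> in \<open>z\<close>, and their
  products in two variables \<open>z\<^sub>1, z\<^sub>2\<close>.
\<close>

definition inv_f :: "complex fps \<Rightarrow> 'i fock fps \<Rightarrow> int \<times> int \<Rightarrow> 'i fock fps" where
  "inv_f h \<omega> = (\<lambda>(p, q). if p < 0 then w_powers h \<omega> (nat (- p - 1)) 0 q else 0)"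
definition inv_g :: "complex fps \<Rightarrow> 'i fock fps \<Rightarrow> int \<times> int \<Rightarrow> 'i fock fps" where
  "inv_g h \<omega> = (\<lambda>(p, q). if 0 \<le> p then - w_powers h \<omega> 0 (- p - 1) q else 0)"
definition inv_ff :: "complex fps \<Rightarrow> 'i fock fps \<Rightarrow> int \<times> int \<times> int \<Rightarrow> 'i fock fps" where
  "inv_ff h \<omega> = (\<lambda>(p, p', q). if p < 0 \<and> p' < 0 then w_powers h \<omega> (nat (- p - 1) + nat (- p' - 1)) 0 q else 0)"
definition inv_fg :: "complex fps \<Rightarrow> 'i fock fps \<Rightarrow> int \<times> int \<times> int \<Rightarrow> 'i fock fps" where
  "inv_fg h \<omega> = (\<lambda>(p, p', q). if p < 0 \<and> 0 \<le> p' then - w_powers h \<omega> (nat (- p - 1)) (- p' - 1) q else 0)"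
definition inv_gg :: "complex fps \<Rightarrow> 'i fock fps \<Rightarrow> int \<times> int \<times> int \<Rightarrow> 'i fock fps" where
  "inv_gg h \<omega> = (\<lambda>(p, p', q). if 0 \<le> p \<and> 0 \<le> p' then w_powers h \<omega> 0 (- p - p' - 2) q else 0)"

lemma act_factor3:
  fixes U :: "int \<times> int \<times> int \<Rightarrow> 'i fock fps"
  shows "act (f1 h) U (p, p', q) = U (p - 1, p', q) - (U (p, p', q - 1) - hsmult h (U (p, p', q)))"
    "act (g1 h) U (p, p', q) = U (p - 1, p', q) - (U (p, p', q - 1) + hsmult h (U (p, p', q)))"
    "act (f2 h) U (p, p', q) = U (p, p' - 1, q) - (U (p, p', q - 1) - hsmult h (U (p, p', q)))"
    "act (g2 h) U (p, p', q) = U (p, p' - 1, q) - (U (p, p', q - 1) + hsmult h (U (p, p', q)))"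
  by (simp_all add: act_diff_left act_add_left single_00 flip: zero_prod_def)

lemma act_factor2:
  fixes U :: "int \<times> int \<Rightarrow> 'i fock fps"
  shows "act (Z1 - W1 + const_shift h) U (p, q) = U (p - 1, q) - (U (p, q - 1) - hsmult h (U (p, q)))"
    "act (Z1 - W1 - const_shift h) U (p, q) = U (p - 1, q) - (U (p, q - 1) + hsmult h (U (p, q)))"
  by (simp_all add: act_diff_left act_add_left)

lemma nat_minus_Suc: "p < 0 \<Longrightarrow> nat (- p) = Suc (nat (- p - 1))"
  by simp

lemma w_powers_plus': "w_powers h \<omega> m r q = w_powers h \<omega> m (r - 1) (q - 1) + hsmult h (w_powers h \<omega> m (r - 1) q)"
  using w_powers_plus[of h \<omega> m "r - 1" q] by simp

lemma act_inv_f: "act (Z1 - W1 + const_shift h) (inv_f h \<omega>) x = delta \<omega> x"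
proof -
  obtain p q where x: "x = (p, q)" by (cases x)
  consider "p < 0" | "p = 0" | "0 < p" by linarith
  then show ?thesis unfolding x act_factor2
    by cases (simp_all add: inv_f_def delta_def zero_prod_def nat_minus_Suc w_powers_Suc w_powers_0)
qed

lemma act_inv_g: "act (Z1 - W1 - const_shift h) (inv_g h \<omega>) x = delta \<omega> x"
proof -
  obtain p q where x: "x = (p, q)" by (cases x)
  consider "p < 0" | "p = 0" | "0 < p" by linarith
  then show ?thesis
  proof cases
    case 2
    then show ?thesis unfolding x act_factor2 using w_powers_plus'[of h \<omega> 0 0 q]
      by (simp add: inv_g_def delta_def zero_prod_def w_powers_0 split: if_splits)
  next
    case 3
    then show ?thesis unfolding x act_factor2 using w_powers_plus'[of h \<omega> 0 "- p" q]
      by (simp add: inv_g_def delta_def zero_prod_def)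
  qed (unfold x act_factor2, simp add: inv_g_def delta_def zero_prod_def)
qed

lemma act_inv_ff:
  "act (f1 h) (inv_ff h \<omega>) x = at_zero (inv_f h \<omega>) x"
  "act (f2 h) (inv_ff h \<omega>) x = swap3 (at_zero (inv_f h \<omega>)) x"
proof -
  obtain p p' q where x: "x = (p, p', q)" by (cases x)
  consider "p < 0" | "p = 0" | "0 < p" by linarith
  then show "act (f1 h) (inv_ff h \<omega>) x = at_zero (inv_f h \<omega>) x"
    unfolding x act_factor3 by cases (simp_all add: inv_ff_def inv_f_def at_zero_def nat_minus_Suc w_powers_Suc)
  consider "p' < 0" | "p' = 0" | "0 < p'" by linarith
  then show "act (f2 h) (inv_ff h \<omega>) x = swap3 (at_zero (inv_f h \<omega>)) x"
    unfolding x act_factor3 by cases (simp_all add: inv_ff_def inv_f_def at_zero_def swap3_def nat_minus_Suc w_powers_Suc)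
qed

lemma act_inv_fg:
  "act (f1 h) (inv_fg h \<omega>) x = at_zero (inv_g h \<omega>) x"
  "act (g2 h) (inv_fg h \<omega>) x = swap3 (at_zero (inv_f h \<omega>)) x"
proof -
  obtain p p' q where x: "x = (p, p', q)" by (cases x)
  consider "p < 0" | "p = 0" | "0 < p" by linarith
  then show "act (f1 h) (inv_fg h \<omega>) x = at_zero (inv_g h \<omega>) x"
    unfolding x act_factor3 by cases (simp_all add: inv_fg_def inv_g_def at_zero_def nat_minus_Suc w_powers_Suc)
  consider "p' < 0" | "p' = 0" | "0 < p'" by linarith
  then show "act (g2 h) (inv_fg h \<omega>) x = swap3 (at_zero (inv_f h \<omega>)) x"
  proof cases
    case 2
    then show ?thesis unfolding x act_factor3 using w_powers_plus'[of h \<omega> "nat (- p - 1)" 0 q]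
      by (simp add: inv_fg_def inv_f_def at_zero_def swap3_def)
  next
    case 3
    then show ?thesis unfolding x act_factor3 using w_powers_plus'[of h \<omega> "nat (- p - 1)" "- p'" q]
      by (simp add: inv_fg_def inv_f_def at_zero_def swap3_def)
  qed (unfold x act_factor3, simp add: inv_fg_def inv_f_def at_zero_def swap3_def)
qed

lemma act_inv_gg:
  "act (g1 h) (inv_gg h \<omega>) x = at_zero (inv_g h \<omega>) x"
  "act (g2 h) (inv_gg h \<omega>) x = swap3 (at_zero (inv_g h \<omega>)) x"
proof -
  obtain p p' q where x: "x = (p, p', q)" by (cases x)
  define m where "m = - p - p' - 2"
  have j: "- (p - 1) - p' - 2 = m + 1" "- p - (p' - 1) - 2 = m + 1" by (simp_all add: m_def)
  have e: "inv_gg h \<omega> (p - 1, p', q) = (if 0 \<le> p - 1 \<and> 0 \<le> p' then w_powers h \<omega> 0 (m + 1) q else 0)"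
    "inv_gg h \<omega> (p, p' - 1, q) = (if 0 \<le> p \<and> 0 \<le> p' - 1 then w_powers h \<omega> 0 (m + 1) q else 0)"
    "inv_gg h \<omega> (p, p', q) = (if 0 \<le> p \<and> 0 \<le> p' then w_powers h \<omega> 0 m q else 0)"
    "inv_gg h \<omega> (p, p', q - 1) = (if 0 \<le> p \<and> 0 \<le> p' then w_powers h \<omega> 0 m (q - 1) else 0)"
    unfolding inv_gg_def prod.case j m_def[symmetric] by (rule refl)+
  have m1: "p = 0 \<Longrightarrow> m + 1 = - p' - 1" "p' = 0 \<Longrightarrow> m + 1 = - p - 1" by (simp_all add: m_def)
  have g: "at_zero (inv_g h \<omega>) (p, p', q) = (if p = 0 \<and> 0 \<le> p' then - w_powers h \<omega> 0 (m + 1) q else 0)"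
    "swap3 (at_zero (inv_g h \<omega>)) (p, p', q) = (if p' = 0 \<and> 0 \<le> p then - w_powers h \<omega> 0 (m + 1) q else 0)"
    by (auto simp: at_zero_def inv_g_def swap3_def m1)
  show "act (g1 h) (inv_gg h \<omega>) x = at_zero (inv_g h \<omega>) x"
    "act (g2 h) (inv_gg h \<omega>) x = swap3 (at_zero (inv_g h \<omega>)) x"
    unfolding x act_factor3 e g w_powers_plus by auto
qed

definition swap3_shift :: "(int \<times> int \<times> int) shift \<Rightarrow> (int \<times> int \<times> int) shift" where
  "swap3_shift = push (\<lambda>(p, p', q). (p', p, q))"

lemma additive_map_swap3: "additive_map (\<lambda>(p :: int, p' :: int, q :: int). (p', p, q))"
  by unfold_locales auto

lemma swap3_swap3 [simp]: "swap3 (swap3 U) = U"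
  by (auto simp: swap3_def)

lemma act_swap3: "act (swap3_shift L) (swap3 U) x = swap3 (act L U) x"
proof -
  obtain p p' q where x: "x = (p, p', q)" by (cases x)
  show ?thesis
    using additive_map.act_push[OF additive_map_swap3, of L "swap3 U" 0 "(p', p, q)"]
    by (simp add: x swap3_shift_def swap3_def case_prod_unfold)
qed

lemma swap3_shift_factor:
  "swap3_shift (f1 h) = f2 h" "swap3_shift (f2 h) = f1 h" "swap3_shift (g1 h) = g2 h" "swap3_shift (g2 h) = g1 h"
  by (simp_all add: swap3_shift_def push_add push_diff single_00 zero_prod_def)

text \<open>
  Here \<open>x = z\<^sub>1 - z\<^sub>2\<close>; the sum is the correlation function of the Serre relator, up to a monomial.
\<close>

lemma serre_identity:
  fixes h :: "complex fps" and \<omega> :: "'i fock fps"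
  defines "x \<equiv> Z3 - Y3" and "k \<equiv> 2 * const_shift h"
  shows "act (x * (x + k) * M) (inv_ff h \<omega>) u + act (x * (x - k) * M) (inv_ff h \<omega>) u
    + (act (x * (x + k) * M) (inv_gg h \<omega>) u + act (x * (x - k) * M) (inv_gg h \<omega>) u)
    = act (x * (x + k) * M) (inv_fg h \<omega>) u + act (x * (x + k) * M) (inv_fg h \<omega>) u
    + (act (x * (x - k) * M) (swap3 (inv_fg h \<omega>)) u + act (x * (x - k) * M) (swap3 (inv_fg h \<omega>)) u)"
proof -
  \<comment> \<open>Four ways of writing z_1 - z_2 as a difference of two denominators, up to k = 2
    h. Each summand of such a difference removes one of the two poles.\<close>
  have x: "x = f1 h - f2 h" "x = g1 h - g2 h" "x = f1 h - g2 h - k" "x = g1 h - f2 h + k"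
    by (simp_all add: x_def k_def)
  let ?F = "at_zero (inv_f h \<omega>)" and ?G = "at_zero (inv_g h \<omega>)"
  have ff: "act x (inv_ff h \<omega>) v = ?F v - swap3 ?F v" for v
    unfolding x(1) act_diff_left[of "f1 h" "f2 h"] act_inv_ff ..
  have gg: "act x (inv_gg h \<omega>) v = ?G v - swap3 ?G v" for v
    unfolding x(2) act_diff_left[of "g1 h" "g2 h"] act_inv_gg ..
  have fg: "act x (inv_fg h \<omega>) v = ?G v - swap3 ?F v - act k (inv_fg h \<omega>) v" for v
    unfolding x(3) act_diff_left[of "f1 h - g2 h" k] act_diff_left[of "f1 h" "g2 h"] act_inv_fg ..
  have "act (g1 h) (swap3 (inv_fg h \<omega>)) v = ?F v" "act (f2 h) (swap3 (inv_fg h \<omega>)) v = swap3 ?G v" for v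
  proof -
    have "act (g2 h) (inv_fg h \<omega>) = swap3 ?F" "act (f1 h) (inv_fg h \<omega>) = ?G" by (rule ext, rule act_inv_fg)+
    then show "act (g1 h) (swap3 (inv_fg h \<omega>)) v = ?F v" "act (f2 h) (swap3 (inv_fg h \<omega>)) v = swap3 ?G v"
      using act_swap3[of "g2 h" "inv_fg h \<omega>" v] act_swap3[of "f1 h" "inv_fg h \<omega>" v]
      by (simp_all only: swap3_shift_factor swap3_swap3)
  qed
  then have gf: "act x (swap3 (inv_fg h \<omega>)) v = ?F v - swap3 ?G v + act k (swap3 (inv_fg h \<omega>)) v" for v
    unfolding x(4) act_add_left[of "g1 h - f2 h" k] act_diff_left[of "g1 h" "f2 h"] by simp
  \<comment> \<open>The combination vanishes already before the remaining factor x is applied: x + k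
    and x - k are exactly the differences of denominators of the mixed terms, and the one-pole terms
    F, G and their exchanges cancel.\<close>
  define D where "D v = act (x + k) (inv_ff h \<omega>) v + act (x - k) (inv_ff h \<omega>) v
      + (act (x + k) (inv_gg h \<omega>) v + act (x - k) (inv_gg h \<omega>) v)
      - (act (x + k) (inv_fg h \<omega>) v + act (x + k) (inv_fg h \<omega>) v
        + (act (x - k) (swap3 (inv_fg h \<omega>)) v + act (x - k) (swap3 (inv_fg h \<omega>)) v))" for v
  have "D v = 0" for v
    unfolding D_def act_add_left act_diff_left ff gg fg gf by (simp add: algebra_simps)
  then have "D = (\<lambda>v. 0)" by (rule ext)
  then have D: "act (x * M) D u = 0" by simp
  have m: "act (x * (x + k) * M) U u = act (x * M) (act (x + k) U) u"
    "act (x * (x - k) * M) U u = act (x * M) (act (x - k) U) u" for U :: "_ \<Rightarrow> 'i fock fps"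
    by (simp_all only: act_mult[symmetric] ac_simps)
  show ?thesis
    using D unfolding m D_def[abs_def] by (simp only: act_diff_right act_add_right right_minus_eq)
qed

lemma at_zero_act: "at_zero (act N U) = act (lift_snd N) (at_zero U)"
proof
  fix x :: "int \<times> 'a" obtain p y where x: "x = (p, y)" by (cases x)
  have "(\<lambda>y. at_zero U (p, y)) = (if p = 0 then U else (\<lambda>y. 0))" by (auto simp: at_zero_def)
  then have "act (lift_snd N) (at_zero U) (p, y) = act N (if p = 0 then U else (\<lambda>y. 0)) y"
    by (rule trans[OF act_push_snd arg_cong[of _ _ "\<lambda>U. act N U y"]])
  then show "at_zero (act N U) x = act (lift_snd N) (at_zero U) x" by (simp add: x at_zero_def)
qed

text \<open>A factor that is injective on bounded families singles out one expansion of a quotient.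
  Correlation functions are identified with explicit expansions in this way.\<close>

lemma upper_unique:
  assumes "upper_regular d M" "additive_map d" "upper d C" "upper d C'" "\<And>x. act M C x = act M C' x"
  shows "C = C'"
proof
  fix x
  have "C x - C' x = 0"
    by (rule upper_regular_act_eq_0[OF assms(1,2) upper_diff[OF assms(3,4)]]) (simp add: act_diff_right assms(5))
  then show "C x = C' x" by simp
qed

lemma lower_unique:
  assumes "lower_regular d M" "additive_map d" "lower d C" "lower d C'" "\<And>x. act M C x = act M C' x"
  shows "C = C'"
proof
  fix x
  have "C x - C' x = 0"
    by (rule lower_regular_act_eq_0[OF assms(1,2) lower_diff[OF assms(3,4)]]) (simp add: act_diff_right assms(5))
  then show "C x = C' x" by simp
qed

lemma upper_restrict: "(\<And>x. K < d x \<Longrightarrow> U x = 0) \<Longrightarrow> upper d U"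
  unfolding upper_def by blast

lemma upper_regular_linear_f: "upper_regular fst (Z1 - W1 + const_shift h)" "upper_regular fst (f1 h)"
proof -
  have "upper_regular fst (Z1 + (const_shift h - W1))"
  proof (rule upper_regular_linear)
    fix t assume "t \<in> Poly_Mapping.keys (const_shift h - W1)"
    then have "t \<in> Poly_Mapping.keys (const_shift h :: (int \<times> int) shift) \<union> Poly_Mapping.keys W1"
      using keys_diff[of "const_shift h" W1] by blast
    then show "fst t = 0" by (auto split: if_splits)
  qed simp
  then show "upper_regular fst (Z1 - W1 + const_shift h)" by (simp add: algebra_simps)
  have "upper_regular fst (Z3 + (const_shift h - W3))"
  proof (rule upper_regular_linear)
    fix t assume "t \<in> Poly_Mapping.keys (const_shift h - W3)"
    then have "t \<in> Poly_Mapping.keys (const_shift h :: (int \<times> int \<times> int) shift) \<union> Poly_Mapping.keys W3"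
      using keys_diff[of "const_shift h" W3] by blast
    then show "fst t = 0" by (auto split: if_splits)
  qed simp
  then show "upper_regular fst (f1 h)" by (simp add: algebra_simps)
qed

lemma lower_regular_linear_g:
  assumes "fps_nth h 0 = 0" shows "lower_regular fst (Z1 - W1 - const_shift h)"
proof -
  have "lower_regular fst (Z1 - (W1 + const_shift h))"
  proof (rule lower_regular_linear)
    show "regular (W1 + const_shift h)" by (rule regular_linear[OF assms])
    fix t assume "t \<in> Poly_Mapping.keys (W1 + const_shift h)"
    then have "t \<in> Poly_Mapping.keys W1 \<union> Poly_Mapping.keys (const_shift h :: (int \<times> int) shift)"
      using Poly_Mapping.keys_add[of W1 "const_shift h"] by blast
    then show "fst t = 0" by (auto split: if_splits)
  qed simp
  then show ?thesis by (simp add: diff_diff_eq)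
qed

abbreviation last3 :: "int \<times> int \<times> int \<Rightarrow> int" where "last3 x \<equiv> snd (snd x)"

lemma additive_map_last3: "additive_map last3"
  by unfold_locales simp

text \<open>With respect to w each g is minus a factor with leading term w; the two minus signs
  cancel in the product.\<close>

lemma upper_regular_linear_g: "upper_regular last3 (g1 h * g2 h)"
proof -
  have "upper_regular last3 (W3 + (const_shift h - Poly_Mapping.single (a, b, 0) 1))" for a b
  proof (rule upper_regular_linear)
    fix t :: "int \<times> int \<times> int" assume "t \<in> Poly_Mapping.keys (const_shift h - Poly_Mapping.single (a, b, 0) 1)"
    then have "t \<in> Poly_Mapping.keys (const_shift h :: (int \<times> int \<times> int) shift) \<union> Poly_Mapping.keys (Poly_Mapping.single (a, b, 0) (1 :: complex fps))"
      using keys_diff[of "const_shift h" "Poly_Mapping.single (a, b, 0) 1"] by blast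
    then show "last3 t = 0" by (auto split: if_splits)
  qed simp
  from upper_regular_mult[OF this[of 1 0] this[of 0 1]] show ?thesis
    by (simp add: algebra_simps)
qed

lemma act_gg_inv_gg: "act (g1 h * g2 h) (inv_gg h \<omega>) x = delta \<omega> x"
proof -
  have "act (g2 h) (inv_gg h \<omega>) = swap3 (at_zero (inv_g h \<omega>))"
    by (rule ext) (rule act_inv_gg)
  then have "act (g1 h * g2 h) (inv_gg h \<omega>) x = act (swap3_shift (g2 h)) (swap3 (at_zero (inv_g h \<omega>))) x"
    by (simp only: act_mult swap3_shift_factor)
  also have "\<dots> = swap3 (act (lift_snd (Z1 - W1 - const_shift h)) (at_zero (inv_g h \<omega>))) x"
    by (simp add: act_swap3 push_diff single_00 flip: zero_prod_def)
  also have "\<dots> = swap3 (at_zero (act (Z1 - W1 - const_shift h) (inv_g h \<omega>))) x"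
    by (simp only: at_zero_act)
  also have "act (Z1 - W1 - const_shift h) (inv_g h \<omega>) = delta \<omega>"
    by (rule ext) (rule act_inv_g)
  finally show ?thesis by (cases x) (auto simp: swap3_def at_zero_def delta_def zero_prod_def)
qed

lemma orient_append: "orient s (x @ x') (y @ y') = orient s x y @ orient s x' y'"
  by (cases s) simp_all

lemma psum_append: "psum (xs @ ys) r = psum xs r + psum ys r"
  by (simp add: psum_def)

text \<open>Passing from X^+ to X^- replaces hbar by -hbar in the roots below, so both signs of the
  Serre relation are proved at once with h = +/- hbar/2.\<close>

abbreviation b_sign :: "sign \<Rightarrow> complex fps" where "b_sign s \<equiv> sg s * b_plus"

lemma const_b_sign: "const_shift (b_sign Plus) = eta" "const_shift (b_sign Minus) = - eta"
  by (simp_all add: sg_def single_uminus flip: fps_const_neg)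

section \<open>Three-point functions for neighbouring nodes\<close>

context simply_laced
begin

lemma orient_roots_same:
  "orient s (pos_roots a s i i z) (neg_roots a s i i z) = [z, z - 2 * const_shift (b_sign s)]"
  "orient s (neg_roots a s i i z) (pos_roots a s i i z) = []"
  by (cases s; simp add: root_rules const_b_sign del: mult_numeral_left)+

lemma orient_roots_adjacent:
  assumes "i \<noteq> j" "a i j = -1"
  shows "orient s (pos_roots a s j i z) (neg_roots a s j i z) = []"
    "orient s (neg_roots a s j i z) (pos_roots a s j i z) = [z - const_shift (b_sign s)]"
    "orient s (pos_roots a s i j z) (neg_roots a s i j z) = []"
    "orient s (neg_roots a s i j z) (pos_roots a s i j z) = [z - const_shift (b_sign s)]"
  using assms a_sym[of i j] by (cases s; simp add: root_rules const_b_sign)+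

text \<open>Eigenvalues and commutators are sums over the factors of a product, so they do not
  depend on the order; all orders of two or three currents share these data once the variables are
  matched.\<close>

definition pair_l :: "sign \<Rightarrow> 'i \<Rightarrow> 'i \<Rightarrow> 'i \<Rightarrow> nat \<Rightarrow> (int \<times> int) shift" where
  "pair_l s i j k r = lam a s i Z1 k r + lam a s j W1 k r"
definition pair_m :: "sign \<Rightarrow> 'i \<Rightarrow> 'i \<Rightarrow> 'i \<Rightarrow> nat \<Rightarrow> (int \<times> int) shift" where
  "pair_m s i j k r = (if k = i then Poly_Mapping.single (- int r, 0) (sg s) else 0)
     + (if k = j then Poly_Mapping.single (0, - int r) (sg s) else 0)"
definition serre_l :: "sign \<Rightarrow> 'i \<Rightarrow> 'i \<Rightarrow> 'i \<Rightarrow> nat \<Rightarrow> (int \<times> int \<times> int) shift" where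
  "serre_l s i j k r = lam a s i Z3 k r + lam a s i Y3 k r + lam a s j W3 k r"
definition serre_m :: "sign \<Rightarrow> 'i \<Rightarrow> 'i \<Rightarrow> 'i \<Rightarrow> nat \<Rightarrow> (int \<times> int \<times> int) shift" where
  "serre_m s i j k r = (if k = i then Poly_Mapping.single (- int r, 0, 0) (sg s) else 0)
     + (if k = i then Poly_Mapping.single (0, - int r, 0) (sg s) else 0)
     + (if k = j then Poly_Mapping.single (0, 0, - int r) (sg s) else 0)"

lemma additive_map_first: "additive_map (\<lambda>p :: int. (p, 0 :: int, 0 :: int))"
  by unfold_locales auto

lemma push_if: "push \<phi> (if b then L else 0) = (if b then push \<phi> L else 0)"
  by simp

lemma pair_family:
  "vertex_family (pair_l s i j) (\<lambda>k r. 1) (pair_m s i j) (\<lambda>(p, q) v. X s i p (X s j q v))"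
  by (rule vertex_family_cong[OF vertex_family_tensor[OF vertex_field_X vertex_field_imp_family[OF vertex_field_X]]])
     (simp_all add: pair_l_def pair_m_def push_lam additive_map.push_1 push_if)

lemma pair_family_swapped:
  "vertex_family (pair_l s i j) (\<lambda>k r. 1) (pair_m s i j) (\<lambda>(p, q) v. X s j q (X s i p v))"
proof -
  have "vertex_family (pair_l s i j) (\<lambda>k r. 1) (pair_m s i j) (\<lambda>y. (\<lambda>(q, p) v. X s j q (X s i p v)) (prod.swap y))"
    by (rule vertex_family_cong[OF vertex_family_reindex[OF pair_family additive_map_swap]])
       (simp_all add: pair_l_def pair_m_def push_lam additive_map.push_1 push_add push_if add.commute)
  also have "(\<lambda>y. (\<lambda>(q, p) v. X s j q (X s i p v)) (prod.swap y)) = (\<lambda>(p, q) v. X s j q (X s i p v))"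
    by (auto simp: prod.swap_def)
  finally show ?thesis .
qed

lemma serre_family_tensor:
  assumes "vertex_family (pair_l s i j) (\<lambda>k r. 1) (pair_m s i j) P"
  shows "vertex_family (serre_l s i j) (\<lambda>k r. 1) (serre_m s i j) (\<lambda>(p, y) v. X s i p (P y v))"
  by (rule vertex_family_cong[OF vertex_family_tensor[OF vertex_field_X assms]])
     (simp_all add: pair_l_def pair_m_def serre_l_def serre_m_def push_lam additive_map.push_1 push_add push_if zero_prod_def add.assoc additive_map_first)

lemma additive_map_rotate: "additive_map (\<lambda>(q :: int, p :: int, p' :: int). (p, p', q))"
  by unfold_locales auto

lemma serre_family_last:
  "vertex_family (serre_l s i j) (\<lambda>k r. 1) (serre_m s i j) (\<lambda>(p, p', q) v. X s j q (X s i p (X s i p' v)))"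
proof -
  have "vertex_family (serre_l s i j) (\<lambda>k r. 1) (serre_m s i j)
      (\<lambda>y. (\<lambda>(q, y) v. X s j q ((\<lambda>(p, q) v. X s i p (X s i q v)) y v)) ((\<lambda>(p, p', q). (q, p, p')) y))"
    by (rule vertex_family_cong[OF vertex_family_reindex[OF vertex_family_tensor[OF vertex_field_X pair_family] additive_map_rotate]])
       (auto simp add: pair_l_def pair_m_def serre_l_def serre_m_def push_lam additive_map.push_1 push_add push_if
          additive_map_rotate additive_map_first additive_map.push_mult zero_prod_def ac_simps)
  also have "(\<lambda>y. (\<lambda>(q, y) v. X s j q ((\<lambda>(p, q) v. X s i p (X s i q v)) y v)) ((\<lambda>(p, p', q). (q, p, p')) y))
      = (\<lambda>(p, p', q) v. X s j q (X s i p (X s i p' v)))"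
    by (auto simp: case_prod_unfold)
  finally show ?thesis .
qed

lemma serre_family_swap:
  assumes "vertex_family (serre_l s i j) (\<lambda>k r. 1) (serre_m s i j) P"
  shows "vertex_family (serre_l s i j) (\<lambda>k r. 1) (serre_m s i j) (\<lambda>y. P ((\<lambda>(p, p', q). (p', p, q)) y))"
  by (rule vertex_family_cong[OF vertex_family_reindex[OF assms additive_map_swap3]])
     (auto simp add: serre_l_def serre_m_def push_lam additive_map.push_1 push_add push_if additive_map_swap3 zero_prod_def ac_simps)

lemma pair_eigen: "0 < r \<Longrightarrow> heis_pos k r (X s i (fst y) (X s j (snd y) (vv \<beta>)))
    = act (pair_l s i j k r) (\<lambda>y. X s i (fst y) (X s j (snd y) (vv \<beta>))) y"
  and pair_eigen_swapped: "0 < r \<Longrightarrow> heis_pos k r (X s j (snd y) (X s i (fst y) (vv \<beta>)))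
    = act (pair_l s i j k r) (\<lambda>y. X s j (snd y) (X s i (fst y) (vv \<beta>))) y"
  using pair_family[of s i j] pair_family_swapped[of s i j] unfolding vertex_family_def case_prod_unfold by simp_all

context
  fixes i j :: 'i assumes ij: "i \<noteq> j" and adj: "a i j = -1"
begin

text \<open>The monomial common to all three orders of X_i, X_i, X_j. The other cocycle values occur
  in squares, which are 1.\<close>

definition serre_mono :: "sign \<Rightarrow> 'i lattice \<Rightarrow> (int \<times> int \<times> int) shift" where
  "serre_mono s \<gamma> = Poly_Mapping.single (form a (rt s i) \<gamma>, form a (rt s i) \<gamma>, form a (rt s j) \<gamma>)
     (sg s * fps_const (\<epsilon> (rt s i) (rt s i) * \<epsilon> (rt s j) \<gamma>))"

text \<open>The denominator z - w + h is injective on families bounded above in z, which forces the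
  expansion in descending powers.\<close>

lemma pair_correlator:
  fixes s :: sign and \<beta> :: "'i lattice"
  defines "\<gamma> \<equiv> \<beta> - rt s i - rt s j"
  shows "(\<lambda>(p, q). vac \<beta> (X s i p (X s j q (vv \<beta>0)))) = act (mono2 s i s j \<gamma>) (inv_f (b_sign s) (vac \<gamma> (vv \<beta>0)))"
proof (rule upper_unique[OF upper_regular_linear_f(1)[of "b_sign s"]])
  let ?N = "neg_roots a s j i zz" and ?P = "pos_roots a s j i zz"
  show "upper fst (\<lambda>(p, q). vac \<beta> (X s i p (X s j q (vv \<beta>0))))" by (rule X_correlator_upper)
  show "upper fst (act (mono2 s i s j \<gamma>) (inv_f (b_sign s) (vac \<gamma> (vv \<beta>0))))"
    by (rule upper_act[OF _ upper_restrict[of 0]]) (auto simp: inv_f_def)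
  fix x
  have "act (zfactors 0 (orient s ?N ?P)) (\<lambda>(p, q). vac \<beta> (X s i p (X s j q (vv \<beta>0)))) x
      = act (zfactors 0 (orient s ?P ?N) * mono2 s i s j \<gamma>) (delta (vac \<gamma> (vv \<beta>0))) x"
    unfolding \<gamma>_def by (rule XX_correlator)
  also have "zfactors 0 (orient s ?N ?P) = Z1 - W1 + const_shift (b_sign s)"
    unfolding orient_roots_adjacent[OF ij adj] by (simp add: push_diff single_00 flip: zero_prod_def)
  also have "zfactors 0 (orient s ?P ?N) = 1"
    unfolding orient_roots_adjacent[OF ij adj] by simp
  also have "delta (vac \<gamma> (vv \<beta>0)) = act (Z1 - W1 + const_shift (b_sign s)) (inv_f (b_sign s) (vac \<gamma> (vv \<beta>0)))"
    by (rule ext) (rule act_inv_f[symmetric])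
  finally show "act (Z1 - W1 + const_shift (b_sign s)) (\<lambda>(p, q). vac \<beta> (X s i p (X s j q (vv \<beta>0)))) x
      = act (Z1 - W1 + const_shift (b_sign s)) (act (mono2 s i s j \<gamma>) (inv_f (b_sign s) (vac \<gamma> (vv \<beta>0)))) x"
    by (simp only: mult_1 act_commute[of "mono2 s i s j \<gamma>"])
qed simp

text \<open>In this order the vacuum vector bounds the exponents of z from below, which forces the
  ascending expansion. The sign (-1)^(a_ij) = -1 absorbs the passage from w - z to z - w.\<close>

lemma pair_correlator_swapped:
  fixes s :: sign and \<beta> :: "'i lattice"
  defines "\<gamma> \<equiv> \<beta> - rt s i - rt s j"
  shows "(\<lambda>(p, q). vac \<beta> (X s j q (X s i p (vv \<beta>0)))) = act (mono2 s i s j \<gamma>) (inv_g (b_sign s) (vac \<gamma> (vv \<beta>0)))"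
proof (rule lower_unique[OF lower_regular_linear_g[of "b_sign s"]])
  let ?N = "neg_roots a s i j zz" and ?P = "pos_roots a s i j zz"
  let ?C = "(\<lambda>(p, q). vac \<beta> (X s j q (X s i p (vv \<beta>0))))"
  show "fps_nth (b_sign s) 0 = 0" by (cases s) (simp_all add: sg_def)
  have "?C x = 0" if "fst x < form a (rt s i) \<beta>0" for x
    using that by (cases x) (simp add: X_op_vv_lower module_hom.zero[OF lin_X_op] module_hom.zero[OF lin_vac])
  then show "lower fst ?C" by (rule lower_restrict)
  show "lower fst (act (mono2 s i s j \<gamma>) (inv_g (b_sign s) (vac \<gamma> (vv \<beta>0))))"
    by (rule lower_act[OF _ lower_restrict[of _ 0]]) (auto simp: inv_g_def)
  fix x
  have "act (push prod.swap (zfactors 0 (orient s ?N ?P))) ?C x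
      = act (push prod.swap (zfactors 0 (orient s ?P ?N)) * (const_shift (fps_const ((-1) powi (a i j)))
              * mono2 s i s j \<gamma>)) (delta (vac \<gamma> (vv \<beta>0))) x"
    unfolding \<gamma>_def by (rule XX_correlator_swapped)
  also have "push prod.swap (zfactors 0 (orient s ?N ?P)) = - (Z1 - W1 - const_shift (b_sign s))"
    unfolding orient_roots_adjacent[OF ij adj]
    by (simp add: push_diff push_add single_00 swap_0 flip: zero_prod_def)
  also have "push prod.swap (zfactors 0 (orient s ?P ?N)) * (const_shift (fps_const ((-1) powi (a i j))) * mono2 s i s j \<gamma>)
      = - mono2 s i s j \<gamma>"
    unfolding orient_roots_adjacent[OF ij adj] by (simp add: adj const_minus_1 additive_map.push_1)
  also have "delta (vac \<gamma> (vv \<beta>0)) = act (Z1 - W1 - const_shift (b_sign s)) (inv_g (b_sign s) (vac \<gamma> (vv \<beta>0)))"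
    by (rule ext) (rule act_inv_g[symmetric])
  finally show "act (Z1 - W1 - const_shift (b_sign s)) ?C x
      = act (Z1 - W1 - const_shift (b_sign s)) (act (mono2 s i s j \<gamma>) (inv_g (b_sign s) (vac \<gamma> (vv \<beta>0)))) x"
    by (simp only: act_uminus_left neg_equal_iff_equal act_commute[of "mono2 s i s j \<gamma>"])
qed simp

text \<open>U is the inner pair in either order. Passing the outer X_i over it contributes the
  numerator (z_1 - z_2) (z_1 - z_2 + 2 h) from the other X_i and the denominator z_1 - w + h from
  X_j.\<close>

lemma triple_correlator:
  fixes s :: sign and \<beta> :: "'i lattice" and U :: "int \<times> int \<Rightarrow> 'i fock fps"
  defines "\<gamma> \<equiv> \<beta> - rt s i - rt s i - rt s j"
  assumes U: "\<And>r y. 0 < r \<Longrightarrow> heis_pos i r (U y) = act (pair_l s i j i r) U y"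
    and C: "(\<lambda>y. vac (\<beta> - rt s i) (U y)) = act (mono2 s i s j \<gamma>) \<Theta>"
    and \<Phi>: "\<And>x. act (f1 (b_sign s)) \<Phi> x = at_zero \<Theta> x" "upper fst \<Phi>"
  shows "(\<lambda>(p, y). vac \<beta> (X s i p (U y)))
     = act ((Z3 - Y3) * (Z3 - Y3 + 2 * const_shift (b_sign s)) * serre_mono s \<gamma>) \<Phi>"
proof (rule upper_unique[OF upper_regular_linear_f(2)[of "b_sign s"]])
  let ?D = "(Z3 - Y3) * (Z3 - Y3 + 2 * const_shift (b_sign s))"
  define xs ys where "xs = pos_roots a s i i Z1 @ pos_roots a s j i W1" and "ys = neg_roots a s i i Z1 @ neg_roots a s j i W1"
  define num den where "num = orient s xs ys" and "den = orient s ys xs"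
  define e \<kappa> where "e = form a (rt s i) (\<beta> - rt s i) + int (length den) - int (length num)"
    and "\<kappa> = sg s * fps_const (\<epsilon> (rt s i) (\<beta> - rt s i))"
  have nd: "num = [Z1, Z1 - 2 * const_shift (b_sign s)]" "den = [W1 - const_shift (b_sign s)]"
    unfolding num_def den_def xs_def ys_def orient_append orient_roots_same orient_roots_adjacent[OF ij adj] by simp_all
  have b: "\<beta> - rt s i = \<gamma> + rt s i + rt s j" by (simp add: \<gamma>_def)
  have e: "e = form a (rt s i) \<gamma>"
    unfolding e_def nd b by (simp add: form_add_right form_rt sg_square adj)
  show "upper fst (\<lambda>(p, y). vac \<beta> (X s i p (U y)))" by (rule X_correlator_upper)
  show "upper fst (act (?D * serre_mono s \<gamma>) \<Phi>)" by (rule upper_act[OF _ \<Phi>(2)]) simp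
  have mono: "Poly_Mapping.single (e, 0) \<kappa> * lift_snd (mono2 s i s j \<gamma>) = serre_mono s \<gamma>"
  proof -
    \<comment> \<open>Every cocycle value other than \<epsilon> of the root i with itself and of the
      root j with \<gamma> occurs twice and squares to 1.\<close>
    have "sg s * \<epsilon> (rt s i) (\<beta> - rt s i) * (sg s * sg s * (\<epsilon> (rt s i) \<gamma> * \<epsilon> (rt s j) \<gamma> * \<epsilon> (rt s i) (rt s j)))
       = sg s * (sg s * sg s) * \<epsilon> (rt s i) (rt s i) * (\<epsilon> (rt s i) \<gamma> * \<epsilon> (rt s i) \<gamma>)
          * (\<epsilon> (rt s i) (rt s j) * \<epsilon> (rt s i) (rt s j)) * \<epsilon> (rt s j) \<gamma>"
      unfolding b cocycle by (simp only: ac_simps)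
    then have "sg s * \<epsilon> (rt s i) (\<beta> - rt s i) * (sg s * sg s * (\<epsilon> (rt s i) \<gamma> * \<epsilon> (rt s j) \<gamma> * \<epsilon> (rt s i) (rt s j)))
       = sg s * (\<epsilon> (rt s i) (rt s i) * \<epsilon> (rt s j) \<gamma>)"
      by (simp add: cocycle_square sg_square)
    then have "fps_const (sg s * \<epsilon> (rt s i) (\<beta> - rt s i) * (sg s * sg s * (\<epsilon> (rt s i) \<gamma> * \<epsilon> (rt s j) \<gamma> * \<epsilon> (rt s i) (rt s j))))
       = fps_const (sg s * (\<epsilon> (rt s i) (rt s i) * \<epsilon> (rt s j) \<gamma>))" by (simp only:)
    moreover have "fps_const (sg s) = (sg s :: complex fps)" by (cases s) (simp_all add: sg_def flip: fps_const_neg)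
    ultimately show ?thesis
      unfolding mono2_def serre_mono_def \<kappa>_def e
      by (simp only: push_single mult_single fps_const_mult[symmetric]) simp
  qed
  fix u
  have "act (zfactors 0 den) (\<lambda>(p, y). vac \<beta> (X s i p (U y))) u
     = act (zfactors 0 num * Poly_Mapping.single (e, 0) \<kappa>) (at_zero (\<lambda>y. vac (\<beta> - rt s i) (U y))) u"
    unfolding num_def den_def e_def \<kappa>_def
    by (rule X_correlator) (simp add: U pair_l_def lam_def psum_append xs_def ys_def algebra_simps)
  also have "at_zero (\<lambda>y. vac (\<beta> - rt s i) (U y)) = act (lift_snd (mono2 s i s j \<gamma>)) (at_zero \<Theta>)"
    unfolding C by (rule at_zero_act)
  also have "at_zero \<Theta> = act (f1 (b_sign s)) \<Phi>" by (rule ext) (rule \<Phi>(1)[symmetric])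
  also have "zfactors 0 num = ?D"
    unfolding nd by (simp add: push_diff push_numeral zero_prod_def; simp add: algebra_simps)
  also have "zfactors 0 den = f1 (b_sign s)"
    unfolding nd by (simp add: push_diff zero_prod_def; simp add: algebra_simps)
  finally show "act (f1 (b_sign s)) (\<lambda>(p, y). vac \<beta> (X s i p (U y))) u
     = act (f1 (b_sign s)) (act (?D * serre_mono s \<gamma>) \<Phi>) u"
    unfolding mono[symmetric] by (simp only: act_mult[symmetric] ac_simps)
qed simp

text \<open>Now X_j(w) stands leftmost, so the expansion is in descending powers of w. The variables
  are rotated to put w first, where \<open>X_correlator\<close> expects the outer variable.\<close>

lemma triple_correlator_last:
  fixes s :: sign and \<beta> :: "'i lattice"
  defines "\<gamma> \<equiv> \<beta> - rt s i - rt s i - rt s j"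
  shows "(\<lambda>(p, p', q). vac \<beta> (X s j q (X s i p (X s i p' (vv \<beta>0)))))
     = act ((Z3 - Y3) * (Z3 - Y3 + 2 * const_shift (b_sign s)) * serre_mono s \<gamma>) (inv_gg (b_sign s) (vac \<gamma> (vv \<beta>0)))"
proof (rule upper_unique[OF upper_regular_linear_g[of "b_sign s"] additive_map_last3])
  let ?D = "(Z3 - Y3) * (Z3 - Y3 + 2 * const_shift (b_sign s))"
  let ?\<sigma> = "\<lambda>(q :: int, p :: int, p' :: int). (p, p', q)"
  define \<omega> where "\<omega> = vac \<gamma> (vv \<beta>0)"
  define U where "U y = X s i (fst y) (X s i (snd y) (vv \<beta>0))" for y
  define E where "E = (\<lambda>(q, y). vac \<beta> (X s j q (U y)))"
  define C where "C = (\<lambda>(p, p', q). vac \<beta> (X s j q (X s i p (X s i p' (vv \<beta>0)))))"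
  have CE: "C (?\<sigma> y) = E y" for y by (cases y) (simp add: C_def E_def U_def)
  define xs ys where "xs = pos_roots a s i j Z1 @ pos_roots a s i j W1" and "ys = neg_roots a s i j Z1 @ neg_roots a s i j W1"
  define num den where "num = orient s xs ys" and "den = orient s ys xs"
  define e \<kappa> where "e = form a (rt s j) (\<beta> - rt s j) + int (length den) - int (length num)"
    and "\<kappa> = sg s * fps_const (\<epsilon> (rt s j) (\<beta> - rt s j))"
  have nd: "num = []" "den = [Z1 - const_shift (b_sign s), W1 - const_shift (b_sign s)]"
    unfolding num_def den_def xs_def ys_def orient_append orient_roots_adjacent[OF ij adj] by simp_all
  have b: "\<beta> - rt s j = \<gamma> + rt s i + rt s i" by (simp add: \<gamma>_def)
  have e: "e = form a (rt s j) \<gamma>"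
    unfolding e_def nd b by (simp add: form_add_right form_rt sg_square a_sym[of j i] adj)
  have E: "act (zfactors 0 den) E u = act (Poly_Mapping.single (e, 0) \<kappa>) (at_zero (\<lambda>y. vac (\<beta> - rt s j) (U y))) u" for u
  proof -
    have "act (zfactors 0 den) E u = act (zfactors 0 num * Poly_Mapping.single (e, 0) \<kappa>) (at_zero (\<lambda>y. vac (\<beta> - rt s j) (U y))) u"
      unfolding num_def den_def e_def \<kappa>_def E_def U_def
      by (rule X_correlator) (simp add: pair_eigen pair_l_def lam_def psum_append xs_def ys_def algebra_simps)
    then show ?thesis by (simp add: nd)
  qed
  let ?D2 = "(Z1 - W1) * (Z1 - W1 + 2 * const_shift (b_sign s))"
  have "(\<lambda>y. vac (\<beta> - rt s j) (U y)) = act (?D2 * mono2 s i s i \<gamma>) (delta \<omega>)"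
  proof
    fix y
    have \<gamma>: "\<gamma> = (\<beta> - rt s j) - rt s i - rt s i" by (simp add: \<gamma>_def)
    let ?N = "neg_roots a s i i zz" and ?P = "pos_roots a s i i zz"
    have "act (zfactors 0 (orient s ?N ?P)) (\<lambda>(p, q). vac (\<beta> - rt s j) (X s i p (X s i q (vv \<beta>0)))) y
        = act (zfactors 0 (orient s ?P ?N) * mono2 s i s i \<gamma>) (delta (vac \<gamma> (vv \<beta>0))) y"
      unfolding \<gamma> by (rule XX_correlator)
    moreover have "zfactors 0 (orient s ?P ?N) = ?D2"
      unfolding orient_roots_same by (simp add: push_diff push_numeral single_00 flip: zero_prod_def; simp add: algebra_simps)
    ultimately show "vac (\<beta> - rt s j) (U y) = act (?D2 * mono2 s i s i \<gamma>) (delta \<omega>) y"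
      unfolding orient_roots_same \<omega>_def[symmetric] by (simp add: U_def case_prod_unfold)
  qed
  then have E: "act (zfactors 0 den) E u
      = act (Poly_Mapping.single (e, 0) \<kappa> * lift_snd (?D2 * mono2 s i s i \<gamma>)) (delta \<omega>) u" for u
    unfolding E by (simp only: at_zero_delta act_mult)
  have mono: "push ?\<sigma> (Poly_Mapping.single (e, 0) \<kappa> * lift_snd (mono2 s i s i \<gamma>)) = serre_mono s \<gamma>"
  proof -
    have "sg s * \<epsilon> (rt s j) (\<beta> - rt s j) * (sg s * sg s * (\<epsilon> (rt s i) \<gamma> * \<epsilon> (rt s i) \<gamma> * \<epsilon> (rt s i) (rt s i)))
       = sg s * (sg s * sg s) * \<epsilon> (rt s i) (rt s i) * (\<epsilon> (rt s i) \<gamma> * \<epsilon> (rt s i) \<gamma>)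
          * (\<epsilon> (rt s j) (rt s i) * \<epsilon> (rt s j) (rt s i)) * \<epsilon> (rt s j) \<gamma>"
      unfolding b cocycle by (simp only: ac_simps)
    then have "sg s * \<epsilon> (rt s j) (\<beta> - rt s j) * (sg s * sg s * (\<epsilon> (rt s i) \<gamma> * \<epsilon> (rt s i) \<gamma> * \<epsilon> (rt s i) (rt s i)))
       = sg s * (\<epsilon> (rt s i) (rt s i) * \<epsilon> (rt s j) \<gamma>)"
      by (simp add: cocycle_square sg_square)
    then have "fps_const (sg s * \<epsilon> (rt s j) (\<beta> - rt s j) * (sg s * sg s * (\<epsilon> (rt s i) \<gamma> * \<epsilon> (rt s i) \<gamma> * \<epsilon> (rt s i) (rt s i))))
       = fps_const (sg s * (\<epsilon> (rt s i) (rt s i) * \<epsilon> (rt s j) \<gamma>))" by (simp only:)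
    moreover have "fps_const (sg s) = (sg s :: complex fps)" by (cases s) (simp_all add: sg_def flip: fps_const_neg)
    ultimately show ?thesis
      unfolding mono2_def serre_mono_def \<kappa>_def e
      by (simp only: push_single mult_single fps_const_mult[symmetric]) (simp add: zero_prod_def)
  qed
  show "upper last3 C"
  proof -
    obtain K where K: "\<And>x. K < fst x \<Longrightarrow> E x = 0" using X_correlator_upper[of \<beta> a \<epsilon> s j U] unfolding E_def upper_def by blast
    have "C x = 0" if "K < last3 x" for x
      using K[of "(snd (snd x), fst x, fst (snd x))"] that CE[of "(snd (snd x), fst x, fst (snd x))"] by simp
    then show ?thesis by (rule upper_restrict)
  qed
  show "upper last3 (act (?D * serre_mono s \<gamma>) (inv_gg (b_sign s) (vac \<gamma> (vv \<beta>0))))"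
    by (rule upper_act[OF additive_map_last3 upper_restrict[of 0]]) (auto simp: inv_gg_def w_powers_upper)
  fix u :: "int \<times> int \<times> int"
  obtain y where u: "u = ?\<sigma> y" by (cases u) (auto intro: that[of "(_, _, _)"])
  have push: "act (push ?\<sigma> L) V (?\<sigma> y) = act L (\<lambda>y. V (?\<sigma> y)) y" for L V
    using additive_map.act_push[OF additive_map_rotate, of L V 0 y] by (simp only: add_0_left)
  have "act (push ?\<sigma> (zfactors 0 den)) C u = act (zfactors 0 den) E y"
    unfolding u push CE ..
  also have "\<dots> = act (push ?\<sigma> (Poly_Mapping.single (e, 0) \<kappa> * lift_snd (?D2 * mono2 s i s i \<gamma>))) (delta \<omega>) u"
  proof -
    have "(\<lambda>y. delta \<omega> (?\<sigma> y)) = delta \<omega>" by (auto simp: delta_def zero_prod_def)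
    then show ?thesis unfolding u push E by simp
  qed
  also have "push ?\<sigma> (Poly_Mapping.single (e, 0) \<kappa> * lift_snd (?D2 * mono2 s i s i \<gamma>)) = ?D * serre_mono s \<gamma>"
  proof -
    have "push ?\<sigma> (lift_snd ?D2) = ?D"
      by (simp add: additive_map.push_mult additive_map_rotate push_add push_diff push_2[OF additive_map_rotate] push_2[OF additive_map_Pair(2)] zero_prod_def)
    then show ?thesis
      unfolding mono[symmetric] by (simp only: additive_map.push_mult additive_map_rotate additive_map_Pair ac_simps)
  qed
  also have "push ?\<sigma> (zfactors 0 den) = g1 (b_sign s) * g2 (b_sign s)"
    unfolding nd by (simp add: additive_map.push_mult additive_map_rotate push_add push_diff zero_prod_def; simp add: algebra_simps)
  also have "delta \<omega> = act (g1 (b_sign s) * g2 (b_sign s)) (inv_gg (b_sign s) \<omega>)"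
    by (rule ext) (rule act_gg_inv_gg[symmetric])
  finally show "act (g1 (b_sign s) * g2 (b_sign s)) C u
      = act (g1 (b_sign s) * g2 (b_sign s)) (act (?D * serre_mono s \<gamma>) (inv_gg (b_sign s) (vac \<gamma> (vv \<beta>0)))) u"
    unfolding \<omega>_def by (simp only: act_commute[of "?D * serre_mono s \<gamma>"])
qed

text \<open>There are three correlation functions, for the three positions of X_j, together with
  their exchanges of z_1 and z_2. They share one monomial and one numerator, so that
  \<open>serre_identity\<close> applies.\<close>

theorem XXX_serre:
  "X s i p (X s i p' (X s j q v)) + X s i p' (X s i p (X s j q v))
     + (X s j q (X s i p (X s i p' v)) + X s j q (X s i p' (X s i p v)))
   = X s i p (X s j q (X s i p' v)) + X s i p (X s j q (X s i p' v))
     + (X s i p' (X s j q (X s i p v)) + X s i p' (X s j q (X s i p v)))"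
proof -
  define A B C where "A = (\<lambda>(p, y) v. X s i p ((\<lambda>(p, q) v. X s i p (X s j q v)) y v))"
    and "B = (\<lambda>(p, y) v. X s i p ((\<lambda>(p, q) v. X s j q (X s i p v)) y v))"
    and "C = (\<lambda>(p, p', q) v. X s j q (X s i p (X s i p' v)))"
  let ?\<tau> = "\<lambda>(p :: int, p' :: int, q :: int). (p', p, q)"
  let ?D = "\<lambda>x v. A x v + A (?\<tau> x) v + (C x v + C (?\<tau> x) v) - (B x v + B x v + (B (?\<tau> x) v + B (?\<tau> x) v))"
  have fam: "vertex_family (serre_l s i j) (\<lambda>k r. 1) (serre_m s i j) A"
    "vertex_family (serre_l s i j) (\<lambda>k r. 1) (serre_m s i j) B"
    "vertex_family (serre_l s i j) (\<lambda>k r. 1) (serre_m s i j) C"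
    unfolding A_def B_def C_def
    by (rule serre_family_tensor[OF pair_family] serre_family_tensor[OF pair_family_swapped] serre_family_last)+
  note fam' = fam[THEN serre_family_swap]
  have D: "vertex_family (serre_l s i j) (\<lambda>k r. 1) (serre_m s i j) ?D"
    by (rule vertex_family_diff[OF vertex_family_add[OF vertex_family_add[OF fam(1) fam'(1)] vertex_family_add[OF fam(3) fam'(3)]]
          vertex_family_add[OF vertex_family_add[OF fam(2) fam(2)] vertex_family_add[OF fam'(2) fam'(2)]]])
  have "?D (p, p', q) v = 0"
  proof (rule vertex_family_eq_0[OF D])
    show "regular 1" for k :: 'i and r :: nat by (rule regular_1)
    fix \<beta> \<beta>0 x
    define \<gamma> \<omega> where "\<gamma> = \<beta> - rt s i - rt s i - rt s j" and "\<omega> = vac \<gamma> (vv \<beta>0)"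
    let ?h = "b_sign s"
    let ?x = "Z3 - Y3" and ?k = "2 * const_shift ?h :: (int \<times> int \<times> int) shift" and ?M = "serre_mono s \<gamma>"
    have \<gamma>': "\<beta> - rt s i - rt s i - rt s j = \<gamma>" by (simp add: \<gamma>_def)
    have vacA: "(\<lambda>x. vac \<beta> (A x (vv \<beta>0))) = act (?x * (?x + ?k) * ?M) (inv_ff ?h \<omega>)"
    proof -
      have "(\<lambda>(p, y). vac \<beta> (X s i p (X s i (fst y) (X s j (snd y) (vv \<beta>0))))) = act (?x * (?x + ?k) * ?M) (inv_ff ?h \<omega>)"
        unfolding \<gamma>_def
      proof (rule triple_correlator)
        show "upper fst (inv_ff ?h \<omega>)" by (rule upper_restrict[of 0]) (auto simp: inv_ff_def)
        show "(\<lambda>y. vac (\<beta> - rt s i) (X s i (fst y) (X s j (snd y) (vv \<beta>0))))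
            = act (mono2 s i s j (\<beta> - rt s i - rt s i - rt s j)) (inv_f ?h \<omega>)"
          using pair_correlator[where s = s and \<beta> = "\<beta> - rt s i"] unfolding \<omega>_def \<gamma>_def by (simp add: case_prod_unfold)
      qed (rule pair_eigen act_inv_ff; assumption?)+
      then show ?thesis by (simp add: A_def case_prod_unfold)
    qed
    have vacB: "(\<lambda>x. vac \<beta> (B x (vv \<beta>0))) = act (?x * (?x + ?k) * ?M) (inv_fg ?h \<omega>)"
    proof -
      have "(\<lambda>(p, y). vac \<beta> (X s i p (X s j (snd y) (X s i (fst y) (vv \<beta>0))))) = act (?x * (?x + ?k) * ?M) (inv_fg ?h \<omega>)"
        unfolding \<gamma>_def
      proof (rule triple_correlator)
        show "upper fst (inv_fg ?h \<omega>)" by (rule upper_restrict[of 0]) (auto simp: inv_fg_def)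
        show "(\<lambda>y. vac (\<beta> - rt s i) (X s j (snd y) (X s i (fst y) (vv \<beta>0))))
            = act (mono2 s i s j (\<beta> - rt s i - rt s i - rt s j)) (inv_g ?h \<omega>)"
          using pair_correlator_swapped[where s = s and \<beta> = "\<beta> - rt s i"] unfolding \<omega>_def \<gamma>_def by (simp add: case_prod_unfold)
      qed (rule pair_eigen_swapped act_inv_fg; assumption?)+
      then show ?thesis by (simp add: B_def case_prod_unfold)
    qed
    have vacC: "(\<lambda>x. vac \<beta> (C x (vv \<beta>0))) = act (?x * (?x + ?k) * ?M) (inv_gg ?h \<omega>)"
      using triple_correlator_last[where s = s and \<beta> = \<beta>] unfolding \<gamma>' \<omega>_def by (simp add: C_def case_prod_unfold)
    \<comment> \<open>The exchange reverses the sign of x = z_1 - z_2, and (-x) (-x + k) = x (x -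
      k); the monomial is symmetric.\<close>
    have swap: "swap3_shift (?x * (?x + ?k) * ?M) = ?x * (?x - ?k) * ?M"
    proof -
      have "swap3_shift (?x * (?x + ?k) * ?M) = - ?x * (- ?x + ?k) * ?M"
        by (simp add: swap3_shift_def additive_map.push_mult additive_map_swap3 push_add push_diff push_2[OF additive_map_swap3] zero_prod_def serre_mono_def)
      then show ?thesis by (simp add: algebra_simps)
    qed
    have sw: "vac \<beta> (F (?\<tau> x) (vv \<beta>0)) = act (?x * (?x - ?k) * ?M) (swap3 V) x"
      if "(\<lambda>x. vac \<beta> (F x (vv \<beta>0))) = act (?x * (?x + ?k) * ?M) V" for F V
    proof -
      have "vac \<beta> (F (?\<tau> x) (vv \<beta>0)) = swap3 (act (?x * (?x + ?k) * ?M) V) x"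
        using fun_cong[OF that, of "?\<tau> x"] by (simp add: swap3_def case_prod_unfold)
      then show ?thesis by (simp only: swap act_swap3[symmetric])
    qed
    have sym: "swap3 (inv_ff ?h \<omega>) = inv_ff ?h \<omega>" "swap3 (inv_gg ?h \<omega>) = inv_gg ?h \<omega>"
    proof -
      have e: "- p' - p - 2 = - p - p' - 2" for p p' :: int by simp
      show "swap3 (inv_ff ?h \<omega>) = inv_ff ?h \<omega>"
        by (auto simp: swap3_def inv_ff_def add.commute)
      show "swap3 (inv_gg ?h \<omega>) = inv_gg ?h \<omega>"
        unfolding swap3_def inv_gg_def prod.case by (subst e) (auto simp: conj_commute)
    qed
    have lin: "vac \<beta> (?D x (vv \<beta>0)) = vac \<beta> (A x (vv \<beta>0)) + vac \<beta> (A (?\<tau> x) (vv \<beta>0))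
        + (vac \<beta> (C x (vv \<beta>0)) + vac \<beta> (C (?\<tau> x) (vv \<beta>0)))
        - (vac \<beta> (B x (vv \<beta>0)) + vac \<beta> (B x (vv \<beta>0)) + (vac \<beta> (B (?\<tau> x) (vv \<beta>0)) + vac \<beta> (B (?\<tau> x) (vv \<beta>0))))"
      by (simp only: module_hom.diff[OF lin_vac] module_hom.add[OF lin_vac])
    show "vac \<beta> (?D x (vv \<beta>0)) = 0"
      unfolding lin
      unfolding sw[of A, OF vacA] sw[of B, OF vacB] sw[of C, OF vacC] sym
      unfolding fun_cong[OF vacA] fun_cong[OF vacB] fun_cong[OF vacC]
      unfolding serre_identity by simp
  qed
  then show ?thesis by (simp add: A_def B_def C_def)
qed

end

end

section \<open>The Cartan series modulo \<hbar>\<close>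

lemma hz_act_eta: "eta dvd L \<Longrightarrow> hz 1 (act L U x)"
proof (elim dvdE)
  fix K assume "L = eta * K"
  then have "act L U x = hsmult b_plus (act K U x)" by (simp add: act_mult)
  then show ?thesis by (simp add: hz_hsmult_0 del: One_nat_def)
qed

lemma eta_dvd_power_diff: "eta dvd x - y \<Longrightarrow> eta dvd x ^ r - (y :: 'x::ab_group_add shift) ^ r"
  by (rule dvd_trans[OF _ diff_dvd_power_diff])

text \<open>The linear factors z + hbar/2 and z - hbar/2 agree modulo hbar, so numerator and
  denominator of the ratio agree, and the denominator is regular and can be cancelled modulo
  hbar.\<close>

lemma ratio_powers_mod: "hz 1 (hsmult (ratio_powers n p) w - (if p = 0 then w else 0))"
proof -
  define N1 N2 where "N1 = nat n" and "N2 = nat (- n)"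
  have n: "n = int N1 - int N2" by (simp add: N1_def N2_def)
  let ?A = "zz + const_shift b_minus" and ?B = "zz + const_shift b_plus"
  let ?L = "?A ^ N1 * ?B ^ N2" and ?L' = "?B ^ N1 * ?A ^ N2"
  let ?\<delta> = "\<lambda>p :: int. if p = 0 then w else 0"
  let ?R = "\<lambda>p. hsmult (ratio_powers n p) w - ?\<delta> p"
  have "hz 1 (?R p)"
  proof (rule regular_hz[of ?L 1 ?R])
    show "regular ?L" by (intro regular_mult regular_power regular_linear) simp_all
    fix p
    have "act ?L (\<lambda>p. hsmult (ratio_powers n p) w - ?\<delta> p) p = act (?L' - ?L) ?\<delta> p"
      unfolding act_diff_right act_diff_left ratio_powers_eq[OF n] ..
    moreover have "eta dvd ?L' - ?L"
    proof -
      have AB: "eta dvd ?B - ?A"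
        unfolding const_b_minus by (rule dvdI[of _ _ 2]) simp
      have "?L' - ?L = (?B ^ N1 - ?A ^ N1) * ?A ^ N2 - ?A ^ N1 * (?B ^ N2 - ?A ^ N2)"
        by (simp add: algebra_simps)
      then show ?thesis using eta_dvd_power_diff[OF AB] by (simp add: dvd_diff)
    qed
    ultimately show "hz 1 (act ?L ?R p)"
      by (simp only: hz_act_eta)
  qed
  then show ?thesis .
qed

section \<open>Integrality of the reduced Cartan series\<close>

context simply_laced
begin

lemma lin_delta: "lin (\<lambda>v. if (p :: int) = 0 then v else 0)"
  by (cases "p = 0") simp_all

text \<open>Modulo hbar the roots of the two factors A coincide and their power sums cancel, so H^-
  - 1 is annihilated like a vacuum vector. It commutes with creation operators, and its expectation
  value is zero even without reduction.\<close>

lemma H_minus_mod: "hz 1 (H Minus i p v - (if p = 0 then v else 0))"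
proof -
  define D where "D = (\<lambda>p v. H Minus i p v - (if p = 0 then v else 0))"
  have linD: "lin (D p)" for p unfolding D_def by (rule lin_minus[OF lin_H_minus lin_delta])
  have fld: "heis_pos k r (H Minus i p v) = H Minus i p (heis_pos k r v) + act (lam a Minus i zz k r + lam a Plus i zz k r) (\<lambda>p. H Minus i p v) p"
    "heis_neg k r (H Minus i p v) = H Minus i p (heis_neg k r v)" if "0 < r" for k r p v
    using vertex_field_H_minus[of a i] that by (simp_all add: vertex_field_def)
  have "hz 1 (D p v)"
  proof (rule creation_determined[where D = D, OF linD])
    show "hz 1 (D p (vv \<beta>))" for \<beta> p
    proof (rule annihilation_determined[where l = "\<lambda>k r. 0" and U = "\<lambda>p. D p (vv \<beta>)"])
      fix k and r :: nat and p assume r: "0 < r"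
      have "eta dvd lam a Minus i zz k r + lam a Plus i zz k r"
      proof -
        have T: "eta dvd (zz + c * eta) ^ r - (zz + d * eta) ^ r" for c d :: "int shift"
          by (rule eta_dvd_power_diff, rule dvdI[of _ _ "c - d"]) (simp add: algebra_simps)
        have "eta dvd (zz - 2 * eta) ^ r - (zz + 2 * eta) ^ r" "eta dvd (zz + eta) ^ r - (zz - eta) ^ r"
          using T[of "- 2" 2] T[of 1 "- 1"] by simp_all
        then show ?thesis by (simp add: lam_def root_rules psum_def)
      qed
      then have "hz 1 (act (lam a Minus i zz k r + lam a Plus i zz k r) (\<lambda>p. H Minus i p (vv \<beta>)) p)"
        by (rule hz_act_eta)
      then show "hz 1 (heis_pos k r (D p (vv \<beta>)) - act 0 (\<lambda>p. D p (vv \<beta>)) p)"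
        by (simp add: D_def module_hom.diff[OF lin_heis_pos] fld[OF r] module_hom.zero[OF lin_H_minus]
            module_hom.zero[OF lin_heis_pos] if_distrib[of "heis_pos k r"] cong: if_cong)
    next
      show "hz 1 (vac \<beta>' (D p (vv \<beta>)))" for \<beta>' p
        by (simp add: D_def module_hom.diff[OF lin_vac] vac_H_minus module_hom.zero[OF lin_vac])
    qed
  next
    fix k and r :: nat and v p assume r: "0 < r" and v: "\<And>p. hz 1 (D p v)"
    have "D p (heis_neg k r v) = heis_neg k r (D p v)"
      by (simp add: D_def module_hom.diff[OF lin_heis_neg] fld[OF r] module_hom.zero[OF lin_heis_neg])
    then show "hz 1 (D p (heis_neg k r v))" using hz_lin[OF lin_heis_neg v] by simp
  qed
  then show ?thesis by (simp add: D_def)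
qed

text \<open>On vacuum vectors H^+ is a power of the ratio, hence congruent to 1. The commutator with
  a creation operator is divisible by hbar after clearing a denominator that is regular.\<close>

lemma H_plus_mod: "hz 1 (H Plus i p v - (if p = 0 then v else 0))"
proof -
  define D where "D = (\<lambda>p v. H Plus i p v - (if p = 0 then v else 0))"
  have linD: "lin (D p)" for p unfolding D_def by (rule lin_minus[OF lin_H_plus lin_delta])
  have "hz 1 (D p v)"
  proof (rule creation_determined[where D = D, OF linD])
    show "hz 1 (D p (vv \<beta>))" for \<beta> p
      unfolding D_def H_plus_vv by (rule ratio_powers_mod)
  next
    fix k and r :: nat and v p assume r: "0 < r" and v: "\<And>p. hz 1 (D p v)"
    let ?Q = "(zz + const_shift b_plus) ^ r * (zz + const_shift b_minus) ^ r"
    let ?m = "if k = i then (zz + const_shift b_minus) ^ r - (zz + const_shift b_plus) ^ r else 0"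
    define K where "K p = heis_neg k r (H Plus i p v) - H Plus i p (heis_neg k r v)" for p
    have "hz 1 (K p)"
    proof (rule regular_hz[of ?Q])
      show "regular ?Q" by (intro regular_mult regular_power regular_linear) simp_all
      fix p
      have "act ?Q K p = act ?m (\<lambda>p. H Plus i p v) p"
        unfolding K_def
        by (rule conjunct2[OF conjunct2[OF vertex_field_H_plus[of i a, unfolded vertex_field_def]], rule_format, OF r])
      moreover have "eta dvd ?m"
      proof -
        have "eta dvd (zz + const_shift b_minus) - (zz + const_shift b_plus :: int shift)"
          unfolding const_b_minus by (rule dvdI[of _ _ "- 2"]) simp
        from eta_dvd_power_diff[OF this] show ?thesis by (auto simp only: dvd_0_right split: if_splits)
      qed
      ultimately show "hz 1 (act ?Q K p)" by (simp only: hz_act_eta)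
    qed
    moreover have "D p (heis_neg k r v) = heis_neg k r (D p v) - K p"
      by (simp add: D_def K_def module_hom.diff[OF lin_heis_neg] module_hom.zero[OF lin_heis_neg])
    ultimately show "hz 1 (D p (heis_neg k r v))" using hz_diff[OF hz_lin[OF lin_heis_neg v]] by simp
  qed
  then show ?thesis by (simp add: D_def)
qed

text \<open>The image of the series with a tilde. Division by hbar is a shift of coefficients, exact
  because H is congruent to 1, and \<open>sg\<close> accounts for the sign in h = 1 +/- hbar times
  that series.\<close>

definition T :: "sign \<Rightarrow> 'i \<Rightarrow> 'i opser" where
  "T s i p v = hsmult (sg s) (fps_shift 1 (H s i p v - (if p = 0 then v else 0)))"

lemma lin_H: "lin (H s i p)"
  by (cases s) (simp_all add: lin_H_plus lin_H_minus)

lemma H_T: "H s i p v = (if p = 0 then v else 0) + hsmult (sg s * fps_X) (T s i p v)"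
proof -
  have "hz 1 (H s i p v - (if p = 0 then v else 0))"
    by (cases s) (simp_all only: H_plus_mod H_minus_mod)
  from hz_imp_shift[OF this]
  have e: "hsmult fps_X (fps_shift 1 (H s i p v - (if p = 0 then v else 0))) = H s i p v - (if p = 0 then v else 0)"
    by simp
  have "sg s * fps_X * sg s = (fps_X :: complex fps)" by (cases s) (simp_all add: sg_def)
  then have "hsmult (sg s * fps_X) (T s i p v) = hsmult fps_X (fps_shift 1 (H s i p v - (if p = 0 then v else 0)))"
    unfolding T_def hs.scale_scale by (simp only:)
  then show ?thesis using e by simp
qed

lemma fps_X_T: "hsmult fps_X (T s i p v) = hsmult (sg s) (H s i p v - (if p = 0 then v else 0))"
proof -
  have "sg s * (sg s * fps_X) = (fps_X :: complex fps)" by (cases s) (simp_all add: sg_def)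
  then show ?thesis unfolding H_T add_diff_cancel_left' hs.scale_scale by (simp only:)
qed

lemma H_plus_T: "H Plus i p v = (if p = 0 then v else 0) + hsmult fps_X (T Plus i p v)"
  and H_minus_T: "H Minus i p v = (if p = 0 then v else 0) - hsmult fps_X (T Minus i p v)"
  using H_T[of Plus i p v] H_T[of Minus i p v] by (simp_all add: sg_def)

text \<open>By \<open>fps_X_T\<close>, hbar times T is linear, and hbar can be cancelled.\<close>

lemma lin_T: "lin (T s i p)"
proof (rule linI)
  have D: "lin (\<lambda>v. hsmult (sg s) (H s i p v - (if p = 0 then v else 0)))"
    by (rule lin_hsmult[OF lin_minus[OF lin_H lin_delta]])
  show "T s i p (u + v) = T s i p u + T s i p v" for u v
    using module_hom.add[OF D, of u v] unfolding fps_X_T[symmetric] hs.scale_right_distrib[symmetric] hsmult_fps_X_cancel .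
  show "T s i p (hsmult c v) = hsmult c (T s i p v)" for c v
    using module_hom.scale[OF D, of c v] unfolding fps_X_T[symmetric] hs.scale_left_commute[of c fps_X] hsmult_fps_X_cancel .
qed

lemma T_outside: "(case s of Plus \<Rightarrow> 0 \<le> p | Minus \<Rightarrow> p < 0) \<Longrightarrow> T s i p v = 0"
proof -
  assume "case s of Plus \<Rightarrow> 0 \<le> p | Minus \<Rightarrow> p < 0"
  then have "H s i p v = (if p = 0 then v else 0)"
    by (cases s; cases "p = 0") (auto simp: H_plus_mode_0 H_plus_pos H_minus_neg)
  then show ?thesis by (simp add: T_def)
qed

section \<open>The relations for the reduced Cartan series\<close>

lemma of_int_const_shift: "of_int n * const_shift c = (const_shift (of_int n * c) :: 'x::ab_group_add shift)"
  by (simp add: mult_single flip: single_of_int)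

text \<open>Insert H = 1 +/- hbar T. The constant 1 meets L' - L, which is a multiple of hbar; after
  cancelling hbar it becomes the inhomogeneous term of the defining relation.\<close>

lemma HX_reduced:
  assumes "act L (\<lambda>(p, q). H t i p (X s j q v)) x = act L' (\<lambda>(p, q). X s j q (H t i p v)) x"
    and c: "L' - L = const_shift (c * fps_X)"
  shows "act L (\<lambda>(p, q). T t i p (X s j q v)) x - act L' (\<lambda>(p, q). X s j q (T t i p v)) x
     = hsmult (sg t * c) (at_zero (\<lambda>q. X s j q v) x)"
proof -
  let ?A = "at_zero (\<lambda>q. X s j q v)"
  let ?TX = "\<lambda>(p, q). T t i p (X s j q v)" and ?XT = "\<lambda>(p, q). X s j q (T t i p v)"
  have 1: "(\<lambda>(p, q). H t i p (X s j q v)) = (\<lambda>x. ?A x + hsmult (sg t * fps_X) (?TX x))"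
    by (auto simp: H_T at_zero_def)
  have 2: "(\<lambda>(p, q). X s j q (H t i p v)) = (\<lambda>x. ?A x + hsmult (sg t * fps_X) (?XT x))"
    by (auto simp: H_T at_zero_def module_hom.add[OF lin_X_op] module_hom.scale[OF lin_X_op] module_hom.zero[OF lin_X_op])
  have "act L ?A x + hsmult (sg t * fps_X) (act L ?TX x) = act L' ?A x + hsmult (sg t * fps_X) (act L' ?XT x)"
    using assms(1) unfolding 1 2 act_add_right act_hsmult .
  then have "hsmult (sg t * fps_X) (act L ?TX x - act L' ?XT x) = act (L' - L) ?A x"
    by (simp add: act_diff_left hs.scale_right_diff_distrib algebra_simps)
  then have "hsmult (sg t * fps_X) (act L ?TX x - act L' ?XT x) = hsmult (c * fps_X) (?A x)"
    unfolding c by simp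
  then have e: "hsmult (sg t) (hsmult (sg t * fps_X) (act L ?TX x - act L' ?XT x)) = hsmult (sg t) (hsmult (c * fps_X) (?A x))"
    by simp
  have "hsmult fps_X (act L ?TX x - act L' ?XT x) = hsmult fps_X (hsmult (sg t * c) (?A x))"
  proof -
    have "sg t * (sg t * fps_X) = (fps_X :: complex fps)" "sg t * (c * fps_X) = fps_X * (sg t * c)"
      by (cases t; simp add: sg_def)+
    then show ?thesis using e unfolding hs.scale_scale by (simp only:)
  qed
  then show ?thesis unfolding hsmult_fps_X_cancel .
qed

lemma eta_expand: "Z1 - W1 - of_int n * eta = Z1 - W1 + const_shift (- (of_int n * b_plus))"
    "Z1 - W1 + of_int n * eta = Z1 - W1 + const_shift (of_int n * b_plus)"
  unfolding of_int_const_shift by (simp_all add: single_uminus)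

lemma linear_diff: "Z1 - W1 + const_shift x - (Z1 - W1 + const_shift (- y)) = const_shift (x + y)"
  by (simp add: single_add single_uminus)

lemma b_plus_double: "b_plus + b_plus = (fps_X :: complex fps)"
  by (simp flip: distrib_right)

lemma TX_minus:
  "act (Z1 - W1 + const_shift (of_int (sg s * a i j) * b_plus)) (\<lambda>(p, q). X s j q (T Minus i p v)) x
   - act (Z1 - W1 + const_shift (- (of_int (sg s * a i j) * b_plus))) (\<lambda>(p, q). T Minus i p (X s j q v)) x
   = hsmult (of_int (sg s * a i j)) (at_zero (\<lambda>q. X s j q v) x)"
proof -
  let ?n = "of_int (sg s * a i j) :: complex fps"
  have "?n * b_plus + ?n * b_plus = ?n * (b_plus + b_plus)" by (simp only: distrib_left)
  then have "?n * b_plus + ?n * b_plus = ?n * fps_X" unfolding b_plus_double .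
  then have c: "Z1 - W1 + const_shift (?n * b_plus) - (Z1 - W1 + const_shift (- (?n * b_plus))) = const_shift (?n * fps_X)"
    by (simp only: linear_diff)
  have e: "sg Minus * ?n = - ?n" by (simp add: sg_def)
  show ?thesis
    using arg_cong[OF HX_reduced[OF HX_minus[unfolded eta_expand] c, of v x], of uminus]
    unfolding e hs.scale_minus_left minus_minus minus_diff_eq .
qed

lemma TX_plus:
  "act (Z1 - W1 + const_shift (- (of_int (sg s * (a i j - 1)) * b_plus))) (\<lambda>(p, q). T Plus i p (X s j q v)) x
   - act (Z1 - W1 + const_shift (of_int (sg s * (a i j + 1)) * b_plus)) (\<lambda>(p, q). X s j q (T Plus i p v)) x
   = hsmult (of_int (sg s * a i j)) (at_zero (\<lambda>q. X s j q v) x)"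
proof -
  let ?n = "of_int (sg s * a i j) :: complex fps"
  let ?l = "of_int (sg s * (a i j - 1)) :: complex fps" and ?l' = "of_int (sg s * (a i j + 1)) :: complex fps"
  have "?l' * b_plus + ?l * b_plus = (?n + ?n) * b_plus" by (simp add: algebra_simps)
  also have "\<dots> = ?n * (b_plus + b_plus)" by (simp only: distrib_left distrib_right)
  also have "\<dots> = ?n * fps_X" unfolding b_plus_double ..
  finally have "?l' * b_plus + ?l * b_plus = ?n * fps_X" .
  then have c: "Z1 - W1 + const_shift (?l' * b_plus) - (Z1 - W1 + const_shift (- (?l * b_plus))) = const_shift (?n * fps_X)"
    by (simp only: linear_diff)
  show ?thesis
    using HX_reduced[OF HX_plus[unfolded eta_expand] c, of v x] by (simp add: sg_def)
qed

lemma TT_same_sign: "T s i p (T s j q v) = T s j q (T s i p v)"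
proof -
  define D where "D = (\<lambda>i p v. H s i p v - (if p = 0 then v else 0))"
  let ?c = "sg s * fps_X :: complex fps"
  have D: "hsmult ?c (T s i p v) = D i p v" for i p v by (simp add: H_T D_def)
  have linD: "lin (D i p)" for i p unfolding D_def by (rule lin_minus[OF lin_H lin_delta])
  have DD: "hsmult ?c (hsmult ?c (T s i p (T s j q v))) = D i p (D j q v)" for i j p q
    unfolding D[of i p] module_hom.scale[OF linD, symmetric] D[of j q] ..
  have "D i p (D j q v) = D j q (D i p v)"
    using HH_same_sign[of s i p j q v] by (simp add: D_def module_hom.diff[OF lin_H] module_hom.zero[OF lin_H])
  then have "hsmult (?c * ?c) (T s i p (T s j q v)) = hsmult (?c * ?c) (T s j q (T s i p v))"
    unfolding DD[symmetric] hs.scale_scale .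
  moreover have "?c * ?c = fps_X * fps_X" by (cases s) (simp_all add: sg_def)
  ultimately have "hsmult fps_X (hsmult fps_X (T s i p (T s j q v))) = hsmult fps_X (hsmult fps_X (T s j q (T s i p v)))"
    by simp
  then show ?thesis unfolding hsmult_fps_X_cancel .
qed

text \<open>S collects the terms with at most one T; it is the same for both orders and meets only
  the difference of the two polynomials. The terms with two T carry hbar^2, which is cancelled at
  the end.\<close>

lemma TT_mixed:
  fixes v :: "'i fock fps" and i j :: 'i
  defines "S \<equiv> (\<lambda>(p, q). (if p = 0 \<and> q = 0 then v else 0)
      - hsmult fps_X ((if p = 0 then T Minus j q v else 0) - (if q = 0 then T Plus i p v else 0)))"
  shows "act ((Z1 - W1)\<^sup>2 - const_shift ((of_int (a i j + 1) * b_plus)\<^sup>2)) (\<lambda>(p, q). T Minus j q (T Plus i p v)) x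
     - act ((Z1 - W1)\<^sup>2 - const_shift ((of_int (a i j - 1) * b_plus)\<^sup>2)) (\<lambda>(p, q). T Plus i p (T Minus j q v)) x
     + hsmult (of_int (a i j)) (S x) = 0"
proof -
  let ?L = "(Z1 - W1)\<^sup>2 - const_shift ((of_int (a i j - 1) * b_plus)\<^sup>2)"
  let ?L' = "(Z1 - W1)\<^sup>2 - const_shift ((of_int (a i j + 1) * b_plus)\<^sup>2)"
  let ?PM = "\<lambda>(p, q). T Plus i p (T Minus j q v)" and ?MP = "\<lambda>(p, q). T Minus j q (T Plus i p v)"
  have sq: "(of_int n * eta)\<^sup>2 = (const_shift ((of_int n * b_plus)\<^sup>2) :: (int \<times> int) shift)" for n
    unfolding of_int_const_shift by (simp add: power2_eq_square mult_single)
  have 1: "(\<lambda>(p, q). H Plus i p (H Minus j q v)) = (\<lambda>x. S x - hsmult (fps_X * fps_X) (?PM x))"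
  proof (rule ext, clarify)
    fix p q :: int
    show "H Plus i p (H Minus j q v) = S (p, q) - hsmult (fps_X * fps_X) (T Plus i p (T Minus j q v))"
      by (cases "p = 0"; cases "q = 0"; simp add: H_plus_T H_minus_T S_def module_hom.neg[OF lin_T] module_hom.diff[OF lin_T] module_hom.add[OF lin_T] module_hom.scale[OF lin_T]
          module_hom.zero[OF lin_T] hs.scale_right_distrib hs.scale_right_diff_distrib)
  qed
  have 2: "(\<lambda>(p, q). H Minus j q (H Plus i p v)) = (\<lambda>x. S x - hsmult (fps_X * fps_X) (?MP x))"
  proof (rule ext, clarify)
    fix p q :: int
    show "H Minus j q (H Plus i p v) = S (p, q) - hsmult (fps_X * fps_X) (T Minus j q (T Plus i p v))"
      by (cases "p = 0"; cases "q = 0"; simp add: H_plus_T H_minus_T S_def module_hom.neg[OF lin_T] module_hom.diff[OF lin_T] module_hom.add[OF lin_T] module_hom.scale[OF lin_T]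
          module_hom.zero[OF lin_T] hs.scale_right_distrib hs.scale_right_diff_distrib)
  qed
  have "act ?L (\<lambda>(p, q). H Plus i p (H Minus j q v)) x = act ?L' (\<lambda>(p, q). H Minus j q (H Plus i p v)) x"
    using HH_mixed[of i j v x] unfolding sq .
  then have "act (?L - ?L') S x + hsmult (fps_X * fps_X) (act ?L' ?MP x - act ?L ?PM x) = 0"
    unfolding 1 2 act_diff_right act_hsmult act_diff_left[of ?L ?L'] hs.scale_right_diff_distrib by (simp add: algebra_simps)
  \<comment> \<open>(n + 1)^2 - (n - 1)^2 = 4 n, multiplied by (hbar/2)^2, gives hbar^2
    a_ij.\<close>
  moreover have "?L - ?L' = const_shift (fps_X * fps_X * of_int (a i j))"
  proof -
    have "(of_int (a i j + 1) * b_plus)\<^sup>2 - (of_int (a i j - 1) * b_plus)\<^sup>2 = of_int (a i j) * ((b_plus + b_plus) * (b_plus + b_plus) :: complex fps)"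
    proof -
      have "((c + 1) * b)\<^sup>2 - ((c - 1) * b)\<^sup>2 = c * ((b + b) * (b + b))" for b c :: "complex fps"
        by (simp add: power2_eq_square algebra_simps)
      from this[of "of_int (a i j)" b_plus] show ?thesis by (simp only: of_int_add of_int_diff of_int_1)
    qed
    then have "(of_int (a i j + 1) * b_plus)\<^sup>2 - (of_int (a i j - 1) * b_plus)\<^sup>2 = fps_X * fps_X * (of_int (a i j) :: complex fps)"
      unfolding b_plus_double by (simp only: ac_simps)
    then show ?thesis by (simp flip: single_diff)
  qed
  ultimately have "hsmult (fps_X * fps_X) (act ?L' ?MP x - act ?L ?PM x + hsmult (of_int (a i j)) (S x)) = 0"
    by (simp add: hs.scale_right_distrib add.commute)
  then show ?thesis by (simp flip: hs.scale_scale)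
qed

text \<open>The constant term 1 of H^+ is untouched by the substitution; all other terms are hbar
  times the reduced series.\<close>

lemma H_shifted_T:
  "(\<Sum>n\<in>{q..-1}. hsmult (shifted_power b_plus n q) (hsmult fps_X (T Plus i n v))) = H_shifted i q v - (if q = 0 then v else 0)"
proof -
  have H: "H_shifted i q v = (\<Sum>n\<in>{q..0}. hsmult (shifted_power b_plus n q) (H Plus i n v))"
    unfolding H_shifted_def by (rule shift_series_sum) (simp add: H_plus_pos)
  have e: "hsmult fps_X (T Plus i n v) = H Plus i n v" if "n \<in> {q..-1}" for n
    using that by (simp add: fps_X_T sg_def)
  show ?thesis
  proof (cases "q \<le> 0")
    case True
    then have "{q..0} = insert 0 {q..-1}" by auto
    then show ?thesis unfolding H by (simp add: e H_plus_mode_0 shifted_power_0_right)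
  next
    case False
    then show ?thesis unfolding H by simp
  qed
qed

end

section \<open>Evaluation of the free algebra\<close>

locale evaluation =
  fixes \<phi> :: "'g \<Rightarrow> 'i fock fps \<Rightarrow> 'i fock fps"
  assumes lin_gen: "lin (\<phi> g)"
begin

fun word_op :: "'g word \<Rightarrow> 'i fock fps \<Rightarrow> 'i fock fps" where
  "word_op (Word gs) v = foldr \<phi> gs v"

definition ev :: "'g free \<Rightarrow> 'i fock fps \<Rightarrow> 'i fock fps" where
  "ev u v = (\<Sum>w\<in>Poly_Mapping.keys u. hsmult (fps_of_poly (lookup u w)) (word_op w v))"

lemma lin_word_op: "lin (word_op w)"
proof -
  have "lin (foldr \<phi> gs)" for gs
  proof (induction gs)
    case Nil
    show ?case unfolding foldr.simps by (rule lin_id(2))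
  next
    case (Cons g gs)
    have "foldr \<phi> (g # gs) = (\<lambda>v. \<phi> g (foldr \<phi> gs v))" by auto
    then show ?case by (simp only: lin_compose[OF lin_gen Cons])
  qed
  moreover obtain gs where "w = Word gs" by (cases w)
  moreover have "word_op (Word gs) = foldr \<phi> gs" for gs by auto
  ultimately show ?thesis by simp
qed

lemma word_op_plus: "word_op (w + w') v = word_op w (word_op w' v)"
  by (cases w; cases w') simp

lemma word_op_0: "word_op 0 v = v"
  by (simp add: zero_word_def)

lemma lin_ev: "lin (ev u)"
  unfolding ev_def[abs_def] by (rule lin_setsum[OF lin_hsmult[OF lin_word_op]])

lemma ev_superset:
  assumes "finite S" "Poly_Mapping.keys u \<subseteq> S"
  shows "ev u v = (\<Sum>w\<in>S. hsmult (fps_of_poly (lookup u w)) (word_op w v))"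
  unfolding ev_def using assms by (intro sum.mono_neutral_left) (auto simp: in_keys_iff)

lemma ev_add: "ev (u + u') v = ev u v + ev u' v"
proof -
  let ?S = "Poly_Mapping.keys u \<union> Poly_Mapping.keys u'"
  have "ev (u + u') v = (\<Sum>w\<in>?S. hsmult (fps_of_poly (lookup (u + u') w)) (word_op w v))"
    by (rule ev_superset) (simp_all add: Poly_Mapping.keys_add)
  then show ?thesis
    using ev_superset[of ?S u v] ev_superset[of ?S u' v]
    by (simp add: lookup_add fps_of_poly_add hs.scale_left_distrib sum.distrib)
qed

lemma ev_single: "ev (Poly_Mapping.single w c) v = hsmult (fps_of_poly c) (word_op w v)"
  by (subst ev_superset[of "{w}"]) auto

lemma ev_0: "ev 0 v = 0"
  by (simp add: ev_def)

lemma ev_uminus: "ev (- u) v = - ev u v"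
  using ev_add[of u "- u" v] by (simp add: ev_0 eq_neg_iff_add_eq_0 add.commute)

lemma ev_diff: "ev (u - u') v = ev u v - ev u' v"
  using ev_add[of u "- u'" v] by (simp add: ev_uminus)

lemma ev_sum: "ev (\<Sum>b\<in>S. u b) v = (\<Sum>b\<in>S. ev (u b) v)"
  by (induction S rule: infinite_finite_induct) (simp_all add: ev_0 ev_add)

lemma ev_mult: "ev (u * u') v = ev u (ev u' v)"
proof (rule additive_eq_on_single[where f = u and S = "\<lambda>u. ev (u * u') v" and T = "\<lambda>u. ev u (ev u' v)"])
  fix w c
  show "ev (Poly_Mapping.single w c * u') v = ev (Poly_Mapping.single w c) (ev u' v)"
  proof (rule additive_eq_on_single[where f = u' and S = "\<lambda>u'. ev (Poly_Mapping.single w c * u') v"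
        and T = "\<lambda>u'. ev (Poly_Mapping.single w c) (ev u' v)"])
    fix w' c'
    show "ev (Poly_Mapping.single w c * Poly_Mapping.single w' c') v
        = ev (Poly_Mapping.single w c) (ev (Poly_Mapping.single w' c') v)"
      by (simp add: mult_single ev_single word_op_plus fps_of_poly_mult module_hom.scale[OF lin_word_op])
  qed (simp_all add: distrib_left ev_add module_hom.add[OF lin_ev])
qed (simp_all add: distrib_right ev_add)

lemma ev_scalar: "ev (scalar p) v = hsmult (fps_of_poly p) v"
  by (simp add: scalar_def ev_single word_op_0)

lemma ev_gen: "ev (gen g) v = \<phi> g v"
  by (simp add: gen_def ev_single)

lemma ev_1: "ev 1 v = v"
  using ev_single[of 0 1 v] by (simp add: word_op_0)

lemma ev_of_int: "ev (of_int n) v = hsmult (of_int n) v"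
proof (induction n rule: int_induct[where k = 0])
  case (step1 i)
  then show ?case by (simp only: of_int_add of_int_1 ev_add ev_1 hs.scale_left_distrib hs.scale_one)
next
  case (step2 i)
  then show ?case by (simp only: of_int_diff of_int_1 ev_diff ev_1 hs.scale_left_diff_distrib hs.scale_one)
qed (simp add: ev_0)

lemma ev_2: "ev 2 v = hsmult 2 v"
  using ev_of_int[of 2 v] by simp

lemma ev_sg: "ev (sg s) v = hsmult (sg s) v"
  by (cases s) (simp_all add: sg_def ev_1 ev_uminus)

lemma ev_of_bool: "ev (of_bool P) v = (if P then v else 0)"
  by (simp add: ev_0 ev_1)

lemma ev_power: "(\<And>v. ev b v = hsmult c v) \<Longrightarrow> ev (b ^ n) v = hsmult (c ^ n) v"
  by (induction n) (simp_all add: ev_1 ev_mult)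

lemma ev_shifted_power:
  assumes "\<And>v. ev b v = hsmult c v"
  shows "ev (shifted_power b r p) v = hsmult (shifted_power c r p) v"
  by (simp add: shifted_power_def ev_0 ev_mult ev_of_int ev_power[OF assms])

lemma ev_zw_times:
  assumes "\<And>v. ev b v = hsmult c v"
  shows "ev (zw_times b F p q) v = act (Z1 - W1 + const_shift c) (\<lambda>(p, q). ev (F p q) v) (p, q)"
  by (simp add: zw_times_def ev_add ev_diff ev_mult act_add_left act_diff_left assms)

lemma ev_zw_times_twice:
  "ev (zw_times 0 (zw_times 0 F) p q) v = act ((Z1 - W1)\<^sup>2) (\<lambda>(p, q). ev (F p q) v) (p, q)"
proof -
  have z: "ev 0 v = hsmult 0 v" for v by (simp add: ev_0)
  have "(\<lambda>(p, q). ev (zw_times 0 F p q) v) = act (Z1 - W1 + const_shift 0) (\<lambda>(p, q). ev (F p q) v)"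
    by (rule ext) (simp only: case_prod_unfold ev_zw_times[OF z] prod.collapse)
  then have "ev (zw_times 0 (zw_times 0 F) p q) v
      = act (Z1 - W1 + const_shift 0) (act (Z1 - W1 + const_shift 0) (\<lambda>(p, q). ev (F p q) v)) (p, q)"
    by (simp only: ev_zw_times[OF z])
  then show ?thesis by (simp add: power2_eq_square act_mult)
qed

lemma ring_free_algebra: "ring (free_algebra :: (complex poly, 'g free) module)"
proof (rule ringI)
  show "abelian_group (free_algebra :: (complex poly, 'g free) module)"
  proof (rule abelian_groupI)
    fix x :: "'g free"
    show "\<exists>y\<in>carrier free_algebra. y \<oplus>\<^bsub>free_algebra\<^esub> x = \<zero>\<^bsub>free_algebra\<^esub>"
      by (rule bexI[of _ "- x"]) (simp_all add: free_algebra_def)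
  qed (simp_all add: free_algebra_def algebra_simps)
  show "Group.monoid (free_algebra :: (complex poly, 'g free) module)"
    by (rule monoidI) (simp_all add: free_algebra_def mult.assoc)
qed (simp_all add: free_algebra_def algebra_simps)

lemma ideal_kernel: "ideal {u. \<forall>v. ev u v = 0} free_algebra"
proof (rule idealI[OF ring_free_algebra])
  interpret ring "free_algebra :: (complex poly, 'g free) module" by (rule ring_free_algebra)
  show "subgroup {u. \<forall>v. ev u v = 0} (add_monoid free_algebra)"
  proof (rule subgroup.intro)
    fix u assume u: "u \<in> {u. \<forall>v. ev u v = 0}"
    have "\<ominus>\<^bsub>free_algebra\<^esub> u = - u"
      by (rule minus_equality) (simp_all add: free_algebra_def)
    then show "inv\<^bsub>add_monoid free_algebra\<^esub> u \<in> {u. \<forall>v. ev u v = 0}"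
      using u by (simp add: a_inv_def ev_uminus)
  qed (auto simp: free_algebra_def ev_add ev_0)
qed (simp_all add: free_algebra_def ev_mult module_hom.zero[OF lin_ev])

text \<open>The kernel of evaluation is an ideal that contains the relators, hence it contains the
  ideal they generate.\<close>

theorem quotient_evaluation:
  assumes S: "\<And>u v. u \<in> S \<Longrightarrow> ev u v = 0"
  defines "I \<equiv> genideal free_algebra S"
  shows "\<exists>\<rho>\<in>algebra_homs (quotient_algebra free_algebra I) end_algebra. \<forall>u. \<rho> (I +>\<^bsub>free_algebra\<^esub> u) = ev u"
proof -
  interpret ring "free_algebra :: (complex poly, 'g free) module" by (rule ring_free_algebra)
  have SI: "S \<subseteq> carrier free_algebra" by (simp add: free_algebra_def)
  interpret I: ideal I free_algebra unfolding I_def by (rule genideal_ideal[OF SI])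
  have ker: "ev u v = 0" if "u \<in> I" for u v
    using genideal_minimal[OF ideal_kernel, of S] S that unfolding I_def by blast
  have zero: "0 \<in> I" using I.zero_closed by (simp add: free_algebra_def)
  have coset: "I +>\<^bsub>free_algebra\<^esub> u = (\<lambda>h. h + u) ` I" for u
    by (auto simp: a_r_coset_def' free_algebra_def)
  have self: "u \<in> I +>\<^bsub>free_algebra\<^esub> u" for u
    unfolding coset using zero by (intro image_eqI[of _ _ 0]) simp_all
  have cst: "ev y = ev u" if "y \<in> I +>\<^bsub>free_algebra\<^esub> u" for y u
    using that unfolding coset by (auto simp: ev_add ker)
  \<comment> \<open>Evaluation of an arbitrary representative; by \<open>cst\<close> it is constant
    on each coset.\<close>
  define \<rho> where "\<rho> K = ev (SOME u. u \<in> K)" for K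
  have \<rho>: "\<rho> K = e" if "u \<in> K" "\<And>y. y \<in> K \<Longrightarrow> ev y = e" for K e u
    unfolding \<rho>_def by (rule that(2)) (rule someI[of "\<lambda>u. u \<in> K", OF that(1)])
  have \<rho>_coset: "\<rho> (I +>\<^bsub>free_algebra\<^esub> u) = ev u" for u
    by (rule \<rho>[OF self cst])
  let ?A = "quotient_algebra free_algebra I"
  have carrier: "carrier ?A = range (\<lambda>u. I +>\<^bsub>free_algebra\<^esub> u)"
    by (auto simp: quotient_algebra_def ring.defs FactRing_def A_RCOSETS_def' free_algebra_def)
  have "\<rho> \<in> ring_hom ?A end_algebra"
  proof (rule ring_hom_memI)
    fix K assume "K \<in> carrier ?A"
    then obtain x where K: "K = I +>\<^bsub>free_algebra\<^esub> x" unfolding carrier by blast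
    show "\<rho> K \<in> carrier end_algebra" unfolding K \<rho>_coset by (simp add: end_algebra_def lin_ev)
    fix L assume "L \<in> carrier ?A"
    then obtain y where L: "L = I +>\<^bsub>free_algebra\<^esub> y" unfolding carrier by blast
    have mult: "K \<otimes>\<^bsub>?A\<^esub> L = (\<Union>x\<in>K. \<Union>y\<in>L. I +>\<^bsub>free_algebra\<^esub> (x * y))"
      by (auto simp: quotient_algebra_def ring.defs FactRing_def rcoset_mult_def free_algebra_def)
    have add: "K \<oplus>\<^bsub>?A\<^esub> L = (\<Union>x\<in>K. \<Union>y\<in>L. {x + y})"
      by (auto simp: quotient_algebra_def ring.defs FactRing_def set_add_def set_mult_def free_algebra_def)
    have xy: "\<rho> K = ev x" "\<rho> L = ev y" by (simp_all add: K L \<rho>_coset)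
    show "\<rho> (K \<otimes>\<^bsub>?A\<^esub> L) = \<rho> K \<otimes>\<^bsub>end_algebra\<^esub> \<rho> L"
    proof (rule \<rho>[of "x * y"])
      show "x * y \<in> K \<otimes>\<^bsub>?A\<^esub> L" unfolding mult unfolding K L using self by blast
      fix z assume "z \<in> K \<otimes>\<^bsub>?A\<^esub> L"
      then obtain x' y' where "x' \<in> K" "y' \<in> L" "z \<in> I +>\<^bsub>free_algebra\<^esub> (x' * y')" unfolding mult by blast
      then have "ev z = ev (x' * y')" "ev x' = ev x" "ev y' = ev y" unfolding K L by (simp_all only: cst)
      then have "ev z v = (ev x \<circ> ev y) v" for v by (simp add: ev_mult)
      then show "ev z = \<rho> K \<otimes>\<^bsub>end_algebra\<^esub> \<rho> L" by (auto simp: xy end_algebra_def)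
    qed
    show "\<rho> (K \<oplus>\<^bsub>?A\<^esub> L) = \<rho> K \<oplus>\<^bsub>end_algebra\<^esub> \<rho> L"
    proof (rule \<rho>[of "x + y"])
      show "x + y \<in> K \<oplus>\<^bsub>?A\<^esub> L" unfolding add unfolding K L using self by blast
      fix z assume "z \<in> K \<oplus>\<^bsub>?A\<^esub> L"
      then obtain x' y' where "x' \<in> K" "y' \<in> L" "z = x' + y'" unfolding add by blast
      then have "z = x' + y'" "ev x' = ev x" "ev y' = ev y" unfolding K L by (simp_all only: cst)
      then have "ev z v = ev x v + ev y v" for v by (simp add: ev_add)
      then show "ev z = \<rho> K \<oplus>\<^bsub>end_algebra\<^esub> \<rho> L" by (auto simp: xy end_algebra_def)
    qed
  next
    have "\<one>\<^bsub>?A\<^esub> = I +>\<^bsub>free_algebra\<^esub> 1"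
      by (simp add: quotient_algebra_def ring.defs FactRing_def free_algebra_def)
    then show "\<rho> \<one>\<^bsub>?A\<^esub> = \<one>\<^bsub>end_algebra\<^esub>"
      by (auto simp: \<rho>_coset end_algebra_def ev_1)
  qed
  moreover have "\<rho> (p \<odot>\<^bsub>?A\<^esub> K) = p \<odot>\<^bsub>end_algebra\<^esub> \<rho> K" if KA: "K \<in> carrier ?A" for p K
  proof -
    obtain x where K: "K = I +>\<^bsub>free_algebra\<^esub> x" using KA unfolding carrier by blast
    have smult: "p \<odot>\<^bsub>?A\<^esub> K = (\<Union>u\<in>K. I +>\<^bsub>free_algebra\<^esub> (scalar p * u))"
      by (simp add: quotient_algebra_def ring.defs module.defs FactRing_def free_algebra_def)
    show ?thesis
    proof (rule \<rho>[of "scalar p * x"])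
      show "scalar p * x \<in> p \<odot>\<^bsub>?A\<^esub> K" unfolding smult unfolding K using self by blast
      fix z assume "z \<in> p \<odot>\<^bsub>?A\<^esub> K"
      then obtain u where u: "u \<in> K" "z \<in> I +>\<^bsub>free_algebra\<^esub> (scalar p * u)" unfolding smult by blast
      then have "ev z = ev (scalar p * u)" "ev u = ev x" unfolding K by (simp_all only: cst)
      then have "ev z v = hsmult (fps_of_poly p) (ev x v)" for v by (simp add: ev_mult ev_scalar)
      then show "ev z = p \<odot>\<^bsub>end_algebra\<^esub> \<rho> K" by (auto simp: K \<rho>_coset end_algebra_def)
    qed
  qed
  ultimately have "\<rho> \<in> algebra_homs ?A end_algebra" by (simp add: algebra_homs_def)
  then show ?thesis using \<rho>_coset by blast
qed

end

section \<open>The homomorphism\<close>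

context simply_laced
begin

text \<open>Modes r >= 0 of h belong to the plus series and the others to the minus series; mode r
  is the coefficient of z^(-r-1).\<close>

fun gen_image :: "'i ygen \<Rightarrow> 'i fock fps \<Rightarrow> 'i fock fps" where
  "gen_image GenC = id"
| "gen_image (GenX s i r) = X s i (- r - 1)"
| "gen_image (GenH i r) = T (if 0 \<le> r then Plus else Minus) i (- r - 1)"

sublocale evaluation gen_image
proof (rule evaluation.intro)
  show "lin (gen_image g)" for g by (cases g) (simp_all add: lin_X_op lin_T)
qed

lemma ev_x_ser: "ev (x_ser s i p) v = X s i p v"
  by (simp add: x_ser_def ev_gen)

lemma ev_ht_ser: "ev (ht_ser s i p) v = T s i p v"
  by (cases s) (auto simp: ht_ser_def ev_gen ev_0 T_outside)

lemma ev_hb: "ev hb v = hsmult fps_X v"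
  by (simp add: hb_def ev_scalar fps_of_poly_pCons)

lemma ev_cc: "ev cc v = v"
  by (simp add: cc_def ev_gen)

lemma ev_const: "ev (scalar [:c:]) v = hsmult (fps_const c) v"
  by (simp add: ev_scalar fps_of_poly_const)

lemma fps_const_half: "fps_const (of_int n / 2) = of_int n * (fps_const (1/2) :: complex fps)"
  by (simp flip: fps_of_int)

lemma ev_dd: "ev (dd a i j) v = hsmult (of_int (a i j) * fps_const (1/2)) v"
  unfolding dd_def ev_const fps_const_half ..

lemma double_half: "2 * (c * (fps_const (1/2) :: complex fps)) = c"
proof -
  have "2 * fps_const (1/2) = (1 :: complex fps)"
    by (simp flip: fps_numeral_fps_const)
  then show ?thesis by (simp add: mult.left_commute[of 2])
qed

lemma ev_2_dd: "hsmult 2 (ev (dd a i j) v) = hsmult (of_int (a i j)) v"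
  unfolding ev_dd hs.scale_scale double_half ..

lemma of_int_sg: "of_int (sg s) = (sg s :: complex fps)"
  by (cases s) (simp_all add: sg_def)

text \<open>With c = 1, hbar d_ij +/- hbar/2 is (a_ij +/- 1) times hbar/2, the form in which these
  shifts occur in the operator relations.\<close>

lemma ev_cpm: "ev (cpm a s i j) v = hsmult (of_int (a i j + sg s) * b_plus) v"
proof -
  have "ev (cpm a s i j) v = hsmult (fps_X * (of_int (a i j) * fps_const (1/2)) + sg s * fps_const (1/2) * fps_X) v"
    by (simp only: cpm_def ev_add ev_mult ev_hb ev_dd ev_sg ev_cc ev_const hs.scale_scale hs.scale_left_distrib mult.assoc)
  also have "fps_X * (of_int (a i j) * fps_const (1/2)) + sg s * fps_const (1/2) * fps_X = of_int (a i j + sg s) * b_plus"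
    unfolding of_int_add of_int_sg distrib_right by (simp only: ac_simps)
  finally show ?thesis .
qed

lemma ev_sg_cpm: "ev (sg s * cpm a t i j) v = hsmult (of_int (sg s * (a i j + sg t)) * b_plus) v"
    "ev (- sg s * cpm a t i j) v = hsmult (- (of_int (sg s * (a i j + sg t)) * b_plus)) v"
proof -
  show 1: "ev (sg s * cpm a t i j) v = hsmult (of_int (sg s * (a i j + sg t)) * b_plus) v"
    by (simp only: ev_mult ev_sg ev_cpm hs.scale_scale of_int_mult[of "sg s"] of_int_sg mult.assoc)
  show "ev (- sg s * cpm a t i j) v = hsmult (- (of_int (sg s * (a i j + sg t)) * b_plus)) v"
    by (simp only: mult_minus_left ev_uminus 1 hs.scale_minus_left)
qed

lemma ev_sg_hb_dd: "ev (sg s * hb * dd a i j) v = hsmult (of_int (sg s * a i j) * b_plus) v"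
    "ev (- sg s * hb * dd a i j) v = hsmult (- (of_int (sg s * a i j) * b_plus)) v"
proof -
  show 1: "ev (sg s * hb * dd a i j) v = hsmult (of_int (sg s * a i j) * b_plus) v"
    unfolding ev_mult ev_sg ev_hb ev_dd hs.scale_scale of_int_mult of_int_sg by (simp only: ac_simps)
  show "ev (- sg s * hb * dd a i j) v = hsmult (- (of_int (sg s * a i j) * b_plus)) v"
    by (simp only: mult_minus_left ev_uminus 1 hs.scale_minus_left)
qed

lemma ev_in_w_x: "ev (sg s * 2 * dd a i j * in_w (x_ser s j) p q) v
    = hsmult (of_int (sg s * a i j)) (at_zero (\<lambda>q. X s j q v) (p, q))"
proof -
  have "ev (in_w (x_ser s j) p q) v = at_zero (\<lambda>q. X s j q v) (p, q)"
    by (simp add: in_w_def at_zero_def ev_x_ser ev_0)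
  then show ?thesis
    unfolding ev_mult ev_sg ev_2 ev_2_dd by (simp add: of_int_sg)
qed

lemma ev_delta_ser: "ev (delta_ser (hb * cc) p q) v = hsmult (shifted_power fps_X (- p - 1) q) v"
    "ev (delta_ser 0 p q) v = (if q = - p - 1 then v else 0)"
proof -
  show "ev (delta_ser (hb * cc) p q) v = hsmult (shifted_power fps_X (- p - 1) q) v"
    unfolding delta_ser_def by (rule ev_shifted_power) (simp add: ev_mult ev_hb ev_cc)
  have "ev (delta_ser 0 p q) v = hsmult (shifted_power 0 (- p - 1) q) v"
    unfolding delta_ser_def by (rule ev_shifted_power) (simp add: ev_0)
  then show "ev (delta_ser 0 p q) v = (if q = - p - 1 then v else 0)"
    by (simp add: shifted_power_0)
qed

lemma ev_ht_plus_shifted: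
  "hsmult fps_X (ev (ht_plus_shifted i (scalar [:1/2:] * hb * cc) q) v) = H_shifted i q v - (if q = 0 then v else 0)"
proof -
  have b: "ev (scalar [:1/2:] * hb * cc) v = hsmult b_plus v" for v
    by (simp add: ev_mult ev_const ev_hb ev_cc)
  have "hsmult fps_X (ev (ht_plus_shifted i (scalar [:1/2:] * hb * cc) q) v)
      = (\<Sum>n\<in>{q..-1}. hsmult (shifted_power b_plus n q) (hsmult fps_X (T Plus i n v)))"
    by (simp only: ht_plus_shifted_def ev_sum ev_mult ev_shifted_power[OF b] ev_ht_ser hs.scale_sum_right
        hs.scale_left_commute[of fps_X])
  then show ?thesis unfolding H_shifted_T .
qed

lemma H_shifted_0: "H_shifted i 0 v = v"
  unfolding H_shifted_def by (subst shift_series_sum[of 0]) (simp_all add: H_plus_pos H_plus_mode_0 shifted_power_0_right)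

text \<open>Multiplied by hbar, \<open>delta_quot\<close> restores the constant terms 1 of H^+ and
  H^- that the reduced series lack; the term n = q of the delta series is the one with the constant
  term of H^+.\<close>

lemma ev_xx_bracket:
  "hsmult fps_X (ev (xx_bracket i p q) v) = delta_times p (\<lambda>n. H_shifted i n v) q - H Minus i (p + q + 1) v"
proof -
  let ?s = "\<lambda>n. shifted_power fps_X (- p - 1) n :: complex fps"
  have "hsmult fps_X (ev (delta_quot p q) v) = ev (hb * delta_quot p q) v"
    by (simp add: ev_mult ev_hb)
  then have 1: "hsmult fps_X (ev (delta_quot p q) v) = hsmult (?s q) v - (if q = - p - 1 then v else 0)"
    by (simp add: hb_delta_quot ev_diff ev_delta_ser)
  let ?b = "scalar [:1/2:] * hb * cc"
  have "hsmult fps_X (ev (\<Sum>n\<in>{q<..-p-1}. delta_ser (hb * cc) p n * ht_plus_shifted i ?b (q - n)) v)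
      = (\<Sum>n\<in>{q<..-p-1}. hsmult (?s n) (hsmult fps_X (ev (ht_plus_shifted i ?b (q - n)) v)))"
    by (simp only: ev_sum ev_mult[of "delta_ser (hb * cc) p n" for n] ev_delta_ser hs.scale_sum_right hs.scale_left_commute[of fps_X])
  also have "\<dots> = (\<Sum>n\<in>{q<..-p-1}. hsmult (?s n) (H_shifted i (q - n) v))"
    unfolding ev_ht_plus_shifted by (rule sum.cong) auto
  finally have 2: "hsmult fps_X (ev (\<Sum>n\<in>{q<..-p-1}. delta_ser (hb * cc) p n * ht_plus_shifted i ?b (q - n)) v)
      = (\<Sum>n\<in>{q<..-p-1}. hsmult (?s n) (H_shifted i (q - n) v))" .
  have 3: "delta_times p (\<lambda>n. H_shifted i n v) q = hsmult (?s q) v + (\<Sum>n\<in>{q<..-p-1}. hsmult (?s n) (H_shifted i (q - n) v))"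
  proof -
    have e: "delta_times p (\<lambda>n. H_shifted i n v) q = (\<Sum>n\<in>{q..-p-1}. hsmult (?s n) (H_shifted i (q - n) v))"
      by (rule delta_times_sum) (rule H_shifted_pos)
    show ?thesis
    proof (cases "q \<le> - p - 1")
      case True
      then have "{q..-p-1} = insert q {q<..-p-1}" by auto
      then show ?thesis unfolding e by (simp add: H_shifted_0)
    next
      case False
      then show ?thesis unfolding e by (simp add: shifted_power_outside)
    qed
  qed
  have 4: "hsmult fps_X (ev (ht_ser Minus i (p + q + 1)) v) = (if q = - p - 1 then v else 0) - H Minus i (p + q + 1) v"
  proof -
    have "p + q + 1 = 0 \<longleftrightarrow> q = - p - 1" by auto
    then show ?thesis unfolding ev_ht_ser H_minus_T by simp
  qed
  show ?thesis
    unfolding xx_bracket_def ev_add hs.scale_right_distrib 1 2 3 4 by simp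
qed

lemma ev_comm: "ev (comm u u') v = ev u (ev u' v) - ev u' (ev u v)"
  by (simp add: comm_def ev_diff ev_mult)

lemma permutes_lessThan_1: "{\<sigma>. \<sigma> permutes {..<1 :: nat}} = {id}"
proof -
  have "{..<1 :: nat} = {0}" by auto
  then show ?thesis by (simp add: permutes_sing)
qed

lemma permutes_lessThan_2: "{\<sigma>. \<sigma> permutes {..<2 :: nat}} = {id, Transposition.transpose 0 1}"
proof -
  have "{..<2 :: nat} = {0, 1}" by auto
  then show ?thesis by (simp add: permutes_doubleton_iff Collect_disj_eq insert_commute)
qed

text \<open>In the simply laced case m is 1 or 2: the relation is either commutativity or the sum of
  two double commutators, which expands to \<open>XXX_serre\<close>.\<close>

lemma ev_serre:
  fixes f :: "nat \<Rightarrow> int"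
  assumes ij: "i \<noteq> j" and m: "m = nat (1 - a i j)"
  shows "ev (\<Sum>\<sigma> | \<sigma> permutes {..<m}. foldr (\<lambda>k u. comm (x_ser s i (f (\<sigma> k))) u) [0..<m] (x_ser s j q)) v = 0"
proof (cases "a i j = 0")
  case True
  then have m1: "m = 1" using m by simp
  have "ev (comm (x_ser s i (f 0)) (x_ser s j q)) v = 0"
    unfolding ev_comm ev_x_ser using XX_orthogonal[OF True, of s "f 0" s q v] by simp
  then show ?thesis unfolding m1 permutes_lessThan_1 by simp
next
  case False
  then have adj: "a i j = -1" using a_off[OF ij] by simp
  then have m2: "m = 2" using m by simp
  have l: "[0..<2] = [0, 1 :: nat]" by (simp add: upt_rec)
  have ne: "id \<noteq> Transposition.transpose 0 (1 :: nat)"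
    by (metis id_apply transpose_apply_first zero_neq_one)
  have "ev (comm (x_ser s i (f 0)) (comm (x_ser s i (f 1)) (x_ser s j q))
      + comm (x_ser s i (f 1)) (comm (x_ser s i (f 0)) (x_ser s j q))) v = 0"
    unfolding ev_add ev_comm ev_x_ser module_hom.diff[OF lin_X_op]
    using XXX_serre[OF ij adj, of s "f 0" "f 1" q v] by (simp add: algebra_simps)
  then show ?thesis
    unfolding m2 permutes_lessThan_2 l using ne by simp
qed

theorem ev_relators: "u \<in> yangian_relators a \<Longrightarrow> ev u v = 0"
proof (induction rule: yangian_relators.induct)
  case (central g)
  show ?case by (simp add: ev_comm ev_cc)
next
  case (h_h s i p j q)
  show ?case by (simp add: ev_comm ev_ht_ser TT_same_sign[of s i p j q])
next
  case (h_h_mixed j i p q)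
  let ?c1 = "of_int (a i j + 1) * b_plus" and ?c2 = "of_int (a i j - 1) * b_plus"
  have sq: "ev ((cpm a Plus i j)\<^sup>2) w = hsmult (?c1\<^sup>2) w" "ev ((cpm a Minus i j)\<^sup>2) w = hsmult (?c2\<^sup>2) w" for w
    using ev_power[OF ev_cpm, of Plus i j 2 w] ev_power[OF ev_cpm, of Minus i j 2 w] by (simp_all add: sg_def)
  let ?MP = "\<lambda>(p, q). T Minus j q (T Plus i p v)" and ?PM = "\<lambda>(p, q). T Plus i p (T Minus j q v)"
  have MP: "(\<lambda>(p, q). ev (ht_ser Minus j q * ht_ser Plus i p) v) = ?MP"
    and PM: "(\<lambda>(p, q). ev (ht_ser Plus i p * ht_ser Minus j q) v) = ?PM"
    by (simp_all add: ev_mult ev_ht_ser)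
  have two: "hsmult 2 (hsmult fps_X w) = hsmult fps_X (hsmult 2 w)" for w :: "'i fock fps"
    by (rule hs.scale_left_commute)
  have S1: "ev (- 2 * dd a i j * cc * of_bool (p = 0 \<and> q = 0)) v
      = - hsmult (of_int (a i j)) (if p = 0 \<and> q = 0 then v else 0)"
    unfolding mult_minus_left ev_uminus ev_mult ev_2 ev_2_dd ev_cc ev_of_bool ..
  have S2: "ev (2 * hb * dd a i j * (in_w (ht_ser Minus j) p q - in_z (ht_ser Plus i) p q) * cc) v
      = hsmult fps_X (hsmult (of_int (a i j)) ((if p = 0 then T Minus j q v else 0) - (if q = 0 then T Plus i p v else 0)))"
    unfolding ev_mult ev_2 ev_hb two ev_2_dd ev_cc ev_diff
    by (simp add: in_w_def in_z_def ev_ht_ser ev_0)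
  have act: "act ((Z1 - W1)\<^sup>2 - const_shift c) U (p, q) = act ((Z1 - W1)\<^sup>2) U (p, q) - hsmult c (U (p, q))" for c and U :: "_ \<Rightarrow> 'i fock fps"
    by (simp add: act_diff_left)
  have aux: "P - (- hsmult n s + hsmult fps_X (hsmult n d)) = 0" if "P + hsmult n (s - hsmult fps_X d) = 0"
    for P s d :: "'i fock fps" and n
  proof -
    have "P - (- hsmult n s + hsmult fps_X (hsmult n d)) = P + hsmult n (s - hsmult fps_X d)"
      by (simp add: hs.scale_right_diff_distrib mult.commute)
    then show ?thesis using that by simp
  qed
  show ?case
    unfolding Let_def ev_diff ev_add S1 S2 ev_zw_times_twice MP PM ev_mult[of "(cpm a Plus i j)\<^sup>2"] ev_mult[of "(cpm a Minus i j)\<^sup>2"] sq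
      ev_mult[of "ht_ser Minus j q"] ev_mult[of "ht_ser Plus i p"] ev_ht_ser
    by (rule aux) (use TT_mixed[of i j v "(p, q)"] in \<open>simp only: act prod.case\<close>)
next
  case (h_plus_x s i j p q)
  have e: "(\<lambda>(p, q). ev (ht_ser Plus i p * x_ser s j q) v) = (\<lambda>(p, q). T Plus i p (X s j q v))"
    "(\<lambda>(p, q). ev (x_ser s j q * ht_ser Plus i p) v) = (\<lambda>(p, q). X s j q (T Plus i p v))"
    by (simp_all add: ev_mult ev_ht_ser ev_x_ser)
  have g: "sg Minus = (-1 :: int)" "sg Plus = (1 :: int)" by (simp_all add: sg_def)
  show ?case
    unfolding ev_diff ev_zw_times[OF ev_sg_cpm(2)] ev_zw_times[OF ev_sg_cpm(1)] e ev_in_w_x g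
    using TX_plus[of s i j v "(p, q)"] by simp
next
  case (h_minus_x s i j p q)
  have e: "(\<lambda>(p, q). ev (ht_ser Minus i p * x_ser s j q) v) = (\<lambda>(p, q). T Minus i p (X s j q v))"
    "(\<lambda>(p, q). ev (x_ser s j q * ht_ser Minus i p) v) = (\<lambda>(p, q). X s j q (T Minus i p v))"
    by (simp_all add: ev_mult ev_ht_ser ev_x_ser)
  show ?case
    unfolding ev_diff ev_zw_times[OF ev_sg_hb_dd(2)] ev_zw_times[OF ev_sg_hb_dd(1)] e ev_in_w_x
    using TX_minus[of s i j v "(p, q)"] by simp
next
  case (x_x s i j p q)
  have e: "(\<lambda>(p, q). ev (x_ser s i p * x_ser s j q) v) = (\<lambda>(p, q). X s i p (X s j q v))"
    "(\<lambda>(p, q). ev (x_ser s j q * x_ser s i p) v) = (\<lambda>(p, q). X s j q (X s i p v))"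
    by (simp_all add: ev_mult ev_x_ser)
  show ?case
    unfolding ev_diff ev_zw_times[OF ev_sg_hb_dd(2)] ev_zw_times[OF ev_sg_hb_dd(1)] e
    using XX_same_sign[of s i j v "(p, q)", unfolded eta_expand] by simp
next
  case (x_plus_x_minus i p j q)
  show ?case
  proof (cases "i = j")
    case True
    \<comment> \<open>Both sides are known only after multiplication by hbar; torsion freeness
      removes the factor.\<close>
    have "hsmult fps_X (ev (comm (x_ser Plus j p) (x_ser Minus j q)) v) = hsmult fps_X (ev (xx_bracket j p q) v)"
      unfolding ev_comm ev_x_ser XX_bracket ev_xx_bracket ..
    then show ?thesis unfolding hsmult_fps_X_cancel using True by (simp add: ev_diff)
  next
    case False
    then show ?thesis using XX_opposite[OF False, of p q v] by (simp add: ev_comm ev_x_ser ev_diff ev_0)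
  qed
next
  case (serre i j m s f q)
  then show ?case by (rule ev_serre)
qed

lemma ev_h_ser: "ev (h_ser s i p) v = H s i p v"
  by (simp add: h_ser_def ev_add ev_mult ev_sg ev_hb ev_ht_ser ev_0 ev_1 H_T)

theorem representation:
  "\<exists>\<rho> \<in> algebra_homs (yangian_double a) end_algebra.
     (\<forall>s i p. \<rho> (yclass a (x_ser s i p)) = X s i p) \<and>
     (\<forall>s i p. \<rho> (yclass a (h_ser s i p)) = H s i p) \<and>
     \<rho> (yclass a cc) = id"
proof -
  obtain \<rho> where \<rho>: "\<rho> \<in> algebra_homs (quotient_algebra free_algebra (yangian_ideal a)) end_algebra"
    "\<And>u. \<rho> (yangian_ideal a +>\<^bsub>free_algebra\<^esub> u) = ev u"
    using quotient_evaluation[of "yangian_relators a", OF ev_relators] unfolding yangian_ideal_def by blast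
  show ?thesis
    using \<rho>(1) unfolding yangian_double_def
    by (intro bexI[of _ \<rho>]) (auto simp: yclass_def \<rho>(2) ev_x_ser ev_h_ser ev_cc)
qed

end

theorem theorem5p5:
  fixes a :: "'i::finite \<Rightarrow> 'i \<Rightarrow> int"
    and \<epsilon> :: "'i lattice \<Rightarrow> 'i lattice \<Rightarrow> complex"
  assumes "simply_laced_cartan a"
    and "sign_cocycle a \<epsilon>"
  shows "\<exists>\<rho> \<in> algebra_homs (yangian_double a) end_algebra.
           (\<forall>s i p. \<rho> (yclass a (x_ser s i p)) = X_op a \<epsilon> s i p) \<and>
           (\<forall>s i p. \<rho> (yclass a (h_ser s i p)) = H_op a s i p) \<and>
           \<rho> (yclass a cc) = id"
  by (rule simply_laced.representation[OF simply_laced.intro[OF assms]])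

end
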